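(* Assume (A) (stated in the context), with ellipticity constant $\lambda>0$, and let $2_*$ be the exponent fixed in the context. Then the following hold. (i) (Existence, uniqueness and boundedness.) Let $f\in L^{2_*}(U)$ and $F\in L^2(U,\mathbb{R}^d)$. Then there exist a unique weak solution $u\in H^{1,2}_0(U)$ to $$-\mathrm{div}(A\nabla u)+\langle B,\nabla u\rangle+(c+\alpha)u=f-\mathrm{div}F \ \text{ in } U,\qquad u=0\ \text{ on }\partial U, \qquad ( * )$$ and a constant $C_1>0$ which only depends on $\lambda$, $d$ and $|U|$ such that $$\|u\|_{H^{1,2}_0(U)}\le C_1\big(\|f\|_{L^{2_*}(U)}+\|F\|_{L^2(U)}\big).$$ Moreover, if $q\in(d/2,\infty)$ with $2_*\le q$, $f\in L^q(U)$ and $F\in L^{2q}(U,\mathbb{R}^d)$, then $u\in L^\infty(U)$ and $$\|u\|_{L^\infty(U)}\le C_2\big(\|f\|_{L^q(U)}+\|F\|_{L^{2q}(U)}\big),$$ where $C_2>0$ is a constant which only depends on $\lambda$, $d$, $q$ and $|U|$. (ii) (Contraction properties.) Let $\alpha\in(0,\infty)$, $r\in[1,\infty]$, $q\in(d/2,\infty)$, $f\in L^r(U)\cap L^{2_*}(U)$ and $F\in L^{2q}(U,\mathbb{R}^d)$. Then the weak solution $u\in H^{1,2}_0(U)$ to $( * )$ as in (i) satisfies $u\in L^r(U)$ and $$\|u\|_{L^r(U)}\le \alpha^{-1}\|f\|_{L^r(U)}+C_2|U|^{1/r}\|F\|_{L^{2q}(U)},$$ where $C_2>0$ is the constant as in 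(i).
   Context: $\langle\cdot,\cdot\rangle$ and $\|\cdot\|$ are the Euclidean inner product and norm on $\mathbb{R}^d$; $dx$ is Lebesgue measure and $|U|$ is the Lebesgue measure of $U$; $L^p(U)$ is taken with respect to $dx$; $L^p(U,\mathbb{R}^d)$ is the space of $L^p$ vector fields, with $\|F\|_{L^p(U)}:=\big\|\,\|F\|\,\big\|_{L^p(U)}$. $H^{1,2}(U)$ is the Sobolev space with norm $\big(\|f\|_{L^2(U)}^2+\sum_{i=1}^d\|\partial_i f\|_{L^2(U)}^2\big)^{1/2}$, and $H^{1,2}_0(U)$ is the closure of $C_0^\infty(U)$ (smooth functions compactly supported in $U$) in it, with the same norm. $|U|^{1/r}$ is read as $1$ if $r=\infty$. Exponent: $2_*:=\frac{2d}{d+2}$ if $d\ge3$; if $d=2$, $2_*\in(1,2)$ is arbitrary but fixed. Assumption (A): $U$ is a bounded open subset of $\mathbb{R}^d$ with $d\ge2$. $A=(a_{ij})_{1\le i,j\le d}$ is a $d\times d$ (possibly non-symmetric) matrix of functions in $L^\infty(U)$ such that for some constants $\lambda,\Lambda>0$, $\langle A(x)\xi,\xi\rangle\ge\lambda\|\xi\|^2$ and $\max_{1\le i,j\le d}|a_{ij}(x)|\le\Lambda$ for all $x\in U$ and $\xi\in\mathbb{R}^d$. $B\in L^2(U,\mathbb{R}^d)$ satisfies $\mathrm{div}B\le0$ weakly in $U$, i.e. $\int_U\langle B,\nabla\varphi\rangle dx\ge0$ for all $\varphi\in C_0^\infty(U)$ with $\varphi\ge0$. $\alpha\in[0,\infty)$,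 and $c\in L^{2_*}(U)$ with $c\ge0$. Weak solution: $u$ is a weak solution to $( * )$ if $u\in H^{1,2}_0(U)$ satisfies for any $\varphi\in C_0^\infty(U)$ $$\int_U\langle A\nabla u,\nabla\varphi\rangle+\big(\langle B,\nabla u\rangle+(c+\alpha)u\big)\varphi\,dx=\int_U f\varphi+\langle F,\nabla\varphi\rangle\,dx,$$ where both integrals are well defined in $\mathbb{R}$. *)

theory Defs
  imports "HOL-Analysis.Analysis" "HOL-Probability.Essential_Supremum"
begin

text \<open>
  Elements of $L^p(U)$ and of the Sobolev spaces are represented by functions on the whole
  space; only their values on \<open>U\<close> matter, and equality in these spaces is equality almost
  everywhere with respect to \<open>lebesgue_on U\<close>.
\<close>

definition Lp_space :: "'a measure \<Rightarrow> ennreal \<Rightarrow> ('a \<Rightarrow> 'b::euclidean_space) set" where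
  "Lp_space M p = {f \<in> borel_measurable M.
     if p = \<infinity> then esssup M (\<lambda>x. ennreal (norm (f x))) < \<infinity>
     else integrable M (\<lambda>x. norm (f x) powr enn2real p)}"

definition Lp_norm :: "'a measure \<Rightarrow> ennreal \<Rightarrow> ('a \<Rightarrow> 'b::euclidean_space) \<Rightarrow> real" where
  "Lp_norm M p f =
     (if p = \<infinity> then enn2real (esssup M (\<lambda>x. ennreal (norm (f x))))
      else (LINT x|M. norm (f x) powr enn2real p) powr (1 / enn2real p))"

definition partial_deriv :: "'n::finite \<Rightarrow> (real^'n \<Rightarrow> real) \<Rightarrow> real^'n \<Rightarrow> real" where
  "partial_deriv i f x = frechet_derivative f (at x) (axis i 1)"

definition gradient :: "(real^'n::finite \<Rightarrow> real) \<Rightarrow> real^'n \<Rightarrow> real^'n" where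
  "gradient f x = (\<chi> i. partial_deriv i f x)"

primrec C_k :: "nat \<Rightarrow> (real^'n::finite \<Rightarrow> real) \<Rightarrow> bool" where
  "C_k 0 f \<longleftrightarrow> continuous_on UNIV f"
| "C_k (Suc k) f \<longleftrightarrow> (\<forall>x. f differentiable (at x)) \<and> (\<forall>i. C_k k (partial_deriv i f))"

text \<open>$C_0^\infty(U)$, its elements being extended by zero to the whole space.\<close>

definition test_functions :: "(real^'n::finite) set \<Rightarrow> (real^'n \<Rightarrow> real) set" where
  "test_functions U =
     {\<phi>. (\<forall>k. C_k k \<phi>) \<and> compact (closure {x. \<phi> x \<noteq> 0}) \<and> closure {x. \<phi> x \<noteq> 0} \<subseteq> U}"

definition locally_integrable :: "(real^'n::finite) set \<Rightarrow> (real^'n \<Rightarrow> real) \<Rightarrow> bool" where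
  "locally_integrable U f \<longleftrightarrow> (\<forall>K. compact K \<and> K \<subseteq> U \<longrightarrow> integrable (lebesgue_on K) f)"

definition has_weak_partial ::
  "(real^'n::finite) set \<Rightarrow> 'n \<Rightarrow> (real^'n \<Rightarrow> real) \<Rightarrow> (real^'n \<Rightarrow> real) \<Rightarrow> bool" where
  "has_weak_partial U i u g \<longleftrightarrow> locally_integrable U u \<and> locally_integrable U g \<and>
     (\<forall>\<phi>\<in>test_functions U.
        (LINT x|lebesgue_on U. u x * partial_deriv i \<phi> x) = - (LINT x|lebesgue_on U. g x * \<phi> x))"

text \<open>
  Weak partial derivatives on an open set are unique almost everywhere, so the choice below
  picks a representative; it is meaningful only when a weak partial derivative exists.
\<close>

definition weak_partial ::
  "(real^'n::finite) set \<Rightarrow> 'n \<Rightarrow> (real^'n \<Rightarrow> real) \<Rightarrow> real^'n \<Rightarrow> real" where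
  "weak_partial U i u = (SOME g. has_weak_partial U i u g)"

definition weak_gradient ::
  "(real^'n::finite) set \<Rightarrow> (real^'n \<Rightarrow> real) \<Rightarrow> real^'n \<Rightarrow> real^'n" where
  "weak_gradient U u x = (\<chi> i. weak_partial U i u x)"

definition H12 :: "(real^'n::finite) set \<Rightarrow> (real^'n \<Rightarrow> real) set" where
  "H12 U = {u \<in> Lp_space (lebesgue_on U) 2.
     \<forall>i. \<exists>g \<in> Lp_space (lebesgue_on U) 2. has_weak_partial U i u g}"

definition H12_norm :: "(real^'n::finite) set \<Rightarrow> (real^'n \<Rightarrow> real) \<Rightarrow> real" where
  "H12_norm U u = sqrt ((Lp_norm (lebesgue_on U) 2 u)\<^sup>2 +
     (\<Sum>i\<in>UNIV. (Lp_norm (lebesgue_on U) 2 (weak_partial U i u))\<^sup>2))"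

definition H12_0 :: "(real^'n::finite) set \<Rightarrow> (real^'n \<Rightarrow> real) set" where
  "H12_0 U = {u \<in> H12 U. \<forall>\<epsilon>>0. \<exists>\<phi>\<in>test_functions U. H12_norm U (\<lambda>x. \<phi> x - u x) < \<epsilon>}"

definition weakly_div_nonpos ::
  "(real^'n::finite) set \<Rightarrow> (real^'n \<Rightarrow> real^'n) \<Rightarrow> bool" where
  "weakly_div_nonpos U B \<longleftrightarrow> (\<forall>\<phi>\<in>test_functions U. (\<forall>x\<in>U. 0 \<le> \<phi> x) \<longrightarrow>
     0 \<le> (LINT x|lebesgue_on U. B x \<bullet> gradient \<phi> x))"

text \<open>The exponent $2_*$ in dimension \<open>d\<close>; for $d = 2$ any element of the interval is allowed.\<close>

definition is_two_star :: "nat \<Rightarrow> real \<Rightarrow> bool" where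
  "is_two_star d s \<longleftrightarrow>
     (if d = 2 then 1 < s \<and> s < 2 else s = 2 * real d / (real d + 2))"

text \<open>
  The ellipticity and boundedness conditions on \<open>A\<close> hold at every point of \<open>U\<close>, whereas
  \<open>c \<ge> 0\<close> is a statement about a class in $L^{2_*}(U)$, i.e. almost everywhere.
\<close>

definition assumption_A ::
  "real \<Rightarrow> (real^'n::finite) set \<Rightarrow> (real^'n \<Rightarrow> real^'n^'n) \<Rightarrow> (real^'n \<Rightarrow> real^'n) \<Rightarrow>
   (real^'n \<Rightarrow> real) \<Rightarrow> real \<Rightarrow> real \<Rightarrow> real \<Rightarrow> bool" where
  "assumption_A s U A B c \<alpha> lam Lam \<longleftrightarrow>
     2 \<le> CARD('n) \<and> bounded U \<and> open U \<and>
     0 < lam \<and> 0 < Lam \<and>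
     (\<forall>i j. (\<lambda>x. A x $ i $ j) \<in> Lp_space (lebesgue_on U) \<infinity>) \<and>
     (\<forall>x\<in>U. \<forall>\<xi>. lam * (norm \<xi>)\<^sup>2 \<le> (A x *v \<xi>) \<bullet> \<xi>) \<and>
     (\<forall>x\<in>U. \<forall>i j. \<bar>A x $ i $ j\<bar> \<le> Lam) \<and>
     B \<in> Lp_space (lebesgue_on U) 2 \<and> weakly_div_nonpos U B \<and>
     0 \<le> \<alpha> \<and>
     c \<in> Lp_space (lebesgue_on U) (ennreal s) \<and> (AE x in lebesgue_on U. 0 \<le> c x)"

definition weak_solution ::
  "(real^'n::finite) set \<Rightarrow> (real^'n \<Rightarrow> real^'n^'n) \<Rightarrow> (real^'n \<Rightarrow> real^'n) \<Rightarrow>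
   (real^'n \<Rightarrow> real) \<Rightarrow> real \<Rightarrow> (real^'n \<Rightarrow> real) \<Rightarrow> (real^'n \<Rightarrow> real^'n) \<Rightarrow>
   (real^'n \<Rightarrow> real) \<Rightarrow> bool" where
  "weak_solution U A B c \<alpha> f F u \<longleftrightarrow> u \<in> H12_0 U \<and>
     (\<forall>\<phi>\<in>test_functions U.
        (let lhs = (\<lambda>x. (A x *v weak_gradient U u x) \<bullet> gradient \<phi> x +
                        (B x \<bullet> weak_gradient U u x + (c x + \<alpha>) * u x) * \<phi> x);
             rhs = (\<lambda>x. f x * \<phi> x + F x \<bullet> gradient \<phi> x)
         in integrable (lebesgue_on U) lhs \<and> integrable (lebesgue_on U) rhs \<and>
            (LINT x|lebesgue_on U. lhs x) = (LINT x|lebesgue_on U. rhs x)))"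

end

theory Submission
  imports Defs
begin

text \<open>
  The space \<open>H\<^sub>0\<close> of pairs (limit of test functions, limit of their gradients) in $L^2$ replaces
  $H^{1,2}_0$. Integrating a product of line integrals one coordinate at a time bounds the
  $L^{d/(d-1)}$ norm of a test function by that of its gradient in $L^1$; applied to a power of the
  test function this gives the Sobolev and Poincare inequalities, with constants depending on
  \<open>d\<close>, \<open>|U|\<close> and the exponent only.

  The drift is merely square integrable, so the bilinear form is not bounded on \<open>H\<^sub>0\<close>. It is,
  however, bounded in its first argument for every fixed test function, and coercive on test
  functions because $\mathrm{div} B \le 0$; Lions' extension of the Lax--Milgram lemma then gives
  existence. For the remaining claims one tests with smooth bounded nondecreasing functions of \<open>u\<close>: the drift
  term is the integral of \<open>B\<close> against the gradient of a nonnegative function, hence nonnegative, and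
  drops out. Passing to truncations \<open>T\<close> of \<open>u\<close> between two levels gives
  $\lambda \|\nabla T\|^2 + \alpha \int u\,T \le \int f\,T + \langle F, \nabla T\rangle$.
  Letting the levels tend to infinity yields the energy estimate and uniqueness; the measures of the level sets
  then satisfy Stampacchia's recursion, which bounds \<open>u\<close>. For \<open>F = 0\<close>, letting the two levels
  merge gives $\alpha \int_{|u| \ge a} |u| \le \int_{|u| \ge a} |f|$ for all \<open>a > 0\<close>, and
  integrating this against $a^{r-2}\,da$ together with Hoelder's inequality gives the $L^r$
  contraction. The part of \<open>u\<close> caused by \<open>F\<close> is bounded by the \<open>L\<^sup>\<infinity>\<close> estimate.
\<close>

section \<open>Inequalities for integrals\<close>

text \<open>The product of \<open>B\<close> with a gradient is only in L^1, so the lower-order part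
  \<open>low u G\<close> can be paired with bounded functions only. Every test is therefore a
  bounded smooth function of \<open>u\<close> with bounded derivative, never \<open>u\<close>
  itself, and large levels are reached by a limit afterwards. The final constants must not see
  \<open>B\<close>, \<open>c\<close>, \<open>\<alpha>\<close> or \<open>Lam\<close>: in the
  estimates these enter through signs alone, and nonnegative terms are discarded. The weak gradient
  of the definitions is a choice and cannot be computed with; a pair in \<open>H0\<close> carries
  its gradient explicitly, and \<open>H12_0_iff_H0\<close> and \<open>weak_solution_iff\<close>
  translate once and for all. The Sobolev inequality is used with two exponents:
  \<open>\<kappa> = s / (s - 1)\<close>, dual to \<open>s\<close>, for existence and energy, and
  \<open>Linf_exponent\<close>, which depends on the dimension and \<open>q\<close> only, for
  boundedness; so the second constant is independent of \<open>s\<close>.\<close>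

lemma weighted_arith_geo_mean:
  fixes a w :: "'i \<Rightarrow> real"
  assumes "finite J" and a: "\<And>j. j \<in> J \<Longrightarrow> 0 \<le> a j" and w: "\<And>j. j \<in> J \<Longrightarrow> 0 \<le> w j"
    and sum: "(\<Sum>j\<in>J. w j) = 1"
  shows "(\<Prod>j\<in>J. a j powr w j) \<le> (\<Sum>j\<in>J. w j * a j)"
proof (cases "\<exists>j\<in>J. a j = 0")
  case True
  then have "(\<Prod>j\<in>J. a j powr w j) = 0"
    using \<open>finite J\<close> by (auto intro!: prod_zero)
  then show ?thesis
    using a w by (simp add: sum_nonneg)
next
  case False
  then have pos: "\<And>j. j \<in> J \<Longrightarrow> 0 < a j"
    using a by (metis order_le_less)
  have "J \<noteq> {}" using sum by auto
  have "(\<Prod>j\<in>J. a j powr w j) = exp (\<Sum>j\<in>J. w j *\<^sub>R ln (a j))"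
    unfolding real_scaleR_def exp_sum[OF \<open>finite J\<close>]
    by (intro prod.cong refl) (use pos in \<open>force simp: powr_def\<close>)
  also have "\<dots> \<le> (\<Sum>j\<in>J. w j * exp (ln (a j)))"
    by (rule convex_on_sum[OF \<open>finite J\<close> \<open>J \<noteq> {}\<close> exp_convex sum]) (use w in auto)
  also have "\<dots> = (\<Sum>j\<in>J. w j * a j)"
    using pos by (auto intro!: sum.cong)
  finally show ?thesis .
qed

text \<open>Each \<open>F j\<close> is divided by its integral and the weighted mean inequality is
  integrated; if one integral is 0, that factor, hence the product, vanishes almost everywhere.
  Weights on integrable functions, instead of exponents on norms, allow any finite number of factors
  and also weight 0.\<close>

lemma generalized_Hoelder:
  fixes F :: "'i \<Rightarrow> 'a \<Rightarrow> real"
  assumes "finite J" and F0: "\<And>j x. j \<in> J \<Longrightarrow> 0 \<le> F j x"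
    and int: "\<And>j. j \<in> J \<Longrightarrow> integrable M (F j)"
    and w: "\<And>j. j \<in> J \<Longrightarrow> 0 \<le> w j" and sum: "(\<Sum>j\<in>J. w j) = 1"
  shows "integrable M (\<lambda>x. \<Prod>j\<in>J. F j x powr w j)" (is "integrable M ?P")
    and "(LINT x|M. (\<Prod>j\<in>J. F j x powr w j)) \<le> (\<Prod>j\<in>J. (LINT x|M. F j x) powr w j)"
proof -
  have [measurable]: "\<And>j. j \<in> J \<Longrightarrow> F j \<in> borel_measurable M"
    using int by auto
  have amgm: "?P x \<le> (\<Sum>j\<in>J. w j * F j x)" for x
    by (rule weighted_arith_geo_mean) (use assms in auto)
  have int_sum: "integrable M (\<lambda>x. \<Sum>j\<in>J. w j * F j x)"
    using int by auto
  show intP: "integrable M ?P"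
    by (rule Bochner_Integration.integrable_bound[OF int_sum])
       (use amgm w F0 in \<open>auto simp: abs_of_nonneg prod_nonneg sum_nonneg\<close>)
  show "(LINT x|M. ?P x) \<le> (\<Prod>j\<in>J. (LINT x|M. F j x) powr w j)"
  proof (cases "\<exists>j\<in>J. (LINT x|M. F j x) = 0")
    case True
    then obtain i where i: "i \<in> J" "(LINT x|M. F i x) = 0" by auto
    then have "AE x in M. F i x = 0"
      using integral_nonneg_eq_0_iff_AE[OF int[OF i(1)]] F0[OF i(1)] by auto
    then have "AE x in M. ?P x = 0"
      by eventually_elim (use i \<open>finite J\<close> in \<open>auto intro!: prod_zero\<close>)
    then have "(LINT x|M. ?P x) = 0"
      by (simp add: integral_eq_zero_AE)
    then show ?thesis by (simp add: prod_nonneg)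
  next
    case False
    define N where "N j = (LINT x|M. F j x)" for j
    have N: "N j > 0" if "j \<in> J" for j
      using False that Bochner_Integration.integral_nonneg[of M "F j"] F0[OF that] unfolding N_def
      by (metis order_le_less)
    have le: "?P x \<le> (\<Prod>j\<in>J. N j powr w j) * (\<Sum>j\<in>J. w j * (F j x / N j))" for x
    proof -
      have "?P x = (\<Prod>j\<in>J. N j powr w j * (F j x / N j) powr w j)"
      proof (intro prod.cong refl)
        fix j assume "j \<in> J"
        then have "F j x = N j * (F j x / N j)" "0 \<le> N j" "0 \<le> F j x / N j"
          using N[of j] F0[of j x] by auto
        then show "F j x powr w j = N j powr w j * (F j x / N j) powr w j"
          by (metis powr_mult)
      qed
      also have "\<dots> = (\<Prod>j\<in>J. N j powr w j) * (\<Prod>j\<in>J. (F j x / N j) powr w j)"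
        by (simp add: prod.distrib)
      also have "\<dots> \<le> (\<Prod>j\<in>J. N j powr w j) * (\<Sum>j\<in>J. w j * (F j x / N j))"
        by (intro mult_left_mono weighted_arith_geo_mean prod_nonneg)
           (use assms N in \<open>auto simp: less_imp_le\<close>)
      finally show ?thesis .
    qed
    have "(LINT x|M. ?P x) \<le> (LINT x|M. (\<Prod>j\<in>J. N j powr w j) * (\<Sum>j\<in>J. w j * (F j x / N j)))"
      using int by (intro integral_mono intP le) auto
    also have "\<dots> = (\<Prod>j\<in>J. N j powr w j) * (\<Sum>j\<in>J. LINT x|M. w j * (F j x / N j))"
      unfolding integral_mult_right_zero by (subst Bochner_Integration.integral_sum) (use int in auto)
    also have "(\<Sum>j\<in>J. LINT x|M. w j * (F j x / N j)) = (\<Sum>j\<in>J. w j)"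
    proof (rule sum.cong[OF refl])
      fix j assume "j \<in> J"
      then have "N j \<noteq> 0" using N by force
      then show "(LINT x|M. w j * (F j x / N j)) = w j"
        unfolding integral_mult_right_zero integral_divide_zero N_def[symmetric] by simp
    qed
    finally show ?thesis unfolding sum N_def by simp
  qed
qed

lemma Hoelder:
  fixes f g :: "'a \<Rightarrow> real"
  assumes [measurable]: "f \<in> borel_measurable M" "g \<in> borel_measurable M"
    and p: "0 < p" and q: "0 < q" and pq: "1 / p + 1 / q = 1"
    and f: "integrable M (\<lambda>x. \<bar>f x\<bar> powr p)" and g: "integrable M (\<lambda>x. \<bar>g x\<bar> powr q)"
  shows "integrable M (\<lambda>x. f x * g x)"
    and "(LINT x|M. \<bar>f x * g x\<bar>) \<le>
      (LINT x|M. \<bar>f x\<bar> powr p) powr (1/p) * (LINT x|M. \<bar>g x\<bar> powr q) powr (1/q)"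
proof -
  \<comment> \<open>The two factors are indexed by the booleans.\<close>
  define F where "F b x = (if b then \<bar>f x\<bar> powr p else \<bar>g x\<bar> powr q)" for b x
  define w where "w b = (if b then 1/p else 1/q)" for b
  have eq: "(\<Prod>b\<in>UNIV. F b x powr w b) = \<bar>f x * g x\<bar>" for x
    using p q by (auto simp: F_def w_def UNIV_bool powr_powr abs_mult)
  have 1: "integrable M (F b)" for b
    using f g by (cases b) (auto simp: F_def[abs_def])
  have 2: "(\<Sum>b\<in>UNIV. w b) = 1"
    using pq by (auto simp: w_def UNIV_bool)
  note H = generalized_Hoelder[of UNIV F M w, OF _ _ 1 _ 2]
  have "integrable M (\<lambda>x. \<bar>f x * g x\<bar>)"
    using H(1) p q unfolding eq by (auto simp: F_def w_def)
  then show "integrable M (\<lambda>x. f x * g x)"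
    by (rule Bochner_Integration.integrable_bound) auto
  show "(LINT x|M. \<bar>f x * g x\<bar>) \<le>
      (LINT x|M. \<bar>f x\<bar> powr p) powr (1/p) * (LINT x|M. \<bar>g x\<bar> powr q) powr (1/q)"
    using H(2) p q unfolding eq by (auto simp: F_def w_def UNIV_bool mult.commute)
qed

text \<open>Hoelder's inequality with the indicator of \<open>A\<close> as second factor, of weight
  \<open>1 - p/q\<close>.\<close>

lemma (in finite_measure) powr_integral_exponent_le:
  fixes f :: "'a \<Rightarrow> real"
  assumes [measurable]: "f \<in> borel_measurable M" "A \<in> sets M"
    and p: "0 < p" "p \<le> q" and f: "integrable M (\<lambda>x. \<bar>f x\<bar> powr q)"
  shows "integrable M (\<lambda>x. indicator A x * \<bar>f x\<bar> powr p)"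
    and "(LINT x|M. indicator A x * \<bar>f x\<bar> powr p) \<le>
      (LINT x|M. \<bar>f x\<bar> powr q) powr (p/q) * measure M A powr (1 - p/q)"
proof -
  define F where "F b x = (if b then \<bar>f x\<bar> powr q else indicator A x)" for b x
  define w where "w b = (if b then p/q else 1 - p/q)" for b
  \<comment> \<open>For \<open>p = q\<close> the indicator carries weight 0; the convention
    \<open>0 powr 0 = 0\<close> leaves it intact.\<close>
  have eq: "(\<Prod>b\<in>UNIV. F b x powr w b) = indicator A x * \<bar>f x\<bar> powr p" for x
    using p by (auto simp: F_def w_def UNIV_bool powr_powr indicator_def)
  have 1: "integrable M (F b)" for b
    using f by (cases b) (auto simp: F_def[abs_def] emeasure_eq_measure)
  have 2: "(\<Sum>b\<in>UNIV. w b) = 1"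
    by (auto simp: w_def UNIV_bool)
  note H = generalized_Hoelder[of UNIV F M w, OF _ _ 1 _ 2]
  show "integrable M (\<lambda>x. indicator A x * \<bar>f x\<bar> powr p)"
    using H(1) p unfolding eq by (auto simp: F_def w_def)
  show "(LINT x|M. indicator A x * \<bar>f x\<bar> powr p) \<le>
      (LINT x|M. \<bar>f x\<bar> powr q) powr (p/q) * measure M A powr (1 - p/q)"
    using H(2) p unfolding eq by (auto simp: F_def w_def UNIV_bool mult.commute)
qed

section \<open>Square-integrable functions\<close>

text \<open>Squares of norms in place of \<open>powr 2\<close>, so that expansion by inner products
  applies directly; \<open>Lp_space_2\<close> and \<open>Lp_norm_2\<close> translate.\<close>

definition L2 :: "'a measure \<Rightarrow> ('a \<Rightarrow> 'b::euclidean_space) \<Rightarrow> bool" where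
  "L2 M f \<longleftrightarrow> f \<in> borel_measurable M \<and> integrable M (\<lambda>x. (norm (f x))\<^sup>2)"

definition nrm2 :: "'a measure \<Rightarrow> ('a \<Rightarrow> 'b::euclidean_space) \<Rightarrow> real" where
  "nrm2 M f = sqrt (LINT x|M. (norm (f x))\<^sup>2)"

lemma L2_measurable: "L2 M f \<Longrightarrow> f \<in> borel_measurable M"
  and L2_integrable: "L2 M f \<Longrightarrow> integrable M (\<lambda>x. (norm (f x))\<^sup>2)"
  by (auto simp: L2_def)

lemma L2_integrable_real: "L2 M f \<Longrightarrow> integrable M (\<lambda>x. (f x)\<^sup>2)" for f :: "'a \<Rightarrow> real"
  using L2_integrable[of M f] by simp

lemma Lp_space_2: "f \<in> Lp_space M 2 \<longleftrightarrow> L2 M f"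
  by (simp add: Lp_space_def L2_def)

lemma Lp_norm_2: "Lp_norm M 2 f = nrm2 M f"
  by (simp add: Lp_norm_def nrm2_def powr_half_sqrt)

lemma nrm2_nonneg [simp]: "0 \<le> nrm2 M f"
  by (simp add: nrm2_def)

lemma nrm2_sq: "(nrm2 M f)\<^sup>2 = (LINT x|M. (norm (f x))\<^sup>2)"
  by (simp add: nrm2_def)

lemma nrm2_cong_AE:
  assumes "AE x in M. f x = g x" "f \<in> borel_measurable M" "g \<in> borel_measurable M"
  shows "nrm2 M f = nrm2 M g"
proof -
  have [measurable]: "f \<in> borel_measurable M" "g \<in> borel_measurable M" by fact+
  show ?thesis unfolding nrm2_def
    using assms(1) by (intro arg_cong[where f=sqrt] integral_cong_AE) auto
qed

lemma L2_cong_AE: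
  assumes "AE x in M. f x = g x" "g \<in> borel_measurable M" "L2 M f"
  shows "L2 M g"
proof -
  have [measurable]: "f \<in> borel_measurable M" "g \<in> borel_measurable M"
    using assms L2_measurable by auto
  have "integrable M (\<lambda>x. (norm (f x))\<^sup>2)" using assms L2_integrable by auto
  then have "integrable M (\<lambda>x. (norm (g x))\<^sup>2)"
    by (rule Bochner_Integration.integrable_bound) (use assms(1) in auto)
  then show ?thesis using assms by (simp add: L2_def)
qed

lemma L2_bound:
  assumes "L2 M f" "g \<in> borel_measurable M" "AE x in M. norm (g x) \<le> K * norm (f x)"
  shows "L2 M g"
proof -
  have [measurable]: "g \<in> borel_measurable M" by fact
  have "integrable M (\<lambda>x. K\<^sup>2 * (norm (f x))\<^sup>2)" using L2_integrable[OF assms(1)] by auto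
  then have "integrable M (\<lambda>x. (norm (g x))\<^sup>2)"
  proof (rule Bochner_Integration.integrable_bound)
    show "AE x in M. norm ((norm (g x))\<^sup>2) \<le> norm (K\<^sup>2 * (norm (f x))\<^sup>2)"
      using assms(3)
    proof eventually_elim
      case (elim x)
      then have "(norm (g x))\<^sup>2 \<le> (K * norm (f x))\<^sup>2"
        by (intro power_mono) auto
      then show ?case by (simp add: power_mult_distrib)
    qed
  qed measurable
  then show ?thesis using assms by (simp add: L2_def)
qed

lemma L2_prod_norm:
  assumes "L2 M f" "L2 M g"
  shows "integrable M (\<lambda>x. norm (f x) * norm (g x))"
    and "(LINT x|M. norm (f x) * norm (g x)) \<le> nrm2 M f * nrm2 M g"
proof -
  have [measurable]: "f \<in> borel_measurable M" "g \<in> borel_measurable M"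
    using assms L2_measurable by auto
  note H = Hoelder[of "\<lambda>x. norm (f x)" M "\<lambda>x. norm (g x)" 2 2]
  have "integrable M (\<lambda>x. norm (f x) * norm (g x))"
    by (rule H(1)) (use assms L2_integrable in \<open>auto\<close>)
  moreover have "(LINT x|M. \<bar>norm (f x) * norm (g x)\<bar>) \<le> (LINT x|M. \<bar>norm (f x)\<bar> powr 2) powr (1/2) *
      (LINT x|M. \<bar>norm (g x)\<bar> powr 2) powr (1/2)"
    by (rule H(2)) (use assms L2_integrable in \<open>auto\<close>)
  ultimately show "integrable M (\<lambda>x. norm (f x) * norm (g x))"
    and "(LINT x|M. norm (f x) * norm (g x)) \<le> nrm2 M f * nrm2 M g"
    by (auto simp: nrm2_def powr_half_sqrt)
qed

lemma L2_inner_integrable: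
  assumes "L2 M f" "L2 M g"
  shows "integrable M (\<lambda>x. f x \<bullet> g x)"
proof -
  have [measurable]: "f \<in> borel_measurable M" "g \<in> borel_measurable M"
    using assms L2_measurable by auto
  show ?thesis
    by (rule Bochner_Integration.integrable_bound[OF L2_prod_norm(1)[OF assms]]) (auto simp: Cauchy_Schwarz_ineq2)
qed

lemma L2_Cauchy_Schwarz:
  assumes "L2 M f" "L2 M g"
  shows "\<bar>LINT x|M. f x \<bullet> g x\<bar> \<le> nrm2 M f * nrm2 M g"
proof -
  have "\<bar>LINT x|M. f x \<bullet> g x\<bar> \<le> (LINT x|M. \<bar>f x \<bullet> g x\<bar>)"
    using integral_norm_bound[of M "\<lambda>x. f x \<bullet> g x"] by simp
  also have "\<dots> \<le> (LINT x|M. norm (f x) * norm (g x))"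
    using assms by (intro integral_mono L2_prod_norm integrable_abs L2_inner_integrable)
       (auto simp: Cauchy_Schwarz_ineq2)
  finally show ?thesis using L2_prod_norm(2)[OF assms] by linarith
qed

lemma L2_scaleR: "L2 M f \<Longrightarrow> L2 M (\<lambda>x. a *\<^sub>R f x)"
  by (auto simp: L2_def power_mult_distrib)

lemma L2_uminus: "L2 M f \<Longrightarrow> L2 M (\<lambda>x. - f x)"
  by (auto simp: L2_def)

lemma L2_add:
  assumes "L2 M f" "L2 M g"
  shows "L2 M (\<lambda>x. f x + g x)"
proof -
  have [measurable]: "f \<in> borel_measurable M" "g \<in> borel_measurable M"
    using assms L2_measurable by auto
  have "(norm (f x + g x))\<^sup>2 = (norm (f x))\<^sup>2 + 2 * (f x \<bullet> g x) + (norm (g x))\<^sup>2" for x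
    by (simp add: power2_norm_eq_inner inner_simps inner_commute)
  then show ?thesis
    using L2_integrable[OF assms(1)] L2_integrable[OF assms(2)] L2_inner_integrable[OF assms]
    by (simp add: L2_def)
qed

lemma L2_diff: "L2 M f \<Longrightarrow> L2 M g \<Longrightarrow> L2 M (\<lambda>x. f x - g x)"
  using L2_add[OF _ L2_uminus, of M f g] by simp

lemma L2_linear: "L2 M f \<Longrightarrow> L2 M g \<Longrightarrow> L2 M (\<lambda>x. a *\<^sub>R f x + b *\<^sub>R g x)"
  by (intro L2_add L2_scaleR)

lemma nrm2_scaleR: "nrm2 M (\<lambda>x. a *\<^sub>R f x) = \<bar>a\<bar> * nrm2 M f"
  by (simp add: nrm2_def power_mult_distrib real_sqrt_mult)

lemma nrm2_minus_commute: "nrm2 M (\<lambda>x. f x - g x) = nrm2 M (\<lambda>x. g x - f x)"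
  by (simp add: nrm2_def norm_minus_commute)

lemma nrm2_sq_add:
  assumes "L2 M f" "L2 M g"
  shows "(nrm2 M (\<lambda>x. f x + g x))\<^sup>2 = (nrm2 M f)\<^sup>2 + 2 * (LINT x|M. f x \<bullet> g x) + (nrm2 M g)\<^sup>2"
proof -
  have "(norm (f x + g x))\<^sup>2 = (norm (f x))\<^sup>2 + 2 * (f x \<bullet> g x) + (norm (g x))\<^sup>2" for x
    by (simp add: power2_norm_eq_inner inner_simps inner_commute)
  then show ?thesis
    using L2_integrable[OF assms(1)] L2_integrable[OF assms(2)] L2_inner_integrable[OF assms]
    by (simp add: nrm2_sq)
qed

lemma nrm2_triangle:
  assumes "L2 M f" "L2 M g"
  shows "nrm2 M (\<lambda>x. f x + g x) \<le> nrm2 M f + nrm2 M g"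
proof (rule power2_le_imp_le)
  have "(nrm2 M (\<lambda>x. f x + g x))\<^sup>2 \<le> (nrm2 M f)\<^sup>2 + 2 * (nrm2 M f * nrm2 M g) + (nrm2 M g)\<^sup>2"
    using nrm2_sq_add[OF assms] L2_Cauchy_Schwarz[OF assms] by auto
  then show "(nrm2 M (\<lambda>x. f x + g x))\<^sup>2 \<le> (nrm2 M f + nrm2 M g)\<^sup>2"
    by (simp add: power2_eq_square algebra_simps)
qed simp

lemma nrm2_triangle_diff:
  assumes "L2 M f" "L2 M g"
  shows "nrm2 M f \<le> nrm2 M g + nrm2 M (\<lambda>x. f x - g x)"
  using nrm2_triangle[OF assms(2) L2_diff[OF assms]] by simp

lemma nrm2_eq_0_AE:
  assumes "L2 M f" "nrm2 M f = 0"
  shows "AE x in M. f x = 0"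
proof -
  have "(LINT x|M. (norm (f x))\<^sup>2) = 0" using assms(2) by (simp add: nrm2_def)
  then have "AE x in M. (norm (f x))\<^sup>2 = 0"
    using integral_nonneg_eq_0_iff_AE[OF L2_integrable[OF assms(1)]] by auto
  then show ?thesis by auto
qed

lemma nrm2_mono:
  assumes "L2 M g" "f \<in> borel_measurable M" "AE x in M. norm (f x) \<le> norm (g x)"
  shows "nrm2 M f \<le> nrm2 M g"
proof -
  have "L2 M f" using L2_bound[of M g f 1] assms by auto
  then show ?thesis unfolding nrm2_def using assms
    by (auto intro!: integral_mono_AE L2_integrable elim!: eventually_mono power_mono)
qed

lemma nrm2_tendsto_AE_subseq:
  assumes L: "\<And>n. L2 M (f n)" and lim: "(\<lambda>n. nrm2 M (f n)) \<longlonglongrightarrow> 0"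
  shows "\<exists>r::nat\<Rightarrow>nat. strict_mono r \<and> (AE x in M. (\<lambda>n. f (r n) x) \<longlonglongrightarrow> 0)"
proof -
  have "(\<lambda>n. (nrm2 M (f n))\<^sup>2) \<longlonglongrightarrow> 0\<^sup>2" by (intro tendsto_power lim)
  then have "(\<lambda>n. LINT x|M. norm ((norm (f n x))\<^sup>2)) \<longlonglongrightarrow> 0" by (simp add: nrm2_sq)
  then obtain r :: "nat \<Rightarrow> nat" where r: "strict_mono r" "AE x in M. (\<lambda>n. (norm (f (r n) x))\<^sup>2) \<longlonglongrightarrow> 0"
    using tendsto_L1_AE_subseq[of M "\<lambda>n x. (norm (f n x))\<^sup>2"] L2_integrable[OF L] by auto
  have "AE x in M. (\<lambda>n. f (r n) x) \<longlonglongrightarrow> 0"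
    using r(2)
  proof eventually_elim
    case (elim x)
    then have "(\<lambda>n. sqrt ((norm (f (r n) x))\<^sup>2)) \<longlonglongrightarrow> sqrt 0" by (intro tendsto_real_sqrt)
    then show ?case by (simp add: tendsto_norm_zero_iff)
  qed
  with r show ?thesis by auto
qed

text \<open>The passage to the limit behind every nonlinear test: \<open>Yn\<close> converges in
  norm, the coefficient \<open>b n\<close> is merely bounded and convergent almost everywhere. The
  integral splits into the one with \<open>Yn n x - Y x\<close>, which is small by Cauchy-Schwarz,
  and the one with \<open>Y x\<close>, where dominated convergence applies.\<close>

lemma L2_inner_tendsto:
  assumes X: "L2 M X" and Y: "L2 M Y" and Yn: "\<And>n. L2 M (Yn n)"
    and lim: "(\<lambda>n. nrm2 M (\<lambda>x. Yn n x - Y x)) \<longlonglongrightarrow> 0"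
    and b: "\<And>n. b n \<in> borel_measurable M" "\<And>n x. \<bar>b n x\<bar> \<le> K"
    and b': "b' \<in> borel_measurable M" "AE x in M. (\<lambda>n. b n x) \<longlonglongrightarrow> b' x"
  shows "(\<lambda>n. LINT x|M. b n x * (X x \<bullet> Yn n x)) \<longlonglongrightarrow> (LINT x|M. b' x * (X x \<bullet> Y x))"
    and "integrable M (\<lambda>x. b' x * (X x \<bullet> Y x))"
proof -
  have [measurable]: "X \<in> borel_measurable M" "Y \<in> borel_measurable M" "\<And>n. Yn n \<in> borel_measurable M"
    using X Y Yn L2_measurable by blast+
  have [measurable]: "b' \<in> borel_measurable M" "\<And>n. b n \<in> borel_measurable M"
    using b b' by auto
  have K: "0 \<le> K" using b(2)[of undefined undefined] by linarith
  have int: "integrable M (\<lambda>x. K * (norm (X x) * norm (Y x)))"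
    using L2_prod_norm[OF X Y] by auto
  have *: "\<bar>b n x * (X x \<bullet> Z)\<bar> \<le> K * (norm (X x) * norm Z)" for n x Z
    unfolding abs_mult by (intro mult_mono b Cauchy_Schwarz_ineq2) (use K in auto)
  have c1: "(\<lambda>n. LINT x|M. b n x * (X x \<bullet> Y x)) \<longlonglongrightarrow> (LINT x|M. b' x * (X x \<bullet> Y x))"
  proof (rule integral_dominated_convergence[OF _ _ int])
    show "AE x in M. (\<lambda>n. b n x * (X x \<bullet> Y x)) \<longlonglongrightarrow> b' x * (X x \<bullet> Y x)"
      using b'(2) by eventually_elim (intro tendsto_intros)
    show "AE x in M. norm (b n x * (X x \<bullet> Y x)) \<le> K * (norm (X x) * norm (Y x))" for n
      using * by auto
  qed measurable
  show "integrable M (\<lambda>x. b' x * (X x \<bullet> Y x))"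
  proof (rule integrable_dominated_convergence[OF _ _ int])
    show "AE x in M. (\<lambda>n. b n x * (X x \<bullet> Y x)) \<longlonglongrightarrow> b' x * (X x \<bullet> Y x)"
      using b'(2) by eventually_elim (intro tendsto_intros)
    show "AE x in M. norm (b n x * (X x \<bullet> Y x)) \<le> K * (norm (X x) * norm (Y x))" for n
      using * by auto
  qed measurable
  have i1: "integrable M (\<lambda>x. b n x * (X x \<bullet> Z x))" if "L2 M Z" for n Z
  proof -
    have [measurable]: "Z \<in> borel_measurable M" using that L2_measurable by auto
    have "integrable M (\<lambda>x. K * (norm (X x) * norm (Z x)))"
      using L2_prod_norm[OF X that] by auto
    then show ?thesis by (rule Bochner_Integration.integrable_bound) (auto intro!: AE_I2 order_trans[OF *])
  qed
  have c2: "(\<lambda>n. LINT x|M. b n x * (X x \<bullet> (Yn n x - Y x))) \<longlonglongrightarrow> 0"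
  proof (rule tendsto_0_le[where K=1])
    show "(\<lambda>n. K * (nrm2 M X * nrm2 M (\<lambda>x. Yn n x - Y x))) \<longlonglongrightarrow> 0"
      using tendsto_mult_right_zero[OF tendsto_mult_right_zero[OF lim]] by auto
    have "\<bar>LINT x|M. b n x * (X x \<bullet> (Yn n x - Y x))\<bar> \<le> K * (nrm2 M X * nrm2 M (\<lambda>x. Yn n x - Y x))" for n
    proof -
      have L: "L2 M (\<lambda>x. Yn n x - Y x)" by (intro L2_diff Yn Y)
      have "\<bar>LINT x|M. b n x * (X x \<bullet> (Yn n x - Y x))\<bar> \<le> (LINT x|M. \<bar>b n x * (X x \<bullet> (Yn n x - Y x))\<bar>)"
        using integral_norm_bound[of M "\<lambda>x. b n x * (X x \<bullet> (Yn n x - Y x))"] by simp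
      also have "\<dots> \<le> (LINT x|M. K * (norm (X x) * norm (Yn n x - Y x)))"
        by (intro integral_mono integrable_abs i1 L integrable_mult_right L2_prod_norm X *)
      also have "\<dots> \<le> K * (nrm2 M X * nrm2 M (\<lambda>x. Yn n x - Y x))"
        using K L2_prod_norm(2)[OF X L] by (simp add: mult_left_mono)
      finally show ?thesis .
    qed
    then show "\<forall>\<^sub>F n in sequentially. norm (LINT x|M. b n x * (X x \<bullet> (Yn n x - Y x)))
        \<le> norm (K * (nrm2 M X * nrm2 M (\<lambda>x. Yn n x - Y x))) * 1"
      by (auto intro!: always_eventually order_trans[OF _ abs_ge_self])
  qed
  have "(LINT x|M. b n x * (X x \<bullet> Yn n x)) = (LINT x|M. b n x * (X x \<bullet> (Yn n x - Y x))) + (LINT x|M. b n x * (X x \<bullet> Y x))" for n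
    using i1[OF Yn] i1[OF Y] i1[OF L2_diff[OF Yn Y]]
    by (subst Bochner_Integration.integral_add[symmetric]) (auto simp: inner_simps algebra_simps)
  then show "(\<lambda>n. LINT x|M. b n x * (X x \<bullet> Yn n x)) \<longlonglongrightarrow> (LINT x|M. b' x * (X x \<bullet> Y x))"
    using tendsto_add[OF c2 c1] by simp
qed

text \<open>Riesz-Fischer. Along a fast subsequence the increments are summable in L^1, because on a
  finite measure space the L^1 norm is controlled by the L^2 norm; so the subsequence converges
  almost everywhere. Fatou's lemma then carries the Cauchy estimate over to the limit.\<close>

lemma (in finite_measure) L2_complete:
  fixes f :: "nat \<Rightarrow> 'a \<Rightarrow> 'b::euclidean_space"
  assumes L: "\<And>n. L2 M (f n)"
    and Cauchy: "\<And>e. 0 < e \<Longrightarrow> \<exists>N. \<forall>m\<ge>N. \<forall>n\<ge>N. nrm2 M (\<lambda>x. f m x - f n x) < e"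
  shows "\<exists>g. L2 M g \<and> (\<lambda>n. nrm2 M (\<lambda>x. f n x - g x)) \<longlonglongrightarrow> 0"
proof -
  have [measurable]: "\<And>n. f n \<in> borel_measurable M" using L L2_measurable by auto
  have "\<exists>N. \<forall>m\<ge>N. \<forall>n\<ge>N. nrm2 M (\<lambda>x. f m x - f n x) < (1/2)^k" for k
    by (rule Cauchy) auto
  then obtain N where N: "\<And>k m n. N k \<le> m \<Longrightarrow> N k \<le> n \<Longrightarrow> nrm2 M (\<lambda>x. f m x - f n x) < (1/2)^k"
    by metis
  \<comment> \<open>The sum makes \<open>r\<close> monotone and at least \<open>N k\<close>; the
    summand \<open>k\<close> makes it tend to infinity.\<close>
  define r where "r k = (\<Sum>i\<le>k. N i) + k" for k
  have rN: "N k \<le> r k" for k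
    unfolding r_def using member_le_sum[of k "{..k}" N] by auto
  have rmono: "r k \<le> r (Suc k)" for k by (simp add: r_def)
  have rk: "k \<le> r k" for k by (simp add: r_def)
  define d where "d k x = norm (f (r (Suc k)) x - f (r k) x)" for k x
  have Ld: "L2 M (d k)" for k
    using L2_diff[OF L L, of "r (Suc k)" "r k"] by (simp add: d_def[abs_def] L2_def)
  have one: "L2 M (\<lambda>x. 1::real)" by (simp add: L2_def)
  have dint: "integrable M (d k)" for k
    using L2_inner_integrable[OF Ld one, of k] by simp
  have "\<bar>LINT x|M. d k x\<bar> \<le> nrm2 M (d k) * nrm2 M (\<lambda>x. 1::real)" for k
    using L2_Cauchy_Schwarz[OF Ld one, of k] by simp
  moreover have "nrm2 M (d k) \<le> (1/2)^k" for k
  proof -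
    have "nrm2 M (d k) = nrm2 M (\<lambda>x. f (r (Suc k)) x - f (r k) x)"
      by (simp add: nrm2_def d_def)
    then show ?thesis
      using N[of k "r (Suc k)" "r k"] order_trans[OF rN rmono, of k] rN[of k] by linarith
  qed
  ultimately have dle: "(LINT x|M. d k x) \<le> (1/2)^k * nrm2 M (\<lambda>x. 1::real)" for k
    by (smt (verit) mult_right_mono nrm2_nonneg)
  have "summable (\<lambda>k. LINT x|M. norm (d k x))"
  proof (rule summable_comparison_test')
    show "summable (\<lambda>k. (1/2)^k * nrm2 M (\<lambda>x. 1::real))" by (intro summable_mult2) auto
    show "norm (LINT x|M. norm (d k x)) \<le> (1/2)^k * nrm2 M (\<lambda>x. 1::real)" for k
      using dle[of k] by (simp add: d_def)
  qed
  have dnn: "0 \<le> d k x" for k x by (simp add: d_def)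
  have "(\<integral>\<^sup>+x. (\<Sum>k. ennreal (d k x)) \<partial>M) = (\<Sum>k. \<integral>\<^sup>+x. ennreal (d k x) \<partial>M)"
    using dint by (intro nn_integral_suminf) auto
  also have "\<dots> = (\<Sum>k. ennreal (LINT x|M. d k x))"
    using dint dnn by (simp add: nn_integral_eq_integral)
  also have "\<dots> < top"
    using \<open>summable (\<lambda>k. LINT x|M. norm (d k x))\<close> dnn
    by (subst suminf_ennreal2) auto
  finally have "AE x in M. (\<Sum>k. ennreal (d k x)) \<noteq> \<infinity>"
    using dint by (intro nn_integral_noteq_infinite) (auto simp: less_top)
  then have conv: "AE x in M. convergent (\<lambda>k. f (r k) x)"
  proof eventually_elim
    case (elim x)
    then have "summable (\<lambda>k. d k x)"
      using dnn by (intro summable_suminf_not_top) auto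
    then have "summable (\<lambda>k. f (r (Suc k)) x - f (r k) x)"
      unfolding d_def by (rule summable_norm_cancel)
    then have "convergent (\<lambda>n. \<Sum>k<n. f (r (Suc k)) x - f (r k) x)"
      by (simp add: summable_iff_convergent)
    then have "convergent (\<lambda>n. f (r n) x - f (r 0) x)"
      using sum_lessThan_telescope[of "\<lambda>k. f (r k) x"] by simp
    then have "convergent (\<lambda>n. (f (r n) x - f (r 0) x) + f (r 0) x)"
      by (intro convergent_add convergent_const)
    then show ?case by simp
  qed
  define g where "g x = lim (\<lambda>k. f (r k) x)" for x
  have [measurable]: "g \<in> borel_measurable M"
    unfolding g_def by (rule borel_measurable_lim_metric) simp
  have lim: "AE x in M. (\<lambda>k. f (r k) x) \<longlonglongrightarrow> g x"
    using conv by eventually_elim (simp add: g_def convergent_LIMSEQ_iff)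
  have fatou: "L2 M (\<lambda>x. f n x - g x) \<and> nrm2 M (\<lambda>x. f n x - g x) \<le> e"
    if e: "0 < e" and n: "\<And>m. N' \<le> m \<Longrightarrow> nrm2 M (\<lambda>x. f n x - f m x) \<le> e" for n e N'
  proof -
    have "(\<integral>\<^sup>+x. ennreal ((norm (f n x - g x))\<^sup>2) \<partial>M) = (\<integral>\<^sup>+x. liminf (\<lambda>k. ennreal ((norm (f n x - f (r k) x))\<^sup>2)) \<partial>M)"
    proof (rule nn_integral_cong_AE)
      show "AE x in M. ennreal ((norm (f n x - g x))\<^sup>2) = liminf (\<lambda>k. ennreal ((norm (f n x - f (r k) x))\<^sup>2))"
        using lim
      proof eventually_elim
        case (elim x)
        then have "(\<lambda>k. ennreal ((norm (f n x - f (r k) x))\<^sup>2)) \<longlonglongrightarrow> ennreal ((norm (f n x - g x))\<^sup>2)"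
          by (intro tendsto_intros)
        then show ?case by (intro lim_imp_Liminf[symmetric]) auto
      qed
    qed
    also have "\<dots> \<le> liminf (\<lambda>k. \<integral>\<^sup>+x. ennreal ((norm (f n x - f (r k) x))\<^sup>2) \<partial>M)"
      by (intro nn_integral_liminf) auto
    also have "\<dots> = liminf (\<lambda>k. ennreal ((nrm2 M (\<lambda>x. f n x - f (r k) x))\<^sup>2))"
      using L2_integrable[OF L2_diff[OF L L]] by (simp add: nn_integral_eq_integral nrm2_sq)
    also have "\<dots> \<le> liminf (\<lambda>k. ennreal (e\<^sup>2))"
    proof (rule Liminf_mono)
      show "\<forall>\<^sub>F k in sequentially. ennreal ((nrm2 M (\<lambda>x. f n x - f (r k) x))\<^sup>2) \<le> ennreal (e\<^sup>2)"
        using eventually_ge_at_top[of N']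
      proof eventually_elim
        case (elim k)
        then have "N' \<le> r k" using rk order_trans by blast
        then show ?case using n[of "r k"] by (auto intro!: ennreal_leI power_mono)
      qed
    qed
    also have "\<dots> = ennreal (e\<^sup>2)" by (intro Liminf_const) auto
    finally have le: "(\<integral>\<^sup>+x. ennreal ((norm (f n x - g x))\<^sup>2) \<partial>M) \<le> ennreal (e\<^sup>2)" .
    then have int: "integrable M (\<lambda>x. (norm (f n x - g x))\<^sup>2)"
      by (intro integrableI_bounded) (auto simp: order_le_less_trans)
    then have "ennreal ((nrm2 M (\<lambda>x. f n x - g x))\<^sup>2) \<le> ennreal (e\<^sup>2)"
      using le by (simp add: nn_integral_eq_integral nrm2_sq)
    then have "(nrm2 M (\<lambda>x. f n x - g x))\<^sup>2 \<le> e\<^sup>2" by simp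
    then have "nrm2 M (\<lambda>x. f n x - g x) \<le> e" by (rule power2_le_imp_le) (use e in simp)
    moreover have "L2 M (\<lambda>x. f n x - g x)" unfolding L2_def using int by simp
    ultimately show ?thesis by blast
  qed
  have "L2 M g"
  proof -
    have "L2 M (\<lambda>x. f (N 0) x - g x)"
      using fatou[of 1 "N 0" "N 0"] N[of 0 "N 0"] by (auto simp: less_imp_le)
    from L2_diff[OF L this, of "N 0"] show ?thesis by simp
  qed
  moreover have "(\<lambda>n. nrm2 M (\<lambda>x. f n x - g x)) \<longlonglongrightarrow> 0"
  proof (rule LIMSEQ_I)
    fix e :: real assume "0 < e"
    then obtain N' where N': "\<forall>m\<ge>N'. \<forall>n\<ge>N'. nrm2 M (\<lambda>x. f m x - f n x) < e/2"
      using Cauchy[of "e/2"] by auto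
    have "nrm2 M (\<lambda>x. f n x - g x) < e" if "n \<ge> N'" for n
    proof -
      have "nrm2 M (\<lambda>x. f n x - g x) \<le> e/2"
        using fatou[of "e/2" N' n] N' that \<open>0 < e\<close> by (meson half_gt_zero less_imp_le)
      then show ?thesis using \<open>0 < e\<close> by linarith
    qed
    then show "\<exists>no. \<forall>n\<ge>no. norm (nrm2 M (\<lambda>x. f n x - g x) - 0) < e" by auto
  qed
  ultimately show ?thesis by auto
qed

section \<open>Smooth functions of one variable\<close>

text \<open>The derivative is quantified existentially, so closure under sums, products and
  composition follows by exhibiting a derivative and inducting on \<open>k\<close>.\<close>

primrec diffk :: "nat \<Rightarrow> (real \<Rightarrow> real) \<Rightarrow> bool" where
  "diffk 0 f \<longleftrightarrow> continuous_on UNIV f"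
| "diffk (Suc k) f \<longleftrightarrow> (\<exists>f'. (\<forall>x. (f has_real_derivative f' x) (at x)) \<and> diffk k f')"

definition smooth :: "(real \<Rightarrow> real) \<Rightarrow> bool" where
  "smooth f \<longleftrightarrow> (\<forall>k. diffk k f)"

lemma diffk_SucD: "diffk (Suc k) f \<Longrightarrow> diffk k f"
proof (induction k arbitrary: f)
  case 0
  then obtain f' where "\<And>x. (f has_real_derivative f' x) (at x)"
    unfolding diffk.simps by blast
  then have "isCont f x" for x by (rule DERIV_isCont)
  then show ?case by (simp add: continuous_at_imp_continuous_on)
next
  case (Suc k)
  from Suc.prems obtain f' where f': "\<forall>x. (f has_real_derivative f' x) (at x)" "diffk (Suc k) f'"
    unfolding diffk.simps(2)[of "Suc k"] by blast
  have "diffk k f'" by (rule Suc.IH) (rule f'(2))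
  with f'(1) show ?case unfolding diffk.simps(2) by blast
qed

lemma diffk_SucI:
  "(\<And>x. (f has_real_derivative f' x) (at x)) \<Longrightarrow> diffk k f' \<Longrightarrow> diffk (Suc k) f"
  unfolding diffk.simps by blast

lemma diffk_const: "diffk k (\<lambda>x. c)"
proof (induction k arbitrary: c)
  case (Suc k)
  show ?case by (rule diffk_SucI[OF DERIV_const Suc.IH])
qed simp

lemma diffk_ident: "diffk k (\<lambda>x. x)"
proof (cases k)
  case (Suc k')
  show ?thesis unfolding Suc by (rule diffk_SucI[OF DERIV_ident diffk_const])
qed simp

lemma diffk_add: "diffk k f \<Longrightarrow> diffk k g \<Longrightarrow> diffk k (\<lambda>x. f x + g x)"
proof (induction k arbitrary: f g)
  case 0
  then show ?case by (auto intro: continuous_on_add)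
next
  case (Suc k)
  obtain f' where f': "\<And>x. (f has_real_derivative f' x) (at x)" "diffk k f'"
    using Suc.prems(1) unfolding diffk.simps by blast
  obtain g' where g': "\<And>x. (g has_real_derivative g' x) (at x)" "diffk k g'"
    using Suc.prems(2) unfolding diffk.simps by blast
  show ?case by (rule diffk_SucI[OF DERIV_add[OF f'(1) g'(1)] Suc.IH[OF f'(2) g'(2)]])
qed

lemma diffk_mult: "diffk k f \<Longrightarrow> diffk k g \<Longrightarrow> diffk k (\<lambda>x. f x * g x)"
proof (induction k arbitrary: f g)
  case 0
  then show ?case by (auto intro: continuous_on_mult)
next
  case (Suc k)
  obtain f' where f': "\<And>x. (f has_real_derivative f' x) (at x)" "diffk k f'"
    using Suc.prems(1) unfolding diffk.simps by blast
  obtain g' where g': "\<And>x. (g has_real_derivative g' x) (at x)" "diffk k g'"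
    using Suc.prems(2) unfolding diffk.simps by blast
  have "diffk k (\<lambda>x. f' x * g x + g' x * f x)"
    by (intro diffk_add Suc.IH f' g' diffk_SucD[OF Suc.prems(1)] diffk_SucD[OF Suc.prems(2)])
  then show ?case by (rule diffk_SucI[OF DERIV_mult[OF f'(1) g'(1)]])
qed

lemma diffk_compose: "diffk k f \<Longrightarrow> diffk k g \<Longrightarrow> diffk k (\<lambda>x. f (g x))"
proof (induction k arbitrary: f g)
  case 0
  then show ?case
    unfolding diffk.simps by (rule continuous_on_compose2) simp
next
  case (Suc k)
  obtain f' where f': "\<And>x. (f has_real_derivative f' x) (at x)" "diffk k f'"
    using Suc.prems(1) unfolding diffk.simps by blast
  obtain g' where g': "\<And>x. (g has_real_derivative g' x) (at x)" "diffk k g'"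
    using Suc.prems(2) unfolding diffk.simps by blast
  have "diffk k (\<lambda>x. f' (g x) * g' x)"
    by (rule diffk_mult[OF Suc.IH[OF f'(2) diffk_SucD[OF Suc.prems(2)]] g'(2)])
  then show ?case by (rule diffk_SucI[OF DERIV_chain2[OF f'(1) g'(1)]])
qed

lemma smooth_const: "smooth (\<lambda>x. c)"
  and smooth_ident: "smooth (\<lambda>x. x)"
  and smooth_add: "smooth f \<Longrightarrow> smooth g \<Longrightarrow> smooth (\<lambda>x. f x + g x)"
  and smooth_mult: "smooth f \<Longrightarrow> smooth g \<Longrightarrow> smooth (\<lambda>x. f x * g x)"
  and smooth_compose: "smooth f \<Longrightarrow> smooth g \<Longrightarrow> smooth (\<lambda>x. f (g x))"
  by (auto simp: smooth_def intro: diffk_const diffk_ident diffk_add diffk_mult diffk_compose)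

lemma smooth_cmult: "smooth f \<Longrightarrow> smooth (\<lambda>x. c * f x)"
  by (intro smooth_mult smooth_const)

lemma smooth_antiderivative:
  assumes "\<And>x. (f has_real_derivative f' x) (at x)" "smooth f'"
  shows "smooth f"
  unfolding smooth_def
proof
  fix k show "diffk k f"
  proof (rule diffk_SucD)
    show "diffk (Suc k) f"
      using assms(2) by (intro diffk_SucI[OF assms(1)]) (simp add: smooth_def)
  qed
qed

lemma smooth_continuous: "smooth f \<Longrightarrow> continuous_on UNIV f"
  by (metis smooth_def diffk.simps(1))

section \<open>Flat functions and cutoffs\<close>

text \<open>The function exp(-1/t), extended by 0, is not closed under differentiation; this family
  around it is, which turns smoothness into a plain induction.\<close>

definition poly_flat :: "real poly \<Rightarrow> real \<Rightarrow> real" where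
  "poly_flat p t = (if 0 < t then poly p (1 / t) * exp (- (1 / t)) else 0)"

lemma poly_exp_tendsto_0: "((\<lambda>y::real. poly p y * exp (- y)) \<longlongrightarrow> 0) at_top"
proof -
  have "((\<lambda>y::real. \<Sum>i\<le>degree p. coeff p i * (y ^ i / exp y)) \<longlongrightarrow> (\<Sum>i\<le>degree p. coeff p i * 0)) at_top"
    by (intro tendsto_intros tendsto_power_div_exp_0)
  then show ?thesis
    by (simp add: poly_altdef sum_distrib_right exp_minus divide_inverse mult.assoc)
qed

text \<open>In the variable y = 1/t the chain rule turns p into y^2 (p - p'), and
  \<open>[:0, 0, 1:]\<close> is y^2. At 0 only the right-hand limit of the difference quotient needs
  work.\<close>

lemma poly_flat_DERIV:
  "(poly_flat p has_real_derivative poly_flat ([:0, 0, 1:] * (p - pderiv p)) t) (at t)"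
proof -
  consider "0 < t" | "t < 0" | "t = 0" by linarith
  then show ?thesis
  proof cases
    case 1
    have "((\<lambda>t. poly p (1 / t) * exp (- (1 / t))) has_real_derivative
        poly_flat ([:0, 0, 1:] * (p - pderiv p)) t) (at t)"
      using 1 by (auto intro!: derivative_eq_intros DERIV_chain2[of "poly p", OF poly_DERIV]
          simp: poly_flat_def field_simps power2_eq_square)
    then show ?thesis
      by (rule has_field_derivative_transform_within_open[of _ _ _ "{0<..}"])
         (use 1 in \<open>auto simp: poly_flat_def\<close>)
  next
    case 2
    have "((\<lambda>t. 0) has_real_derivative poly_flat ([:0, 0, 1:] * (p - pderiv p)) t) (at t)"
      using 2 by (simp add: poly_flat_def)
    then show ?thesis
      by (rule has_field_derivative_transform_within_open[of _ _ _ "{..<0}"])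
         (use 2 in \<open>auto simp: poly_flat_def\<close>)
  next
    case 3
    have r: "((\<lambda>h. poly_flat p h / h) \<longlongrightarrow> 0) (at_right 0)"
    proof (rule Lim_transform_eventually)
      \<comment> \<open>Dividing by \<open>h\<close> multiplies the polynomial by its variable
        \<open>1/h\<close>; \<open>pCons 0 p\<close> is that product.\<close>
      show "((\<lambda>h::real. poly (pCons 0 p) (inverse h) * exp (- inverse h)) \<longlongrightarrow> 0) (at_right 0)"
        by (rule filterlim_compose[OF poly_exp_tendsto_0 filterlim_inverse_at_top_right])
      show "\<forall>\<^sub>F h in at_right 0. poly (pCons 0 p) (inverse h) * exp (- inverse h) = poly_flat p h / h"
        by (auto simp: poly_flat_def eventually_at_filter inverse_eq_divide)
    qed
    have l: "((\<lambda>h. poly_flat p h / h) \<longlongrightarrow> 0) (at_left 0)"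
      by (rule Lim_transform_eventually[OF tendsto_const])
         (auto simp: poly_flat_def eventually_at_filter)
    have "((\<lambda>h. poly_flat p h / h) \<longlongrightarrow> 0) (at 0)"
      using filterlim_split_at l r by blast
    then show ?thesis
      using 3 by (simp add: DERIV_def poly_flat_def)
  qed
qed

lemma smooth_poly_flat: "smooth (poly_flat p)"
proof -
  have "diffk k (poly_flat p)" for k
  proof (induction k arbitrary: p)
    case 0
    show ?case
      by (auto intro!: continuous_at_imp_continuous_on DERIV_isCont[OF poly_flat_DERIV])
  next
    case (Suc k)
    show ?case by (rule diffk_SucI[OF poly_flat_DERIV Suc.IH])
  qed
  then show ?thesis by (simp add: smooth_def)
qed

definition cutoff :: "real \<Rightarrow> real" where
  "cutoff t = (if 0 < t then exp (- (1 / t)) else 0)"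

lemma smooth_cutoff: "smooth cutoff"
proof -
  have "cutoff = poly_flat 1" by (auto simp: cutoff_def poly_flat_def)
  then show ?thesis by (metis smooth_poly_flat)
qed

lemma cutoff_bounds: "0 \<le> cutoff t" "cutoff t \<le> 1"
  by (auto simp: cutoff_def)

text \<open>Steep rescaling approximates the indicator of the open half line from below, at every
  point. This takes the place of mollification throughout.\<close>

lemma cutoff_tendsto:
  "(\<lambda>n. cutoff (real (Suc n) * t)) \<longlonglongrightarrow> (if 0 < t then 1 else 0)"
proof (cases "0 < t")
  case True
  have "(\<lambda>n. exp (- ((1 / t) * inverse (real (Suc n))))) \<longlonglongrightarrow> exp (- ((1/t) * 0))"
    by (intro tendsto_intros LIMSEQ_inverse_real_of_nat)
  moreover have "cutoff (real (Suc n) * t) = exp (- ((1 / t) * inverse (real (Suc n))))" for n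
  proof -
    have "0 < real (Suc n) * t" using True by simp
    then show ?thesis unfolding cutoff_def by (simp add: divide_inverse mult.commute)
  qed
  ultimately show ?thesis using True by simp
next
  case False
  then show ?thesis by (simp add: cutoff_def zero_less_mult_iff)
qed

section \<open>Smooth functions of several variables\<close>

lemma partial_deriv_eq: "(f has_derivative D) (at x) \<Longrightarrow> partial_deriv i f x = D (axis i 1)"
  unfolding partial_deriv_def by (metis frechet_derivative_at)

lemma gradient_has_derivative:
  fixes f :: "real^'n::finite \<Rightarrow> real"
  assumes "f differentiable (at x)"
  shows "(f has_derivative (\<lambda>v. gradient f x \<bullet> v)) (at x)"
proof -
  obtain D where D: "(f has_derivative D) (at x)" using assms by (auto simp: differentiable_def)
  interpret linear D using D has_derivative_linear by blast
  have "D = (\<lambda>v. gradient f x \<bullet> v)"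
  proof
    fix v
    have "D v = D (\<Sum>i\<in>UNIV. (v $ i) *\<^sub>R axis i 1)"
      using basis_expansion[of v] by (simp add: scalar_mult_eq_scaleR)
    also have "\<dots> = (\<Sum>i\<in>UNIV. (v $ i) * D (axis i 1))" by (simp add: sum scale)
    also have "\<dots> = gradient f x \<bullet> v"
      by (simp add: gradient_def inner_vec_def partial_deriv_eq[OF D] mult.commute)
    finally show "D v = gradient f x \<bullet> v" .
  qed
  then show ?thesis using D by simp
qed

lemma gradient_eqI:
  fixes f :: "real^'n::finite \<Rightarrow> real"
  assumes "(f has_derivative (\<lambda>v. g \<bullet> v)) (at x)"
  shows "gradient f x = g"
  by (simp add: vec_eq_iff gradient_def partial_deriv_eq[OF assms] inner_axis)

lemma C_k_SucD: "C_k (Suc k) f \<Longrightarrow> C_k k f"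
proof (induction k arbitrary: f)
  case 0
  then show ?case
    by (auto intro!: continuous_at_imp_continuous_on differentiable_imp_continuous_within)
next
  case (Suc k)
  from Suc.prems have "\<forall>x. f differentiable (at x)" "\<forall>i. C_k (Suc k) (partial_deriv i f)"
    unfolding C_k.simps(2)[of "Suc k"] by blast+
  moreover have "C_k k (partial_deriv i f)" for i
    by (rule Suc.IH) (use \<open>\<forall>i. C_k (Suc k) (partial_deriv i f)\<close> in blast)
  ultimately show ?case unfolding C_k.simps(2) by blast
qed

lemma C_k_const: "C_k k (\<lambda>x. c)"
proof (induction k arbitrary: c)
  case (Suc k)
  have "partial_deriv i (\<lambda>x. c) = (\<lambda>x. 0)" for i :: 'a
    by (rule ext) (simp add: partial_deriv_eq[OF has_derivative_const])
  with Suc show ?case by auto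
qed auto

lemma C_k_coordinate: "C_k k (\<lambda>x. x $ j)"
proof (cases k)
  case (Suc k)
  have "((\<lambda>x. x $ j) has_derivative (\<lambda>v. v $ j)) (at x)" for x :: "real^'a"
    by (rule bounded_linear.has_derivative[OF bounded_linear_vec_nth has_derivative_ident])
  then have "partial_deriv i (\<lambda>x. x $ j) = (\<lambda>x. axis i 1 $ j)" for i
    by (intro ext) (rule partial_deriv_eq)
  with Suc show ?thesis
    using \<open>\<And>x. ((\<lambda>x. x $ j) has_derivative (\<lambda>v. v $ j)) (at x)\<close>
    by (auto simp: C_k_const differentiable_def)
qed (auto intro!: continuous_intros)

lemma partial_deriv_add:
  assumes "f differentiable (at x)" "g differentiable (at x)"
  shows "partial_deriv i (\<lambda>x. f x + g x) x = partial_deriv i f x + partial_deriv i g x"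
proof -
  obtain f' g' where *: "(f has_derivative f') (at x)" "(g has_derivative g') (at x)"
    using assms by (auto simp: differentiable_def)
  show ?thesis
    using partial_deriv_eq[OF has_derivative_add[OF *]] *[THEN partial_deriv_eq] by simp
qed

lemma partial_deriv_mult:
  assumes "f differentiable (at x)" "g differentiable (at x)"
  shows "partial_deriv i (\<lambda>x. f x * g x) x = f x * partial_deriv i g x + partial_deriv i f x * g x"
proof -
  obtain f' g' where *: "(f has_derivative f') (at x)" "(g has_derivative g') (at x)"
    using assms by (auto simp: differentiable_def)
  show ?thesis
    using partial_deriv_eq[OF has_derivative_mult[OF *]] *[THEN partial_deriv_eq] by simp
qed

lemma has_derivative_DERIV_compose:
  assumes "(f has_derivative D) (at x)" "(h has_real_derivative h') (at (f x))"
  shows "((\<lambda>x. h (f x)) has_derivative (\<lambda>v. h' * D v)) (at x)"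
  using has_derivative_compose[OF assms(1), of h "(*) h'"] assms(2)
  by (simp add: has_field_derivative_def)

lemma partial_deriv_compose:
  assumes "f differentiable (at x)" "(h has_real_derivative h') (at (f x))"
  shows "partial_deriv i (\<lambda>x. h (f x)) x = h' * partial_deriv i f x"
proof -
  obtain f' where *: "(f has_derivative f') (at x)"
    using assms by (auto simp: differentiable_def)
  show ?thesis
    using partial_deriv_eq[OF has_derivative_DERIV_compose[OF * assms(2)]] *[THEN partial_deriv_eq] by simp
qed

lemma C_k_add: "C_k k f \<Longrightarrow> C_k k g \<Longrightarrow> C_k k (\<lambda>x. f x + g x)"
proof (induction k arbitrary: f g)
  case 0
  then show ?case by (auto intro: continuous_on_add)
next
  case (Suc k)
  have "partial_deriv i (\<lambda>x. f x + g x) = (\<lambda>x. partial_deriv i f x + partial_deriv i g x)" for i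
    using Suc.prems by (auto intro!: partial_deriv_add)
  with Suc show ?case by auto
qed

lemma C_k_mult: "C_k k f \<Longrightarrow> C_k k g \<Longrightarrow> C_k k (\<lambda>x. f x * g x)"
proof (induction k arbitrary: f g)
  case 0
  then show ?case by (auto intro: continuous_on_mult)
next
  case (Suc k)
  have "partial_deriv i (\<lambda>x. f x * g x) = (\<lambda>x. f x * partial_deriv i g x + partial_deriv i f x * g x)" for i
    using Suc.prems by (auto intro!: partial_deriv_mult)
  moreover have "C_k k (\<lambda>x. f x * partial_deriv i g x + partial_deriv i f x * g x)" for i
    using Suc.prems Suc.prems[THEN C_k_SucD] by (intro C_k_add Suc.IH) auto
  ultimately show ?case using Suc.prems by auto
qed

lemma C_k_compose: "C_k k f \<Longrightarrow> diffk k h \<Longrightarrow> C_k k (\<lambda>x. h (f x))"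
proof (induction k arbitrary: f h)
  case 0
  then show ?case
    unfolding diffk.simps C_k.simps by (intro continuous_on_compose2[of UNIV h UNIV f]) auto
next
  case (Suc k)
  obtain h' where h': "\<And>x. (h has_real_derivative h' x) (at x)" "diffk k h'"
    using Suc.prems(2) unfolding diffk.simps by blast
  have f: "\<And>x. f differentiable (at x)" "\<And>i. C_k k (partial_deriv i f)"
    using Suc.prems(1) by auto
  have "partial_deriv i (\<lambda>x. h (f x)) = (\<lambda>x. h' (f x) * partial_deriv i f x)" for i
    by (rule ext) (rule partial_deriv_compose[OF f(1) h'(1)])
  moreover have "C_k k (\<lambda>x. h' (f x) * partial_deriv i f x)" for i
    by (rule C_k_mult[OF Suc.IH[OF C_k_SucD[OF Suc.prems(1)] h'(2)] f(2)])
  moreover have "(\<lambda>x. h (f x)) differentiable (at x)" for x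
    using has_derivative_DERIV_compose[OF gradient_has_derivative[OF f(1)] h'(1)]
    unfolding differentiable_def by blast
  ultimately show ?case by simp
qed

lemma C_k_prod: "finite I \<Longrightarrow> (\<And>i. i \<in> I \<Longrightarrow> C_k k (f i)) \<Longrightarrow> C_k k (\<lambda>x. \<Prod>i\<in>I. f i x)"
  by (induction rule: finite_induct) (auto intro: C_k_const C_k_mult)

section \<open>Test functions\<close>

lemma test_functionsI:
  assumes "\<And>k. C_k k \<phi>" "compact K" "K \<subseteq> U" "\<And>x. x \<notin> K \<Longrightarrow> \<phi> x = 0"
  shows "\<phi> \<in> test_functions U"
proof -
  have "closure {x. \<phi> x \<noteq> 0} \<subseteq> K"
    using assms by (intro closure_minimal compact_imp_closed) auto
  then have "compact (closure {x. \<phi> x \<noteq> 0})"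
    using \<open>compact K\<close> by (meson bounded_subset closed_closure compact_eq_bounded_closed)
  with \<open>closure {x. \<phi> x \<noteq> 0} \<subseteq> K\<close> show ?thesis
    using assms by (auto simp: test_functions_def)
qed

locale test_fct =
  fixes U :: "(real^'n::finite) set" and \<phi> :: "real^'n \<Rightarrow> real"
  assumes test: "\<phi> \<in> test_functions U"
begin

definition supp where "supp = closure {x. \<phi> x \<noteq> 0}"

lemma C_k: "C_k k \<phi>"
  using test by (simp add: test_functions_def)

lemma compact_supp: "compact supp" and supp_subset: "supp \<subseteq> U"
  using test by (auto simp: test_functions_def supp_def)

lemma zero_outside: "x \<notin> supp \<Longrightarrow> \<phi> x = 0"
  using closure_subset by (force simp: supp_def)

lemma differentiable: "\<phi> differentiable (at x)"
  using C_k[of 1] by simp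

lemma has_derivative: "(\<phi> has_derivative (\<lambda>v. gradient \<phi> x \<bullet> v)) (at x)"
  by (rule gradient_has_derivative[OF differentiable])

lemma gradient_outside: "x \<notin> supp \<Longrightarrow> gradient \<phi> x = 0"
proof -
  assume x: "x \<notin> supp"
  have "((\<lambda>x. 0::real) has_derivative (\<lambda>v. 0 \<bullet> v)) (at x)" by simp
  then have "(\<phi> has_derivative (\<lambda>v. 0 \<bullet> v)) (at x)"
    by (rule has_derivative_transform_within_open[of _ _ _ _ "- supp"])
       (use x compact_supp zero_outside in \<open>auto intro: compact_imp_closed open_Compl\<close>)
  then show ?thesis by (rule gradient_eqI)
qed

lemma continuous: "continuous_on UNIV \<phi>"
  using C_k[of 0] by simp

lemma continuous_partial: "continuous_on UNIV (partial_deriv i \<phi>)"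
  using C_k[of "Suc 0"] by simp

lemma continuous_gradient: "continuous_on UNIV (gradient \<phi>)"
  unfolding gradient_def using continuous_partial by (intro continuous_intros) auto

lemma measurable [measurable]: "\<phi> \<in> borel_measurable borel" "gradient \<phi> \<in> borel_measurable borel"
  using continuous continuous_gradient by (auto intro: borel_measurable_continuous_onI)

lemma bounded: obtains b where "0 < b" "\<And>x. \<bar>\<phi> x\<bar> \<le> b" "\<And>x. norm (gradient \<phi> x) \<le> b"
proof -
  have "compact (\<phi> ` supp)" "compact (gradient \<phi> ` supp)"
    using compact_supp continuous continuous_gradient
    by (auto intro!: compact_continuous_image intro: continuous_on_subset)
  then have "bounded (\<phi> ` supp)" "bounded (gradient \<phi> ` supp)"
    by (simp_all add: compact_imp_bounded)
  then obtain b1 b2 where "\<forall>x\<in>\<phi> ` supp. norm x \<le> b1" "\<forall>x\<in>gradient \<phi> ` supp. norm x \<le> b2"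
    unfolding bounded_iff by blast
  then have b1: "\<And>x. x \<in> supp \<Longrightarrow> norm (\<phi> x) \<le> b1"
    and b2: "\<And>x. x \<in> supp \<Longrightarrow> norm (gradient \<phi> x) \<le> b2"
    by simp_all
  show ?thesis
  proof (rule that[of "\<bar>b1\<bar> + \<bar>b2\<bar> + 1"])
    show "\<bar>\<phi> x\<bar> \<le> \<bar>b1\<bar> + \<bar>b2\<bar> + 1" for x
      using b1[of x] zero_outside[of x] by (cases "x \<in> supp") auto
    show "norm (gradient \<phi> x) \<le> \<bar>b1\<bar> + \<bar>b2\<bar> + 1" for x
      using b2[of x] gradient_outside[of x] by (cases "x \<in> supp") auto
  qed auto
qed

end

lemma test_fctI: "\<phi> \<in> test_functions U \<Longrightarrow> test_fct U \<phi>"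
  by (simp add: test_fct_def)

lemma test_zero: "(\<lambda>x. 0) \<in> test_functions U"
  by (rule test_functionsI[of _ "{}"]) (auto intro: C_k_const)

lemma test_linear:
  assumes "\<phi> \<in> test_functions U" "\<psi> \<in> test_functions U"
  shows "(\<lambda>x. a * \<phi> x + b * \<psi> x) \<in> test_functions U"
    and "gradient (\<lambda>x. a * \<phi> x + b * \<psi> x) x = a *\<^sub>R gradient \<phi> x + b *\<^sub>R gradient \<psi> x"
proof -
  interpret p: test_fct U \<phi> by (rule test_fctI) fact
  interpret q: test_fct U \<psi> by (rule test_fctI) fact
  show "(\<lambda>x. a * \<phi> x + b * \<psi> x) \<in> test_functions U"
    by (rule test_functionsI[of _ "p.supp \<union> q.supp"])
       (use p.compact_supp q.compact_supp p.supp_subset q.supp_subset in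
        \<open>auto intro!: C_k_add C_k_mult C_k_const p.C_k q.C_k simp: p.zero_outside q.zero_outside\<close>)
  have "((\<lambda>x. a * \<phi> x + b * \<psi> x) has_derivative
      (\<lambda>v. a * (gradient \<phi> x \<bullet> v) + b * (gradient \<psi> x \<bullet> v))) (at x)"
    by (intro derivative_intros p.has_derivative q.has_derivative)
  then show "gradient (\<lambda>x. a * \<phi> x + b * \<psi> x) x = a *\<^sub>R gradient \<phi> x + b *\<^sub>R gradient \<psi> x"
    by (intro gradient_eqI) (simp add: inner_simps)
qed

lemma test_mult:
  assumes "\<phi> \<in> test_functions U" "\<psi> \<in> test_functions U"
  shows "(\<lambda>x. \<phi> x * \<psi> x) \<in> test_functions U"
    and "gradient (\<lambda>x. \<phi> x * \<psi> x) x = \<phi> x *\<^sub>R gradient \<psi> x + \<psi> x *\<^sub>R gradient \<phi> x"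
proof -
  interpret p: test_fct U \<phi> by (rule test_fctI) fact
  interpret q: test_fct U \<psi> by (rule test_fctI) fact
  show "(\<lambda>x. \<phi> x * \<psi> x) \<in> test_functions U"
    by (rule test_functionsI[of _ "p.supp"])
       (use p.compact_supp p.supp_subset in
        \<open>auto intro!: C_k_mult p.C_k q.C_k simp: p.zero_outside\<close>)
  have "((\<lambda>x. \<phi> x * \<psi> x) has_derivative
      (\<lambda>v. \<phi> x * (gradient \<psi> x \<bullet> v) + (gradient \<phi> x \<bullet> v) * \<psi> x)) (at x)"
    by (intro derivative_intros p.has_derivative q.has_derivative)
  then show "gradient (\<lambda>x. \<phi> x * \<psi> x) x = \<phi> x *\<^sub>R gradient \<psi> x + \<psi> x *\<^sub>R gradient \<phi> x"
    by (intro gradient_eqI) (simp add: inner_simps mult.commute)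
qed

lemma test_compose:
  assumes "\<phi> \<in> test_functions U" "smooth h" "h 0 = 0"
  shows "(\<lambda>x. h (\<phi> x)) \<in> test_functions U"
proof -
  interpret p: test_fct U \<phi> by (rule test_fctI) fact
  show "(\<lambda>x. h (\<phi> x)) \<in> test_functions U"
  proof (rule test_functionsI[of _ "p.supp"])
    show "C_k k (\<lambda>x. h (\<phi> x))" for k
      by (rule C_k_compose[OF p.C_k]) (use assms(2) in \<open>simp add: smooth_def\<close>)
  qed (simp_all add: p.compact_supp p.supp_subset assms p.zero_outside)
qed

lemma gradient_compose:
  assumes "\<phi> \<in> test_functions U" "(h has_real_derivative h') (at (\<phi> x))"
  shows "gradient (\<lambda>x. h (\<phi> x)) x = h' *\<^sub>R gradient \<phi> x"
proof -
  interpret p: test_fct U \<phi> by (rule test_fctI) fact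
  show ?thesis
    using has_derivative_DERIV_compose[OF p.has_derivative assms(2)]
    by (intro gradient_eqI) simp
qed

lemma finite_measure_lebesgue_on:
  assumes "bounded U" "open U"
  shows "finite_measure (lebesgue_on U)"
proof
  have "emeasure lebesgue U < top"
    using assms by (meson fmeasurableD2 lmeasurable_open less_top)
  then show "emeasure (lebesgue_on U) (space (lebesgue_on U)) \<noteq> \<infinity>"
    using assms by (simp add: emeasure_restrict_space lmeasurable_open fmeasurableD)
qed

lemma borel_measurable_lebesgue_on: "f \<in> borel_measurable borel \<Longrightarrow> f \<in> borel_measurable (lebesgue_on U)"
  by (intro measurable_restrict_space1 measurable_completion) simp

lemma (in finite_measure) L2_bounded:
  assumes "f \<in> borel_measurable M" "\<And>x. norm (f x) \<le> b"
  shows "L2 M f"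
proof -
  have [measurable]: "f \<in> borel_measurable M" by fact
  have "integrable M (\<lambda>x. (norm (f x))\<^sup>2)"
    by (rule integrable_const_bound[of _ "b\<^sup>2"]) (use assms in \<open>auto intro!: power_mono AE_I2\<close>)
  then show ?thesis using assms by (simp add: L2_def)
qed

lemma test_L2:
  assumes "bounded U" "open U" "\<phi> \<in> test_functions U"
  shows "L2 (lebesgue_on U) \<phi>" "L2 (lebesgue_on U) (gradient \<phi>)"
proof -
  interpret finite_measure "lebesgue_on U" using assms by (simp add: finite_measure_lebesgue_on)
  interpret p: test_fct U \<phi> by (rule test_fctI) fact
  obtain b where "0 < b" "\<And>x. \<bar>\<phi> x\<bar> \<le> b" "\<And>x. norm (gradient \<phi> x) \<le> b" using p.bounded by blast
  then show "L2 (lebesgue_on U) \<phi>" "L2 (lebesgue_on U) (gradient \<phi>)"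
    by (auto intro!: L2_bounded[of _ b] borel_measurable_lebesgue_on)
qed

section \<open>Weak derivatives\<close>

lemma measurable_vec_nth:
  fixes G :: "'a \<Rightarrow> real^'n::finite"
  assumes "G \<in> borel_measurable M"
  shows "(\<lambda>x. G x $ i) \<in> borel_measurable M"
proof -
  have "(\<lambda>x. G x \<bullet> axis i 1) \<in> borel_measurable M" using assms by simp
  then show ?thesis by (simp add: inner_axis)
qed

lemma L2_vec_nth:
  fixes G :: "'a \<Rightarrow> real^'n::finite"
  assumes "L2 M G"
  shows "L2 M (\<lambda>x. G x $ i)"
proof (rule L2_bound[OF assms, of _ 1])
  show "(\<lambda>x. G x $ i) \<in> borel_measurable M" by (rule measurable_vec_nth[OF L2_measurable[OF assms]])
  show "AE x in M. norm (G x $ i) \<le> 1 * norm (G x)"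
    using component_le_norm_cart by auto
qed

lemma measurable_vec_lambda:
  fixes g :: "'n::finite \<Rightarrow> 'a \<Rightarrow> real"
  assumes "\<And>i. g i \<in> borel_measurable M"
  shows "(\<lambda>x. \<chi> i. g i x) \<in> borel_measurable M"
proof (subst borel_measurable_euclidean_space, rule ballI)
  fix b :: "real^'n" assume "b \<in> Basis"
  then obtain i where "b = axis i 1" by (auto simp: Basis_vec_def)
  then show "(\<lambda>x. (\<chi> i. g i x) \<bullet> b) \<in> borel_measurable M" using assms by (simp add: inner_axis)
qed

section \<open>The fundamental lemma of the calculus of variations\<close>

text \<open>Open boxes form an intersection-stable generator of the Borel sets, and the sets over
  which \<open>f\<close> integrates to 0 form a Dynkin system. Closure under complements rests on
  \<open>total\<close>, obtained by exhausting the space with boxes.\<close>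

lemma null_if_box_integrals_zero:
  fixes f :: "'a::euclidean_space \<Rightarrow> real"
  assumes f: "integrable lborel f"
    and 0: "\<And>a b. (LINT x|lborel. indicator (box a b) x * f x) = 0"
  shows "AE x in lborel. f x = 0"
proof (rule sigma_finite_measure.density_zero[OF sigma_finite_lborel f])
  let ?G = "range (\<lambda>(a, b). box a b :: 'a set)"
  let ?P = "\<lambda>A. set_lebesgue_integral lborel A f = 0"
  have sets: "sets lborel = sigma_sets UNIV ?G"
    by (simp add: borel_eq_box)
  have total: "(LINT x|lborel. f x) = 0"
  proof (rule LIMSEQ_unique)
    let ?B = "\<lambda>n::nat. box (- (real n *\<^sub>R One)) (real n *\<^sub>R One) :: 'a set"
    have ev: "\<forall>\<^sub>F n in sequentially. x \<in> ?B n" for x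
    proof -
      obtain N :: nat where N: "norm x < real N" using reals_Archimedean2 by blast
      show ?thesis
      proof (rule eventually_sequentiallyI[of N])
        fix n assume "N \<le> n"
        then have "\<bar>x \<bullet> i\<bar> < real n" if "i \<in> Basis" for i
          using N Basis_le_norm[OF that, of x] by linarith
        then have "- real n < x \<bullet> i \<and> x \<bullet> i < real n" if "i \<in> Basis" for i
          using that by (metis abs_less_iff minus_less_iff)
        then show "x \<in> ?B n" by (simp add: mem_box)
      qed
    qed
    show "(\<lambda>n. LINT x|lborel. indicator (?B n) x * f x) \<longlonglongrightarrow> (LINT x|lborel. f x)"
    proof (rule integral_dominated_convergence[OF _ _ integrable_abs[OF f]])
      show "AE x in lborel. (\<lambda>n. indicator (?B n) x * f x) \<longlonglongrightarrow> f x"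
      proof (rule AE_I2)
        fix x
        have "\<forall>\<^sub>F n in sequentially. indicator (?B n) x * f x = f x"
          using ev[of x] by eventually_elim simp
        then show "(\<lambda>n. indicator (?B n) x * f x) \<longlonglongrightarrow> f x"
          by (rule tendsto_eventually)
      qed
      show "AE x in lborel. norm (indicator (?B n) x * f x) \<le> \<bar>f x\<bar>" for n
        by (auto simp: indicator_def)
    qed (use f in auto)
    show "(\<lambda>n. LINT x|lborel. indicator (?B n) x * f x) \<longlonglongrightarrow> 0"
      using 0 by simp
  qed
  fix A :: "'a set" assume "A \<in> sets lborel"
  then have A: "A \<in> sigma_sets UNIV ?G" using sets by simp
  show "?P A"
  proof (rule sigma_sets_induct_disjoint[of ?G UNIV A ?P, OF _ _ A])
    show "Int_stable ?G" by (auto simp: Int_stable_def box_Int_box)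
    show "?P A" if "A \<in> ?G" for A
      using that 0 by (auto simp: set_lebesgue_integral_def)
    show "?P (UNIV - A)" if "A \<in> sigma_sets UNIV ?G" "?P A" for A
    proof -
      have A: "A \<in> sets lborel" using that sets by blast
      have *: "indicator (UNIV - A) x *\<^sub>R f x = f x - indicator A x *\<^sub>R f x" for x
        by (auto simp: indicator_def)
      have "integrable lborel (\<lambda>x. indicator A x *\<^sub>R f x)"
        by (rule integrable_mult_indicator[OF A f])
      then have "(LINT x|lborel. f x - indicator A x *\<^sub>R f x) =
          (LINT x|lborel. f x) - (LINT x|lborel. indicator A x *\<^sub>R f x)"
        by (rule Bochner_Integration.integral_diff[OF f])
      then show ?thesis
        unfolding set_lebesgue_integral_def * using total that(2) by (simp add: set_lebesgue_integral_def)
    qed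
    show "?P (\<Union>i. A i)"
      if "disjoint_family A" "range A \<subseteq> sigma_sets UNIV ?G" "\<And>i. ?P (A i)" for A :: "nat \<Rightarrow> 'a set"
    proof -
      have A: "A i \<in> sets lborel" for i using that(2) sets by blast
      have "set_integrable lborel (\<Union>i. A i) f"
        unfolding set_integrable_def using A f by (intro integrable_mult_indicator) auto
      then have "set_lebesgue_integral lborel (\<Union>i. A i) f = (\<Sum>i. set_lebesgue_integral lborel (A i) f)"
        using A that(1) by (intro lebesgue_integral_countable_add) (auto simp: disjoint_family_on_def)
      then show ?thesis using that(3) by simp
    qed
  qed (auto simp: set_lebesgue_integral_def)
qed

text \<open>Serves twice: products over the coordinates give test functions that approximate
  indicators of boxes, and antiderivatives give smooth approximations of truncations.\<close>

definition interval_bump :: "real \<Rightarrow> real \<Rightarrow> nat \<Rightarrow> real \<Rightarrow> real" where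
  "interval_bump a b n t = cutoff (real (Suc n) * (t - a)) * cutoff (real (Suc n) * (b - t))"

lemma smooth_interval_bump: "smooth (interval_bump a b n)"
proof -
  have "smooth (\<lambda>t. real (Suc n) * (t + (- a)))" "smooth (\<lambda>t. real (Suc n) * (b + (-1) * t))"
    by (intro smooth_add smooth_ident smooth_const smooth_cmult)+
  from this[THEN smooth_compose[OF smooth_cutoff]] show ?thesis
    unfolding interval_bump_def[abs_def] by (intro smooth_mult) simp_all
qed

lemma interval_bump_bounds: "0 \<le> interval_bump a b n t" "interval_bump a b n t \<le> 1"
  unfolding interval_bump_def by (auto intro: mult_le_one cutoff_bounds mult_nonneg_nonneg)

lemma interval_bump_eq_0: "t \<le> a \<or> b \<le> t \<Longrightarrow> interval_bump a b n t = 0"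
  by (auto simp: interval_bump_def cutoff_def zero_less_mult_iff)

lemma interval_bump_tendsto: "(\<lambda>n. interval_bump a b n t) \<longlonglongrightarrow> indicator {a<..<b} t"
proof -
  have "(\<lambda>n. interval_bump a b n t) \<longlonglongrightarrow> (if 0 < t - a then 1 else 0) * (if 0 < b - t then 1 else 0)"
    unfolding interval_bump_def by (intro tendsto_mult cutoff_tendsto)
  moreover have "(if 0 < t - a then 1 else 0) * (if 0 < b - t then 1 else 0) = indicat_real {a<..<b} t"
    by (auto simp: indicator_def)
  ultimately show ?thesis by simp
qed

definition box_bump :: "real^'n::finite \<Rightarrow> real^'n \<Rightarrow> nat \<Rightarrow> real^'n \<Rightarrow> real" where
  "box_bump a b n x = (\<Prod>i\<in>UNIV. interval_bump (a $ i) (b $ i) n (x $ i))"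

lemma box_bump_bounds: "0 \<le> box_bump a b n x" "box_bump a b n x \<le> 1"
  unfolding box_bump_def by (auto intro!: prod_nonneg prod_le_1 interval_bump_bounds)

lemma box_bump_eq_0: "x \<notin> box a b \<Longrightarrow> box_bump a b n x = 0"
  unfolding box_bump_def by (auto simp: mem_box_cart not_less intro!: prod_zero interval_bump_eq_0)

lemma box_bump_test:
  assumes "cbox a b \<subseteq> U"
  shows "box_bump a b n \<in> test_functions U"
proof (rule test_functionsI[OF _ compact_cbox assms])
  fix k
  have "C_k k (\<lambda>x. interval_bump (a $ i) (b $ i) n (x $ i))" for i
    by (rule C_k_compose[OF C_k_coordinate, where h="interval_bump (a $ i) (b $ i) n"])
       (use smooth_interval_bump in \<open>simp add: smooth_def\<close>)
  then show "C_k k (box_bump a b n)"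
    unfolding box_bump_def[abs_def] by (intro C_k_prod) auto
next
  fix x assume "x \<notin> cbox a b"
  then show "box_bump a b n x = 0" using box_subset_cbox by (intro box_bump_eq_0) blast
qed

lemma box_bump_tendsto: "(\<lambda>n. box_bump a b n x) \<longlonglongrightarrow> indicator (box a b) x"
proof -
  have "(\<lambda>n. box_bump a b n x) \<longlonglongrightarrow> (\<Prod>i\<in>UNIV. indicator {a $ i<..<b $ i} (x $ i))"
    unfolding box_bump_def by (intro tendsto_prod interval_bump_tendsto)
  moreover have "(\<Prod>i\<in>UNIV. indicat_real {a $ i<..<b $ i} (x $ i)) = indicator (box a b) x"
  proof (cases "x \<in> box a b")
    case True
    then show ?thesis by (simp add: mem_box_cart)
  next
    case False
    then obtain i where "x $ i \<notin> {a $ i<..<b $ i}" by (auto simp: mem_box_cart)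
    then have "indicat_real {a $ i<..<b $ i} (x $ i) = 0" by simp
    then have "(\<Prod>i\<in>UNIV. indicat_real {a $ i<..<b $ i} (x $ i)) = 0"
      by (intro prod_zero bexI[of _ i]) auto
    with False show ?thesis by simp
  qed
  ultimately show ?thesis by simp
qed

lemma lebesgue_on_integral:
  fixes f :: "'a::euclidean_space \<Rightarrow> 'b::{banach, second_countable_topology}"
  assumes "S \<in> sets lebesgue"
  shows "integrable (lebesgue_on S) f \<longleftrightarrow> integrable lebesgue (\<lambda>x. indicator S x *\<^sub>R f x)"
    and "integral\<^sup>L (lebesgue_on S) f = (LINT x|lebesgue. indicator S x *\<^sub>R f x)"
  using assms by (auto simp: integrable_restrict_space integral_restrict_space)

lemma integrable_lebesgue_on_subset:
  fixes f :: "'a::euclidean_space \<Rightarrow> 'b::{banach, second_countable_topology}"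
  assumes "integrable (lebesgue_on S) f" "S \<in> sets lebesgue" "T \<in> sets lebesgue" "T \<subseteq> S"
  shows "integrable (lebesgue_on T) f"
proof -
  have "integrable lebesgue (\<lambda>x. indicator S x *\<^sub>R f x)"
    using assms lebesgue_on_integral(1) by blast
  then have "integrable lebesgue (\<lambda>x. indicator T x *\<^sub>R (indicator S x *\<^sub>R f x))"
    by (rule integrable_mult_indicator[OF assms(3)])
  moreover have "(\<lambda>x. indicat_real T x *\<^sub>R (indicat_real S x *\<^sub>R f x)) = (\<lambda>x. indicator T x *\<^sub>R f x)"
    using assms(4) by (intro ext) (auto simp: indicator_def)
  ultimately have "integrable lebesgue (\<lambda>x. indicat_real T x *\<^sub>R f x)" by metis
  then show ?thesis using assms(3) lebesgue_on_integral(1) by blast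
qed

lemma compact_lebesgue: "compact K \<Longrightarrow> K \<in> sets lebesgue"
  by (simp add: borel_compact sets_completionI_sets)

lemma open_lebesgue: "open K \<Longrightarrow> K \<in> sets lebesgue"
  by (simp add: borel_open sets_completionI_sets)

lemma (in test_fct) locally_integrable_times:
  assumes "open U" "locally_integrable U g" "\<psi> \<in> borel_measurable borel" "\<And>x. \<bar>\<psi> x\<bar> \<le> b"
    "\<And>x. x \<notin> supp \<Longrightarrow> \<psi> x = 0"
  shows "integrable (lebesgue_on U) (\<lambda>x. g x * \<psi> x)"
proof -
  have K: "supp \<in> sets lebesgue" using compact_supp by (rule compact_lebesgue)
  have U: "U \<in> sets lebesgue" using assms(1) by (rule open_lebesgue)
  have "integrable (lebesgue_on supp) g"
    using assms(2) compact_supp supp_subset by (auto simp: locally_integrable_def)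
  then have g: "integrable lebesgue (\<lambda>x. indicator supp x *\<^sub>R g x)"
    using K lebesgue_on_integral by blast
  have [measurable]: "\<psi> \<in> borel_measurable lebesgue"
    using assms(3) by (intro measurable_completion) simp
  have "integrable lebesgue (\<lambda>x. b * \<bar>indicator supp x *\<^sub>R g x\<bar>)"
    using g by auto
  then have "integrable lebesgue (\<lambda>x. (indicator supp x *\<^sub>R g x) * \<psi> x)"
  proof (rule Bochner_Integration.integrable_bound)
    show "AE x in lebesgue. norm ((indicator supp x *\<^sub>R g x) * \<psi> x) \<le> norm (b * \<bar>indicator supp x *\<^sub>R g x\<bar>)"
    proof (rule AE_I2)
      fix x
      have "\<bar>indicator supp x *\<^sub>R g x\<bar> * \<bar>\<psi> x\<bar> \<le> \<bar>indicator supp x *\<^sub>R g x\<bar> * \<bar>b\<bar>"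
        using assms(4)[of x] by (intro mult_left_mono) auto
      then show "norm ((indicator supp x *\<^sub>R g x) * \<psi> x) \<le> norm (b * \<bar>indicator supp x *\<^sub>R g x\<bar>)"
        by (simp add: abs_mult mult.commute)
    qed
  qed (use g in measurable)
  moreover have "(\<lambda>x. (indicat_real supp x *\<^sub>R g x) * \<psi> x) = (\<lambda>x. indicator U x *\<^sub>R (g x * \<psi> x))"
  proof
    fix x show "(indicat_real supp x *\<^sub>R g x) * \<psi> x = indicator U x *\<^sub>R (g x * \<psi> x)"
      using assms(5)[of x] supp_subset by (cases "x \<in> supp") (auto simp: indicator_def)
  qed
  ultimately have "integrable lebesgue (\<lambda>x. indicat_real U x *\<^sub>R (g x * \<psi> x))" by metis
  then show ?thesis using U lebesgue_on_integral(1) by blast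
qed

text \<open>A chosen weak derivative is known only to be locally integrable. Its measurability on
  all of \<open>U\<close> comes from covering \<open>U\<close> by countably many closed
  boxes.\<close>

lemma locally_integrable_measurable:
  assumes "open U" "locally_integrable U g"
  shows "g \<in> borel_measurable (lebesgue_on U)"
proof -
  obtain \<D> where D: "countable \<D>" "\<D> \<subseteq> Pow U" "\<And>X. X \<in> \<D> \<Longrightarrow> \<exists>a b. X = cbox a b" "\<Union>\<D> = U"
    using open_countable_Union_open_cbox[OF assms(1)] by metis
  have U: "U \<in> sets lebesgue" using assms(1) by (rule open_lebesgue)
  show ?thesis
  proof (rule measurable_piecewise_restrict[OF D(1)])
    fix X assume X: "X \<in> \<D>"
    then obtain a b where ab: "X = cbox a b" using D by blast
    have "X \<subseteq> U" using X D by blast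
    then have XU: "U \<inter> X = X" by blast
    show "X \<inter> space (lebesgue_on U) \<in> sets (lebesgue_on U)"
      using XU ab U \<open>X \<subseteq> U\<close> by (simp add: sets_restrict_space_iff Int_commute)
    have "integrable (lebesgue_on X) g"
      using assms(2) ab \<open>X \<subseteq> U\<close> by (auto simp: locally_integrable_def)
    moreover have "restrict_space (lebesgue_on U) X = lebesgue_on X"
      using XU ab U by (subst restrict_restrict_space) auto
    ultimately show "g \<in> borel_measurable (restrict_space (lebesgue_on U) X)" by simp
  qed (use D in auto)
qed

text \<open>Testing with \<open>box_bump\<close> and letting the bumps grow to the indicator shows
  that \<open>g\<close> integrates to 0 over each open box whose closed box lies in
  \<open>U\<close>. So \<open>g\<close> vanishes almost everywhere on each closed box inside
  \<open>U\<close>, and countably many of these cover \<open>U\<close>.\<close>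

lemma fundamental_lemma_calculus_of_variations:
  assumes U: "open U" and g: "locally_integrable U g"
    and 0: "\<And>\<phi>. \<phi> \<in> test_functions U \<Longrightarrow> (LINT x|lebesgue_on U. g x * \<phi> x) = 0"
  shows "AE x in lebesgue_on U. g x = 0"
proof -
  have Us: "U \<in> sets lebesgue" using U by (rule open_lebesgue)
  have box0: "(LINT x|lebesgue. indicator (box a b) x * g x) = 0" if ab: "cbox a b \<subseteq> U" for a b
  proof (rule LIMSEQ_unique)
    have gab: "integrable lebesgue (\<lambda>x. indicator (cbox a b) x *\<^sub>R g x)"
      using g ab lebesgue_on_integral(1)[of "cbox a b" g] by (auto simp: locally_integrable_def)
    have eq: "indicator U x *\<^sub>R (g x * box_bump a b n x) = (indicator (cbox a b) x *\<^sub>R g x) * box_bump a b n x" for n x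
      using box_bump_eq_0[of x a b n] ab box_subset_cbox[of a b] by (cases "x \<in> box a b") (auto simp: indicator_def)
    have [measurable]: "box_bump a b n \<in> borel_measurable lebesgue" for n
      using test_fct.measurable(1)[OF test_fctI[OF box_bump_test[OF ab]]]
      by (intro measurable_completion) simp
    show "(\<lambda>n. LINT x|lebesgue. (indicator (cbox a b) x *\<^sub>R g x) * box_bump a b n x) \<longlonglongrightarrow> (LINT x|lebesgue. indicator (box a b) x * g x)"
    proof (rule integral_dominated_convergence[OF _ _ integrable_abs[OF gab]])
      have *: "indicator (box a b) x * g x = (indicator (cbox a b) x *\<^sub>R g x) * indicator (box a b) x" for x
        using box_subset_cbox[of a b] by (auto simp: indicator_def)
      show "(\<lambda>x. indicator (box a b) x * g x) \<in> borel_measurable lebesgue"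
        unfolding * by (intro borel_measurable_times borel_measurable_integrable[OF gab] borel_measurable_indicator) auto
      show "AE x in lebesgue. (\<lambda>n. (indicator (cbox a b) x *\<^sub>R g x) * box_bump a b n x) \<longlonglongrightarrow> indicator (box a b) x * g x"
        unfolding * by (intro AE_I2 tendsto_mult tendsto_const box_bump_tendsto)
      show "AE x in lebesgue. norm ((indicator (cbox a b) x *\<^sub>R g x) * box_bump a b n x) \<le> \<bar>indicator (cbox a b) x *\<^sub>R g x\<bar>" for n
        using box_bump_bounds[of a b n] by (intro AE_I2) (auto simp: abs_mult mult_left_le)
    qed (use gab in measurable)
    have "(LINT x|lebesgue. (indicator (cbox a b) x *\<^sub>R g x) * box_bump a b n x) = 0" for n
      using 0[OF box_bump_test[OF ab], of n] unfolding lebesgue_on_integral(2)[OF Us] eq .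
    then show "(\<lambda>n. LINT x|lebesgue. (indicator (cbox a b) x *\<^sub>R g x) * box_bump a b n x) \<longlonglongrightarrow> 0"
      by simp
  qed
  have cbox0: "AE x in lebesgue. x \<in> cbox a b \<longrightarrow> g x = 0" if ab: "cbox a b \<subseteq> U" for a b
  proof -
    have "integrable lebesgue (\<lambda>x. indicator (cbox a b) x *\<^sub>R g x)"
      using g ab lebesgue_on_integral(1)[of "cbox a b" g] by (auto simp: locally_integrable_def)
    moreover have "AE x in lebesgue. x \<in> cbox a b \<longleftrightarrow> x \<in> box a b"
    proof (rule AE_I)
      show "emeasure lebesgue (cbox a b - box a b) = 0"
        using null_sets_cbox_Diff_box[of a b] by auto
      show "{x \<in> space lebesgue. \<not> (x \<in> cbox a b \<longleftrightarrow> x \<in> box a b)} \<subseteq> cbox a b - box a b"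
        using box_subset_cbox[of a b] by auto
    qed auto
    ultimately have gb: "integrable lebesgue (\<lambda>x. indicator (box a b) x * g x)" 
    proof -
      assume i: "integrable lebesgue (\<lambda>x. indicator (cbox a b) x *\<^sub>R g x)"
      have e: "(\<lambda>x. indicator (box a b) x *\<^sub>R (indicator (cbox a b) x *\<^sub>R g x)) = (\<lambda>x. indicator (box a b) x * g x)"
        using box_subset_cbox[of a b] by (intro ext) (auto simp: indicator_def)
      have "box a b \<in> sets lebesgue" by simp
      from integrable_mult_indicator[OF this i] show ?thesis unfolding e .
    qed
    \<comment> \<open>The Dynkin argument lives on Borel sets, so a Borel representative replaces
      the Lebesgue measurable function.\<close>
    then obtain g' where g': "g' \<in> borel_measurable lborel" "AE x in lborel. indicator (box a b) x * g x = g' x"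
      using completion_ex_borel_measurable_real[OF borel_measurable_integrable] by blast
    have g'i: "integrable lborel g'"
    proof -
      have "integrable lebesgue g'"
      proof (rule Bochner_Integration.integrable_bound[OF gb])
        show "g' \<in> borel_measurable lebesgue" using g'(1) by (rule measurable_completion)
        show "AE x in lebesgue. norm (g' x) \<le> norm (indicator (box a b) x * g x)"
          using g'(2) unfolding AE_completion_iff by eventually_elim simp
      qed
      then show ?thesis using g' integrable_completion by blast
    qed
    have "AE x in lborel. g' x = 0"
    proof (rule null_if_box_integrals_zero[OF g'i])
      fix c d
      \<comment> \<open>The two boxes meet in a box \<open>box p q\<close>; if it is nonempty, its
        closure lies in \<open>cbox a b\<close> and hence in \<open>U\<close>, so
        \<open>box0\<close> applies to it.\<close>
      obtain p q where pq: "box c d \<inter> box a b = box p q" by (rule that[OF box_Int_box])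
      have "(LINT x|lborel. indicator (box c d) x * g' x) = (LINT x|lebesgue. indicator (box c d) x * g' x)"
        using g' by (intro integral_completion[symmetric]) auto
      also have "\<dots> = (LINT x|lebesgue. indicator (box c d) x * (indicator (box a b) x * g x))"
      proof (rule integral_cong_AE)
        have g'm: "g' \<in> borel_measurable lebesgue" using g' by (intro measurable_completion) simp
        show "(\<lambda>x. indicator (box c d) x * g' x) \<in> borel_measurable lebesgue"
          by (rule borel_measurable_times[OF borel_measurable_indicator[OF open_lebesgue[OF open_box]] g'm])
        show "(\<lambda>x. indicator (box c d) x * (indicator (box a b) x * g x)) \<in> borel_measurable lebesgue"
          by (rule borel_measurable_times[OF borel_measurable_indicator[OF open_lebesgue[OF open_box]] borel_measurable_integrable[OF gb]])
        show "AE x in lebesgue. indicator (box c d) x * g' x = indicator (box c d) x * (indicator (box a b) x * g x)"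
          using g'(2) unfolding AE_completion_iff by eventually_elim simp
      qed
      also have "\<dots> = (LINT x|lebesgue. indicator (box p q) x * g x)"
        unfolding pq[symmetric] by (simp add: indicator_inter_arith mult.assoc)
      also have "\<dots> = 0"
      proof (cases "box p q = {}")
        case False
        have "cbox p q \<subseteq> cbox a b"
        proof -
          have "box p q \<subseteq> box a b" using pq by blast
          moreover from this False have "box a b \<noteq> {}" by blast
          ultimately show ?thesis using closure_mono[of "box p q" "box a b"] False by (simp add: closure_box)
        qed
        then show ?thesis using box0[of p q] ab by blast
      qed auto
      finally show "(LINT x|lborel. indicator (box c d) x * g' x) = 0" .
    qed
    with g' have "AE x in lebesgue. indicator (box a b) x * g x = 0"
      by (auto simp: AE_completion_iff)
    with \<open>AE x in lebesgue. x \<in> cbox a b \<longleftrightarrow> x \<in> box a b\<close> show ?thesis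
      by eventually_elim (auto simp: indicator_def)
  qed
  obtain \<D> where D: "countable \<D>" "\<D> \<subseteq> Pow U" "\<And>X. X \<in> \<D> \<Longrightarrow> \<exists>a b. X = cbox a b" "\<Union>\<D> = U"
    using open_countable_Union_open_cbox[OF U] by metis
  have "AE x in lebesgue. \<forall>X\<in>\<D>. x \<in> X \<longrightarrow> g x = 0"
  proof (subst AE_ball_countable[OF D(1)], intro ballI)
    fix X assume X: "X \<in> \<D>"
    then obtain a b where "X = cbox a b" using D by blast
    then show "AE x in lebesgue. x \<in> X \<longrightarrow> g x = 0" using cbox0 X D by blast
  qed
  then have "AE x in lebesgue. x \<in> U \<longrightarrow> g x = 0"
    by eventually_elim (use D in blast)
  then show ?thesis using Us by (simp add: AE_restrict_space_iff)
qed

section \<open>Integration by parts and uniqueness of weak derivatives\<close>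

lemma (in test_fct) integral_lebesgue_on_eq_lborel:
  fixes f :: "_ \<Rightarrow> real"
  assumes "open U" "f \<in> borel_measurable borel" "\<And>x. x \<notin> supp \<Longrightarrow> f x = 0"
  shows "(LINT x|lebesgue_on U. f x) = (LINT x|lborel. f x)"
proof -
  have "(\<lambda>x. indicator U x *\<^sub>R f x) = f"
  proof
    fix x show "indicator U x *\<^sub>R f x = f x"
      using assms(3)[of x] supp_subset by (cases "x \<in> supp") auto
  qed
  then show ?thesis
    using assms lebesgue_on_integral(2)[OF open_lebesgue[OF assms(1)], of f] integral_completion[of f lborel] by simp
qed

text \<open>The integral of a difference quotient vanishes by translation invariance.\<close>

lemma (in test_fct) integral_partial_deriv: "(LINT x|lborel. partial_deriv i \<phi> x) = 0"
proof (rule LIMSEQ_unique)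
  obtain b where b: "0 < b" "\<And>x. \<bar>\<phi> x\<bar> \<le> b" "\<And>x. norm (gradient \<phi> x) \<le> b" using bounded by blast
  define h where "h n = inverse (real (Suc n))" for n
  have h0: "h n \<noteq> 0" and h1: "\<bar>h n\<bar> \<le> 1" for n by (auto simp: h_def field_simps)
  define q where "q n x = (\<phi> (h n *\<^sub>R axis i 1 + x) - \<phi> x) / h n" for n x
  \<comment> \<open>The gradient bound makes \<open>\<phi>\<close> Lipschitz, which bounds all
    difference quotients at once.\<close>
  have lip: "\<bar>\<phi> x - \<phi> y\<bar> \<le> b * norm (x - y)" for x y
  proof -
    have "norm (\<phi> x - \<phi> y) \<le> b * norm (x - y)"
    proof (rule differentiable_bound[of UNIV \<phi> "\<lambda>x v. gradient \<phi> x \<bullet> v"])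
      show "onorm (\<lambda>v. gradient \<phi> x \<bullet> v) \<le> b" for x
        by (rule onorm_le) (metis Cauchy_Schwarz_ineq2 b(3) mult_right_mono norm_ge_zero order_trans real_norm_def)
    qed (auto intro: has_derivative)
    then show ?thesis by simp
  qed
  obtain R where R: "\<And>x. x \<in> supp \<Longrightarrow> norm x \<le> R"
    using compact_supp compact_imp_bounded bounded_iff by metis
  \<comment> \<open>Since \<open>\<bar>h n\<bar> \<le> 1\<close>, the shifted supports all stay in
    the ball of radius \<open>R + 1\<close>.\<close>
  have int: "integrable lborel (\<lambda>x. b * indicator (cball 0 (R + 1)) x :: real)"
    by (intro integrable_mult_right) (auto intro!: integrable_real_indicator emeasure_bounded_finite)
  have qb: "\<bar>q n x\<bar> \<le> b * indicator (cball 0 (R + 1)) x" for n x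
  proof (cases "x \<in> cball 0 (R + 1)")
    case True
    have "\<bar>\<phi> (h n *\<^sub>R axis i 1 + x) - \<phi> x\<bar> \<le> b * \<bar>h n\<bar>"
      using lip[of "h n *\<^sub>R axis i 1 + x" x] by (simp add: norm_axis_1)
    then show ?thesis using True h0[of n] by (simp add: q_def abs_divide divide_le_eq)
  next
    case False
    then have n: "norm x > R + 1" by simp
    have "norm (h n *\<^sub>R axis i 1 :: real^'n) \<le> 1" using h1 by (simp add: norm_axis_1)
    then have "norm (h n *\<^sub>R axis i 1 + x) > R" 
      using n norm_triangle_ineq2[of x "- (h n *\<^sub>R axis i 1)"] by (simp add: add.commute)
    then have "x \<notin> supp" "h n *\<^sub>R axis i 1 + x \<notin> supp"
      using R[of x] R[of "h n *\<^sub>R axis i 1 + x"] n by force+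
    then have "q n x = 0" unfolding q_def by (simp add: zero_outside)
    then show ?thesis using b(1) by simp
  qed
  have [measurable]: "partial_deriv i \<phi> \<in> borel_measurable borel"
    using continuous_partial by (rule borel_measurable_continuous_onI)
  have [measurable]: "q n \<in> borel_measurable borel" for n
    unfolding q_def[abs_def] by measurable
  show "(\<lambda>n. LINT x|lborel. q n x) \<longlonglongrightarrow> (LINT x|lborel. partial_deriv i \<phi> x)"
  proof (rule integral_dominated_convergence[OF _ _ int])
    show "AE x in lborel. (\<lambda>n. q n x) \<longlonglongrightarrow> partial_deriv i \<phi> x"
    proof (rule AE_I2)
      fix x
      have "((\<lambda>t. \<phi> (t *\<^sub>R axis i 1 + x)) has_derivative (\<lambda>t. gradient \<phi> x \<bullet> (t *\<^sub>R axis i 1))) (at 0)"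
        by (rule has_derivative_compose[of "\<lambda>t. t *\<^sub>R axis i 1 + x" "\<lambda>t. t *\<^sub>R axis i 1" 0 UNIV \<phi>])
           (auto intro!: derivative_eq_intros has_derivative)
      then have "((\<lambda>t. \<phi> (t *\<^sub>R axis i 1 + x)) has_real_derivative partial_deriv i \<phi> x) (at 0)"
        unfolding has_field_derivative_def
        by (rule has_derivative_eq_rhs) (auto simp: gradient_def inner_axis)
      then have "((\<lambda>t. (\<phi> (t *\<^sub>R axis i 1 + x) - \<phi> x) / t) \<longlongrightarrow> partial_deriv i \<phi> x) (at 0)"
        by (simp add: DERIV_def)
      moreover have "filterlim h (at 0) sequentially"
        unfolding filterlim_at h_def using LIMSEQ_inverse_real_of_nat by auto
      ultimately show "(\<lambda>n. q n x) \<longlonglongrightarrow> partial_deriv i \<phi> x"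
        unfolding q_def by (rule filterlim_compose)
    qed
    show "AE x in lborel. norm (q n x) \<le> b * indicator (cball 0 (R + 1)) x" for n
      using qb by auto
  qed measurable
  have i\<phi>: "integrable lborel \<phi>"
  proof (rule Bochner_Integration.integrable_bound[OF int])
    show "AE x in lborel. norm (\<phi> x) \<le> norm (b * indicator (cball 0 (R + 1)) x :: real)"
    proof (rule AE_I2)
      fix x
      show "norm (\<phi> x) \<le> norm (b * indicator (cball 0 (R + 1)) x :: real)"
      proof (cases "x \<in> supp")
        case True
        then have "norm x \<le> R + 1" using R[of x] by simp
        then show ?thesis using b(1,2) by simp
      qed (simp add: zero_outside)
    qed
  qed measurable
  have "(LINT x|lborel. q n x) = 0" for n
  proof -
    let ?T = "(+) (h n *\<^sub>R axis i 1 :: real^'n)"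
    have "(LINT x|lborel. \<phi> (?T x)) = (LINT x|distr lborel borel ?T. \<phi> x)"
      by (rule integral_distr[symmetric]) measurable
    then have e: "(LINT x|lborel. \<phi> (?T x)) = (LINT x|lborel. \<phi> x)"
      by (simp add: lborel_distr_plus)
    have "integrable (distr lborel borel ?T) \<phi>" using i\<phi> by (simp add: lborel_distr_plus)
    then have "integrable lborel (\<lambda>x. \<phi> (?T x))"
      by (subst (asm) integrable_distr_eq) measurable
    then show ?thesis using e i\<phi> by (simp add: q_def[abs_def])
  qed
  then show "(\<lambda>n. LINT x|lborel. q n x) \<longlonglongrightarrow> 0" by simp
qed

text \<open>The product of two test functions is a test function, whose partial derivative
  integrates to 0.\<close>

lemma integration_by_parts:
  assumes U: "bounded U" "open U" and \<phi>: "\<phi> \<in> test_functions U" and \<psi>: "\<psi> \<in> test_functions U"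
  shows "(LINT x|lebesgue_on U. \<phi> x * partial_deriv i \<psi> x) = - (LINT x|lebesgue_on U. partial_deriv i \<phi> x * \<psi> x)"
proof -
  interpret t: test_fct U "\<lambda>x. \<phi> x * \<psi> x" by (rule test_fctI[OF test_mult(1)[OF \<phi> \<psi>]])
  interpret p: test_fct U \<phi> by (rule test_fctI[OF \<phi>])
  interpret q: test_fct U \<psi> by (rule test_fctI[OF \<psi>])
  have pd: "partial_deriv i (\<lambda>x. \<phi> x * \<psi> x) x = \<phi> x * partial_deriv i \<psi> x + partial_deriv i \<phi> x * \<psi> x" for x
    by (rule partial_deriv_mult[OF p.differentiable q.differentiable])
  have comp: "L2 (lebesgue_on U) (partial_deriv i \<eta>)" if "\<eta> \<in> test_functions U" for \<eta>
    using L2_vec_nth[OF test_L2(2)[OF U that], of i] by (simp add: gradient_def)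
  have "(LINT x|lebesgue_on U. partial_deriv i (\<lambda>x. \<phi> x * \<psi> x) x) = (LINT x|lborel. partial_deriv i (\<lambda>x. \<phi> x * \<psi> x) x)"
  proof (rule t.integral_lebesgue_on_eq_lborel[OF U(2)])
    show "partial_deriv i (\<lambda>x. \<phi> x * \<psi> x) \<in> borel_measurable borel"
      using t.continuous_partial by (rule borel_measurable_continuous_onI)
    show "partial_deriv i (\<lambda>x. \<phi> x * \<psi> x) x = 0" if "x \<notin> t.supp" for x
      using t.gradient_outside[OF that] by (simp add: gradient_def vec_eq_iff)
  qed
  then have "(LINT x|lebesgue_on U. \<phi> x * partial_deriv i \<psi> x + partial_deriv i \<phi> x * \<psi> x) = 0"
    using t.integral_partial_deriv[of i] by (simp add: pd)
  moreover have "integrable (lebesgue_on U) (\<lambda>x. \<phi> x * partial_deriv i \<psi> x)"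
    using L2_inner_integrable[OF test_L2(1)[OF U \<phi>] comp[OF \<psi>]] by simp
  moreover have "integrable (lebesgue_on U) (\<lambda>x. partial_deriv i \<phi> x * \<psi> x)"
    using L2_inner_integrable[OF comp[OF \<phi>] test_L2(1)[OF U \<psi>]] by simp
  ultimately show ?thesis by simp
qed

lemma L2_locally_integrable:
  assumes U: "bounded U" "open U" and u: "L2 (lebesgue_on U) u"
  shows "locally_integrable U u"
proof -
  interpret finite_measure "lebesgue_on U" using U by (rule finite_measure_lebesgue_on)
  have "L2 (lebesgue_on U) (\<lambda>x. 1::real)" by (rule L2_bounded[of _ 1]) auto
  from L2_inner_integrable[OF u this] have "integrable (lebesgue_on U) u" by simp
  then show ?thesis
    unfolding locally_integrable_def
    using integrable_lebesgue_on_subset compact_lebesgue open_lebesgue[OF U(2)] by blast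
qed

lemma locally_integrable_diff:
  assumes "locally_integrable U u" "locally_integrable U v"
  shows "locally_integrable U (\<lambda>x. u x - v x)"
  unfolding locally_integrable_def
proof (intro allI impI Bochner_Integration.integrable_diff)
  fix K assume "compact K \<and> K \<subseteq> U"
  then show "integrable (lebesgue_on K) u" "integrable (lebesgue_on K) v"
    using assms unfolding locally_integrable_def by blast+
qed

lemma has_weak_partial_diff:
  assumes U: "bounded U" "open U" and u: "has_weak_partial U i u g" and v: "has_weak_partial U i v h"
  shows "has_weak_partial U i (\<lambda>x. u x - v x) (\<lambda>x. g x - h x)"
  unfolding has_weak_partial_def
proof (intro conjI ballI)
  show "locally_integrable U (\<lambda>x. u x - v x)" "locally_integrable U (\<lambda>x. g x - h x)"
    using u v by (auto simp: has_weak_partial_def intro: locally_integrable_diff)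
  fix \<phi> assume \<phi>: "\<phi> \<in> test_functions U"
  interpret test_fct U \<phi> by (rule test_fctI[OF \<phi>])
  obtain b where "0 < b" and b: "\<And>x. \<bar>\<phi> x\<bar> \<le> b" "\<And>x. norm (gradient \<phi> x) \<le> b"
    using bounded by blast
  have pd: "\<bar>partial_deriv i \<phi> x\<bar> \<le> b" for x
    using b(2)[of x] component_le_norm_cart[of "gradient \<phi> x" i] by (simp add: gradient_def)
  have i1: "integrable (lebesgue_on U) (\<lambda>x. w x * \<phi> x)" if "locally_integrable U w" for w
    by (rule locally_integrable_times[OF U(2) that measurable(1) b(1) zero_outside])
  have i2: "integrable (lebesgue_on U) (\<lambda>x. w x * partial_deriv i \<phi> x)" if "locally_integrable U w" for w
  proof (rule locally_integrable_times[OF U(2) that _ pd])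
    show "partial_deriv i \<phi> x = 0" if "x \<notin> supp" for x
      using gradient_outside[OF that] by (simp add: gradient_def vec_eq_iff)
  qed (rule borel_measurable_continuous_onI[OF continuous_partial])
  have loc: "locally_integrable U u" "locally_integrable U g" "locally_integrable U v" "locally_integrable U h"
    and eqs: "(LINT x|lebesgue_on U. u x * partial_deriv i \<phi> x) = - (LINT x|lebesgue_on U. g x * \<phi> x)"
      "(LINT x|lebesgue_on U. v x * partial_deriv i \<phi> x) = - (LINT x|lebesgue_on U. h x * \<phi> x)"
    using u v \<phi> by (simp_all add: has_weak_partial_def)
  show "(LINT x|lebesgue_on U. (u x - v x) * partial_deriv i \<phi> x) = - (LINT x|lebesgue_on U. (g x - h x) * \<phi> x)"
    using i2[OF loc(1)] i2[OF loc(3)] i1[OF loc(2)] i1[OF loc(4)] eqs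
    by (simp add: left_diff_distrib)
qed

lemma has_weak_partial_unique:
  assumes U: "bounded U" "open U" and u: "has_weak_partial U i u g" "has_weak_partial U i u h"
  shows "AE x in lebesgue_on U. g x = h x"
proof -
  have *: "has_weak_partial U i (\<lambda>x. u x - u x) (\<lambda>x. g x - h x)"
    by (rule has_weak_partial_diff[OF U u])
  have "AE x in lebesgue_on U. g x - h x = 0"
    by (rule fundamental_lemma_calculus_of_variations[OF U(2)])
       (use * in \<open>auto simp: has_weak_partial_def\<close>)
  then show ?thesis by simp
qed

text \<open>The bridge from the choice operator to computation: any explicit weak derivative
  identifies \<open>weak_partial\<close> almost everywhere, and local integrability makes the chosen
  one measurable.\<close>

lemma weak_partial_eq:
  assumes U: "bounded U" "open U" and u: "has_weak_partial U i u g"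
  shows "AE x in lebesgue_on U. weak_partial U i u x = g x"
    and "weak_partial U i u \<in> borel_measurable (lebesgue_on U)"
proof -
  have *: "has_weak_partial U i u (weak_partial U i u)"
    unfolding weak_partial_def by (rule someI[of "has_weak_partial U i u", OF u])
  show "AE x in lebesgue_on U. weak_partial U i u x = g x"
    by (rule has_weak_partial_unique[OF U * u])
  show "weak_partial U i u \<in> borel_measurable (lebesgue_on U)"
    by (rule locally_integrable_measurable[OF U(2)]) (use * in \<open>simp add: has_weak_partial_def\<close>)
qed

lemma nrm2_components:
  fixes G :: "'a \<Rightarrow> real^'n::finite"
  assumes "L2 M G"
  shows "(nrm2 M G)\<^sup>2 = (\<Sum>i\<in>UNIV. (nrm2 M (\<lambda>x. G x $ i))\<^sup>2)"
proof -
  have "L2 M (\<lambda>x. G x $ i)" for i by (rule L2_vec_nth[OF assms])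
  then have "integrable M (\<lambda>x. (G x $ i)\<^sup>2)" for i by (rule L2_integrable_real)
  then show ?thesis
    unfolding nrm2_sq by (simp add: power2_norm_eq_inner inner_vec_def) (simp add: power2_eq_square)
qed

lemma H12_norm_eq:
  assumes U: "bounded U" "open U" and G: "L2 (lebesgue_on U) G"
    and wp: "\<And>i. has_weak_partial U i u (\<lambda>x. G x $ i)"
  shows "H12_norm U u = sqrt ((nrm2 (lebesgue_on U) u)\<^sup>2 + (nrm2 (lebesgue_on U) G)\<^sup>2)"
proof -
  have "nrm2 (lebesgue_on U) (weak_partial U i u) = nrm2 (lebesgue_on U) (\<lambda>x. G x $ i)" for i
    by (intro nrm2_cong_AE weak_partial_eq[OF U wp] measurable_vec_nth[OF L2_measurable[OF G]])
  then show ?thesis by (simp add: H12_norm_def Lp_norm_2 nrm2_components[OF G])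
qed

section \<open>Pairs of functions and gradients\<close>

definition H0 :: "(real^'n::finite) set \<Rightarrow> (real^'n \<Rightarrow> real) \<Rightarrow> (real^'n \<Rightarrow> real^'n) \<Rightarrow> bool" where
  "H0 U u G \<longleftrightarrow> L2 (lebesgue_on U) u \<and> L2 (lebesgue_on U) G \<and>
    (\<exists>\<phi>. (\<forall>n. \<phi> n \<in> test_functions U) \<and>
       (\<lambda>n. nrm2 (lebesgue_on U) (\<lambda>x. \<phi> n x - u x)) \<longlonglongrightarrow> 0 \<and>
       (\<lambda>n. nrm2 (lebesgue_on U) (\<lambda>x. gradient (\<phi> n) x - G x)) \<longlonglongrightarrow> 0)"

lemma H0_L2: "H0 U u G \<Longrightarrow> L2 (lebesgue_on U) u" "H0 U u G \<Longrightarrow> L2 (lebesgue_on U) G"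
  by (auto simp: H0_def)

lemma H0_test:
  assumes "bounded U" "open U" "\<phi> \<in> test_functions U"
  shows "H0 U \<phi> (gradient \<phi>)"
  unfolding H0_def using assms by (auto intro!: test_L2 exI[of _ "\<lambda>n. \<phi>"] simp: nrm2_def)

text \<open>Integration by parts holds for the approximating test functions and survives their L^2
  limit. The vector field \<open>\<psi> x *\<^sub>R axis i 1\<close> picks the \<open>i\<close>-th
  component of the gradient as an inner product.\<close>

lemma H0_has_weak_partial:
  fixes U :: "(real^'n::finite) set"
  assumes U: "bounded U" "open U" and u: "H0 U u G"
  shows "has_weak_partial U i u (\<lambda>x. G x $ i)"
  unfolding has_weak_partial_def
proof (intro conjI ballI)
  let ?M = "lebesgue_on U"
  note L = H0_L2[OF u]
  have Gi: "L2 ?M (\<lambda>x. G' x $ i)" if "L2 ?M G'" for G' :: "real^'n \<Rightarrow> real^'n"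
    using that by (rule L2_vec_nth)
  show "locally_integrable U u" "locally_integrable U (\<lambda>x. G x $ i)"
    using U L Gi[OF L(2)] by (auto intro: L2_locally_integrable)
  fix \<psi> assume \<psi>: "\<psi> \<in> test_functions U"
  obtain \<phi> where \<phi>: "\<And>n. \<phi> n \<in> test_functions U"
    "(\<lambda>n. nrm2 ?M (\<lambda>x. \<phi> n x - u x)) \<longlonglongrightarrow> 0" "(\<lambda>n. nrm2 ?M (\<lambda>x. gradient (\<phi> n) x - G x)) \<longlonglongrightarrow> 0"
    using u by (auto simp: H0_def)
  have \<psi>i: "L2 ?M (\<lambda>x. partial_deriv i \<psi> x)"
    using Gi[OF test_L2(2)[OF U \<psi>]] by (simp add: gradient_def)
  have c1: "(\<lambda>n. LINT x|?M. 1 * (partial_deriv i \<psi> x \<bullet> \<phi> n x)) \<longlonglongrightarrow> (LINT x|?M. 1 * (partial_deriv i \<psi> x \<bullet> u x))"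
    by (rule L2_inner_tendsto(1)[OF \<psi>i L(1) test_L2(1)[OF U \<phi>(1)] \<phi>(2), where K=1]) auto
  have c2: "(\<lambda>n. LINT x|?M. 1 * ((\<psi> x *\<^sub>R axis i 1) \<bullet> gradient (\<phi> n) x)) \<longlonglongrightarrow> (LINT x|?M. 1 * ((\<psi> x *\<^sub>R axis i 1) \<bullet> G x))"
  proof (rule L2_inner_tendsto(1)[OF _ L(2) test_L2(2)[OF U \<phi>(1)] \<phi>(3), where K=1])
    show "L2 ?M (\<lambda>x. \<psi> x *\<^sub>R (axis i 1 :: real^'n))"
      by (rule L2_bound[OF test_L2(1)[OF U \<psi>], of _ 1])
         (use L2_measurable[OF test_L2(1)[OF U \<psi>]] in \<open>auto simp: norm_axis_1\<close>)
  qed auto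
  have "(LINT x|?M. 1 * (partial_deriv i \<psi> x \<bullet> \<phi> n x)) = - (LINT x|?M. 1 * ((\<psi> x *\<^sub>R axis i 1) \<bullet> gradient (\<phi> n) x))" for n
    using integration_by_parts[OF U \<phi>(1)[of n] \<psi>, of i]
    by (simp add: mult.commute inner_axis' gradient_def)
  then have "(\<lambda>n. LINT x|?M. 1 * (partial_deriv i \<psi> x \<bullet> \<phi> n x)) \<longlonglongrightarrow> - (LINT x|?M. 1 * ((\<psi> x *\<^sub>R axis i 1) \<bullet> G x))"
    using tendsto_minus[OF c2] by simp
  from LIMSEQ_unique[OF c1 this]
  show "(LINT x|?M. u x * partial_deriv i \<psi> x) = - (LINT x|?M. G x $ i * \<psi> x)"
    by (simp add: mult.commute inner_axis')
qed

lemma H0_weak_gradient: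
  assumes U: "bounded U" "open U" and u: "H0 U u G"
  shows "AE x in lebesgue_on U. weak_gradient U u x = G x"
proof -
  have "AE x in lebesgue_on U. \<forall>i. weak_partial U i u x = G x $ i"
    using weak_partial_eq(1)[OF U H0_has_weak_partial[OF U u]] by (subst AE_all_countable) blast
  then show ?thesis by eventually_elim (simp add: weak_gradient_def vec_eq_iff)
qed

lemma H0_H12_norm:
  assumes U: "bounded U" "open U" and u: "H0 U u G"
  shows "H12_norm U u = sqrt ((nrm2 (lebesgue_on U) u)\<^sup>2 + (nrm2 (lebesgue_on U) G)\<^sup>2)"
  by (rule H12_norm_eq[OF U H0_L2(2)[OF u] H0_has_weak_partial[OF U u]])

text \<open>Smallness of \<open>H12_norm\<close> is joint L^2 smallness of the function and of its
  gradient. For the direction from \<open>H12_0\<close>, the components supplied by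
  \<open>H12\<close> are assembled into one field \<open>G\<close>, and test functions within
  \<open>inverse (real (Suc n))\<close> form the sequence.\<close>

lemma H12_0_iff_H0:
  assumes U: "bounded U" "open U"
  shows "u \<in> H12_0 U \<longleftrightarrow> (\<exists>G. H0 U u G)"
proof
  let ?M = "lebesgue_on U"
  assume "\<exists>G. H0 U u G"
  then obtain G where u: "H0 U u G" by auto
  note L = H0_L2[OF u]
  have Gi: "L2 ?M (\<lambda>x. G x $ i)" for i
    using L(2) by (rule L2_vec_nth)
  have "u \<in> H12 U"
  proof -
    have "\<exists>g\<in>Lp_space ?M 2. has_weak_partial U i u g" for i
      using H0_has_weak_partial[OF U u, of i] Gi[of i] unfolding Lp_space_2[symmetric] by (rule bexI[of _ "\<lambda>x. G x $ i"])
    then show ?thesis using L by (simp add: H12_def Lp_space_2)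
  qed
  moreover have "\<exists>\<phi>\<in>test_functions U. H12_norm U (\<lambda>x. \<phi> x - u x) < \<epsilon>" if "0 < \<epsilon>" for \<epsilon>
  proof -
    obtain \<phi> where \<phi>: "\<And>n. \<phi> n \<in> test_functions U"
      "(\<lambda>n. nrm2 ?M (\<lambda>x. \<phi> n x - u x)) \<longlonglongrightarrow> 0" "(\<lambda>n. nrm2 ?M (\<lambda>x. gradient (\<phi> n) x - G x)) \<longlonglongrightarrow> 0"
      using u by (auto simp: H0_def)
    have "(\<lambda>n. sqrt ((nrm2 ?M (\<lambda>x. \<phi> n x - u x))\<^sup>2 + (nrm2 ?M (\<lambda>x. gradient (\<phi> n) x - G x))\<^sup>2)) \<longlonglongrightarrow> sqrt (0\<^sup>2 + 0\<^sup>2)"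
      by (intro tendsto_intros \<phi>)
    moreover have "H12_norm U (\<lambda>x. \<phi> n x - u x) = sqrt ((nrm2 ?M (\<lambda>x. \<phi> n x - u x))\<^sup>2 + (nrm2 ?M (\<lambda>x. gradient (\<phi> n) x - G x))\<^sup>2)" for n
    proof (rule H12_norm_eq[OF U L2_diff[OF test_L2(2)[OF U \<phi>(1)] L(2)]])
      show "has_weak_partial U i (\<lambda>x. \<phi> n x - u x) (\<lambda>x. (gradient (\<phi> n) x - G x) $ i)" for i
        using has_weak_partial_diff[OF U H0_has_weak_partial[OF U H0_test[OF U \<phi>(1)]] H0_has_weak_partial[OF U u]]
        by simp
    qed
    ultimately have "(\<lambda>n. H12_norm U (\<lambda>x. \<phi> n x - u x)) \<longlonglongrightarrow> 0" by simp
    then have "\<forall>\<^sub>F n in sequentially. H12_norm U (\<lambda>x. \<phi> n x - u x) < \<epsilon>"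
      using that by (rule order_tendstoD(2))
    then obtain n where "H12_norm U (\<lambda>x. \<phi> n x - u x) < \<epsilon>"
      using eventually_happens'[OF sequentially_bot] by blast
    then show ?thesis using \<phi>(1) by blast
  qed
  ultimately show "u \<in> H12_0 U" by (simp add: H12_0_def)
next
  let ?M = "lebesgue_on U"
  assume u: "u \<in> H12_0 U"
  then have Lu: "L2 ?M u" and "\<forall>i. \<exists>g. L2 ?M g \<and> has_weak_partial U i u g"
    by (simp_all add: H12_0_def H12_def Lp_space_2 Bex_def)
  then obtain g where g: "\<And>i. L2 ?M (g i)" "\<And>i. has_weak_partial U i u (g i)" by metis
  define G where "G x = (\<chi> i. g i x)" for x
  have Gm: "G \<in> borel_measurable ?M"
    unfolding G_def[abs_def] using g(1) L2_measurable by (intro measurable_vec_lambda) blast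
  have LG: "L2 ?M G"
  proof -
    have "integrable ?M (\<lambda>x. \<Sum>i\<in>UNIV. (g i x)\<^sup>2)"
      using L2_integrable_real[OF g(1)] by auto
    moreover have "(norm (G x))\<^sup>2 = (\<Sum>i\<in>UNIV. (g i x)\<^sup>2)" for x
      unfolding power2_norm_eq_inner inner_vec_def G_def by (simp add: power2_eq_square)
    ultimately show ?thesis using Gm by (simp add: L2_def)
  qed
  have "\<forall>n. \<exists>\<phi>\<in>test_functions U. H12_norm U (\<lambda>x. \<phi> x - u x) < inverse (real (Suc n))"
    using u by (auto simp: H12_0_def)
  then obtain \<phi> where \<phi>: "\<And>n. \<phi> n \<in> test_functions U" "\<And>n. H12_norm U (\<lambda>x. \<phi> n x - u x) < inverse (real (Suc n))"
    by metis
  have eq: "H12_norm U (\<lambda>x. \<phi> n x - u x) = sqrt ((nrm2 ?M (\<lambda>x. \<phi> n x - u x))\<^sup>2 + (nrm2 ?M (\<lambda>x. gradient (\<phi> n) x - G x))\<^sup>2)" for n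
  proof (rule H12_norm_eq[OF U L2_diff[OF test_L2(2)[OF U \<phi>(1)] LG]])
    show "has_weak_partial U i (\<lambda>x. \<phi> n x - u x) (\<lambda>x. (gradient (\<phi> n) x - G x) $ i)" for i
      using has_weak_partial_diff[OF U H0_has_weak_partial[OF U H0_test[OF U \<phi>(1)]] g(2)]
      by (simp add: G_def)
  qed
  have le: "nrm2 ?M (\<lambda>x. \<phi> n x - u x) \<le> inverse (real (Suc n))" 
    "nrm2 ?M (\<lambda>x. gradient (\<phi> n) x - G x) \<le> inverse (real (Suc n))" for n
    using \<phi>(2)[of n] real_sqrt_sum_squares_ge1[of "nrm2 ?M (\<lambda>x. \<phi> n x - u x)" "nrm2 ?M (\<lambda>x. gradient (\<phi> n) x - G x)"]
      real_sqrt_sum_squares_ge2[of "nrm2 ?M (\<lambda>x. gradient (\<phi> n) x - G x)" "nrm2 ?M (\<lambda>x. \<phi> n x - u x)"]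
    unfolding eq by linarith+
  have "(\<lambda>n. nrm2 ?M (\<lambda>x. \<phi> n x - u x)) \<longlonglongrightarrow> 0"
    by (rule tendsto_sandwich[OF _ _ tendsto_const LIMSEQ_inverse_real_of_nat]) (use le in \<open>simp_all del: of_nat_Suc\<close>)
  moreover have "(\<lambda>n. nrm2 ?M (\<lambda>x. gradient (\<phi> n) x - G x)) \<longlonglongrightarrow> 0"
    by (rule tendsto_sandwich[OF _ _ tendsto_const LIMSEQ_inverse_real_of_nat]) (use le in \<open>simp_all del: of_nat_Suc\<close>)
  ultimately have "H0 U u G" using Lu LG \<phi>(1) by (auto simp: H0_def)
  then show "\<exists>G. H0 U u G" by auto
qed

section \<open>The Gagliardo--Nirenberg--Sobolev inequality\<close>

text \<open>Power with the convention \<open>0 ^ 0 = 1\<close>, unlike \<open>powr\<close>.\<close>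

definition fpow :: "real \<Rightarrow> real \<Rightarrow> real" where
  "fpow x e = (if e = 0 then 1 else x powr e)"

section \<open>Products of line integrals\<close>

text \<open>The integral along the line through \<open>x\<close> in direction \<open>i\<close>. It
  does not depend on \<open>x i\<close>, so it is at the same time a function of the remaining
  coordinates.\<close>

definition marg :: "'i \<Rightarrow> (('i \<Rightarrow> real) \<Rightarrow> real) \<Rightarrow> ('i \<Rightarrow> real) \<Rightarrow> real" where
  "marg i f x = (LINT t|lborel. f (x(i := t)))"

abbreviation LPi :: "'i set \<Rightarrow> ('i \<Rightarrow> real) measure" where
  "LPi I \<equiv> PiM I (\<lambda>_. lborel)"

text \<open>One class that supplies all integrability and Fubini side conditions and is preserved by
  \<open>marg\<close> and \<open>grid_integrand\<close>. The bounds are demanded for every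
  \<open>x\<close>, also outside the space of extensional functions, so that updates
  \<open>x(i := t)\<close> cause no trouble.\<close>

definition box_supported :: "real \<Rightarrow> 'i set \<Rightarrow> (('i \<Rightarrow> real) \<Rightarrow> real) \<Rightarrow> bool" where
  "box_supported R I f \<longleftrightarrow> f \<in> borel_measurable (LPi I) \<and> (\<exists>K. \<forall>x. 0 \<le> f x \<and> f x \<le> K) \<and>
     (\<forall>x. (\<exists>i\<in>I. R < \<bar>x i\<bar>) \<longrightarrow> f x = 0)"

interpretation lborel_product: product_sigma_finite "\<lambda>_. lborel :: real measure"
  by standard

lemma box_supported_integrable:
  assumes I: "finite I" and f: "box_supported R I f"
  shows "integrable (LPi I) f"
proof -
  obtain K where K: "\<And>x. 0 \<le> f x" "\<And>x. f x \<le> K" using f by (auto simp: box_supported_def)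
  let ?B = "PiE I (\<lambda>_. {-R..R})"
  have B: "?B \<in> sets (LPi I)" using I by (intro sets_PiM_I_finite) auto
  have "emeasure (LPi I) ?B = (\<Prod>i\<in>I. emeasure lborel {-R..R})"
    using I by (intro lborel_product.emeasure_PiM) auto
  also have "\<dots> < \<infinity>" by (simp add: ennreal_prod_eq_top less_top[symmetric] emeasure_lborel_Icc_eq power_eq_top_ennreal)
  finally have "integrable (LPi I) (indicat_real ?B)" using B by (intro integrable_real_indicator)
  then have "integrable (LPi I) (\<lambda>x. K * indicat_real ?B x)" by (rule integrable_mult_right)
  then show ?thesis
  proof (rule Bochner_Integration.integrable_bound)
    show "f \<in> borel_measurable (LPi I)" using f by (simp add: box_supported_def)
    show "AE x in LPi I. norm (f x) \<le> norm (K * indicat_real ?B x)"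
    proof (rule AE_I2)
      fix x assume x: "x \<in> space (LPi I)"
      show "norm (f x) \<le> norm (K * indicat_real ?B x)"
      proof (cases "x \<in> ?B")
        case True
        then show ?thesis using K(1)[of x] K(2)[of x] by simp
      next
        case False
        then obtain i where "i \<in> I" "R < \<bar>x i\<bar>" using x by (auto simp: space_PiM PiE_def Pi_def)
        then have "f x = 0" using f by (auto simp: box_supported_def)
        then show ?thesis by simp
      qed
    qed
  qed
qed

lemma measurable_update:
  assumes "f \<in> borel_measurable (LPi (insert i I))"
  shows "(\<lambda>(x, t). f (x(i := t))) \<in> borel_measurable (LPi I \<Otimes>\<^sub>M lborel)"
  using measurable_compose[OF measurable_add_dim assms] by (simp add: case_prod_unfold)

lemma measurable_marg:
  assumes "f \<in> borel_measurable (LPi (insert i I))"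
  shows "marg i f \<in> borel_measurable (LPi I)"
  unfolding marg_def[abs_def]
  by (rule lborel.borel_measurable_lebesgue_integral[OF measurable_update[OF assms]])

lemma measurable_slice:
  assumes "f \<in> borel_measurable (LPi (insert i I))" "x \<in> space (LPi I)"
  shows "(\<lambda>t. f (x(i := t))) \<in> borel_measurable lborel"
  using measurable_compose[OF measurable_Pair1'[OF assms(2)] measurable_update[OF assms(1)]] by simp

lemma integrable_slice:
  assumes f: "box_supported R (insert i I) f" and x: "x \<in> space (LPi I)"
  shows "integrable lborel (\<lambda>t. f (x(i := t)))"
proof -
  obtain K where K: "\<And>x. 0 \<le> f x" "\<And>x. f x \<le> K" using f by (auto simp: box_supported_def)
  have "integrable lborel (\<lambda>t. K * indicat_real {-R..R} t)" 
    by (intro integrable_mult_right integrable_real_indicator) (auto simp: emeasure_lborel_Icc_eq)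
  then show ?thesis
  proof (rule Bochner_Integration.integrable_bound)
    show "(\<lambda>t. f (x(i := t))) \<in> borel_measurable lborel"
      using f x by (intro measurable_slice[where I=I]) (auto simp: box_supported_def)
    show "AE t in lborel. norm (f (x(i := t))) \<le> norm (K * indicat_real {-R..R} t)"
    proof (rule AE_I2)
      fix t
      show "norm (f (x(i := t))) \<le> norm (K * indicat_real {-R..R} t)"
      proof (cases "t \<in> {-R..R}")
        case True
        then show ?thesis using K(1)[of "x(i := t)"] K(2)[of "x(i := t)"] by simp
      next
        case False
        then have "R < \<bar>(x(i := t)) i\<bar>" by auto
        then have "f (x(i := t)) = 0" using f unfolding box_supported_def by blast
        then show ?thesis by simp
      qed
    qed
  qed
qed

lemma marg_nonneg: "box_supported R I f \<Longrightarrow> 0 \<le> marg i f x"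
  unfolding marg_def by (intro Bochner_Integration.integral_nonneg) (auto simp: box_supported_def)

lemma marg_bounded:
  assumes f: "box_supported R I f" and i: "i \<in> I"
  shows "\<exists>K. \<forall>x. marg i f x \<le> K"
proof -
  obtain K where K: "\<And>x. 0 \<le> f x" "\<And>x. f x \<le> K" using f by (auto simp: box_supported_def)
  have K0: "0 \<le> K" using K(1)[of undefined] K(2)[of undefined] by linarith
  have int: "integrable lborel (\<lambda>t. K * indicat_real {-R..R} t)" 
    by (intro integrable_mult_right integrable_real_indicator) (auto simp: emeasure_lborel_Icc_eq)
  have le: "f (x(i := t)) \<le> K * indicat_real {-R..R} t" for x t
  proof (cases "t \<in> {-R..R}")
    case True
    then show ?thesis using K(2)[of "x(i := t)"] by simp
  next
    case False
    then have "R < \<bar>(x(i := t)) i\<bar>" by auto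
    then have "f (x(i := t)) = 0" using f i unfolding box_supported_def by blast
    then show ?thesis using K0 by simp
  qed
  have nn: "0 \<le> (LINT t|lborel. K * indicat_real {-R..R} t)"
    using K0 by (intro Bochner_Integration.integral_nonneg) auto
  have "marg i f x \<le> (LINT t|lborel. K * indicat_real {-R..R} t)" for x
    unfolding marg_def
  proof (cases "integrable lborel (\<lambda>t. f (x(i := t)))")
    case True
    then show "(LINT t|lborel. f (x(i := t))) \<le> (LINT t|lborel. K * indicat_real {-R..R} t)"
      by (rule integral_mono[OF _ int le])
  next
    \<comment> \<open>A slice through a point outside the product space may fail to be integrable;
      its integral is then 0 by default.\<close>
    case False
    then show "(LINT t|lborel. f (x(i := t))) \<le> (LINT t|lborel. K * indicat_real {-R..R} t)"
      using nn by (simp add: not_integrable_integral_eq)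
  qed
  then show ?thesis by blast
qed

lemma marg_eq_0:
  assumes f: "box_supported R I f" and j: "j \<in> I" "j \<noteq> i" "R < \<bar>x j\<bar>"
  shows "marg i f x = 0"
proof -
  have "f (x(i := t)) = 0" for t
  proof -
    have "R < \<bar>(x(i := t)) j\<bar>" using j by simp
    then show ?thesis using f j(1) unfolding box_supported_def by blast
  qed
  then show ?thesis by (simp add: marg_def)
qed

lemma box_supported_marg:
  assumes f: "box_supported R (insert i I) f" and i: "i \<notin> I"
  shows "box_supported R I (marg i f)"
  unfolding box_supported_def
proof (intro conjI allI impI)
  show "marg i f \<in> borel_measurable (LPi I)"
    using f by (intro measurable_marg) (simp add: box_supported_def)
  show "\<exists>K. \<forall>x. 0 \<le> marg i f x \<and> marg i f x \<le> K"
    using marg_bounded[OF f, of i] marg_nonneg[OF f] by auto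
  fix x assume "\<exists>j\<in>I. R < \<bar>x j\<bar>"
  then obtain j where "j \<in> I" "R < \<bar>x j\<bar>" by blast
  then show "marg i f x = 0" using marg_eq_0[OF f, of j i x] i by blast
qed

text \<open>Fubini in the two coordinates \<open>i\<close> and \<open>j\<close>, all others being
  frozen at \<open>x\<close>.\<close>

lemma marg_commute:
  assumes f: "box_supported R (insert i I) f" and i: "i \<notin> I" and j: "j \<in> I" and x: "x \<in> space (LPi I)"
  shows "(LINT t|lborel. marg j f (x(i := t))) = marg j (marg i f) x"
    and "integrable lborel (\<lambda>t. marg j f (x(i := t)))"
proof -
  obtain K where K: "\<And>x. 0 \<le> f x" "\<And>x. f x \<le> K" using f by (auto simp: box_supported_def)
  define h where "h t s = f (x(i := t, j := s))" for t s
  let ?Q = "{-R..R} \<times> {-R..R}"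
  have hm: "(\<lambda>(t, s). h t s) \<in> borel_measurable (lborel \<Otimes>\<^sub>M lborel)"
  proof -
    have "insert j (insert i I) = insert i I" using j by auto
    then have m1: "(\<lambda>(y, s). f (y(j := s))) \<in> borel_measurable (LPi (insert i I) \<Otimes>\<^sub>M lborel)"
      using f by (intro measurable_update) (simp add: box_supported_def)
    have m2: "(\<lambda>(t, s). (x(i := t), s)) \<in> lborel \<Otimes>\<^sub>M lborel \<rightarrow>\<^sub>M LPi (insert i I) \<Otimes>\<^sub>M (lborel :: real measure)"
    proof -
      have "(\<lambda>t. x(i := t)) \<in> lborel \<rightarrow>\<^sub>M LPi (insert i I)"
        using measurable_compose[OF measurable_Pair1'[OF x] measurable_add_dim] by simp
      from measurable_Pair[OF measurable_compose[OF measurable_fst this] measurable_snd]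
      show ?thesis by (simp add: case_prod_unfold)
    qed
    show ?thesis
      using measurable_compose[OF m2 m1] by (simp add: h_def case_prod_unfold)
  qed
  have B: "integrable (lborel \<Otimes>\<^sub>M lborel) (\<lambda>z. K * indicat_real ?Q z)"
  proof (intro integrable_mult_right integrable_real_indicator)
    have "emeasure (lborel \<Otimes>\<^sub>M lborel) ?Q = emeasure lborel {-R..R} * emeasure lborel {-R..R}"
      by (rule lborel.emeasure_pair_measure_Times) auto
    then show "emeasure (lborel \<Otimes>\<^sub>M lborel) ?Q < \<infinity>"
      by (simp add: emeasure_lborel_Icc_eq ennreal_mult_less_top)
  qed auto
  have "norm (h t s) \<le> norm (K * indicat_real ?Q (t, s))" for t s
  proof (cases "(t, s) \<in> ?Q")
    case True
    then show ?thesis using K(1)[of "x(i := t, j := s)"] K(2)[of "x(i := t, j := s)"] by (simp add: h_def)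
  next
    case False
    then have "R < \<bar>(x(i := t, j := s)) i\<bar> \<or> R < \<bar>(x(i := t, j := s)) j\<bar>" using i j by auto
    then have "h t s = 0" using f j unfolding box_supported_def h_def by blast
    then show ?thesis by simp
  qed
  then have hb: "norm ((\<lambda>(t, s). h t s) z) \<le> norm (K * indicat_real ?Q z)" for z
    by (cases z) (simp only: case_prod_conv)
  have int: "integrable (lborel \<Otimes>\<^sub>M lborel) (\<lambda>(t, s). h t s)"
    by (rule Bochner_Integration.integrable_bound[OF B hm AE_I2[OF hb]])
  have "(LINT t|lborel. marg j f (x(i := t))) = (LINT t|lborel. LINT s|lborel. h t s)"
    by (simp add: marg_def h_def)
  also have "\<dots> = (LINT s|lborel. LINT t|lborel. h t s)"
    by (rule lborel_pair.Fubini_integral[symmetric, OF int])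
  also have "\<dots> = marg j (marg i f) x"
  proof -
    have "i \<noteq> j" using i j by blast
    then have "x(i := t, j := s) = x(j := s, i := t)" for t s by (rule fun_upd_twist)
    then show ?thesis by (simp only: marg_def h_def)
  qed
  finally show "(LINT t|lborel. marg j f (x(i := t))) = marg j (marg i f) x" .
  show "integrable lborel (\<lambda>t. marg j f (x(i := t)))"
    using lborel_pair.integrable_fst'[OF int] by (simp add: marg_def h_def)
qed

lemma fpow_nonneg: "0 \<le> fpow x e"
  by (simp add: fpow_def)

lemma fpow_mono: "0 \<le> x \<Longrightarrow> x \<le> y \<Longrightarrow> 0 \<le> e \<Longrightarrow> fpow x e \<le> fpow y e"
  by (simp add: fpow_def powr_mono2)

lemma fpow_mult_powr: "0 < p \<Longrightarrow> 0 \<le> e \<Longrightarrow> 0 \<le> x \<Longrightarrow> x powr p * fpow x e = fpow x (e + p)"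
  by (auto simp: fpow_def powr_add mult.commute)

text \<open>The exponent of \<open>f\<close> is chosen so that, for fixed \<open>p\<close>, the
  total degree is \<open>1 + p\<close> whatever the number of coordinates: the \<open>card I\<close>
  marginals contribute \<open>card I * p\<close>, and \<open>f\<close> the rest. This lets the
  induction remove coordinates without touching \<open>p\<close>.\<close>

definition grid_integrand :: "real \<Rightarrow> 'i set \<Rightarrow> (('i \<Rightarrow> real) \<Rightarrow> real) \<Rightarrow> ('i \<Rightarrow> real) \<Rightarrow> real" where
  "grid_integrand p I f x =
     fpow (f x) (1 - (real (card I) - 1) * p) * (\<Prod>j\<in>I. marg j f x powr p)"

lemma box_supported_grid_integrand:
  assumes I: "finite I" and f: "box_supported R I f" and p: "0 < p" "(real (card I) - 1) * p \<le> 1"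
  shows "box_supported R I (grid_integrand p I f)"
proof -
  define e where "e = 1 - (real (card I) - 1) * p"
  have e: "0 \<le> e" using p by (simp add: e_def)
  have [measurable]: "f \<in> borel_measurable (LPi I)" using f by (simp add: box_supported_def)
  have [measurable]: "marg j f \<in> borel_measurable (LPi I)" if "j \<in> I" for j
    using f that by (intro measurable_marg) (simp add: box_supported_def insert_absorb)
  obtain K where K: "\<And>x. 0 \<le> f x" "\<And>x. f x \<le> K" using f by (auto simp: box_supported_def)
  have "\<forall>j\<in>I. \<exists>K. \<forall>x. marg j f x \<le> K" using marg_bounded[OF f] by blast
  then obtain L where L: "\<And>j x. j \<in> I \<Longrightarrow> marg j f x \<le> L j" by metis
  show ?thesis
    unfolding box_supported_def
  proof (intro conjI allI impI exI)
    show "grid_integrand p I f \<in> borel_measurable (LPi I)"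
    proof (cases "e = 0")
      case True
      then show ?thesis unfolding grid_integrand_def[abs_def] e_def[symmetric] fpow_def by simp
    next
      case False
      then show ?thesis unfolding grid_integrand_def[abs_def] e_def[symmetric] fpow_def by simp
    qed
    fix x
    show "0 \<le> grid_integrand p I f x"
      unfolding grid_integrand_def by (intro mult_nonneg_nonneg fpow_nonneg prod_nonneg) auto
    show "grid_integrand p I f x \<le> fpow K e * (\<Prod>j\<in>I. L j powr p)"
      unfolding grid_integrand_def e_def[symmetric]
      using p by (intro mult_mono fpow_mono prod_mono e K fpow_nonneg prod_nonneg conjI powr_mono2)
        (auto simp: L marg_nonneg[OF f])
    assume "\<exists>i\<in>I. R < \<bar>x i\<bar>"
    then obtain i where i: "i \<in> I" "R < \<bar>x i\<bar>" by blast
    then have fx: "f x = 0" using f unfolding box_supported_def by blast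
    show "grid_integrand p I f x = 0"
    proof (cases "e = 0")
      case False
      then show ?thesis by (simp add: grid_integrand_def e_def[symmetric] fpow_def fx)
    next
      \<comment> \<open>Here \<open>fpow (f x) 0 = 1\<close>, so vanishing has to come from a
        marginal in a direction \<open>j \<noteq> i\<close>; such a \<open>j\<close> exists because
        \<open>(card I - 1) * p = 1\<close> forces two coordinates.\<close>
      case True
      then have "(real (card I) - 1) * p = 1" by (simp add: e_def)
      have "card I \<ge> 2"
      proof (rule ccontr)
        assume "\<not> card I \<ge> 2"
        then have "card I = 0 \<or> card I = 1" by linarith
        then show False using \<open>(real (card I) - 1) * p = 1\<close> p(1) by (elim disjE) simp_all
      qed
      have "\<exists>j\<in>I. j \<noteq> i"
      proof (rule ccontr)
        assume "\<not> (\<exists>j\<in>I. j \<noteq> i)"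
        then have "I \<subseteq> {i}" by blast
        then have "card I \<le> 1" using card_mono[of "{i}" I] by simp
        then show False using \<open>card I \<ge> 2\<close> by simp
      qed
      then obtain j where "j \<in> I" "j \<noteq> i" by blast
      then have "marg j f x powr p = 0" using marg_eq_0[where j=i and i=j and x=x, OF f i(1) _ i(2)] by simp
      then have "(\<Prod>j\<in>I. marg j f x powr p) = 0" using I \<open>j \<in> I\<close> by (intro prod_zero) auto
      then show ?thesis by (simp add: grid_integrand_def)
    qed
  qed
qed

text \<open>One coordinate is integrated out at a time; each step is an application of Hoelder's
  inequality with \<open>card I\<close> factors of weight \<open>p\<close> and one of weight \<open>1 - card I * p\<close>.\<close>

lemma grid_lines_inequality:
  assumes I: "finite I" and p: "0 < p"
  shows "box_supported R I f \<Longrightarrow> (real (card I) - 1) * p \<le> 1 \<Longrightarrow>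
    (LINT x|LPi I. grid_integrand p I f x) \<le> (LINT x|LPi I. f x) powr (1 + p)"
  using I
proof (induction I arbitrary: f rule: finite_induct)
  case empty
  have "(LINT x|LPi {}. g x) = g (\<lambda>_. undefined)" for g :: "('a \<Rightarrow> real) \<Rightarrow> real"
    by (simp add: PiM_empty lebesgue_integral_count_space_finite)
  then show ?case using p by (simp add: grid_integrand_def fpow_def)
next
  case (insert i I)
  note f = insert.prems(1)
  define n where "n = real (card I)"
  have card: "real (card (insert i I)) - 1 = n" using insert.hyps by (simp add: n_def)
  have np: "n * p \<le> 1" using insert.prems(2) card by simp
  define e where "e = 1 - n * p"
  have e: "0 \<le> e" using np by (simp add: e_def)
  let ?F = "marg i f"
  have F: "box_supported R I ?F" by (rule box_supported_marg[OF f insert.hyps(2)])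
  have bs: "box_supported R (insert i I) (grid_integrand p (insert i I) f)"
    by (rule box_supported_grid_integrand) (use insert p in auto)
  have np': "(real (card I) - 1) * p \<le> 1" using np p by (simp add: n_def algebra_simps)
  have bs': "box_supported R I (grid_integrand p I ?F)"
    by (rule box_supported_grid_integrand[OF insert.hyps(1) F p np'])
  have step: "(LINT t|lborel. grid_integrand p (insert i I) f (x(i := t))) \<le> grid_integrand p I ?F x"
    if x: "x \<in> space (LPi I)" for x
  proof -
    define H where "H j t = (if j = i then f (x(i := t)) else marg j f (x(i := t)))" for j t
    define w where "w j = (if j = i then e else p)" for j
    have H0: "0 \<le> H j t" for j t
      using f marg_nonneg[OF f] by (auto simp: H_def box_supported_def)
    have Hint: "integrable lborel (H j)" if "j \<in> insert i I" for j
    proof (cases "j = i")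
      case True
      then have "H j = (\<lambda>t. f (x(i := t)))" by (simp only: H_def[abs_def] simp_thms if_True)
      then show ?thesis using integrable_slice[OF f x] by (simp only:)
    next
      case False
      then have "H j = (\<lambda>t. marg j f (x(i := t)))" by (simp only: H_def[abs_def] simp_thms if_False)
      then show ?thesis using marg_commute(2)[OF f insert.hyps(2) _ x] that False by simp
    qed
    have HI: "(LINT t|lborel. H j t) = (if j = i then ?F x else marg j ?F x)" if "j \<in> insert i I" for j
      using that marg_commute(1)[OF f insert.hyps(2) _ x] by (auto simp: H_def marg_def[of i])
    \<comment> \<open>A marginal does not see its own coordinate: this factor is constant in
      \<open>t\<close> and leaves the inner integral.\<close>
    have m: "marg i f (x(i := t)) = ?F x" for t by (simp add: marg_def)
    have eq: "grid_integrand p (insert i I) f (x(i := t)) =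
        ?F x powr p * (fpow (H i t) e * (\<Prod>j\<in>I. H j t powr p))" for t
    proof -
      have "(\<Prod>j\<in>I. marg j f (x(i := t)) powr p) = (\<Prod>j\<in>I. H j t powr p)"
        using insert.hyps by (intro prod.cong) (auto simp: H_def)
      then show ?thesis
        unfolding grid_integrand_def card e_def[symmetric]
        using insert.hyps by (simp add: m H_def)
    qed
    have hoelder: "(LINT t|lborel. fpow (H i t) e * (\<Prod>j\<in>I. H j t powr p)) \<le>
        fpow (?F x) e * (\<Prod>j\<in>I. marg j ?F x powr p)"
    proof -
      have prod_eq: "(\<Prod>j\<in>I. (LINT t|lborel. H j t) powr p) = (\<Prod>j\<in>I. marg j ?F x powr p)"
        using HI insert.hyps by (intro prod.cong) auto
      show ?thesis
      \<comment> \<open>For \<open>e = 0\<close> the slice of \<open>f\<close> would have weight 0,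
        and \<open>powr\<close> gives 0 instead of 1 at its zeros; the Hoelder product then runs
        over \<open>I\<close> alone.\<close>
      proof (cases "e = 0")
        case True
        have "(LINT t|lborel. (\<Prod>j\<in>I. H j t powr p)) \<le> (\<Prod>j\<in>I. (LINT t|lborel. H j t) powr p)"
          using True p e_def n_def insert.hyps
          by (intro generalized_Hoelder(2)[of I H lborel "\<lambda>_. p"] Hint) (auto simp: H0)
        then show ?thesis using True prod_eq by (simp add: fpow_def)
      next
        case False
        have "(LINT t|lborel. (\<Prod>j\<in>insert i I. H j t powr w j)) \<le> (\<Prod>j\<in>insert i I. (LINT t|lborel. H j t) powr w j)"
        proof (rule generalized_Hoelder(2))
          have "(\<Sum>j\<in>insert i I. w j) = e + (\<Sum>j\<in>I. w j)"
            using insert.hyps by (simp add: w_def)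
          also have "(\<Sum>j\<in>I. w j) = n * p"
          proof -
            have "(\<Sum>j\<in>I. w j) = (\<Sum>j\<in>I. p)"
              by (rule sum.cong) (use insert.hyps in \<open>auto simp: w_def\<close>)
            then show ?thesis by (simp add: n_def)
          qed
          finally show "(\<Sum>j\<in>insert i I. w j) = 1" by (simp add: e_def)
        qed (use H0 Hint insert.hyps e p in \<open>auto simp: w_def\<close>)
        moreover have "(\<Prod>j\<in>I. g j powr w j) = (\<Prod>j\<in>I. g j powr p)" for g :: "'a \<Rightarrow> real"
          using insert.hyps by (intro prod.cong) (auto simp: w_def)
        ultimately show ?thesis
          using False prod_eq insert.hyps HI[of i] by (simp add: fpow_def w_def)
      qed
    qed
    have "(LINT t|lborel. grid_integrand p (insert i I) f (x(i := t))) =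
        ?F x powr p * (LINT t|lborel. fpow (H i t) e * (\<Prod>j\<in>I. H j t powr p))"
      unfolding eq by simp
    also have "\<dots> \<le> ?F x powr p * (fpow (?F x) e * (\<Prod>j\<in>I. marg j ?F x powr p))"
      by (rule mult_left_mono[OF hoelder]) simp
    \<comment> \<open>The factor taken out raises the exponent of the marginal from \<open>e\<close>
      to \<open>e + p\<close>, which is what \<open>grid_integrand\<close> prescribes for one
      coordinate less.\<close>
    also have "\<dots> = fpow (?F x) (e + p) * (\<Prod>j\<in>I. marg j ?F x powr p)"
      using fpow_mult_powr[OF p e marg_nonneg[OF f], of i x] by (simp add: mult.assoc[symmetric])
    also have "e + p = 1 - (real (card I) - 1) * p" by (simp add: e_def n_def algebra_simps)
    finally show ?thesis unfolding grid_integrand_def[of p I "marg i f"] .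
  qed
  have "(LINT x|LPi (insert i I). grid_integrand p (insert i I) f x) =
      (LINT x|LPi I. LINT t|lborel. grid_integrand p (insert i I) f (x(i := t)))"
    using insert.hyps box_supported_integrable[OF _ bs]
    by (intro lborel_product.product_integral_insert) auto
  also have "\<dots> \<le> (LINT x|LPi I. grid_integrand p I ?F x)"
  proof (rule integral_mono)
    show "integrable (LPi I) (\<lambda>x. LINT t|lborel. grid_integrand p (insert i I) f (x(i := t)))"
      using box_supported_integrable[OF insert.hyps(1) box_supported_marg[OF bs insert.hyps(2)]]
      by (simp add: marg_def[abs_def])
    show "integrable (LPi I) (grid_integrand p I ?F)"
      by (rule box_supported_integrable[OF insert.hyps(1) bs'])
  qed (rule step)
  also have "\<dots> \<le> (LINT x|LPi I. ?F x) powr (1 + p)"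
    by (rule insert.IH[OF F np'])
  also have "(LINT x|LPi I. ?F x) = (LINT x|LPi (insert i I). f x)"
    using insert.hyps box_supported_integrable[OF _ f]
    by (subst lborel_product.product_integral_insert) (auto simp: marg_def[abs_def])
  finally show ?case .
qed

text \<open>The value \<open>p = 1 / (card I - 1)\<close> at which the exponent of \<open>f\<close>
  itself is 0 and only the marginals remain.\<close>

lemma Loomis_Whitney:
  assumes "finite I" "2 \<le> card I" "box_supported R I f"
  shows "(LINT x|LPi I. (\<Prod>j\<in>I. marg j f x powr (1 / (real (card I) - 1)))) \<le>
      (LINT x|LPi I. f x) powr (real (card I) / (real (card I) - 1))"
    and "integrable (LPi I) (\<lambda>x. \<Prod>j\<in>I. marg j f x powr (1 / (real (card I) - 1)))"
proof -
  define p where "p = 1 / (real (card I) - 1)"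
  have p: "0 < p" "(real (card I) - 1) * p = 1" using assms(2) by (auto simp: p_def)
  have eq: "grid_integrand p I f = (\<lambda>x. \<Prod>j\<in>I. marg j f x powr p)"
    unfolding grid_integrand_def[abs_def] p(2) by (simp add: fpow_def)
  have e: "1 + p = real (card I) / (real (card I) - 1)"
    using assms(2) by (simp add: p_def field_simps)
  have "(LINT x|LPi I. (\<Prod>j\<in>I. marg j f x powr p)) \<le> (LINT x|LPi I. f x) powr (1 + p)"
    using grid_lines_inequality[OF assms(1) p(1) assms(3)] p(2) unfolding eq by simp
  then show "(LINT x|LPi I. (\<Prod>j\<in>I. marg j f x powr (1 / (real (card I) - 1)))) \<le>
      (LINT x|LPi I. f x) powr (real (card I) / (real (card I) - 1))"
    unfolding e unfolding p_def .
  show "integrable (LPi I) (\<lambda>x. \<Prod>j\<in>I. marg j f x powr (1 / (real (card I) - 1)))"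
    using box_supported_integrable[OF assms(1) box_supported_grid_integrand[OF assms(1,3) p(1)]] p(2)
    unfolding eq unfolding p_def by simp
qed

section \<open>From line integrals to the gradient\<close>

text \<open>For \<open>g > 1\<close> the power is differentiable also at 0, so powers of a test
  function can be differentiated along lines through its zeros.\<close>

lemma DERIV_abs_powr:
  fixes t :: real
  assumes g: "1 < g"
  shows "((\<lambda>t. \<bar>t\<bar> powr g) has_real_derivative g * \<bar>t\<bar> powr (g - 1) * sgn t) (at t)"
proof -
  consider "0 < t" | "t < 0" | "t = 0" by linarith
  then show ?thesis
  proof cases
    case 1
    have "((\<lambda>t. t powr g) has_real_derivative g * t powr (g - 1)) (at t)"
      by (rule has_real_derivative_powr[OF 1])
    then have "((\<lambda>t. \<bar>t\<bar> powr g) has_real_derivative g * t powr (g - 1)) (at t)"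
      by (rule has_field_derivative_transform_within_open[of _ _ _ "{0<..}"]) (use 1 in auto)
    then show ?thesis using 1 by simp
  next
    case 2
    have "((\<lambda>t. (- t) powr g) has_real_derivative (g * (- t) powr (g - 1)) * (- 1)) (at t)"
      by (rule DERIV_chain2[OF has_real_derivative_powr]) (use 2 in \<open>auto intro!: derivative_eq_intros\<close>)
    then have "((\<lambda>t. \<bar>t\<bar> powr g) has_real_derivative (g * (- t) powr (g - 1)) * (- 1)) (at t)"
      by (rule has_field_derivative_transform_within_open[of _ _ _ "{..<0}"]) (use 2 in auto)
    then show ?thesis using 2 by simp
  next
    case 3
    have "((\<lambda>h::real. \<bar>h\<bar> powr g / h) \<longlongrightarrow> 0) (at 0)"
    proof (rule tendsto_0_le[where K=1])
      have "continuous (at 0) (\<lambda>h::real. \<bar>h\<bar> powr (g - 1))"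
        using g by (intro continuous_intros) auto
      then show "((\<lambda>h::real. \<bar>h\<bar> powr (g - 1)) \<longlongrightarrow> 0) (at 0)"
        using g by (simp add: continuous_within)
      have "norm (\<bar>h\<bar> powr g / h) \<le> norm (\<bar>h\<bar> powr (g - 1)) * 1" if "h \<noteq> 0" for h :: real
        using that by (simp add: powr_diff)
      then show "\<forall>\<^sub>F h in at 0. norm (\<bar>h\<bar> powr g / h) \<le> norm (\<bar>h\<bar> powr (g - 1)) * 1"
        by (auto simp: eventually_at_filter)
    qed
    then show ?thesis using 3 g by (simp add: DERIV_def)
  qed
qed

context test_fct
begin

text \<open>The norm of the gradient of \<open>\<bar>\<phi>\<bar> powr g\<close>, written as a
  formula because that power is in general not smooth and so not a test function.\<close>

definition pgrad :: "real \<Rightarrow> real^'n \<Rightarrow> real" where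
  "pgrad g x = g * \<bar>\<phi> x\<bar> powr (g - 1) * norm (gradient \<phi> x)"

lemma pgrad_nonneg: "0 < g \<Longrightarrow> 0 \<le> pgrad g x"
  by (simp add: pgrad_def)

lemma continuous_pgrad: "1 < g \<Longrightarrow> continuous_on UNIV (pgrad g)"
  unfolding pgrad_def using continuous continuous_gradient
  by (intro continuous_on_mult continuous_on_const continuous_on_norm continuous_on_powr' continuous_on_rabs) auto

lemma pgrad_outside: "x \<notin> supp \<Longrightarrow> pgrad g x = 0"
  by (simp add: pgrad_def gradient_outside)

lemma pgrad_bounded:
  assumes "1 < g"
  obtains K where "\<And>x. pgrad g x \<le> K"
proof -
  obtain b where b: "0 < b" "\<And>x. \<bar>\<phi> x\<bar> \<le> b" "\<And>x. norm (gradient \<phi> x) \<le> b" using bounded by blast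
  have "pgrad g x \<le> g * b powr (g - 1) * b" for x
    unfolding pgrad_def using b assms by (intro mult_mono powr_mono2) auto
  then show ?thesis by (rule that)
qed

lemma supp_bounded:
  obtains R where "0 < R" "\<And>x. x \<in> supp \<Longrightarrow> norm x < R"
proof -
  obtain R where R: "\<And>x. x \<in> supp \<Longrightarrow> norm x \<le> R"
    using compact_supp compact_imp_bounded bounded_iff by metis
  show ?thesis by (rule that[of "\<bar>R\<bar> + 1"]) (use R in force)+
qed

text \<open>The fundamental theorem of calculus on the half line arriving at \<open>x\<close>: the
  power of \<open>\<phi>\<close> vanishes at the far end, and its derivative is at most
  \<open>pgrad g\<close>. Extending the integral to the whole line frees the bound from the position
  of \<open>x\<close> on it.\<close>

lemma line_estimate:
  assumes g: "1 < g" and e: "norm e = 1"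
  shows "\<bar>\<phi> x\<bar> powr g \<le> (LINT t|lborel. pgrad g (x + t *\<^sub>R e))"
    and "integrable lborel (\<lambda>t. pgrad g (x + t *\<^sub>R e))"
proof -
  obtain R where R: "0 < R" "\<And>x. x \<in> supp \<Longrightarrow> norm x < R" using supp_bounded by blast
  \<comment> \<open>For \<open>\<bar>t\<bar> \<ge> T\<close> the point
    \<open>x + t *\<^sub>R e\<close> has norm at least \<open>R\<close> and lies outside the
    support.\<close>
  define T where "T = R + norm x"
  have T: "0 < T" using R by (simp add: T_def add_pos_nonneg)
  have out: "x + t *\<^sub>R e \<notin> supp" if "T \<le> \<bar>t\<bar>" for t
  proof
    assume "x + t *\<^sub>R e \<in> supp"
    then have "norm (x + t *\<^sub>R e) < R" by (rule R)
    moreover have "\<bar>t\<bar> - norm x \<le> norm (x + t *\<^sub>R e)"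
      using norm_triangle_ineq2[of "t *\<^sub>R e" "- x"] e by (simp add: add.commute)
    ultimately show False using that by (simp add: T_def)
  qed
  let ?q = "\<lambda>t. pgrad g (x + t *\<^sub>R e)"
  have cont: "continuous_on UNIV ?q"
    by (rule continuous_on_compose2[OF continuous_pgrad[OF g]]) (auto intro!: continuous_intros)
  have int: "integrable lborel (\<lambda>t. indicator {-T..T} t *\<^sub>R ?q t)"
    using borel_integrable_atLeastAtMost'[OF continuous_on_subset[OF cont subset_UNIV], of "-T" T]
    unfolding set_integrable_def .
  moreover have eqq: "(\<lambda>t. indicator {-T..T} t *\<^sub>R ?q t) = ?q"
  proof
    fix t show "indicator {-T..T} t *\<^sub>R ?q t = ?q t"
      using pgrad_outside[OF out[of t], of g] by (cases "t \<in> {-T..T}") auto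
  qed
  ultimately show intq: "integrable lborel ?q" by simp
  define \<psi>' where "\<psi>' t = g * \<bar>\<phi> (x + t *\<^sub>R e)\<bar> powr (g - 1) * sgn (\<phi> (x + t *\<^sub>R e)) * (gradient \<phi> (x + t *\<^sub>R e) \<bullet> e)" for t
  have deriv: "((\<lambda>t. \<bar>\<phi> (x + t *\<^sub>R e)\<bar> powr g) has_real_derivative \<psi>' t) (at t)" for t
  proof -
    have "((\<lambda>t. \<phi> (x + t *\<^sub>R e)) has_derivative (\<lambda>s. gradient \<phi> (x + t *\<^sub>R e) \<bullet> (s *\<^sub>R e))) (at t)"
      by (rule has_derivative_compose[of "\<lambda>t. x + t *\<^sub>R e" "\<lambda>s. s *\<^sub>R e" t UNIV \<phi>])
         (auto intro!: derivative_eq_intros has_derivative)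
    then have "((\<lambda>t. \<phi> (x + t *\<^sub>R e)) has_real_derivative (gradient \<phi> (x + t *\<^sub>R e) \<bullet> e)) (at t)"
      unfolding has_field_derivative_def by (rule has_derivative_eq_rhs) (auto simp: mult.commute)
    from DERIV_chain2[OF DERIV_abs_powr[OF g] this] show ?thesis
      by (simp add: \<psi>'_def)
  qed
  have bound: "\<bar>\<psi>' t\<bar> \<le> ?q t" for t
  proof -
    have "\<bar>\<psi>' t\<bar> = g * \<bar>\<phi> (x + t *\<^sub>R e)\<bar> powr (g - 1) * \<bar>sgn (\<phi> (x + t *\<^sub>R e)) * (gradient \<phi> (x + t *\<^sub>R e) \<bullet> e)\<bar>"
      using g by (simp add: \<psi>'_def abs_mult mult.assoc)
    also have "\<bar>sgn (\<phi> (x + t *\<^sub>R e)) * (gradient \<phi> (x + t *\<^sub>R e) \<bullet> e)\<bar> \<le> 1 * norm (gradient \<phi> (x + t *\<^sub>R e))"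
      unfolding abs_mult
    proof (rule mult_mono)
      show "\<bar>sgn (\<phi> (x + t *\<^sub>R e))\<bar> \<le> 1" by (simp add: abs_sgn_eq)
      show "\<bar>gradient \<phi> (x + t *\<^sub>R e) \<bullet> e\<bar> \<le> norm (gradient \<phi> (x + t *\<^sub>R e))"
        using Cauchy_Schwarz_ineq2[of "gradient \<phi> (x + t *\<^sub>R e)" e] e by simp
    qed auto
    finally show ?thesis using g by (simp add: pgrad_def mult_left_mono)
  qed
  have "(\<psi>' has_integral (\<bar>\<phi> (x + 0 *\<^sub>R e)\<bar> powr g - \<bar>\<phi> (x + (- T) *\<^sub>R e)\<bar> powr g)) {-T..0}"
    by (rule fundamental_theorem_of_calculus)
       (use T deriv in \<open>auto simp: has_real_derivative_iff_has_vector_derivative[symmetric] intro: DERIV_subset\<close>)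
  moreover have "\<phi> (x + (- T) *\<^sub>R e) = 0"
    by (rule zero_outside[OF out]) (use T in simp)
  ultimately have hi: "(\<psi>' has_integral \<bar>\<phi> x\<bar> powr g) {-T..0}" by simp
  have int0: "set_integrable lborel {-T..0} ?q"
    unfolding set_integrable_def using intq by (intro integrable_mult_indicator) auto
  have "\<bar>\<phi> x\<bar> powr g \<le> integral {-T..0} ?q"
  proof (rule has_integral_le[OF hi])
    show "(?q has_integral integral {-T..0} ?q) {-T..0}"
      by (rule integrable_integral) (rule set_borel_integral_eq_integral(1)[OF int0])
    show "\<psi>' t \<le> ?q t" for t using bound[of t] by linarith
  qed
  also have "\<dots> = (LINT t:{-T..0}|lborel. ?q t)"
    by (rule set_borel_integral_eq_integral(2)[OF int0, symmetric])
  also have "\<dots> \<le> (LINT t|lborel. ?q t)"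
    unfolding set_lebesgue_integral_def
    by (rule integral_mono[OF int0[unfolded set_integrable_def] intq])
       (use g pgrad_nonneg[of g] in \<open>auto simp: indicator_def\<close>)
  finally show "\<bar>\<phi> x\<bar> powr g \<le> (LINT t|lborel. pgrad g (x + t *\<^sub>R e))" .
qed

text \<open>Coordinates are indexed by the basis vectors themselves, since this is the product
  measure of which \<open>lborel\<close> is the image.\<close>

abbreviation coords :: "(real^'n \<Rightarrow> real) \<Rightarrow> real^'n" where
  "coords f \<equiv> (\<Sum>b\<in>Basis. f b *\<^sub>R b)"

lemma coords_update:
  assumes "b \<in> Basis"
  shows "coords (f(b := t)) = coords f + (t - f b) *\<^sub>R b"
proof -
  have "coords (f(b := t)) = t *\<^sub>R b + (\<Sum>c\<in>Basis - {b}. f c *\<^sub>R c)"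
    using assms by (simp add: sum.remove[of Basis b])
  also have "\<dots> = coords f + (t - f b) *\<^sub>R b"
    using assms by (simp add: sum.remove[of Basis b] algebra_simps)
  finally show ?thesis .
qed

lemma coords_inner: "b \<in> Basis \<Longrightarrow> coords f \<bullet> b = f b"
  by (rule inner_sum_left_Basis)

lemma measurable_coords: "(\<lambda>f. coords f) \<in> LPi Basis \<rightarrow>\<^sub>M borel"
  by measurable

lemma integral_lborel_coords:
  fixes h :: "real^'n \<Rightarrow> real"
  assumes "h \<in> borel_measurable borel"
  shows "(LINT x|lborel. h x) = (LINT f|LPi Basis. h (coords f))"
proof -
  have "(LINT x|lborel. h x) = (LINT x|distr (LPi Basis) borel (\<lambda>f. coords f). h x)"
    by (simp add: lborel_eq[symmetric])
  also have "\<dots> = (LINT f|LPi Basis. h (coords f))"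
    by (rule integral_distr[OF measurable_coords assms])
  finally show ?thesis .
qed

text \<open>The line estimates in all \<open>n\<close> directions are multiplied, each raised to the
  power \<open>1 / (n - 1)\<close>; the left side becomes \<open>\<bar>\<phi>\<bar>\<close> to the
  power \<open>g * n / (n - 1)\<close>, and the right side is the integrand of
  \<open>Loomis_Whitney\<close> for \<open>pgrad g\<close>.\<close>

lemma Gagliardo_Nirenberg:
  assumes g: "1 < g" and n: "2 \<le> CARD('n)"
  shows "(LINT x|lborel. \<bar>\<phi> x\<bar> powr (g * (real CARD('n) / (real CARD('n) - 1)))) \<le>
    (LINT x|lborel. pgrad g x) powr (real CARD('n) / (real CARD('n) - 1))"
proof -
  let ?n = "real CARD('n)"
  let ?B = "Basis :: (real^'n) set"
  have card: "card ?B = CARD('n)" by simp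
  define p where "p = 1 / (?n - 1)"
  have p: "0 < p" using n by (simp add: p_def)
  obtain R where R: "0 < R" "\<And>x. x \<in> supp \<Longrightarrow> norm x < R" using supp_bounded by blast
  obtain K where K: "\<And>x. pgrad g x \<le> K" using pgrad_bounded[OF g] by blast
  have pm: "pgrad g \<in> borel_measurable borel"
    using continuous_pgrad[OF g] by (rule borel_measurable_continuous_onI)
  define f where "f y = pgrad g (coords y)" for y
  have bs: "box_supported R ?B f"
    unfolding box_supported_def
  proof (intro conjI allI impI)
    show "f \<in> borel_measurable (LPi ?B)"
      unfolding f_def[abs_def] by (rule measurable_compose[OF measurable_coords pm])
    show "\<exists>K. \<forall>y. 0 \<le> f y \<and> f y \<le> K" using K pgrad_nonneg[of g] g by (auto simp: f_def)
    fix y :: "real^'n \<Rightarrow> real" assume "\<exists>b\<in>?B. R < \<bar>y b\<bar>"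
    then obtain b where b: "b \<in> ?B" "R < \<bar>y b\<bar>" by blast
    then have "R < norm (coords y)" using Basis_le_norm[OF b(1), of "coords y"] coords_inner[OF b(1), of y] by linarith
    then have "coords y \<notin> supp" using R(2) by fastforce
    then show "f y = 0" by (simp add: f_def pgrad_outside)
  qed
  have marg: "\<bar>\<phi> (coords y)\<bar> powr g \<le> marg b f y" if b: "b \<in> ?B" for y b
  proof -
    let ?x = "coords y + (- y b) *\<^sub>R b"
    have "marg b f y = (LINT t|lborel. pgrad g (coords y + (t - y b) *\<^sub>R b))"
      unfolding marg_def f_def coords_update[OF b] ..
    also have "\<dots> = (LINT t|lborel. pgrad g (?x + t *\<^sub>R b))"
      by (simp add: algebra_simps)
    \<comment> \<open>Translation invariance moves the base point of the line from
      \<open>b\<close>-coordinate 0 back to \<open>coords y\<close>.\<close>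
    also have "\<dots> = (LINT t|lborel. pgrad g (?x + (y b + 1 * t) *\<^sub>R b))"
      using lborel_integral_real_affine[of 1 "\<lambda>t. pgrad g (?x + t *\<^sub>R b)" "y b"] by simp
    also have "\<dots> = (LINT t|lborel. pgrad g (coords y + t *\<^sub>R b))"
      by (simp add: algebra_simps)
    finally show ?thesis using line_estimate(1)[OF g, of b "coords y"] b by simp
  qed
  have pw: "\<bar>\<phi> (coords y)\<bar> powr (g * (?n / (?n - 1))) \<le> (\<Prod>b\<in>?B. marg b f y powr p)" for y
  proof -
    have "\<bar>\<phi> (coords y)\<bar> powr (g * (?n / (?n - 1))) = (\<Prod>b\<in>?B. (\<bar>\<phi> (coords y)\<bar> powr g) powr p)"
    proof (cases "\<phi> (coords y) = 0")
      case False
      then have "(\<Prod>b\<in>?B. (\<bar>\<phi> (coords y)\<bar> powr g) powr p) = ((\<bar>\<phi> (coords y)\<bar> powr g) powr p) powr ?n"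
        by (simp add: powr_realpow)
      then show ?thesis by (simp add: powr_powr p_def)
    next
      case True
      then show ?thesis using n by simp
    qed
    also have "\<dots> \<le> (\<Prod>b\<in>?B. marg b f y powr p)"
      using marg p by (intro prod_mono) (auto intro!: powr_mono2)
    finally show ?thesis .
  qed
  have pe: "1 / (real (card ?B) - 1) = p" unfolding card p_def ..
  have int: "integrable (LPi ?B) (\<lambda>y. \<Prod>b\<in>?B. marg b f y powr p)"
    using Loomis_Whitney(2)[OF finite_Basis _ bs] n unfolding pe by simp
  have m: "(\<lambda>x. \<bar>\<phi> x\<bar> powr (g * (?n / (?n - 1)))) \<in> borel_measurable borel" by measurable
  have "(LINT x|lborel. \<bar>\<phi> x\<bar> powr (g * (?n / (?n - 1)))) = (LINT y|LPi ?B. \<bar>\<phi> (coords y)\<bar> powr (g * (?n / (?n - 1))))"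
    by (rule integral_lborel_coords[OF m])
  also have "\<dots> \<le> (LINT y|LPi ?B. (\<Prod>b\<in>?B. marg b f y powr p))"
  proof (rule integral_mono[OF _ int pw])
    show "integrable (LPi ?B) (\<lambda>y. \<bar>\<phi> (coords y)\<bar> powr (g * (?n / (?n - 1))))"
    proof (rule Bochner_Integration.integrable_bound[OF int])
      show "(\<lambda>y. \<bar>\<phi> (coords y)\<bar> powr (g * (?n / (?n - 1)))) \<in> borel_measurable (LPi ?B)"
        by (rule measurable_compose[OF measurable_coords m])
      show "AE y in LPi ?B. norm (\<bar>\<phi> (coords y)\<bar> powr (g * (?n / (?n - 1)))) \<le> norm (\<Prod>b\<in>?B. marg b f y powr p)"
      proof (rule AE_I2)
        fix y
        show "norm (\<bar>\<phi> (coords y)\<bar> powr (g * (?n / (?n - 1)))) \<le> norm (\<Prod>b\<in>?B. marg b f y powr p)"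
          using order_trans[OF pw abs_ge_self, of y] by (simp only: real_norm_def abs_of_nonneg[OF powr_ge_zero])
      qed
    qed
  qed
  also have "\<dots> \<le> (LINT y|LPi ?B. f y) powr (?n / (?n - 1))"
    using Loomis_Whitney(1)[OF finite_Basis _ bs] n by (simp add: p_def)
  also have "(LINT y|LPi ?B. f y) = (LINT x|lborel. pgrad g x)"
    unfolding f_def by (rule integral_lborel_coords[OF pm, symmetric])
  finally show ?thesis .
qed

end

section \<open>Sobolev and Poincare inequalities\<close>

text \<open>The factor \<open>\<kappa> * (n - 1) / n\<close> is the power \<open>g\<close> to which
  the test function is raised; the power of the volume is what Hoelder leaves over, with exponent 0
  at the critical value \<open>\<kappa> = 2 * n / (n - 2)\<close>.\<close>

definition Sobolev_const :: "nat \<Rightarrow> real \<Rightarrow> real \<Rightarrow> real" where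
  "Sobolev_const n \<kappa> v = \<kappa> * (real n - 1) / real n * v powr (1/\<kappa> - 1/2 + 1 / real n)"

lemma measure_lebesgue_on_space: "open U \<Longrightarrow> measure (lebesgue_on U) U = measure lebesgue U"
  by (simp add: measure_restrict_space open_lebesgue)

text \<open>The power \<open>g\<close> is fixed by \<open>g * (n / (n - 1)) = \<kappa>\<close>. The
  bound \<open>2 * (g - 1) \<le> \<kappa>\<close>, which lets the L^k norm for k =
  \<open>\<kappa>\<close> control the L^2 norm of \<open>\<bar>\<phi>\<bar> powr (g - 1)\<close>, is
  the hypothesis on \<open>\<kappa>\<close> rearranged.\<close>

lemma Sobolev_exponents:
  fixes n \<kappa> :: real
  assumes n: "2 \<le> n" and \<kappa>: "2 < \<kappa>" "\<kappa> * (n - 2) \<le> 2 * n"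
  defines "g \<equiv> \<kappa> * (n - 1) / n"
  shows "1 < g" "2 * (g - 1) \<le> \<kappa>" "g * (n / (n - 1)) = \<kappa>"
    "1/2 - (g - 1) / \<kappa> = 1/\<kappa> - 1/2 + 1/n" "(n - 1) / n = (g - 1) / \<kappa> + 1/\<kappa>"
proof -
  have "n \<le> 2 * (n - 1)" using n by simp
  also have "\<dots> < \<kappa> * (n - 1)" using n \<kappa> by (intro mult_strict_right_mono) auto
  finally have "n < \<kappa> * (n - 1)" .
  then show "1 < g" using n by (simp add: g_def field_simps)
  have "2 * (\<kappa> * (n - 1)) \<le> \<kappa> * n + 2 * n" using \<kappa>(2) by (simp add: algebra_simps)
  then show "2 * (g - 1) \<le> \<kappa>" using n by (simp add: g_def field_simps)
  show "g * (n / (n - 1)) = \<kappa>" using n by (simp add: g_def)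
  show "1/2 - (g - 1) / \<kappa> = 1/\<kappa> - 1/2 + 1/n" "(n - 1) / n = (g - 1) / \<kappa> + 1/\<kappa>"
    using n \<kappa> by (simp_all add: g_def field_simps)
qed

text \<open>Cauchy-Schwarz separates \<open>pgrad g\<close> into
  \<open>\<bar>\<phi>\<bar> powr (g - 1)\<close> and the gradient; the first factor is bounded by a
  power of the integral \<open>P\<close> that is being estimated, and this power is less than the
  one on the left.\<close>

lemma Sobolev_test:
  fixes U :: "(real^'n::finite) set"
  assumes U: "bounded U" "open U" and \<phi>: "\<phi> \<in> test_functions U" and n: "2 \<le> CARD('n)"
    and \<kappa>: "2 < \<kappa>" "\<kappa> * (real CARD('n) - 2) \<le> 2 * real CARD('n)"
  shows "(LINT x|lebesgue_on U. \<bar>\<phi> x\<bar> powr \<kappa>) powr (1/\<kappa>) \<le>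
      Sobolev_const CARD('n) \<kappa> (measure lebesgue U) * nrm2 (lebesgue_on U) (gradient \<phi>)"
proof -
  let ?M = "lebesgue_on U" and ?n = "real CARD('n)" and ?v = "measure lebesgue U"
  interpret test_fct U \<phi> by (rule test_fctI[OF \<phi>])
  interpret finite_measure ?M by (rule finite_measure_lebesgue_on[OF U])
  define g where "g = \<kappa> * (?n - 1) / ?n"
  have n': "2 \<le> ?n" using n by simp
  note ex = Sobolev_exponents[OF n' \<kappa>, folded g_def]
  have [measurable]: "\<phi> \<in> borel_measurable ?M" by (rule borel_measurable_lebesgue_on) measurable
  define P where "P = (LINT x|?M. \<bar>\<phi> x\<bar> powr \<kappa>)"
  define D where "D = nrm2 ?M (gradient \<phi>)"
  have P0: "0 \<le> P" by (simp add: P_def)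
  have D0: "0 \<le> D" by (simp add: D_def)
  obtain b where b: "0 < b" "\<And>x. \<bar>\<phi> x\<bar> \<le> b" "\<And>x. norm (gradient \<phi> x) \<le> b" using bounded by blast
  have intk: "integrable ?M (\<lambda>x. \<bar>\<phi> x\<bar> powr \<kappa>)"
    by (rule integrable_const_bound[of _ "b powr \<kappa>"]) (use b \<kappa> in \<open>auto intro!: AE_I2 powr_mono2\<close>)
  have "P = (LINT x|lborel. \<bar>\<phi> x\<bar> powr \<kappa>)"
    unfolding P_def by (rule integral_lebesgue_on_eq_lborel[OF U(2)]) (auto simp: zero_outside)
  also have "\<dots> \<le> (LINT x|lborel. pgrad g x) powr (?n / (?n - 1))"
    using Gagliardo_Nirenberg[OF ex(1) n] unfolding ex(3) .
  also have "(LINT x|lborel. pgrad g x) = (LINT x|?M. pgrad g x)"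
    by (rule integral_lebesgue_on_eq_lborel[OF U(2), symmetric])
       (use continuous_pgrad[OF ex(1)] in \<open>auto intro: borel_measurable_continuous_onI simp: pgrad_outside\<close>)
  finally have P1: "P \<le> (LINT x|?M. pgrad g x) powr (?n / (?n - 1))" .
  have L: "L2 ?M (\<lambda>x. \<bar>\<phi> x\<bar> powr (g - 1))"
    by (rule L2_bounded[of _ "b powr (g - 1)"]) (use b ex(1) in \<open>auto intro!: powr_mono2\<close>)
  have nL: "(nrm2 ?M (\<lambda>x. \<bar>\<phi> x\<bar> powr (g - 1)))\<^sup>2 \<le> P powr (2 * (g - 1) / \<kappa>) * ?v powr (1 - 2 * (g - 1) / \<kappa>)"
  proof -
    have sp: "U \<in> sets ?M" using sets.top[of ?M] by simp
    have "(nrm2 ?M (\<lambda>x. \<bar>\<phi> x\<bar> powr (g - 1)))\<^sup>2 = (LINT x|?M. (\<bar>\<phi> x\<bar> powr (g - 1))\<^sup>2)"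
      by (simp add: nrm2_sq)
    also have "\<dots> = (LINT x|?M. indicator U x * \<bar>\<phi> x\<bar> powr (2 * (g - 1)))"
      by (rule Bochner_Integration.integral_cong) (auto simp: powr_powr powr_numeral[symmetric] mult.commute simp del: powr_numeral)
    also have "\<dots> \<le> P powr (2 * (g - 1) / \<kappa>) * measure ?M U powr (1 - 2 * (g - 1) / \<kappa>)"
      unfolding P_def by (rule powr_integral_exponent_le(2)) (use ex(1,2) intk sp in auto)
    finally show ?thesis by (simp add: measure_lebesgue_on_space[OF U(2)])
  qed
  have N: "nrm2 ?M (\<lambda>x. \<bar>\<phi> x\<bar> powr (g - 1)) \<le> P powr ((g - 1) / \<kappa>) * ?v powr (1/2 - (g - 1) / \<kappa>)"
  proof (rule power2_le_imp_le)
    have e: "(x powr y)\<^sup>2 = x powr (2 * y)" for x y :: real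
      by (simp add: powr_powr powr_numeral[symmetric] mult.commute del: powr_numeral)
    have "2 * (1/2 - (g - 1) / \<kappa>) = 1 - 2 * (g - 1) / \<kappa>" by simp
    then have "(P powr ((g - 1) / \<kappa>) * ?v powr (1/2 - (g - 1) / \<kappa>))\<^sup>2 =
        P powr (2 * (g - 1) / \<kappa>) * ?v powr (1 - 2 * (g - 1) / \<kappa>)"
      unfolding power_mult_distrib e by simp
    then show "(nrm2 ?M (\<lambda>x. \<bar>\<phi> x\<bar> powr (g - 1)))\<^sup>2 \<le> (P powr ((g - 1) / \<kappa>) * ?v powr (1/2 - (g - 1) / \<kappa>))\<^sup>2"
      using nL by simp
  qed simp
  have X: "(LINT x|?M. pgrad g x) \<le> g * (P powr ((g - 1) / \<kappa>) * ?v powr (1/2 - (g - 1) / \<kappa>) * D)"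
  proof -
    have "(LINT x|?M. pgrad g x) = g * (LINT x|?M. norm (\<bar>\<phi> x\<bar> powr (g - 1)) * norm (gradient \<phi> x))"
      by (simp add: pgrad_def mult.assoc)
    also have "\<dots> \<le> g * (nrm2 ?M (\<lambda>x. \<bar>\<phi> x\<bar> powr (g - 1)) * D)"
      unfolding D_def using ex(1) by (intro mult_left_mono L2_prod_norm(2) L test_L2(2) U \<phi>) auto
    also have "\<dots> \<le> g * (P powr ((g - 1) / \<kappa>) * ?v powr (1/2 - (g - 1) / \<kappa>) * D)"
      using ex(1) N D0 by (intro mult_left_mono mult_right_mono) auto
    finally show ?thesis .
  qed
  show ?thesis
  proof (cases "P = 0")
    case True
    then show ?thesis using \<kappa> n' D0 unfolding P_def[symmetric] D_def[symmetric] Sobolev_const_def by simp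
  next
    case False
    then have P: "0 < P" using P0 by simp
    have X0: "0 \<le> (LINT x|?M. pgrad g x)" using ex(1) by (intro Bochner_Integration.integral_nonneg pgrad_nonneg) auto
    have "P powr ((?n - 1) / ?n) \<le> ((LINT x|?M. pgrad g x) powr (?n / (?n - 1))) powr ((?n - 1) / ?n)"
      using P1 P n' by (intro powr_mono2) auto
    also have "\<dots> = (LINT x|?M. pgrad g x)" using n' X0 by (simp add: powr_powr)
    also note X
    finally have "P powr ((g - 1) / \<kappa>) * P powr (1/\<kappa>) \<le> P powr ((g - 1) / \<kappa>) * (g * ?v powr (1/2 - (g - 1) / \<kappa>) * D)"
      unfolding ex(5) powr_add by (simp add: mult.commute mult.left_commute)
    \<comment> \<open>The common positive factor \<open>P powr ((g - 1) / \<kappa>)\<close> cancels.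
      For a test function \<open>P\<close> is the integral of a bounded function, so it is genuinely
      finite.\<close>
    then have "P powr (1/\<kappa>) \<le> g * ?v powr (1/2 - (g - 1) / \<kappa>) * D"
      using P by simp
    then have "P powr (1/\<kappa>) \<le> g * ?v powr (1/\<kappa> - 1/2 + 1/?n) * D" unfolding ex(4) .
    then show ?thesis unfolding P_def D_def Sobolev_const_def g_def .
  qed
qed

lemma Sobolev_const_nonneg: "0 \<le> \<kappa> \<Longrightarrow> 1 \<le> n \<Longrightarrow> 0 \<le> Sobolev_const n \<kappa> v"
  by (simp add: Sobolev_const_def)

lemma H0_sequence:
  assumes U: "bounded U" "open U" and u: "H0 U u G"
  obtains \<phi> where "\<And>n. \<phi> n \<in> test_functions U"
    "(\<lambda>n. nrm2 (lebesgue_on U) (\<lambda>x. \<phi> n x - u x)) \<longlonglongrightarrow> 0"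
    "(\<lambda>n. nrm2 (lebesgue_on U) (\<lambda>x. gradient (\<phi> n) x - G x)) \<longlonglongrightarrow> 0"
    "AE x in lebesgue_on U. (\<lambda>n. \<phi> n x) \<longlonglongrightarrow> u x"
proof -
  let ?M = "lebesgue_on U"
  obtain \<phi> where \<phi>: "\<And>n. \<phi> n \<in> test_functions U"
    "(\<lambda>n. nrm2 ?M (\<lambda>x. \<phi> n x - u x)) \<longlonglongrightarrow> 0" "(\<lambda>n. nrm2 ?M (\<lambda>x. gradient (\<phi> n) x - G x)) \<longlonglongrightarrow> 0"
    using u by (auto simp: H0_def)
  obtain r :: "nat \<Rightarrow> nat" where r: "strict_mono r" "AE x in ?M. (\<lambda>n. \<phi> (r n) x - u x) \<longlonglongrightarrow> 0"
    using nrm2_tendsto_AE_subseq[OF L2_diff[OF test_L2(1)[OF U \<phi>(1)] H0_L2(1)[OF u]] \<phi>(2)] by blast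
  show ?thesis
  proof (rule that[of "\<lambda>n. \<phi> (r n)"])
    show "(\<lambda>n. nrm2 ?M (\<lambda>x. \<phi> (r n) x - u x)) \<longlonglongrightarrow> 0"
      using LIMSEQ_subseq_LIMSEQ[OF \<phi>(2) r(1)] by (simp add: o_def)
    show "(\<lambda>n. nrm2 ?M (\<lambda>x. gradient (\<phi> (r n)) x - G x)) \<longlonglongrightarrow> 0"
      using LIMSEQ_subseq_LIMSEQ[OF \<phi>(3) r(1)] by (simp add: o_def)
    show "AE x in ?M. (\<lambda>n. \<phi> (r n) x) \<longlonglongrightarrow> u x"
      using r(2) by eventually_elim (simp add: LIM_zero_iff)
  qed (rule \<phi>(1))
qed

lemma nrm2_tendsto:
  assumes "L2 M f" "\<And>n. L2 M (fn n)" "(\<lambda>n. nrm2 M (\<lambda>x. fn n x - f x)) \<longlonglongrightarrow> 0"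
  shows "(\<lambda>n. nrm2 M (fn n)) \<longlonglongrightarrow> nrm2 M f"
proof -
  have "\<bar>nrm2 M (fn n) - nrm2 M f\<bar> \<le> nrm2 M (\<lambda>x. fn n x - f x)" for n
    using nrm2_triangle_diff[OF assms(2,1), of n] nrm2_triangle_diff[OF assms(1,2), of n]
      nrm2_minus_commute[of M f "fn n"] by linarith
  then have "(\<lambda>n. nrm2 M (fn n) - nrm2 M f) \<longlonglongrightarrow> 0"
    by (intro tendsto_0_le[OF assms(3), where K=1]) auto
  then show ?thesis by (simp add: LIM_zero_iff)
qed

text \<open>Fatou's lemma along an almost everywhere convergent sequence of test functions; working
  with nonnegative integrals yields the higher integrability of \<open>u\<close> together with the
  bound.\<close>

lemma Sobolev_H0:
  fixes U :: "(real^'n::finite) set"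
  assumes U: "bounded U" "open U" and u: "H0 U u G" and n: "2 \<le> CARD('n)"
    and \<kappa>: "2 < \<kappa>" "\<kappa> * (real CARD('n) - 2) \<le> 2 * real CARD('n)"
  shows "integrable (lebesgue_on U) (\<lambda>x. \<bar>u x\<bar> powr \<kappa>)"
    and "(LINT x|lebesgue_on U. \<bar>u x\<bar> powr \<kappa>) powr (1/\<kappa>) \<le>
      Sobolev_const CARD('n) \<kappa> (measure lebesgue U) * nrm2 (lebesgue_on U) G"
proof -
  let ?M = "lebesgue_on U"
  interpret finite_measure ?M by (rule finite_measure_lebesgue_on[OF U])
  define S where "S = Sobolev_const CARD('n) \<kappa> (measure lebesgue U)"
  have S: "0 \<le> S" unfolding S_def using \<kappa> by (intro Sobolev_const_nonneg) auto
  obtain \<phi> where \<phi>: "\<And>n. \<phi> n \<in> test_functions U"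
    "(\<lambda>n. nrm2 ?M (\<lambda>x. \<phi> n x - u x)) \<longlonglongrightarrow> 0" "(\<lambda>n. nrm2 ?M (\<lambda>x. gradient (\<phi> n) x - G x)) \<longlonglongrightarrow> 0"
    "AE x in ?M. (\<lambda>n. \<phi> n x) \<longlonglongrightarrow> u x"
    using H0_sequence[OF U u] by blast
  note L = H0_L2[OF u]
  have [measurable]: "u \<in> borel_measurable ?M" using L(1) by (rule L2_measurable)
  have [measurable]: "\<phi> n \<in> borel_measurable ?M" for n
    using test_L2(1)[OF U \<phi>(1)] by (rule L2_measurable)
  have nn: "(\<integral>\<^sup>+x. ennreal (\<bar>\<phi> k x\<bar> powr \<kappa>) \<partial>?M) \<le> ennreal ((S * nrm2 ?M (gradient (\<phi> k))) powr \<kappa>)" for k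
  proof -
    interpret test_fct U "\<phi> k" by (rule test_fctI[OF \<phi>(1)])
    obtain b where b: "0 < b" "\<And>x. \<bar>\<phi> k x\<bar> \<le> b" "\<And>x. norm (gradient (\<phi> k) x) \<le> b"
      using bounded by blast
    have int: "integrable ?M (\<lambda>x. \<bar>\<phi> k x\<bar> powr \<kappa>)"
      by (rule integrable_const_bound[of _ "b powr \<kappa>"]) (use b \<kappa> in \<open>auto intro!: AE_I2 powr_mono2\<close>)
    let ?P = "LINT x|?M. \<bar>\<phi> k x\<bar> powr \<kappa>"
    have "?P = (?P powr (1/\<kappa>)) powr \<kappa>" using \<kappa> by (simp add: powr_powr)
    also have "\<dots> \<le> (S * nrm2 ?M (gradient (\<phi> k))) powr \<kappa>"
      using \<kappa> Sobolev_test[OF U \<phi>(1) n \<kappa>, of k] unfolding S_def by (intro powr_mono2) auto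
    finally show ?thesis using int by (simp add: nn_integral_eq_integral ennreal_leI)
  qed
  have t: "(\<lambda>k. S * nrm2 ?M (gradient (\<phi> k))) \<longlonglongrightarrow> S * nrm2 ?M G"
    by (rule tendsto_mult_left[OF nrm2_tendsto[OF L(2) test_L2(2)[OF U \<phi>(1)] \<phi>(3)]])
  have "(\<lambda>k. ennreal ((S * nrm2 ?M (gradient (\<phi> k))) powr \<kappa>)) \<longlonglongrightarrow> ennreal ((S * nrm2 ?M G) powr \<kappa>)"
    by (rule tendsto_ennrealI, rule tendsto_powr'[OF t tendsto_const])
       (use S \<kappa> in \<open>simp add: always_eventually\<close>)
  then have lim: "liminf (\<lambda>k. ennreal ((S * nrm2 ?M (gradient (\<phi> k))) powr \<kappa>)) = ennreal ((S * nrm2 ?M G) powr \<kappa>)"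
    by (intro lim_imp_Liminf) auto
  have "(\<integral>\<^sup>+x. ennreal (\<bar>u x\<bar> powr \<kappa>) \<partial>?M) = (\<integral>\<^sup>+x. liminf (\<lambda>k. ennreal (\<bar>\<phi> k x\<bar> powr \<kappa>)) \<partial>?M)"
  proof (rule nn_integral_cong_AE)
    show "AE x in ?M. ennreal (\<bar>u x\<bar> powr \<kappa>) = liminf (\<lambda>k. ennreal (\<bar>\<phi> k x\<bar> powr \<kappa>))"
      using \<phi>(4)
    proof eventually_elim
      case (elim x)
      then have "(\<lambda>k. ennreal (\<bar>\<phi> k x\<bar> powr \<kappa>)) \<longlonglongrightarrow> ennreal (\<bar>u x\<bar> powr \<kappa>)"
        by (intro tendsto_ennrealI tendsto_powr'[OF tendsto_rabs tendsto_const])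
           (use \<kappa> in \<open>simp_all add: always_eventually\<close>)
      then show ?case by (intro lim_imp_Liminf[symmetric]) auto
    qed
  qed
  also have "\<dots> \<le> liminf (\<lambda>k. \<integral>\<^sup>+x. ennreal (\<bar>\<phi> k x\<bar> powr \<kappa>) \<partial>?M)"
    by (intro nn_integral_liminf) auto
  also have "\<dots> \<le> liminf (\<lambda>k. ennreal ((S * nrm2 ?M (gradient (\<phi> k))) powr \<kappa>))"
    by (intro Liminf_mono always_eventually allI nn)
  finally have le: "(\<integral>\<^sup>+x. ennreal (\<bar>u x\<bar> powr \<kappa>) \<partial>?M) \<le> ennreal ((S * nrm2 ?M G) powr \<kappa>)"
    unfolding lim .
  then have "(\<integral>\<^sup>+x. ennreal (norm (\<bar>u x\<bar> powr \<kappa>)) \<partial>?M) < \<infinity>"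
    by (simp add: order_le_less_trans)
  then show int: "integrable ?M (\<lambda>x. \<bar>u x\<bar> powr \<kappa>)"
    by (intro integrableI_bounded) auto
  have "ennreal (LINT x|?M. \<bar>u x\<bar> powr \<kappa>) \<le> ennreal ((S * nrm2 ?M G) powr \<kappa>)"
    using le int by (simp add: nn_integral_eq_integral)
  then have "(LINT x|?M. \<bar>u x\<bar> powr \<kappa>) \<le> (S * nrm2 ?M G) powr \<kappa>" by simp
  then have "(LINT x|?M. \<bar>u x\<bar> powr \<kappa>) powr (1/\<kappa>) \<le> ((S * nrm2 ?M G) powr \<kappa>) powr (1/\<kappa>)"
    using \<kappa> by (intro powr_mono2) auto
  also have "\<dots> = S * nrm2 ?M G" using \<kappa> S by (simp add: powr_powr)
  finally show "(LINT x|?M. \<bar>u x\<bar> powr \<kappa>) powr (1/\<kappa>) \<le> Sobolev_const CARD('n) \<kappa> (measure lebesgue U) * nrm2 ?M G"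
    by (simp add: S_def)
qed

text \<open>The power of \<open>v\<close> is the price of passing from exponent
  \<open>\<kappa>\<close> down to 2 by Hoelder.\<close>

definition Poincare_const :: "nat \<Rightarrow> real \<Rightarrow> real \<Rightarrow> real" where
  "Poincare_const n \<kappa> v = v powr (1/2 - 1/\<kappa>) * Sobolev_const n \<kappa> v"

lemma Poincare_H0:
  fixes U :: "(real^'n::finite) set"
  assumes U: "bounded U" "open U" and u: "H0 U u G" and n: "2 \<le> CARD('n)"
    and \<kappa>: "2 < \<kappa>" "\<kappa> * (real CARD('n) - 2) \<le> 2 * real CARD('n)"
  shows "nrm2 (lebesgue_on U) u \<le> Poincare_const CARD('n) \<kappa> (measure lebesgue U) * nrm2 (lebesgue_on U) G"
proof -
  let ?M = "lebesgue_on U" and ?v = "measure lebesgue U"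
  interpret finite_measure ?M by (rule finite_measure_lebesgue_on[OF U])
  note L = H0_L2[OF u]
  have [measurable]: "u \<in> borel_measurable ?M" using L(1) by (rule L2_measurable)
  have sp: "U \<in> sets ?M" using sets.top[of ?M] by simp
  define P where "P = (LINT x|?M. \<bar>u x\<bar> powr \<kappa>)"
  have e: "(x powr y)\<^sup>2 = x powr (2 * y)" for x y :: real
    by (simp add: powr_powr powr_numeral[symmetric] mult.commute del: powr_numeral)
  have "(nrm2 ?M u)\<^sup>2 = (LINT x|?M. indicator U x * \<bar>u x\<bar> powr 2)"
    unfolding nrm2_sq by (rule Bochner_Integration.integral_cong) (auto simp: powr_numeral)
  also have "\<dots> \<le> P powr (2/\<kappa>) * measure ?M U powr (1 - 2/\<kappa>)"
    unfolding P_def by (rule powr_integral_exponent_le(2)) (use \<kappa> Sobolev_H0(1)[OF U u n \<kappa>] sp in auto)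
  also have "\<dots> = (P powr (1/\<kappa>) * ?v powr (1/2 - 1/\<kappa>))\<^sup>2"
    unfolding power_mult_distrib e by (simp add: measure_lebesgue_on_space[OF U(2)] right_diff_distrib)
  finally have "nrm2 ?M u \<le> P powr (1/\<kappa>) * ?v powr (1/2 - 1/\<kappa>)"
    by (rule power2_le_imp_le) simp
  also have "\<dots> \<le> (Sobolev_const CARD('n) \<kappa> ?v * nrm2 ?M G) * ?v powr (1/2 - 1/\<kappa>)"
    unfolding P_def by (intro mult_right_mono Sobolev_H0(2)[OF U u n \<kappa>]) simp
  finally show ?thesis by (simp add: Poincare_const_def mult.commute mult.left_commute)
qed

section \<open>Stability of the Sobolev space under truncation\<close>

lemma L2_dominated_convergence:
  assumes w: "L2 M w" and fn: "\<And>n. fn n \<in> borel_measurable M" "\<And>n. AE x in M. norm (fn n x) \<le> \<bar>w x\<bar>"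
    and f: "f \<in> borel_measurable M" and lim: "AE x in M. (\<lambda>n. fn n x) \<longlonglongrightarrow> f x"
  shows "L2 M f" "(\<lambda>n. nrm2 M (\<lambda>x. fn n x - f x)) \<longlonglongrightarrow> 0"
proof -
  have [measurable]: "f \<in> borel_measurable M" "\<And>n. fn n \<in> borel_measurable M" by fact+
  have "AE x in M. \<forall>n. norm (fn n x) \<le> \<bar>w x\<bar>" using fn(2) by (simp add: AE_all_countable)
  with lim have fw: "AE x in M. norm (f x) \<le> \<bar>w x\<bar>"
  proof eventually_elim
    case (elim x)
    then show ?case by (intro LIMSEQ_le_const2[OF tendsto_norm[OF elim(1)]]) auto
  qed
  then show Lf: "L2 M f" by (intro L2_bound[OF w f, of 1]) auto
  have int: "integrable M (\<lambda>x. 4 * (w x)\<^sup>2)" using L2_integrable_real[OF w] by auto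
  have "(\<lambda>n. LINT x|M. (norm (fn n x - f x))\<^sup>2) \<longlonglongrightarrow> (LINT x|M. 0)"
  proof (rule integral_dominated_convergence[OF _ _ int])
    show "AE x in M. (\<lambda>n. (norm (fn n x - f x))\<^sup>2) \<longlonglongrightarrow> 0"
      using lim
    proof eventually_elim
      case (elim x)
      then have "(\<lambda>n. (norm (fn n x - f x))\<^sup>2) \<longlonglongrightarrow> (norm (f x - f x))\<^sup>2" by (intro tendsto_intros)
      then show ?case by simp
    qed
    show "AE x in M. norm ((norm (fn n x - f x))\<^sup>2) \<le> 4 * (w x)\<^sup>2" for n
      using fn(2)[of n] fw
    proof eventually_elim
      case (elim x)
      then have "norm (fn n x - f x) \<le> 2 * \<bar>w x\<bar>"
        using norm_triangle_ineq4[of "fn n x" "f x"] by linarith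
      then have "(norm (fn n x - f x))\<^sup>2 \<le> (2 * \<bar>w x\<bar>)\<^sup>2" by (intro power_mono) auto
      then show ?case by (simp add: power_mult_distrib)
    qed
  qed measurable
  then have "(\<lambda>n. sqrt (LINT x|M. (norm (fn n x - f x))\<^sup>2)) \<longlonglongrightarrow> sqrt 0"
    by (intro tendsto_real_sqrt) simp
  then show "(\<lambda>n. nrm2 M (\<lambda>x. fn n x - f x)) \<longlonglongrightarrow> 0" by (simp add: nrm2_def)
qed

lemma H0_linear:
  assumes U: "bounded U" "open U" and u: "H0 U u G" and v: "H0 U v K"
  shows "H0 U (\<lambda>x. a * u x + b * v x) (\<lambda>x. a *\<^sub>R G x + b *\<^sub>R K x)"
proof -
  let ?M = "lebesgue_on U"
  obtain \<phi> where \<phi>: "\<And>n. \<phi> n \<in> test_functions U"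
    "(\<lambda>n. nrm2 ?M (\<lambda>x. \<phi> n x - u x)) \<longlonglongrightarrow> 0" "(\<lambda>n. nrm2 ?M (\<lambda>x. gradient (\<phi> n) x - G x)) \<longlonglongrightarrow> 0"
    using u by (auto simp: H0_def)
  obtain \<psi> where \<psi>: "\<And>n. \<psi> n \<in> test_functions U"
    "(\<lambda>n. nrm2 ?M (\<lambda>x. \<psi> n x - v x)) \<longlonglongrightarrow> 0" "(\<lambda>n. nrm2 ?M (\<lambda>x. gradient (\<psi> n) x - K x)) \<longlonglongrightarrow> 0"
    using v by (auto simp: H0_def)
  note L = H0_L2[OF u] H0_L2[OF v]
  let ?\<chi> = "\<lambda>n x. a * \<phi> n x + b * \<psi> n x"
  have *: "nrm2 ?M (\<lambda>x. (a *\<^sub>R p x + b *\<^sub>R q x) - (a *\<^sub>R p' x + b *\<^sub>R q' x)) \<le>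
      \<bar>a\<bar> * nrm2 ?M (\<lambda>x. p x - p' x) + \<bar>b\<bar> * nrm2 ?M (\<lambda>x. q x - q' x)"
    if "L2 ?M p" "L2 ?M q" "L2 ?M p'" "L2 ?M q'" for p q p' q' :: "_ \<Rightarrow> 'b::euclidean_space"
  proof -
    have "(\<lambda>x. (a *\<^sub>R p x + b *\<^sub>R q x) - (a *\<^sub>R p' x + b *\<^sub>R q' x)) = (\<lambda>x. a *\<^sub>R (p x - p' x) + b *\<^sub>R (q x - q' x))"
      by (simp add: algebra_simps)
    then show ?thesis
      using nrm2_triangle[OF L2_scaleR[OF L2_diff[OF that(1,3)], of a] L2_scaleR[OF L2_diff[OF that(2,4)], of b]]
      by (simp add: nrm2_scaleR)
  qed
  have lim: "(\<lambda>n. \<bar>a\<bar> * p n + \<bar>b\<bar> * q n) \<longlonglongrightarrow> 0" if "p \<longlonglongrightarrow> 0" "q \<longlonglongrightarrow> 0" for p q :: "nat \<Rightarrow> real"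
    using tendsto_add[OF tendsto_mult_right_zero[OF that(1)] tendsto_mult_right_zero[OF that(2)]] by simp
  have 1: "(\<lambda>n. nrm2 ?M (\<lambda>x. ?\<chi> n x - (a * u x + b * v x))) \<longlonglongrightarrow> 0"
    by (rule tendsto_0_le[OF lim[OF \<phi>(2) \<psi>(2)], where K=1])
       (use *[OF test_L2(1)[OF U \<phi>(1)] test_L2(1)[OF U \<psi>(1)] L(1) L(3)] in \<open>auto intro!: always_eventually\<close>)
  have 2: "(\<lambda>n. nrm2 ?M (\<lambda>x. gradient (?\<chi> n) x - (a *\<^sub>R G x + b *\<^sub>R K x))) \<longlonglongrightarrow> 0"
    by (rule tendsto_0_le[OF lim[OF \<phi>(3) \<psi>(3)], where K=1])
       (use *[OF test_L2(2)[OF U \<phi>(1)] test_L2(2)[OF U \<psi>(1)] L(2) L(4)]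
        in \<open>auto intro!: always_eventually simp: test_linear(2)[OF \<phi>(1) \<psi>(1)]\<close>)
  show ?thesis
    unfolding H0_def
  proof (intro conjI exI[of _ ?\<chi>] allI 1 2)
    show "L2 ?M (\<lambda>x. a * u x + b * v x)" using L2_linear[OF L(1,3), of a b] by simp
    show "L2 ?M (\<lambda>x. a *\<^sub>R G x + b *\<^sub>R K x)" by (rule L2_linear[OF L(2,4)])
    show "?\<chi> n \<in> test_functions U" for n by (rule test_linear(1)[OF \<phi>(1) \<psi>(1)])
  qed
qed

text \<open>A diagonal choice: for each \<open>n\<close> one test function within
  \<open>inverse (real (Suc n))\<close> of \<open>u n\<close> and, with its gradient, of
  \<open>G n\<close>.\<close>

lemma H0_closed:
  assumes U: "bounded U" "open U" and u: "\<And>n. H0 U (u n) (G n)"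
    and L: "L2 (lebesgue_on U) v" "L2 (lebesgue_on U) K"
    and lim: "(\<lambda>n. nrm2 (lebesgue_on U) (\<lambda>x. u n x - v x)) \<longlonglongrightarrow> 0"
      "(\<lambda>n. nrm2 (lebesgue_on U) (\<lambda>x. G n x - K x)) \<longlonglongrightarrow> 0"
  shows "H0 U v K"
proof -
  let ?M = "lebesgue_on U"
  have "\<exists>\<phi>\<in>test_functions U. nrm2 ?M (\<lambda>x. \<phi> x - u n x) < inverse (real (Suc n)) \<and>
      nrm2 ?M (\<lambda>x. gradient \<phi> x - G n x) < inverse (real (Suc n))" for n
  proof -
    obtain \<phi> where \<phi>: "\<And>k. \<phi> k \<in> test_functions U"
      "(\<lambda>k. nrm2 ?M (\<lambda>x. \<phi> k x - u n x)) \<longlonglongrightarrow> 0" "(\<lambda>k. nrm2 ?M (\<lambda>x. gradient (\<phi> k) x - G n x)) \<longlonglongrightarrow> 0"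
      using u[of n] by (auto simp: H0_def)
    have "\<forall>\<^sub>F k in sequentially. nrm2 ?M (\<lambda>x. \<phi> k x - u n x) < inverse (real (Suc n))"
      "\<forall>\<^sub>F k in sequentially. nrm2 ?M (\<lambda>x. gradient (\<phi> k) x - G n x) < inverse (real (Suc n))"
      by (rule order_tendstoD(2)[OF \<phi>(2)], simp) (rule order_tendstoD(2)[OF \<phi>(3)], simp)
    then have "\<forall>\<^sub>F k in sequentially. nrm2 ?M (\<lambda>x. \<phi> k x - u n x) < inverse (real (Suc n)) \<and>
        nrm2 ?M (\<lambda>x. gradient (\<phi> k) x - G n x) < inverse (real (Suc n))"
      by (rule eventually_conj)
    then obtain k where "nrm2 ?M (\<lambda>x. \<phi> k x - u n x) < inverse (real (Suc n)) \<and>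
        nrm2 ?M (\<lambda>x. gradient (\<phi> k) x - G n x) < inverse (real (Suc n))"
      using eventually_happens'[OF sequentially_bot] by blast
    then show ?thesis using \<phi>(1) by blast
  qed
  then have "\<forall>n. \<exists>\<phi>. \<phi> \<in> test_functions U \<and> nrm2 ?M (\<lambda>x. \<phi> x - u n x) < inverse (real (Suc n)) \<and>
      nrm2 ?M (\<lambda>x. gradient \<phi> x - G n x) < inverse (real (Suc n))" by blast
  from choice[OF this] obtain \<phi> where "\<forall>n. \<phi> n \<in> test_functions U \<and>
      nrm2 ?M (\<lambda>x. \<phi> n x - u n x) < inverse (real (Suc n)) \<and>
      nrm2 ?M (\<lambda>x. gradient (\<phi> n) x - G n x) < inverse (real (Suc n))" by (rule exE)
  then have \<phi>: "\<And>n. \<phi> n \<in> test_functions U"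
    "\<And>n. nrm2 ?M (\<lambda>x. \<phi> n x - u n x) < inverse (real (Suc n))"
    "\<And>n. nrm2 ?M (\<lambda>x. gradient (\<phi> n) x - G n x) < inverse (real (Suc n))" by simp_all
  have tri: "nrm2 ?M (\<lambda>x. p x - r x) \<le> nrm2 ?M (\<lambda>x. p x - q x) + nrm2 ?M (\<lambda>x. q x - r x)"
    if "L2 ?M p" "L2 ?M q" "L2 ?M r" for p q r :: "_ \<Rightarrow> 'b::euclidean_space"
    using nrm2_triangle[OF L2_diff[OF that(1,2)] L2_diff[OF that(2,3)]] by simp
  have 1: "(\<lambda>n. nrm2 ?M (\<lambda>x. \<phi> n x - v x)) \<longlonglongrightarrow> 0"
  proof (rule tendsto_0_le[where K=1])
    show "(\<lambda>n. inverse (real (Suc n)) + nrm2 ?M (\<lambda>x. u n x - v x)) \<longlonglongrightarrow> 0"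
      using tendsto_add[OF LIMSEQ_inverse_real_of_nat lim(1)] by simp
    have "nrm2 ?M (\<lambda>x. \<phi> n x - v x) \<le> inverse (real (Suc n)) + nrm2 ?M (\<lambda>x. u n x - v x)" for n
      using tri[OF test_L2(1)[OF U \<phi>(1)] H0_L2(1)[OF u] L(1), of n n] \<phi>(2)[of n] by linarith
    then show "\<forall>\<^sub>F n in sequentially. norm (nrm2 ?M (\<lambda>x. \<phi> n x - v x)) \<le>
        norm (inverse (real (Suc n)) + nrm2 ?M (\<lambda>x. u n x - v x)) * 1"
      by (intro always_eventually allI) (simp add: order_trans[OF _ abs_ge_self] del: of_nat_Suc)
  qed
  have 2: "(\<lambda>n. nrm2 ?M (\<lambda>x. gradient (\<phi> n) x - K x)) \<longlonglongrightarrow> 0"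
  proof (rule tendsto_0_le[where K=1])
    show "(\<lambda>n. inverse (real (Suc n)) + nrm2 ?M (\<lambda>x. G n x - K x)) \<longlonglongrightarrow> 0"
      using tendsto_add[OF LIMSEQ_inverse_real_of_nat lim(2)] by simp
    have "nrm2 ?M (\<lambda>x. gradient (\<phi> n) x - K x) \<le> inverse (real (Suc n)) + nrm2 ?M (\<lambda>x. G n x - K x)" for n
      using tri[OF test_L2(2)[OF U \<phi>(1)] H0_L2(2)[OF u] L(2), of n n] \<phi>(3)[of n] by linarith
    then show "\<forall>\<^sub>F n in sequentially. norm (nrm2 ?M (\<lambda>x. gradient (\<phi> n) x - K x)) \<le>
        norm (inverse (real (Suc n)) + nrm2 ?M (\<lambda>x. G n x - K x)) * 1"
      by (intro always_eventually allI) (simp add: order_trans[OF _ abs_ge_self] del: of_nat_Suc)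
  qed
  show ?thesis unfolding H0_def by (intro conjI L exI[of _ \<phi>] allI \<phi>(1) 1 2)
qed

lemma Lipschitz_of_DERIV:
  fixes h :: "real \<Rightarrow> real"
  assumes "\<And>t. (h has_real_derivative g t) (at t)" "\<And>t. \<bar>g t\<bar> \<le> L"
  shows "\<bar>h a - h b\<bar> \<le> L * \<bar>a - b\<bar>"
  using field_differentiable_bound[of UNIV h g L a b] assms by auto

text \<open>Composing the approximating test functions with \<open>h\<close> gives test functions
  again, as \<open>h\<close> is smooth with \<open>h 0 = 0\<close>. The gradient error splits into
  \<open>g (\<phi> n x)\<close> times the old error, bounded by \<open>L\<close>, and the change of
  \<open>g\<close> times \<open>G x\<close>, which is dominated by a multiple of
  \<open>norm (G x)\<close>.\<close>

lemma H0_compose: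
  assumes U: "bounded U" "open U" and u: "H0 U u G" and h: "smooth h" "h 0 = 0"
    and g: "\<And>t. (h has_real_derivative g t) (at t)" "\<And>t. \<bar>g t\<bar> \<le> L" "continuous_on UNIV g"
  shows "H0 U (\<lambda>x. h (u x)) (\<lambda>x. g (u x) *\<^sub>R G x)"
proof -
  let ?M = "lebesgue_on U"
  obtain \<phi> where \<phi>: "\<And>n. \<phi> n \<in> test_functions U"
    "(\<lambda>n. nrm2 ?M (\<lambda>x. \<phi> n x - u x)) \<longlonglongrightarrow> 0" "(\<lambda>n. nrm2 ?M (\<lambda>x. gradient (\<phi> n) x - G x)) \<longlonglongrightarrow> 0"
    "AE x in ?M. (\<lambda>n. \<phi> n x) \<longlonglongrightarrow> u x"
    using H0_sequence[OF U u] by blast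
  note L = H0_L2[OF u]
  have L0: "0 \<le> L" using g(2)[of 0] by linarith
  have hm: "h \<in> borel_measurable borel" and gm: "g \<in> borel_measurable borel"
    using smooth_continuous[OF h(1)] g(3) by (auto intro: borel_measurable_continuous_onI)
  have um: "u \<in> borel_measurable ?M" and \<phi>m: "\<And>n. \<phi> n \<in> borel_measurable ?M"
    and Gm: "G \<in> borel_measurable ?M"
    using L test_L2(1)[OF U \<phi>(1)] by (auto intro: L2_measurable)
  have hu: "(\<lambda>x. h (u x)) \<in> borel_measurable ?M" "\<And>n. (\<lambda>x. h (\<phi> n x)) \<in> borel_measurable ?M"
    and gu: "(\<lambda>x. g (u x)) \<in> borel_measurable ?M" "\<And>n. (\<lambda>x. g (\<phi> n x)) \<in> borel_measurable ?M"
    using measurable_compose[OF um hm] measurable_compose[OF \<phi>m hm]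
      measurable_compose[OF um gm] measurable_compose[OF \<phi>m gm] by auto
  note lip = Lipschitz_of_DERIV[OF g(1,2)]
  have Lhu: "L2 ?M (\<lambda>x. h (u x))"
    by (rule L2_bound[OF L(1) hu(1), of L]) (use lip[of _ 0] h(2) in auto)
  have LgG: "L2 ?M (\<lambda>x. g (u x) *\<^sub>R G x)"
    by (rule L2_bound[OF L(2), of _ L]) (use gu Gm g(2) in \<open>auto intro!: mult_right_mono\<close>)
  have 1: "(\<lambda>n. nrm2 ?M (\<lambda>x. h (\<phi> n x) - h (u x))) \<longlonglongrightarrow> 0"
  proof (rule tendsto_0_le[OF \<phi>(2), where K=L])
    have "nrm2 ?M (\<lambda>x. h (\<phi> n x) - h (u x)) \<le> nrm2 ?M (\<lambda>x. L *\<^sub>R (\<phi> n x - u x))" for n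
    proof (rule nrm2_mono)
      show "L2 ?M (\<lambda>x. L *\<^sub>R (\<phi> n x - u x))"
        by (intro L2_scaleR L2_diff test_L2(1)[OF U \<phi>(1)] L(1))
      show "AE x in ?M. norm (h (\<phi> n x) - h (u x)) \<le> norm (L *\<^sub>R (\<phi> n x - u x))"
        using lip L0 by (auto simp: abs_mult)
    qed (use hu in auto)
    then show "\<forall>\<^sub>F n in sequentially. norm (nrm2 ?M (\<lambda>x. h (\<phi> n x) - h (u x))) \<le> norm (nrm2 ?M (\<lambda>x. \<phi> n x - u x)) * L"
      unfolding nrm2_scaleR using L0 by (intro always_eventually allI) (simp add: mult.commute)
  qed
  have c2: "(\<lambda>n. nrm2 ?M (\<lambda>x. g (\<phi> n x) *\<^sub>R G x - g (u x) *\<^sub>R G x)) \<longlonglongrightarrow> 0"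
  proof (rule L2_dominated_convergence(2)[of ?M "\<lambda>x. L * norm (G x)"])
    show "L2 ?M (\<lambda>x. L * norm (G x))"
      by (rule L2_bound[OF L(2), of _ L]) (use Gm L0 in auto)
    show "AE x in ?M. norm (g (\<phi> n x) *\<^sub>R G x) \<le> \<bar>L * norm (G x)\<bar>" for n
      using g(2) L0 by (auto simp: mult_right_mono abs_mult)
    show "AE x in ?M. (\<lambda>n. g (\<phi> n x) *\<^sub>R G x) \<longlonglongrightarrow> g (u x) *\<^sub>R G x"
      using \<phi>(4)
    proof eventually_elim
      case (elim x)
      have "isCont g (u x)" using g(3) by (simp add: continuous_on_eq_continuous_at)
      then have "(\<lambda>n. g (\<phi> n x)) \<longlonglongrightarrow> g (u x)" using elim by (rule isCont_tendsto_compose)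
      then show ?case by (intro tendsto_intros)
    qed
  qed (use gu Gm in auto)
  have 2: "(\<lambda>n. nrm2 ?M (\<lambda>x. g (\<phi> n x) *\<^sub>R gradient (\<phi> n) x - g (u x) *\<^sub>R G x)) \<longlonglongrightarrow> 0"
  proof (rule tendsto_0_le[where K=1])
    show "(\<lambda>n. L * nrm2 ?M (\<lambda>x. gradient (\<phi> n) x - G x) + nrm2 ?M (\<lambda>x. g (\<phi> n x) *\<^sub>R G x - g (u x) *\<^sub>R G x)) \<longlonglongrightarrow> 0"
      using tendsto_add[OF tendsto_mult_right_zero[OF \<phi>(3)] c2] by simp
    have "nrm2 ?M (\<lambda>x. g (\<phi> n x) *\<^sub>R gradient (\<phi> n) x - g (u x) *\<^sub>R G x) \<le>
        L * nrm2 ?M (\<lambda>x. gradient (\<phi> n) x - G x) + nrm2 ?M (\<lambda>x. g (\<phi> n x) *\<^sub>R G x - g (u x) *\<^sub>R G x)" for n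
    proof -
      have d: "L2 ?M (\<lambda>x. gradient (\<phi> n) x - G x)" by (intro L2_diff test_L2(2)[OF U \<phi>(1)] L(2))
      have gd: "L2 ?M (\<lambda>x. g (\<phi> n x) *\<^sub>R (gradient (\<phi> n) x - G x))"
        by (rule L2_bound[OF d, of _ L]) (use gu L2_measurable[OF d] g(2) in \<open>auto intro!: mult_right_mono\<close>)
      have gG: "L2 ?M (\<lambda>x. g (\<phi> n x) *\<^sub>R G x)"
        by (rule L2_bound[OF L(2), of _ L]) (use gu Gm g(2) in \<open>auto intro!: mult_right_mono\<close>)
      have "nrm2 ?M (\<lambda>x. g (\<phi> n x) *\<^sub>R (gradient (\<phi> n) x - G x)) \<le> nrm2 ?M (\<lambda>x. L *\<^sub>R (gradient (\<phi> n) x - G x))"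
        by (rule nrm2_mono[OF L2_scaleR[OF d] L2_measurable[OF gd]])
           (use g(2) L0 in \<open>auto intro!: mult_right_mono\<close>)
      moreover have "(\<lambda>x. g (\<phi> n x) *\<^sub>R (gradient (\<phi> n) x - G x) + (g (\<phi> n x) *\<^sub>R G x - g (u x) *\<^sub>R G x)) =
          (\<lambda>x. g (\<phi> n x) *\<^sub>R gradient (\<phi> n) x - g (u x) *\<^sub>R G x)"
        by (simp add: algebra_simps)
      ultimately show ?thesis
        using nrm2_triangle[OF gd L2_diff[OF gG LgG]] L0 by (simp add: nrm2_scaleR)
    qed
    then show "\<forall>\<^sub>F n in sequentially. norm (nrm2 ?M (\<lambda>x. g (\<phi> n x) *\<^sub>R gradient (\<phi> n) x - g (u x) *\<^sub>R G x)) \<le>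
        norm (L * nrm2 ?M (\<lambda>x. gradient (\<phi> n) x - G x) + nrm2 ?M (\<lambda>x. g (\<phi> n x) *\<^sub>R G x - g (u x) *\<^sub>R G x)) * 1"
      by (intro always_eventually allI) (simp add: order_trans[OF _ abs_ge_self])
  qed
  have "gradient (\<lambda>x. h (\<phi> n x)) = (\<lambda>x. g (\<phi> n x) *\<^sub>R gradient (\<phi> n) x)" for n
    by (rule ext) (rule gradient_compose[OF \<phi>(1) g(1)])
  then show ?thesis
    unfolding H0_def using Lhu LgG 1 2 test_compose[OF \<phi>(1) h]
    by (intro conjI exI[of _ "\<lambda>n x. h (\<phi> n x)"]) auto
qed

section \<open>Truncations as limits of smooth functions\<close>

lemma continuous_antiderivative:
  fixes g :: "real \<Rightarrow> real"
  assumes "continuous_on UNIV g"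
  obtains h where "\<And>t. (h has_real_derivative g t) (at t)" "h 0 = 0"
proof -
  have "isCont g x" for x using assms by (simp add: continuous_on_eq_continuous_at)
  then have "\<exists>F. \<forall>x. - \<infinity> < ereal x \<longrightarrow> ereal x < \<infinity> \<longrightarrow> (F has_vector_derivative g x) (at x)"
    by (intro einterval_antiderivative) auto
  then obtain F where F: "\<And>x. (F has_real_derivative g x) (at x)"
    by (auto simp: has_real_derivative_iff_has_vector_derivative)
  show ?thesis
  proof (rule that[of "\<lambda>t. F t - F 0"])
    show "((\<lambda>t. F t - F 0) has_real_derivative g t) (at t)" for t
      using DERIV_diff[OF F[of t] DERIV_const[of "F 0"]] by simp
  qed simp
qed

text \<open>The constant is subtracted so that \<open>trunc a b 0 = 0\<close> for any position of
  the levels: truncating must preserve the zero boundary values.\<close>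

definition trunc :: "real \<Rightarrow> real \<Rightarrow> real \<Rightarrow> real" where
  "trunc a b t = min (max t a) b - min (max 0 a) b"

lemma integral_indicator_Icc_Ioo:
  fixes a b p q :: real
  shows "(LINT x|lborel. indicator {p..q} x * indicator {a<..<b} x) = max 0 (min q b - max p a)"
proof -
  have "AE x in lborel. x \<noteq> a" "AE x in lborel. x \<noteq> b" by (rule AE_lborel_singleton)+
  then have "AE x in lborel. indicator {p..q} x * indicator {a<..<b} x = indicat_real {max p a..min q b} x"
    by eventually_elim (auto simp: indicator_def)
  then have "(LINT x|lborel. indicator {p..q} x * indicator {a<..<b} x) = (LINT x|lborel. indicat_real {max p a..min q b} x)"
    by (intro integral_cong_AE) auto
  also have "\<dots> = measure lborel {max p a..min q b}" by simp
  also have "\<dots> = max 0 (min q b - max p a)" by (auto simp: measure_def emeasure_lborel_Icc_eq min_def max_def)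
  finally show ?thesis .
qed

text \<open>Integrating the bumps from 0 to \<open>t\<close> converges to the integral of the
  indicator of the open interval, which is \<open>trunc a b t\<close>. The bound
  \<open>b - a\<close>, uniform in \<open>n\<close> and \<open>t\<close>, is what permits pairing
  with integrable functions, and the sign property prepares for \<open>c\<close> and the
  drift.\<close>

lemma smooth_trunc_sequence:
  assumes ab: "a < b"
  obtains h where "\<And>n. smooth (h n)" "\<And>n. h n 0 = 0"
    "\<And>n t. (h n has_real_derivative interval_bump a b n t) (at t)"
    "\<And>n t. \<bar>h n t\<bar> \<le> b - a" "\<And>n t. 0 \<le> h n t * t" "\<And>t. (\<lambda>n. h n t) \<longlonglongrightarrow> trunc a b t"
proof -
  have cont: "continuous_on UNIV (interval_bump a b n)" for n
    by (rule smooth_continuous[OF smooth_interval_bump])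
  have "\<forall>n. \<exists>h. (\<forall>t. (h has_real_derivative interval_bump a b n t) (at t)) \<and> h 0 = 0"
    using continuous_antiderivative[OF cont] by metis
  from choice[OF this] obtain h where "\<forall>n. (\<forall>t. (h n has_real_derivative interval_bump a b n t) (at t)) \<and> h n 0 = 0"
    by (rule exE)
  then have h: "\<And>n t. (h n has_real_derivative interval_bump a b n t) (at t)" "\<And>n. h n 0 = 0" by auto
  let ?I = "\<lambda>p q n. LINT x|lborel. indicator {p..q} x * interval_bump a b n x"
  have ftc: "?I p q n = h n q - h n p" if "p \<le> q" for p q n
    using integral_FTC_atLeastAtMost[OF that, of "h n" "interval_bump a b n"] h(1)[of n] cont[of n] that
    by (auto simp: has_real_derivative_iff_has_vector_derivative[symmetric] intro: DERIV_subset continuous_on_subset)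
  have bm: "interval_bump a b n \<in> borel_measurable borel" for n
    using cont by (rule borel_measurable_continuous_onI)
  have ile: "interval_bump a b n x \<le> indicator {a<..<b} x" for n x
    using interval_bump_bounds(2)[of a b n x] interval_bump_eq_0[of x a b n] by (auto simp: indicator_def)
  have iab: "integrable lborel (indicat_real {a<..<b})"
    using ab by (intro integrable_real_indicator) auto
  have ib: "norm (indicator {p..q} x * interval_bump a b n x) \<le> indicat_real {a<..<b} x" for p q x n
    using ile[of n x] interval_bump_bounds(1)[of a b n x] by (cases "x \<in> {p..q}") auto
  have Iint: "integrable lborel (\<lambda>x. indicator {p..q} x * interval_bump a b n x)" for p q n
    by (rule Bochner_Integration.integrable_bound[OF iab])
       (use bm order_trans[OF ib abs_ge_self] in \<open>auto intro!: AE_I2\<close>)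
  have I0: "0 \<le> ?I p q n" for p q n
    by (intro Bochner_Integration.integral_nonneg mult_nonneg_nonneg interval_bump_bounds) auto
  have Iab: "?I p q n \<le> b - a" for p q n
  proof -
    have "?I p q n \<le> (LINT x|lborel. indicat_real {a<..<b} x)"
      by (rule integral_mono[OF Iint iab]) (rule order_trans[OF abs_ge_self ib[unfolded real_norm_def]])
    also have "\<dots> = b - a" using ab by simp
    finally show ?thesis .
  qed
  have lim: "(\<lambda>n. ?I p q n) \<longlonglongrightarrow> max 0 (min q b - max p a)" for p q
    unfolding integral_indicator_Icc_Ioo[symmetric]
  proof (rule integral_dominated_convergence[OF _ _ iab])
    show "AE x in lborel. (\<lambda>n. indicator {p..q} x * interval_bump a b n x) \<longlonglongrightarrow> indicator {p..q} x * indicator {a<..<b} x"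
      by (intro AE_I2 tendsto_mult tendsto_const interval_bump_tendsto)
    show "AE x in lborel. norm (indicator {p..q} x * interval_bump a b n x) \<le> indicator {a<..<b} x" for n
      using ib by (rule AE_I2)
  qed (use bm in auto)
  have hp: "h n t = ?I 0 t n" if "0 \<le> t" for n t using ftc[OF that, of n] h(2)[of n] by simp
  have hn: "h n t = - ?I t 0 n" if "t \<le> 0" for n t using ftc[OF that, of n] h(2)[of n] by simp
  show ?thesis
  proof (rule that[of h])
    show "smooth (h n)" for n by (rule smooth_antiderivative[OF h(1) smooth_interval_bump])
    show "\<bar>h n t\<bar> \<le> b - a" for n t
      using I0[of 0 t n] Iab[of 0 t n] I0[of t 0 n] Iab[of t 0 n] hp[of t n] hn[of t n] by linarith
    show "0 \<le> h n t * t" for n t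
    proof (cases "0 \<le> t")
      case True
      then show ?thesis using I0[of 0 t n] hp[OF True, of n] by simp
    next
      case False
      then have "h n t \<le> 0" using I0[of t 0 n] hn[of t n] by simp
      then show ?thesis using False by (simp add: mult_nonpos_nonpos)
    qed
    show "(\<lambda>n. h n t) \<longlonglongrightarrow> trunc a b t" for t
    proof (cases "0 \<le> t")
      case True
      have "max 0 (min t b - max 0 a) = trunc a b t" using True ab by (auto simp: trunc_def min_def max_def)
      then show ?thesis using lim[of 0 t] hp[OF True] by simp
    next
      case False
      have "- max 0 (min 0 b - max t a) = trunc a b t" using False ab by (auto simp: trunc_def min_def max_def)
      then show ?thesis using tendsto_minus[OF lim[of t 0]] hn[of t] False by simp
    qed
  qed (rule h)+
qed

lemma borel_measurable_trunc [measurable]: "trunc a b \<in> borel_measurable borel"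
  unfolding trunc_def[abs_def] by measurable

text \<open>\<open>H0\<close> is closed, and the smooth approximations and their gradients are
  dominated by \<open>\<bar>u x\<bar>\<close> and \<open>norm (G x)\<close>. The bumps converge at
  every point, to 0 at both levels, which fixes the gradient on the level sets as well.\<close>

lemma H0_trunc:
  assumes U: "bounded U" "open U" and u: "H0 U u G" and ab: "a < b"
  shows "H0 U (\<lambda>x. trunc a b (u x)) (\<lambda>x. indicator {a<..<b} (u x) *\<^sub>R G x)"
proof -
  let ?M = "lebesgue_on U"
  obtain h where h: "\<And>n. smooth (h n)" "\<And>n. h n 0 = 0"
    "\<And>n t. (h n has_real_derivative interval_bump a b n t) (at t)"
    "\<And>t. (\<lambda>n. h n t) \<longlonglongrightarrow> trunc a b t"
    using smooth_trunc_sequence[OF ab] by metis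
  have g1: "\<bar>interval_bump a b n t\<bar> \<le> 1" for n t
    using interval_bump_bounds[of a b n t] by simp
  have H: "H0 U (\<lambda>x. h n (u x)) (\<lambda>x. interval_bump a b n (u x) *\<^sub>R G x)" for n
    by (rule H0_compose[OF U u h(1,2,3) g1 smooth_continuous[OF smooth_interval_bump]])
  note L = H0_L2[OF u]
  have um: "u \<in> borel_measurable ?M" and Gm: "G \<in> borel_measurable ?M"
    using L by (auto intro: L2_measurable)
  have ind: "(\<lambda>x. indicat_real {a<..<b} (u x)) \<in> borel_measurable ?M"
    by (rule measurable_compose[OF um]) measurable
  have LG: "L2 ?M (\<lambda>x. norm (G x))"
    by (rule L2_bound[OF L(2), of _ 1]) (use Gm in auto)
  have d1: "norm (h n t) \<le> \<bar>t\<bar>" for n t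
    using Lipschitz_of_DERIV[OF h(3) g1, of n t 0] h(2)[of n] by simp
  have tm: "(\<lambda>x. trunc a b (u x)) \<in> borel_measurable ?M"
    by (rule measurable_compose[OF um borel_measurable_trunc])
  note D1 = L2_dominated_convergence[OF L(1) L2_measurable[OF H0_L2(1)[OF H]] _ tm]
  have gm: "(\<lambda>x. indicat_real {a<..<b} (u x) *\<^sub>R G x) \<in> borel_measurable ?M"
    using ind Gm by (rule borel_measurable_scaleR)
  note D2 = L2_dominated_convergence[OF LG L2_measurable[OF H0_L2(2)[OF H]] _ gm]
  have b2: "AE x in ?M. norm (interval_bump a b n (u x) *\<^sub>R G x) \<le> \<bar>norm (G x)\<bar>" for n
    using g1[of n] by (intro AE_I2) (simp add: mult_left_le_one_le)
  have l2: "AE x in ?M. (\<lambda>n. interval_bump a b n (u x) *\<^sub>R G x) \<longlonglongrightarrow> indicator {a<..<b} (u x) *\<^sub>R G x"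
    by (intro AE_I2 tendsto_scaleR tendsto_const interval_bump_tendsto)
  show ?thesis
    by (rule H0_closed[OF U H]) (use D1[OF AE_I2[OF d1] AE_I2[OF h(4)]] D2[OF b2 l2] in auto)
qed

section \<open>The Lions--Lax--Milgram theorem\<close>

text \<open>A Hilbert space realised as a closed linear set of square integrable representatives;
  equality is up to null sets.\<close>

locale L2_closed_subspace = finite_measure M for M :: "'a measure" +
  fixes V :: "('a \<Rightarrow> 'e::euclidean_space) set"
  assumes V_L2: "W \<in> V \<Longrightarrow> L2 M W"
    and V_linear: "W \<in> V \<Longrightarrow> X \<in> V \<Longrightarrow> (\<lambda>x. a *\<^sub>R W x + b *\<^sub>R X x) \<in> V"
    and V_closed: "(\<And>n. Wn n \<in> V) \<Longrightarrow> L2 M W \<Longrightarrow> (\<lambda>n. nrm2 M (\<lambda>x. Wn n x - W x)) \<longlonglongrightarrow> 0 \<Longrightarrow> W \<in> V"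
begin

definition ip :: "('a \<Rightarrow> 'e) \<Rightarrow> ('a \<Rightarrow> 'e) \<Rightarrow> real" where
  "ip W X = (LINT x|M. W x \<bullet> X x)"

lemma ip_linear:
  assumes "L2 M W" "L2 M X" "L2 M Y"
  shows "ip W (\<lambda>x. a *\<^sub>R X x + b *\<^sub>R Y x) = a * ip W X + b * ip W Y"
  using L2_inner_integrable[OF assms(1,2)] L2_inner_integrable[OF assms(1,3)]
  by (simp add: ip_def inner_simps)

lemma nrm2_sq_linear:
  assumes "L2 M W" "L2 M X"
  shows "(nrm2 M (\<lambda>x. a *\<^sub>R W x + b *\<^sub>R X x))\<^sup>2 = a\<^sup>2 * (nrm2 M W)\<^sup>2 + 2 * a * b * ip W X + b\<^sup>2 * (nrm2 M X)\<^sup>2"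
  using nrm2_sq_add[OF L2_scaleR[OF assms(1), of a] L2_scaleR[OF assms(2), of b]]
  by (simp add: nrm2_scaleR power_mult_distrib ip_def algebra_simps)

text \<open>The representing vector is the limit of a minimizing sequence of
  \<open>nrm2 X ^ 2 / 2 - lf X\<close> over \<open>S\<close>, which is Cauchy by the parallelogram identity; neither
  closedness of \<open>S\<close> nor an extension of \<open>lf\<close> is needed.\<close>

lemma Riesz_representation:
  assumes S: "S \<subseteq> V" "S \<noteq> {}" "\<And>X Y a b. X \<in> S \<Longrightarrow> Y \<in> S \<Longrightarrow> (\<lambda>x. a *\<^sub>R X x + b *\<^sub>R Y x) \<in> S"
    and l: "\<And>X Y a b. X \<in> S \<Longrightarrow> Y \<in> S \<Longrightarrow> lf (\<lambda>x. a *\<^sub>R X x + b *\<^sub>R Y x) = a * lf X + b * lf Y"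
    and C: "\<And>X. X \<in> S \<Longrightarrow> \<bar>lf X\<bar> \<le> C * nrm2 M X"
  shows "\<exists>W\<in>V. \<forall>X\<in>S. ip W X = lf X"
proof -
  have SL: "L2 M X" if "X \<in> S" for X using S(1) that V_L2 by blast
  define J where "J X = (nrm2 M X)\<^sup>2 / 2 - lf X" for X
  have lower: "- (C\<^sup>2 / 2) \<le> J X" if "X \<in> S" for X
  proof -
    have "0 \<le> (nrm2 M X - C)\<^sup>2" by simp
    then show ?thesis using C[OF that] by (simp add: J_def power2_eq_square algebra_simps)
  qed
  then have bdd: "bdd_below (J ` S)" by (auto intro: bdd_belowI[of _ "- (C\<^sup>2 / 2)"])
  define m where "m = Inf (J ` S)"
  have m: "m \<le> J X" if "X \<in> S" for X unfolding m_def using bdd that by (intro cInf_lower) auto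
  have "\<exists>X\<in>S. J X < m + inverse (real (Suc n))" for n
  proof -
    have "Inf (J ` S) < m + inverse (real (Suc n))" by (simp add: m_def del: of_nat_Suc)
    then show ?thesis using cInf_lessD[of "J ` S" "m + inverse (real (Suc n))"] S(2) by auto
  qed
  then have "\<forall>n. \<exists>X. X \<in> S \<and> J X < m + inverse (real (Suc n))" by blast
  from choice[OF this] obtain X where "\<forall>n. X n \<in> S \<and> J (X n) < m + inverse (real (Suc n))" by (rule exE)
  then have X: "\<And>n. X n \<in> S" "\<And>n. J (X n) < m + inverse (real (Suc n))" by auto
  have par: "(nrm2 M (\<lambda>x. X i x - X j x))\<^sup>2 \<le> 4 * (inverse (real (Suc i)) + inverse (real (Suc j)))" for i j
  proof -
    have mid: "(\<lambda>x. (1/2) *\<^sub>R X i x + (1/2) *\<^sub>R X j x) \<in> S" by (rule S(3)[OF X(1) X(1)])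
    have "(nrm2 M (\<lambda>x. (1/2) *\<^sub>R X i x + (1/2) *\<^sub>R X j x))\<^sup>2 =
        (nrm2 M (X i))\<^sup>2 / 4 + ip (X i) (X j) / 2 + (nrm2 M (X j))\<^sup>2 / 4"
      using nrm2_sq_linear[OF SL[OF X(1)] SL[OF X(1)], of "1/2" i "1/2" j] by (simp add: power2_eq_square)
    moreover have "(nrm2 M (\<lambda>x. X i x - X j x))\<^sup>2 = (nrm2 M (X i))\<^sup>2 - 2 * ip (X i) (X j) + (nrm2 M (X j))\<^sup>2"
      using nrm2_sq_linear[OF SL[OF X(1)] SL[OF X(1)], of 1 i "- 1" j] by simp
    ultimately have eq: "(nrm2 M (\<lambda>x. X i x - X j x))\<^sup>2 =
        4 * (J (X i) + J (X j) - 2 * J (\<lambda>x. (1/2) *\<^sub>R X i x + (1/2) *\<^sub>R X j x))"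
      using l[OF X(1)[of i] X(1)[of j], of "1/2" "1/2"] by (simp add: J_def field_simps)
    have le: "J (X i) + J (X j) - 2 * J (\<lambda>x. (1/2) *\<^sub>R X i x + (1/2) *\<^sub>R X j x) \<le>
        inverse (real (Suc i)) + inverse (real (Suc j))"
      using m[OF mid] less_imp_le[OF X(2)[of i]] less_imp_le[OF X(2)[of j]] by argo
    show ?thesis unfolding eq by (rule mult_left_mono[OF le]) simp
  qed
  have Cauchy: "\<exists>N. \<forall>i\<ge>N. \<forall>j\<ge>N. nrm2 M (\<lambda>x. X i x - X j x) < e" if "0 < e" for e
  proof -
    obtain N :: nat where N: "8 / e\<^sup>2 < real N" using reals_Archimedean2 by blast
    have "nrm2 M (\<lambda>x. X i x - X j x) < e" if "N \<le> i" "N \<le> j" for i j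
    proof (rule power2_less_imp_less)
      have inv: "inverse (real (Suc k)) < e\<^sup>2 / 8" if "N \<le> k" for k
      proof -
        have "8 / e\<^sup>2 < real (Suc k)" using N that by simp
        then have "inverse (real (Suc k)) < inverse (8 / e\<^sup>2)"
          using \<open>0 < e\<close> by (intro less_imp_inverse_less) auto
        then show ?thesis by simp
      qed
      show "(nrm2 M (\<lambda>x. X i x - X j x))\<^sup>2 < e\<^sup>2"
      proof -
        have "x \<le> 4 * (p + q) \<Longrightarrow> p < r / 8 \<Longrightarrow> q < r / 8 \<Longrightarrow> x < r" for x p q r :: real by argo
        from this[OF par inv[OF that(1)] inv[OF that(2)]] show ?thesis .
      qed
    qed (use \<open>0 < e\<close> in simp)
    then show ?thesis by blast
  qed
  have "\<exists>W. L2 M W \<and> (\<lambda>n. nrm2 M (\<lambda>x. X n x - W x)) \<longlonglongrightarrow> 0"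
    by (rule L2_complete[OF SL[OF X(1)] Cauchy])
  then obtain W where W: "L2 M W" "(\<lambda>n. nrm2 M (\<lambda>x. X n x - W x)) \<longlonglongrightarrow> 0" by blast
  have "W \<in> V" by (rule V_closed[OF _ W]) (use X(1) S(1) in blast)
  moreover have "ip W Y = lf Y" if Y: "Y \<in> S" for Y
  proof (rule LIMSEQ_unique)
    define q where "q = (nrm2 M Y)\<^sup>2"
    define d where "d n = ip (X n) Y - lf Y" for n
    have "(\<lambda>n. LINT x|M. 1 * (Y x \<bullet> X n x)) \<longlonglongrightarrow> (LINT x|M. 1 * (Y x \<bullet> W x))"
      by (rule L2_inner_tendsto(1)[OF SL[OF Y] W(1) SL[OF X(1)] W(2), where K=1]) auto
    then show "(\<lambda>n. ip (X n) Y) \<longlonglongrightarrow> ip W Y" by (simp add: ip_def inner_commute)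
    have q: "0 \<le> q" by (simp add: q_def)
    have "(d n)\<^sup>2 \<le> 2 * (q + 1) * inverse (real (Suc n))" for n
    proof -
      \<comment> \<open>The quadratic in \<open>t\<close> is minimal at \<open>- d n / q\<close>;
        \<open>q + 1\<close> in the denominator is nearly as good and covers
        \<open>q = 0\<close>.\<close>
      define t where "t = - d n / (q + 1)"
      have "(\<lambda>x. 1 *\<^sub>R X n x + t *\<^sub>R Y x) \<in> S" by (rule S(3)[OF X(1) Y])
      from m[OF this] have "m \<le> J (X n) + t * d n + t\<^sup>2 * q / 2"
        unfolding J_def nrm2_sq_linear[OF SL[OF X(1)] SL[OF Y]] l[OF X(1) Y] q_def d_def
        by (simp add: algebra_simps)
      then have "- (t * d n) - t\<^sup>2 * q / 2 < inverse (real (Suc n))" using X(2)[of n] by linarith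
      moreover have "- (t * d n) - t\<^sup>2 * q / 2 = (d n)\<^sup>2 * (q + 2) / (2 * (q + 1)\<^sup>2)"
      proof -
        have e1: "- (t * d n) = (d n)\<^sup>2 * (2 * (q + 1)) / (2 * (q + 1)\<^sup>2)"
        proof -
          have "D / r = D * (2 * r) / (2 * r\<^sup>2)" if "r \<noteq> 0" for D r :: real
            using that by (simp add: power2_eq_square)
          moreover have "- (t * d n) = (d n)\<^sup>2 / (q + 1)" by (simp add: t_def power2_eq_square)
          moreover have "q + 1 \<noteq> 0" using q by simp
          ultimately show ?thesis by presburger
        qed
        have e2: "t\<^sup>2 * q / 2 = (d n)\<^sup>2 * q / (2 * (q + 1)\<^sup>2)"
          by (simp add: t_def power_divide)
        have e3: "(d n)\<^sup>2 * (2 * (q + 1)) - (d n)\<^sup>2 * q = (d n)\<^sup>2 * (q + 2)"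
          by (simp add: algebra_simps)
        show ?thesis unfolding e1 e2 diff_divide_distrib[symmetric] e3 ..
      qed
      moreover have "(d n)\<^sup>2 / (2 * (q + 1)) \<le> (d n)\<^sup>2 * (q + 2) / (2 * (q + 1)\<^sup>2)"
      proof -
        have "(d n)\<^sup>2 / (2 * (q + 1)) = (d n)\<^sup>2 * (q + 1) / (2 * (q + 1)\<^sup>2)"
          using q by (simp add: power2_eq_square)
        also have "\<dots> \<le> (d n)\<^sup>2 * (q + 2) / (2 * (q + 1)\<^sup>2)"
          by (intro divide_right_mono mult_left_mono) auto
        finally show ?thesis .
      qed
      ultimately have "(d n)\<^sup>2 / (2 * (q + 1)) \<le> inverse (real (Suc n))" by linarith
      then show ?thesis using q by (simp add: divide_le_eq mult.commute)
    qed
    then have "(\<lambda>n. (d n)\<^sup>2) \<longlonglongrightarrow> 0"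
      by (intro tendsto_sandwich[OF _ _ tendsto_const tendsto_mult_right_zero[OF LIMSEQ_inverse_real_of_nat, of "2 * (q + 1)"]])
         (simp_all del: of_nat_Suc)
    then have "(\<lambda>n. sqrt ((d n)\<^sup>2)) \<longlonglongrightarrow> sqrt 0" by (rule tendsto_real_sqrt)
    then have "d \<longlonglongrightarrow> 0" by (simp add: tendsto_rabs_zero_iff)
    moreover have "d = (\<lambda>n. ip (X n) Y - lf Y)" by (simp add: fun_eq_iff d_def)
    ultimately show "(\<lambda>n. ip (X n) Y) \<longlonglongrightarrow> lf Y" by (simp add: LIM_zero_iff)
  qed
  ultimately show ?thesis by blast
qed

text \<open>By Riesz every test function \<open>\<phi>\<close> has a vector \<open>X\<close> with
  \<open>E W \<phi> = ip W X\<close> on \<open>V\<close>. Coercivity bounds \<open>j \<phi>\<close>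
  by \<open>X\<close>, so \<open>L\<close> becomes a bounded functional of \<open>X\<close> on the
  set \<open>S\<close> of these vectors. A second representation, now of this functional on
  \<open>S\<close>, is the solution \<open>W\<close>.\<close>

lemma Lions_theorem:
  fixes T :: "('c \<Rightarrow> real) set" and j :: "('c \<Rightarrow> real) \<Rightarrow> 'a \<Rightarrow> 'e"
  assumes T: "T \<noteq> {}" "\<And>\<phi> \<psi> a b. \<phi> \<in> T \<Longrightarrow> \<psi> \<in> T \<Longrightarrow> (\<lambda>x. a * \<phi> x + b * \<psi> x) \<in> T"
    and j: "\<And>\<phi>. \<phi> \<in> T \<Longrightarrow> j \<phi> \<in> V"
    and E1: "\<And>W X a b \<phi>. W \<in> V \<Longrightarrow> X \<in> V \<Longrightarrow> \<phi> \<in> T \<Longrightarrow> E (\<lambda>x. a *\<^sub>R W x + b *\<^sub>R X x) \<phi> = a * E W \<phi> + b * E X \<phi>"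
    and E2: "\<And>W \<phi> \<psi> a b. W \<in> V \<Longrightarrow> \<phi> \<in> T \<Longrightarrow> \<psi> \<in> T \<Longrightarrow> E W (\<lambda>x. a * \<phi> x + b * \<psi> x) = a * E W \<phi> + b * E W \<psi>"
    and bounded: "\<And>\<phi>. \<phi> \<in> T \<Longrightarrow> \<exists>C. \<forall>W\<in>V. \<bar>E W \<phi>\<bar> \<le> C * nrm2 M W"
    and coercive: "0 < \<mu>" "\<And>\<phi>. \<phi> \<in> T \<Longrightarrow> \<mu> * (nrm2 M (j \<phi>))\<^sup>2 \<le> E (j \<phi>) \<phi>"
    and L: "\<And>\<phi> \<psi> a b. \<phi> \<in> T \<Longrightarrow> \<psi> \<in> T \<Longrightarrow> L (\<lambda>x. a * \<phi> x + b * \<psi> x) = a * L \<phi> + b * L \<psi>"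
      "\<And>\<phi>. \<phi> \<in> T \<Longrightarrow> \<bar>L \<phi>\<bar> \<le> C * nrm2 M (j \<phi>)"
  shows "\<exists>W\<in>V. \<forall>\<phi>\<in>T. E W \<phi> = L \<phi>"
proof -
  define rep where "rep X \<phi> \<longleftrightarrow> \<phi> \<in> T \<and> (\<forall>W\<in>V. E W \<phi> = ip W X)" for X \<phi>
  define S where "S = {X \<in> V. \<exists>\<phi>. rep X \<phi>}"
  have rep_linear: "rep (\<lambda>x. a *\<^sub>R X x + b *\<^sub>R Y x) (\<lambda>x. a * \<phi> x + b * \<psi> x)"
    if "X \<in> V" "Y \<in> V" "rep X \<phi>" "rep Y \<psi>" for X Y \<phi> \<psi> a b
    using that T(2) E2 ip_linear[OF V_L2 V_L2 V_L2] unfolding rep_def by simp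
  have rep_bound: "\<mu> * nrm2 M (j \<phi>) \<le> nrm2 M X" if "X \<in> V" "rep X \<phi>" for X \<phi>
  proof -
    have \<phi>: "\<phi> \<in> T" using that by (simp add: rep_def)
    have "\<mu> * (nrm2 M (j \<phi>))\<^sup>2 \<le> ip (j \<phi>) X" using coercive(2)[OF \<phi>] j[OF \<phi>] that by (simp add: rep_def)
    also have "\<dots> \<le> nrm2 M (j \<phi>) * nrm2 M X"
      using L2_Cauchy_Schwarz[OF V_L2[OF j[OF \<phi>]] V_L2[OF that(1)]] by (simp add: ip_def)
    finally have "nrm2 M (j \<phi>) * (\<mu> * nrm2 M (j \<phi>)) \<le> nrm2 M (j \<phi>) * nrm2 M X"
      by (simp add: power2_eq_square mult.commute mult.left_commute)
    then show ?thesis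
      by (cases "nrm2 M (j \<phi>) = 0") (auto simp: less_le)
  qed
  have C0: "L \<phi> = 0" if "nrm2 M (j \<phi>) = 0" "\<phi> \<in> T" for \<phi> using L(2)[OF that(2)] that(1) by simp
  \<comment> \<open>The vector \<open>X\<close> determines \<open>\<phi>\<close> up to a difference
    whose \<open>j\<close>-image has norm 0, and \<open>L\<close> vanishes on such a difference;
    hence \<open>lf\<close> does not depend on the choice.\<close>
  have rep_L: "L \<phi> = L \<psi>" if X: "X \<in> V" and r: "rep X \<phi>" "rep X \<psi>" for X \<phi> \<psi>
  proof -
    have r': "rep (\<lambda>x. 1 *\<^sub>R X x + (- 1) *\<^sub>R X x) (\<lambda>x. 1 * \<phi> x + (- 1) * \<psi> x)"
      by (rule rep_linear[OF X X r])
    have "\<mu> * nrm2 M (j (\<lambda>x. 1 * \<phi> x + (- 1) * \<psi> x)) \<le> nrm2 M (\<lambda>x. 1 *\<^sub>R X x + (- 1) *\<^sub>R X x)"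
      by (rule rep_bound[OF V_linear[OF X X] r'])
    also have "\<dots> = 0" by (simp add: nrm2_def)
    finally have "nrm2 M (j (\<lambda>x. 1 * \<phi> x + (- 1) * \<psi> x)) \<le> 0"
      using coercive(1) by (simp add: mult_le_0_iff)
    then have "nrm2 M (j (\<lambda>x. 1 * \<phi> x + (- 1) * \<psi> x)) = 0"
      using nrm2_nonneg by (rule antisym)
    then have "L (\<lambda>x. 1 * \<phi> x + (- 1) * \<psi> x) = 0"
      by (rule C0) (use r' in \<open>simp add: rep_def\<close>)
    then show ?thesis using L(1)[of \<phi> \<psi> 1 "- 1"] r by (simp add: rep_def)
  qed
  define lf where "lf X = L (SOME \<phi>. rep X \<phi>)" for X
  have l_eq: "lf X = L \<phi>" if "X \<in> V" "rep X \<phi>" for X \<phi>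
    unfolding lf_def by (rule rep_L[OF that(1) someI[of "rep X", OF that(2)] that(2)])
  have "\<exists>W\<in>V. \<forall>X\<in>S. ip W X = lf X"
  proof (rule Riesz_representation)
    show "S \<subseteq> V" by (auto simp: S_def)
    show "(\<lambda>x. a *\<^sub>R X x + b *\<^sub>R Y x) \<in> S" if "X \<in> S" "Y \<in> S" for X Y a b
      using that rep_linear V_linear unfolding S_def by blast
    show "lf (\<lambda>x. a *\<^sub>R X x + b *\<^sub>R Y x) = a * lf X + b * lf Y" if XY: "X \<in> S" "Y \<in> S" for X Y a b
    proof -
      have V: "X \<in> V" "Y \<in> V" using XY by (simp_all add: S_def)
      obtain \<phi> \<psi> where r: "rep X \<phi>" "rep Y \<psi>" using XY unfolding S_def by blast
      have "lf (\<lambda>x. a *\<^sub>R X x + b *\<^sub>R Y x) = L (\<lambda>x. a * \<phi> x + b * \<psi> x)"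
        by (rule l_eq[OF V_linear[OF V] rep_linear[OF V r]])
      also have "\<dots> = a * L \<phi> + b * L \<psi>" using r by (intro L(1)) (simp_all add: rep_def)
      finally show ?thesis using l_eq V r by simp
    qed
    show "\<bar>lf X\<bar> \<le> (\<bar>C\<bar> / \<mu>) * nrm2 M X" if XS: "X \<in> S" for X
    proof -
      obtain \<phi> where r: "rep X \<phi>" and V: "X \<in> V" using XS by (auto simp: S_def)
      have "\<bar>lf X\<bar> \<le> \<bar>C\<bar> * nrm2 M (j \<phi>)"
        using L(2)[of \<phi>] r l_eq[OF V r] mult_right_mono[OF abs_ge_self[of C] nrm2_nonneg[of M "j \<phi>"]]
        by (simp add: rep_def)
      also have "\<dots> \<le> \<bar>C\<bar> * (nrm2 M X / \<mu>)"
        using rep_bound[OF V r] coercive(1) by (intro mult_left_mono) (auto simp: le_divide_eq mult.commute)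
      finally show ?thesis by simp
    qed
    obtain \<phi> where \<phi>: "\<phi> \<in> T" using T(1) by blast
    have "rep (\<lambda>x. 0 *\<^sub>R j \<phi> x + 0 *\<^sub>R j \<phi> x) (\<lambda>x. 0 * \<phi> x + 0 * \<phi> x)"
      unfolding rep_def using T(2)[OF \<phi> \<phi>, of 0 0] E2[OF _ \<phi> \<phi>, of _ 0 0] by (simp add: ip_def)
    then show "S \<noteq> {}" using V_linear[OF j[OF \<phi>] j[OF \<phi>], of 0 0] unfolding S_def by blast
  qed
  then obtain W where W: "W \<in> V" "\<And>X. X \<in> S \<Longrightarrow> ip W X = lf X" by blast
  have "E W \<phi> = L \<phi>" if \<phi>: "\<phi> \<in> T" for \<phi>
  proof -
    obtain C' where C': "\<And>W. W \<in> V \<Longrightarrow> \<bar>E W \<phi>\<bar> \<le> C' * nrm2 M W" using bounded[OF \<phi>] by blast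
    \<comment> \<open>Riesz on the whole of \<open>V\<close>: every test function has a representing
      vector, so the identity on \<open>S\<close> covers all of \<open>T\<close>.\<close>
    have "\<exists>X\<in>V. \<forall>W\<in>V. ip X W = E W \<phi>"
      by (rule Riesz_representation[of V "\<lambda>W. E W \<phi>" C'])
         (use W(1) V_linear E1 \<phi> C' in auto)
    then obtain X where X: "X \<in> V" "\<And>W. W \<in> V \<Longrightarrow> ip X W = E W \<phi>" by blast
    then have r: "rep X \<phi>" using \<phi> by (auto simp: rep_def ip_def inner_commute)
    then have "ip W X = lf X" using X(1) by (intro W(2)) (auto simp: S_def)
    then show ?thesis using X W(1) l_eq[OF X(1) r] by (simp add: ip_def inner_commute)
  qed
  then show ?thesis using W(1) by blast
qed

end

section \<open>Weak solutions\<close>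

lemma (in finite_measure) integrable_mult_bounded:
  fixes f g :: "'a \<Rightarrow> real"
  assumes f: "integrable M f" and g: "g \<in> borel_measurable M" "\<And>x. \<bar>g x\<bar> \<le> b"
  shows "integrable M (\<lambda>x. f x * g x)"
proof (rule Bochner_Integration.integrable_bound)
  show "integrable M (\<lambda>x. b * f x)" using f by simp
  show "(\<lambda>x. f x * g x) \<in> borel_measurable M" using f g by measurable
  show "AE x in M. norm (f x * g x) \<le> norm (b * f x)"
  proof (rule AE_I2)
    fix x
    have "\<bar>g x\<bar> \<le> \<bar>b\<bar>" using g(2)[of x] by linarith
    then have "\<bar>f x\<bar> * \<bar>g x\<bar> \<le> \<bar>f x\<bar> * \<bar>b\<bar>" by (rule mult_left_mono) simp
    then show "norm (f x * g x) \<le> norm (b * f x)"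
      by (simp add: abs_mult mult.commute[of "\<bar>b\<bar>"])
  qed
qed

lemma (in finite_measure) L2_integrable_one: "L2 M f \<Longrightarrow> integrable M f" for f :: "'a \<Rightarrow> real"
  using L2_inner_integrable[of M f "\<lambda>x. 1"] L2_bounded[of "\<lambda>x. 1::real" 1] by simp

lemma Lp_spaceD:
  fixes f :: "'a \<Rightarrow> 'b::euclidean_space"
  assumes "f \<in> Lp_space M (ennreal p)" "0 < p"
  shows "f \<in> borel_measurable M" "integrable M (\<lambda>x. norm (f x) powr p)"
  using assms by (auto simp: Lp_space_def)

lemma Lp_norm_eq:
  "0 < p \<Longrightarrow> Lp_norm M (ennreal p) f = (LINT x|M. norm (f x) powr p) powr (1 / p)"
  by (simp add: Lp_norm_def)

lemma Lp_norm_nonneg: "0 \<le> Lp_norm M p f"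
  by (simp add: Lp_norm_def)

lemma Lp_pairing:
  fixes f v :: "'a \<Rightarrow> real"
  assumes f: "f \<in> Lp_space M (ennreal p)" and p: "1 < p" and pq: "1 / p + 1 / q = 1"
    and v: "v \<in> borel_measurable M" "integrable M (\<lambda>x. \<bar>v x\<bar> powr q)"
  shows "integrable M (\<lambda>x. f x * v x)"
    and "(LINT x|M. \<bar>f x * v x\<bar>) \<le> Lp_norm M (ennreal p) f * (LINT x|M. \<bar>v x\<bar> powr q) powr (1/q)"
proof -
  have "1 / p < 1" using p by simp
  then have "0 < 1 / q" using pq by linarith
  then have q: "0 < q" by simp
  have p0: "0 < p" using p by simp
  note fD = Lp_spaceD[OF f p0, unfolded real_norm_def]
  show "integrable M (\<lambda>x. f x * v x)"
    by (rule Hoelder(1)[OF fD(1) v(1) p0 q pq fD(2) v(2)])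
  show "(LINT x|M. \<bar>f x * v x\<bar>) \<le> Lp_norm M (ennreal p) f * (LINT x|M. \<bar>v x\<bar> powr q) powr (1/q)"
    using Hoelder(2)[OF fD(1) v(1) p0 q pq fD(2) v(2)] p0 by (simp add: Lp_norm_eq)
qed

lemma L2_pairs:
  assumes "L2 M u" "L2 M G"
  shows "L2 M (\<lambda>x. (u x, G x))" "(nrm2 M (\<lambda>x. (u x, G x)))\<^sup>2 = (nrm2 M u)\<^sup>2 + (nrm2 M G)\<^sup>2"
proof -
  have [measurable]: "u \<in> borel_measurable M" "G \<in> borel_measurable M"
    using assms by (auto intro: L2_measurable)
  have e: "(norm (u x, G x))\<^sup>2 = (norm (u x))\<^sup>2 + (norm (G x))\<^sup>2" for x
    by (simp add: norm_Pair)
  show "L2 M (\<lambda>x. (u x, G x))"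
    unfolding L2_def e using L2_integrable[OF assms(1)] L2_integrable[OF assms(2)]
    by (auto intro!: borel_measurable_Pair)
  show "(nrm2 M (\<lambda>x. (u x, G x)))\<^sup>2 = (nrm2 M u)\<^sup>2 + (nrm2 M G)\<^sup>2"
    unfolding nrm2_sq e using L2_integrable[OF assms(1)] L2_integrable[OF assms(2)] by simp
qed

lemma L2_fst_snd:
  assumes "L2 M W"
  shows "L2 M (\<lambda>x. fst (W x))" "L2 M (\<lambda>x. snd (W x))"
    "nrm2 M (\<lambda>x. fst (W x)) \<le> nrm2 M W" "nrm2 M (\<lambda>x. snd (W x)) \<le> nrm2 M W"
proof -
  have m: "(\<lambda>x. fst (W x)) \<in> borel_measurable M" "(\<lambda>x. snd (W x)) \<in> borel_measurable M"
    using measurable_compose[OF L2_measurable[OF assms] borel_measurable_continuous_onI[OF continuous_on_fst[OF continuous_on_id]]]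
      measurable_compose[OF L2_measurable[OF assms] borel_measurable_continuous_onI[OF continuous_on_snd[OF continuous_on_id]]]
    by simp_all
  have n: "AE x in M. norm (fst (W x)) \<le> norm (W x)" "AE x in M. norm (snd (W x)) \<le> norm (W x)"
    by (metis (mono_tags, lifting) AE_I2 norm_fst_le norm_snd_le prod.collapse)+
  show "L2 M (\<lambda>x. fst (W x))" by (rule L2_bound[OF assms m(1), of 1]) (use n in simp)
  show "L2 M (\<lambda>x. snd (W x))" by (rule L2_bound[OF assms m(2), of 1]) (use n in simp)
  show "nrm2 M (\<lambda>x. fst (W x)) \<le> nrm2 M W" by (rule nrm2_mono[OF assms m(1) n(1)])
  show "nrm2 M (\<lambda>x. snd (W x)) \<le> nrm2 M W" by (rule nrm2_mono[OF assms m(2) n(2)])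
qed

section \<open>The boundary value problem and existence\<close>

locale elliptic_problem =
  fixes s :: real and U :: "(real^'n::finite) set" and A :: "real^'n \<Rightarrow> real^'n^'n"
    and B :: "real^'n \<Rightarrow> real^'n" and c :: "real^'n \<Rightarrow> real" and \<alpha> lam Lam :: real
  assumes A: "assumption_A s U A B c \<alpha> lam Lam" and n2: "2 \<le> CARD('n)"
    and two_star: "is_two_star CARD('n) s"
begin

abbreviation M where "M \<equiv> lebesgue_on U"

lemma U: "bounded U" "open U" using A by (auto simp: assumption_A_def)

sublocale finite_measure M by (rule finite_measure_lebesgue_on[OF U])

lemma lam: "0 < lam" and Lam: "0 < Lam" and \<alpha>: "0 \<le> \<alpha>"
  and elliptic: "x \<in> U \<Longrightarrow> lam * (norm \<xi>)\<^sup>2 \<le> (A x *v \<xi>) \<bullet> \<xi>"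
  and A_bound: "x \<in> U \<Longrightarrow> \<bar>A x $ i $ j\<bar> \<le> Lam"
  and B: "L2 M B" and div: "weakly_div_nonpos U B"
  and c: "c \<in> Lp_space M (ennreal s)" "AE x in M. 0 \<le> c x"
  using A by (auto simp: assumption_A_def Lp_space_2)

lemma A_measurable: "(\<lambda>x. A x $ i $ j) \<in> borel_measurable M"
  using A by (simp add: assumption_A_def Lp_space_def)

lemma s: "1 < s" "s < 2"
proof -
  have "1 < s \<and> s < 2"
  proof (cases "CARD('n) = 2")
    case True
    then show ?thesis using two_star by (simp add: is_two_star_def)
  next
    case False
    then have d: "2 < real CARD('n)" using n2 by simp
    have "s = 2 * real CARD('n) / (real CARD('n) + 2)" using two_star False by (simp add: is_two_star_def)
    then show ?thesis using d by (simp add: less_divide_eq divide_less_eq)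
  qed
  then show "1 < s" "s < 2" by auto
qed

text \<open>The exponent dual to \<open>s\<close>: the critical Sobolev exponent 2d/(d-2) if d >= 3,
  and some finite exponent above 2 if d = 2. Thus \<open>f\<close> and \<open>c\<close> in L^s pair
  with elements of \<open>H0\<close>.\<close>

definition \<kappa> where "\<kappa> = s / (s - 1)"

lemma \<kappa>: "2 < \<kappa>" "\<kappa> * (real CARD('n) - 2) \<le> 2 * real CARD('n)" "1 / s + 1 / \<kappa> = 1"
proof -
  show "2 < \<kappa>" using s by (simp add: \<kappa>_def field_simps)
  show "1 / s + 1 / \<kappa> = 1" using s by (simp add: \<kappa>_def field_simps)
  show "\<kappa> * (real CARD('n) - 2) \<le> 2 * real CARD('n)"
  proof (cases "CARD('n) = 2")
    case True
    then show ?thesis by simp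
  next
    case False
    define d where "d = real CARD('n)"
    have d: "2 < d" using False n2 by (simp add: d_def)
    have sd: "s = 2 * d / (d + 2)" using two_star False by (simp add: is_two_star_def d_def)
    have s1: "s - 1 = (d - 2) / (d + 2)" using d unfolding sd by (simp add: field_simps)
    have "\<kappa> = s / ((d - 2) / (d + 2))" unfolding \<kappa>_def s1 ..
    also have "\<dots> = 2 * d / (d - 2)" using d unfolding sd by simp
    finally have "\<kappa> = 2 * d / (d - 2)" .
    then show ?thesis using d unfolding d_def[symmetric] by simp
  qed
qed

abbreviation "S \<equiv> Sobolev_const CARD('n) \<kappa> (measure lebesgue U)"
abbreviation "P \<equiv> Poincare_const CARD('n) \<kappa> (measure lebesgue U)"

lemma S0: "0 \<le> S" using \<kappa> by (intro Sobolev_const_nonneg) auto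

lemmas Sobolev = Sobolev_H0[OF U _ n2 \<kappa>(1,2)]
lemmas Poincare = Poincare_H0[OF U _ n2 \<kappa>(1,2)]

lemma Ls_integrable:
  fixes f :: "real^'n \<Rightarrow> real"
  assumes f: "f \<in> Lp_space M (ennreal s)"
  shows "integrable M f"
proof -
  have "integrable M (\<lambda>x. f x * 1)"
    by (rule Lp_pairing(1)[OF f s(1) \<kappa>(3)]) auto
  then show ?thesis by simp
qed

lemma Ls_pairing:
  assumes f: "f \<in> Lp_space M (ennreal s)" and v: "H0 U v G"
  shows "integrable M (\<lambda>x. f x * v x)"
    and "(LINT x|M. \<bar>f x * v x\<bar>) \<le> Lp_norm M (ennreal s) f * (S * nrm2 M G)"
proof -
  have vm: "v \<in> borel_measurable M" by (rule L2_measurable[OF H0_L2(1)[OF v]])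
  show "integrable M (\<lambda>x. f x * v x)"
    by (rule Lp_pairing(1)[OF f s(1) \<kappa>(3) vm Sobolev(1)[OF v]])
  show "(LINT x|M. \<bar>f x * v x\<bar>) \<le> Lp_norm M (ennreal s) f * (S * nrm2 M G)"
    by (rule order_trans[OF Lp_pairing(2)[OF f s(1) \<kappa>(3) vm Sobolev(1)[OF v]]])
       (intro mult_left_mono Sobolev(2)[OF v] Lp_norm_nonneg)
qed

lemma AG_bound:
  assumes x: "x \<in> U"
  shows "norm (A x *v y) \<le> (real CARD('n) * (real CARD('n) * Lam)) * norm y"
proof -
  have "norm (A x *v y) \<le> (\<Sum>i\<in>UNIV. \<bar>(A x *v y) $ i\<bar>)" by (rule norm_le_l1_cart)
  also have "\<dots> \<le> (\<Sum>i\<in>(UNIV :: 'n set). real CARD('n) * (Lam * norm y))"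
  proof (rule sum_mono)
    fix i
    have "\<bar>(A x *v y) $ i\<bar> \<le> (\<Sum>j\<in>UNIV. \<bar>A x $ i $ j * y $ j\<bar>)"
      unfolding matrix_vector_mult_def by (simp add: sum_abs)
    also have "\<dots> \<le> (\<Sum>j\<in>(UNIV :: 'n set). Lam * norm y)"
      unfolding abs_mult by (intro sum_mono mult_mono A_bound[OF x] component_le_norm_cart) (use Lam in auto)
    finally show "\<bar>(A x *v y) $ i\<bar> \<le> real CARD('n) * (Lam * norm y)" by simp
  qed
  finally show ?thesis by (simp add: mult.assoc)
qed

lemma AG_L2:
  assumes G: "L2 M G"
  shows "L2 M (\<lambda>x. A x *v G x)"
proof (rule L2_bound[OF G])
  have "(\<lambda>x. \<Sum>j\<in>UNIV. A x $ i $ j * G x $ j) \<in> borel_measurable M" for i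
    by (intro borel_measurable_sum borel_measurable_times A_measurable measurable_vec_nth L2_measurable[OF G])
  from measurable_vec_lambda[OF this] show "(\<lambda>x. A x *v G x) \<in> borel_measurable M"
    by (simp add: matrix_vector_mult_def)
  show "AE x in M. norm (A x *v G x) \<le> (real CARD('n) * (real CARD('n) * Lam)) * norm (G x)"
    by (rule AE_I2) (use AG_bound in simp)
qed

definition low :: "(real^'n \<Rightarrow> real) \<Rightarrow> (real^'n \<Rightarrow> real^'n) \<Rightarrow> real^'n \<Rightarrow> real" where
  "low u G x = B x \<bullet> G x + (c x + \<alpha>) * u x"

lemma low_integrable:
  assumes u: "H0 U u G"
  shows "integrable M (\<lambda>x. B x \<bullet> G x)" "integrable M (\<lambda>x. c x * u x)" "integrable M u" "integrable M (low u G)"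
    "integrable M (\<lambda>x. (c x + \<alpha>) * u x)"
proof -
  show 1: "integrable M (\<lambda>x. B x \<bullet> G x)" by (rule L2_inner_integrable[OF B H0_L2(2)[OF u]])
  show 2: "integrable M (\<lambda>x. c x * u x)" by (rule Ls_pairing(1)[OF c(1) u])
  show 3: "integrable M u" by (rule L2_integrable_one[OF H0_L2(1)[OF u]])
  show 4: "integrable M (\<lambda>x. (c x + \<alpha>) * u x)" using 2 3 by (simp add: distrib_right)
  show "integrable M (low u G)" unfolding low_def[abs_def] using 1 4 by simp
qed

definition form :: "(real^'n \<Rightarrow> real) \<Rightarrow> (real^'n \<Rightarrow> real^'n) \<Rightarrow> (real^'n \<Rightarrow> real) \<Rightarrow> real" where
  "form u G \<phi> = (LINT x|M. (A x *v G x) \<bullet> gradient \<phi> x) + (LINT x|M. low u G x * \<phi> x)"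

definition rhs :: "(real^'n \<Rightarrow> real) \<Rightarrow> (real^'n \<Rightarrow> real^'n) \<Rightarrow> (real^'n \<Rightarrow> real) \<Rightarrow> real" where
  "rhs f F \<phi> = (LINT x|M. f x * \<phi> x) + (LINT x|M. F x \<bullet> gradient \<phi> x)"

lemma test_times_integrable:
  assumes \<phi>: "\<phi> \<in> test_functions U" and f: "integrable M f"
  shows "integrable M (\<lambda>x. f x * \<phi> x)"
proof -
  interpret test_fct U \<phi> by (rule test_fctI[OF \<phi>])
  obtain b where b: "0 < b" "\<And>x. \<bar>\<phi> x\<bar> \<le> b" "\<And>x. norm (gradient \<phi> x) \<le> b" using bounded by blast
  show ?thesis by (rule integrable_mult_bounded[OF f L2_measurable[OF test_L2(1)[OF U \<phi>]] b(2)])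
qed

text \<open>The chosen weak gradient agrees with \<open>G\<close> almost everywhere, and both
  integrability conditions in \<open>weak_solution\<close> hold automatically; only the equation
  remains.\<close>

lemma weak_solution_iff:
  assumes f: "integrable M f" and F: "L2 M F" and u: "H0 U u G"
  shows "weak_solution U A B c \<alpha> f F u \<longleftrightarrow> (\<forall>\<phi>\<in>test_functions U. form u G \<phi> = rhs f F \<phi>)"
proof -
  note L = H0_L2[OF u]
  have u0: "u \<in> H12_0 U" using u H12_0_iff_H0[OF U] by blast
  note ae = H0_weak_gradient[OF U u]
  have wgm: "weak_gradient U u \<in> borel_measurable M"
    unfolding weak_gradient_def[abs_def]
    by (rule measurable_vec_lambda) (rule weak_partial_eq(2)[OF U H0_has_weak_partial[OF U u]])
  have LW: "L2 M (weak_gradient U u)"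
    by (rule L2_cong_AE[OF _ wgm L(2)]) (use ae in eventually_elim, simp)
  have Ww: "H0 U u G" by (rule u)
  let ?W = "weak_gradient U u"
  have main: "integrable M (\<lambda>x. (A x *v ?W x) \<bullet> gradient \<phi> x + (B x \<bullet> ?W x + (c x + \<alpha>) * u x) * \<phi> x) \<and>
      (LINT x|M. (A x *v ?W x) \<bullet> gradient \<phi> x + (B x \<bullet> ?W x + (c x + \<alpha>) * u x) * \<phi> x) = form u G \<phi> \<and>
      integrable M (\<lambda>x. f x * \<phi> x + F x \<bullet> gradient \<phi> x) \<and>
      (LINT x|M. f x * \<phi> x + F x \<bullet> gradient \<phi> x) = rhs f F \<phi>" if \<phi>: "\<phi> \<in> test_functions U" for \<phi>
  proof (intro conjI)
    have i1: "integrable M (\<lambda>x. (A x *v G x) \<bullet> gradient \<phi> x)"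
      by (rule L2_inner_integrable[OF AG_L2[OF L(2)] test_L2(2)[OF U \<phi>]])
    have i2: "integrable M (\<lambda>x. low u G x * \<phi> x)"
      by (rule test_times_integrable[OF \<phi> low_integrable(4)[OF u]])
    have i3: "integrable M (\<lambda>x. f x * \<phi> x)" by (rule test_times_integrable[OF \<phi> f])
    have i4: "integrable M (\<lambda>x. F x \<bullet> gradient \<phi> x)" by (rule L2_inner_integrable[OF F test_L2(2)[OF U \<phi>]])
    show "integrable M (\<lambda>x. f x * \<phi> x + F x \<bullet> gradient \<phi> x)" using i3 i4 by simp
    show "(LINT x|M. f x * \<phi> x + F x \<bullet> gradient \<phi> x) = rhs f F \<phi>" using i3 i4 by (simp add: rhs_def)
    let ?l = "\<lambda>x. (A x *v ?W x) \<bullet> gradient \<phi> x + (B x \<bullet> ?W x + (c x + \<alpha>) * u x) * \<phi> x"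
    let ?r = "\<lambda>x. (A x *v G x) \<bullet> gradient \<phi> x + low u G x * \<phi> x"
    have rint: "integrable M ?r" using i1 i2 by simp
    have eq: "AE x in M. ?l x = ?r x" using ae by eventually_elim (simp add: low_def)
    have lm: "?l \<in> borel_measurable M"
    proof -
      have m1: "(\<lambda>x. (A x *v ?W x) \<bullet> gradient \<phi> x) \<in> borel_measurable M"
        by (rule borel_measurable_integrable[OF L2_inner_integrable[OF AG_L2[OF LW] test_L2(2)[OF U \<phi>]]])
      have m2: "(\<lambda>x. B x \<bullet> ?W x + (c x + \<alpha>) * u x) \<in> borel_measurable M"
        by (rule borel_measurable_add[OF borel_measurable_integrable[OF L2_inner_integrable[OF B LW]]
            borel_measurable_integrable[OF low_integrable(5)[OF u]]])
      show ?thesis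
        by (rule borel_measurable_add[OF m1 borel_measurable_times[OF m2 L2_measurable[OF test_L2(1)[OF U \<phi>]]]])
    qed
    show "integrable M ?l"
      by (rule integrable_cong_AE_imp[OF rint lm]) (use eq in eventually_elim, simp)
    have "integral\<^sup>L M ?l = integral\<^sup>L M ?r"
      by (rule integral_cong_AE[OF lm borel_measurable_integrable[OF rint] eq])
    then show "integral\<^sup>L M ?l = form u G \<phi>" using i1 i2 by (simp add: form_def)
  qed
  show ?thesis
    unfolding weak_solution_def Let_def using u0 main by auto
qed

lemma weak_solution_H0:
  assumes "integrable M f" "L2 M F" "weak_solution U A B c \<alpha> f F u"
  obtains G where "H0 U u G" "\<And>\<phi>. \<phi> \<in> test_functions U \<Longrightarrow> form u G \<phi> = rhs f F \<phi>"
proof -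
  have "u \<in> H12_0 U" using assms(3) by (simp add: weak_solution_def)
  then obtain G where G: "H0 U u G" using H12_0_iff_H0[OF U] by blast
  show ?thesis by (rule that[OF G]) (use weak_solution_iff[OF assms(1,2) G] assms(3) in blast)
qed

lemma form_linear_left:
  assumes u: "H0 U u G" "H0 U v K" and \<phi>: "\<phi> \<in> test_functions U"
  shows "form (\<lambda>x. a * u x + b * v x) (\<lambda>x. a *\<^sub>R G x + b *\<^sub>R K x) \<phi> = a * form u G \<phi> + b * form v K \<phi>"
proof -
  have 1: "(A x *v (a *\<^sub>R G x + b *\<^sub>R K x)) \<bullet> gradient \<phi> x =
      a * ((A x *v G x) \<bullet> gradient \<phi> x) + b * ((A x *v K x) \<bullet> gradient \<phi> x)" for x
    by (simp add: matrix_vector_right_distrib matrix_vector_mult_scaleR inner_simps)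
  have 2: "low (\<lambda>x. a * u x + b * v x) (\<lambda>x. a *\<^sub>R G x + b *\<^sub>R K x) x * \<phi> x =
      a * (low u G x * \<phi> x) + b * (low v K x * \<phi> x)" for x
    by (simp add: low_def inner_simps algebra_simps)
  have i: "integrable M (\<lambda>x. (A x *v G x) \<bullet> gradient \<phi> x)" "integrable M (\<lambda>x. (A x *v K x) \<bullet> gradient \<phi> x)"
    "integrable M (\<lambda>x. low u G x * \<phi> x)" "integrable M (\<lambda>x. low v K x * \<phi> x)"
    using u \<phi> by (auto intro!: L2_inner_integrable AG_L2 test_L2(2)[OF U] test_times_integrable low_integrable(4) dest: H0_L2(2))
  show ?thesis
    unfolding form_def 1 2 using i by (simp add: algebra_simps)
qed

lemma form_linear_right:
  assumes u: "H0 U u G" and \<phi>: "\<phi> \<in> test_functions U" "\<psi> \<in> test_functions U"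
  shows "form u G (\<lambda>x. a * \<phi> x + b * \<psi> x) = a * form u G \<phi> + b * form u G \<psi>"
proof -
  have i: "integrable M (\<lambda>x. (A x *v G x) \<bullet> gradient \<phi> x)" "integrable M (\<lambda>x. (A x *v G x) \<bullet> gradient \<psi> x)"
    "integrable M (\<lambda>x. low u G x * \<phi> x)" "integrable M (\<lambda>x. low u G x * \<psi> x)"
    using u \<phi> by (auto intro!: L2_inner_integrable AG_L2 test_L2(2)[OF U] test_times_integrable low_integrable(4) dest: H0_L2(2))
  have 2: "low u G x * (a * \<phi> x + b * \<psi> x) = a * (low u G x * \<phi> x) + b * (low u G x * \<psi> x)" for x
    by (simp add: algebra_simps)
  show ?thesis
    unfolding form_def test_linear(2)[OF \<phi>] inner_add_right inner_scaleR_right 2 using i by (simp add: algebra_simps)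
qed

lemma rhs_linear:
  assumes f: "integrable M f" and F: "L2 M F" and \<phi>: "\<phi> \<in> test_functions U" "\<psi> \<in> test_functions U"
  shows "rhs f F (\<lambda>x. a * \<phi> x + b * \<psi> x) = a * rhs f F \<phi> + b * rhs f F \<psi>"
proof -
  have i: "integrable M (\<lambda>x. F x \<bullet> gradient \<phi> x)" "integrable M (\<lambda>x. F x \<bullet> gradient \<psi> x)"
    "integrable M (\<lambda>x. f x * \<phi> x)" "integrable M (\<lambda>x. f x * \<psi> x)"
    using f F \<phi> by (auto intro!: L2_inner_integrable test_L2(2)[OF U] test_times_integrable)
  have 2: "f x * (a * \<phi> x + b * \<psi> x) = a * (f x * \<phi> x) + b * (f x * \<psi> x)" for x
    by (simp add: algebra_simps)
  show ?thesis
    unfolding rhs_def test_linear(2)[OF \<phi>] inner_add_right inner_scaleR_right 2 using i by (simp add: algebra_simps)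
qed

text \<open>The constant may depend on the supremum of \<open>\<phi>\<close> and on its gradient. It
  is this supremum that absorbs \<open>B x \<bullet> G x\<close> and \<open>c x * u x\<close>, both
  only integrable.\<close>

lemma form_bounded:
  assumes \<phi>: "\<phi> \<in> test_functions U"
  shows "\<exists>C. \<forall>u G. H0 U u G \<longrightarrow> \<bar>form u G \<phi>\<bar> \<le> C * nrm2 M u + C * nrm2 M G"
proof -
  interpret test_fct U \<phi> by (rule test_fctI[OF \<phi>])
  obtain b where b: "0 < b" "\<And>x. \<bar>\<phi> x\<bar> \<le> b" "\<And>x. norm (gradient \<phi> x) \<le> b" using bounded by blast
  define N where "N = real CARD('n) * (real CARD('n) * Lam)"
  have N0: "0 \<le> N" using Lam by (simp add: N_def)
  define C where "C = N * nrm2 M (gradient \<phi>) + b * nrm2 M B + b * (Lp_norm M (ennreal s) c * S) + \<alpha> * nrm2 M \<phi>"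
  \<comment> \<open>The share of \<open>C\<close> that multiplies \<open>nrm2 M u\<close>; raising
    both coefficients to \<open>C\<close> leaves a single constant.\<close>
  define C' where "C' = \<alpha> * nrm2 M \<phi>"
  have bound: "\<bar>form u G \<phi>\<bar> \<le> C * nrm2 M u + C * nrm2 M G" if u: "H0 U u G" for u G
  proof -
    note L = H0_L2[OF u]
    have phi_abs: "\<bar>LINT x|M. h x * \<phi> x\<bar> \<le> b * (LINT x|M. \<bar>h x\<bar>)" if h: "integrable M h" for h
    proof -
      have "\<bar>LINT x|M. h x * \<phi> x\<bar> \<le> (LINT x|M. \<bar>h x * \<phi> x\<bar>)"
        using integral_norm_bound[of M "\<lambda>x. h x * \<phi> x"] by simp
      also have "\<dots> \<le> (LINT x|M. b * \<bar>h x\<bar>)"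
        by (intro integral_mono integrable_abs test_times_integrable[OF \<phi> h] integrable_mult_right h)
           (use b in \<open>simp add: abs_mult mult.commute mult_right_mono\<close>)
      finally show ?thesis by simp
    qed
    have t1: "\<bar>LINT x|M. (A x *v G x) \<bullet> gradient \<phi> x\<bar> \<le> N * nrm2 M (gradient \<phi>) * nrm2 M G"
    proof -
      have "nrm2 M (\<lambda>x. A x *v G x) \<le> nrm2 M (\<lambda>x. N *\<^sub>R G x)"
        by (rule nrm2_mono[OF L2_scaleR[OF L(2)] L2_measurable[OF AG_L2[OF L(2)]]])
           (rule AE_I2, use AG_bound N0 in \<open>simp add: N_def\<close>)
      then have "nrm2 M (\<lambda>x. A x *v G x) \<le> N * nrm2 M G" using N0 by (simp add: nrm2_scaleR)
      then have "nrm2 M (\<lambda>x. A x *v G x) * nrm2 M (gradient \<phi>) \<le> (N * nrm2 M G) * nrm2 M (gradient \<phi>)"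
        by (rule mult_right_mono) simp
      then show ?thesis
        using L2_Cauchy_Schwarz[OF AG_L2[OF L(2)] test_L2(2)[OF U \<phi>]] by (simp add: mult.commute mult.left_commute)
    qed
    have t2: "\<bar>LINT x|M. (B x \<bullet> G x) * \<phi> x\<bar> \<le> b * nrm2 M B * nrm2 M G"
    proof -
      have "(LINT x|M. \<bar>B x \<bullet> G x\<bar>) \<le> (LINT x|M. norm (B x) * norm (G x))"
        by (intro integral_mono integrable_abs L2_inner_integrable L2_prod_norm(1) B L Cauchy_Schwarz_ineq2)
      also have "\<dots> \<le> nrm2 M B * nrm2 M G" by (rule L2_prod_norm(2)[OF B L(2)])
      finally have "b * (LINT x|M. \<bar>B x \<bullet> G x\<bar>) \<le> b * (nrm2 M B * nrm2 M G)"
        using b(1) by (intro mult_left_mono) auto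
      then show ?thesis using phi_abs[OF low_integrable(1)[OF u]] by (simp add: mult.assoc)
    qed
    have t3: "\<bar>LINT x|M. (c x * u x) * \<phi> x\<bar> \<le> b * (Lp_norm M (ennreal s) c * S) * nrm2 M G"
    proof -
      have "b * (LINT x|M. \<bar>c x * u x\<bar>) \<le> b * (Lp_norm M (ennreal s) c * (S * nrm2 M G))"
        using b(1) Ls_pairing(2)[OF c(1) u] by (intro mult_left_mono) auto
      then show ?thesis using phi_abs[OF low_integrable(2)[OF u]] by (simp add: mult.assoc)
    qed
    have t4: "\<bar>LINT x|M. u x * \<phi> x\<bar> \<le> nrm2 M \<phi> * nrm2 M u"
      using L2_Cauchy_Schwarz[OF L(1) test_L2(1)[OF U \<phi>]] by (simp add: mult.commute)
    have "(LINT x|M. low u G x * \<phi> x) = (LINT x|M. (B x \<bullet> G x) * \<phi> x) + (LINT x|M. (c x * u x) * \<phi> x) + \<alpha> * (LINT x|M. u x * \<phi> x)"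
    proof -
      have "low u G x * \<phi> x = (B x \<bullet> G x) * \<phi> x + (c x * u x) * \<phi> x + \<alpha> * (u x * \<phi> x)" for x
        by (simp add: low_def algebra_simps)
      then show ?thesis
        using test_times_integrable[OF \<phi> low_integrable(1)[OF u]] test_times_integrable[OF \<phi> low_integrable(2)[OF u]]
          test_times_integrable[OF \<phi> low_integrable(3)[OF u]] by simp
    qed
    then have "\<bar>form u G \<phi>\<bar> \<le> \<bar>LINT x|M. (A x *v G x) \<bullet> gradient \<phi> x\<bar> + \<bar>LINT x|M. (B x \<bullet> G x) * \<phi> x\<bar> +
        \<bar>LINT x|M. (c x * u x) * \<phi> x\<bar> + \<bar>\<alpha> * (LINT x|M. u x * \<phi> x)\<bar>"
      unfolding form_def by linarith
    also have "\<dots> \<le> N * nrm2 M (gradient \<phi>) * nrm2 M G + b * nrm2 M B * nrm2 M G +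
        b * (Lp_norm M (ennreal s) c * S) * nrm2 M G + \<alpha> * (nrm2 M \<phi> * nrm2 M u)"
      using t1 t2 t3 mult_left_mono[OF t4 \<alpha>] \<alpha> by (simp add: abs_mult)
    also have "\<dots> = (C - C') * nrm2 M G + C' * nrm2 M u" by (simp add: C_def C'_def algebra_simps)
    also have "\<dots> \<le> C * nrm2 M G + C * nrm2 M u"
    proof -
      have "0 \<le> C'" using \<alpha> by (simp add: C'_def)
      moreover have "C' \<le> C" unfolding C_def C'_def using N0 b(1) S0 Lp_norm_nonneg[of M "ennreal s" c] by simp
      ultimately show ?thesis by (intro add_mono mult_right_mono) auto
    qed
    finally show ?thesis by simp
  qed
  show ?thesis by (rule exI[of _ C]) (use bound in blast)
qed

text \<open>The drift does not destroy coercivity: \<open>\<phi> \<nabla>\<phi> = \<nabla>(\<phi>\<^sup>2) / 2\<close> and \<open>\<phi>\<^sup>2 \<ge> 0\<close>.\<close>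

lemma form_coercive:
  assumes \<phi>: "\<phi> \<in> test_functions U"
  shows "lam * (nrm2 M (gradient \<phi>))\<^sup>2 \<le> form \<phi> (gradient \<phi>) \<phi>"
proof -
  note H = H0_test[OF U \<phi>]
  note L = test_L2[OF U \<phi>]
  have 1: "lam * (nrm2 M (gradient \<phi>))\<^sup>2 \<le> (LINT x|M. (A x *v gradient \<phi> x) \<bullet> gradient \<phi> x)"
  proof -
    have "lam * (nrm2 M (gradient \<phi>))\<^sup>2 = (LINT x|M. lam * (norm (gradient \<phi> x))\<^sup>2)" by (simp add: nrm2_sq)
    also have "\<dots> \<le> (LINT x|M. (A x *v gradient \<phi> x) \<bullet> gradient \<phi> x)"
      by (intro integral_mono integrable_mult_right L2_integrable L L2_inner_integrable AG_L2) (use elliptic in auto)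
    finally show ?thesis .
  qed
  have g2: "B x \<bullet> gradient (\<lambda>x. \<phi> x * \<phi> x) x = 2 * ((B x \<bullet> gradient \<phi> x) * \<phi> x)" for x
    unfolding test_mult(2)[OF \<phi> \<phi>] inner_add_right inner_scaleR_right by simp
  have "0 \<le> (LINT x|M. B x \<bullet> gradient (\<lambda>x. \<phi> x * \<phi> x) x)"
    using div test_mult(1)[OF \<phi> \<phi>] by (simp add: weakly_div_nonpos_def)
  then have 2: "0 \<le> (LINT x|M. (B x \<bullet> gradient \<phi> x) * \<phi> x)" unfolding g2 by simp
  have 3: "0 \<le> (LINT x|M. (c x + \<alpha>) * \<phi> x * \<phi> x)"
    by (rule integral_nonneg_AE) (use c(2) \<alpha> in \<open>auto elim!: eventually_mono simp: mult.assoc\<close>)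
  have "low \<phi> (gradient \<phi>) x * \<phi> x = (B x \<bullet> gradient \<phi> x) * \<phi> x + (c x + \<alpha>) * \<phi> x * \<phi> x" for x
    by (simp add: low_def algebra_simps)
  then have "(LINT x|M. low \<phi> (gradient \<phi>) x * \<phi> x) = (LINT x|M. (B x \<bullet> gradient \<phi> x) * \<phi> x) + (LINT x|M. (c x + \<alpha>) * \<phi> x * \<phi> x)"
    using test_times_integrable[OF \<phi> low_integrable(1)[OF H]] test_times_integrable[OF \<phi> low_integrable(5)[OF H]]
    by simp
  then show ?thesis using 1 2 3 by (simp add: form_def)
qed

lemma existence:
  assumes f: "f \<in> Lp_space M (ennreal s)" and F: "L2 M F"
  shows "\<exists>u. weak_solution U A B c \<alpha> f F u"
proof -
  \<comment> \<open>With the gradient as second component, the L^2 norm of the pair is the Sobolev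
    norm, and \<open>L2_complete\<close> provides completeness.\<close>
  define V :: "(real^'n \<Rightarrow> real \<times> (real^'n)) set" where "V = {W. H0 U (\<lambda>x. fst (W x)) (\<lambda>x. snd (W x))}"
  define j where "j \<phi> x = (\<phi> x, gradient \<phi> x)" for \<phi> :: "real^'n \<Rightarrow> real" and x
  have fi: "integrable M f" by (rule Ls_integrable[OF f])
  interpret V: L2_closed_subspace M V
  proof
    show LV: "L2 M W" if "W \<in> V" for W
    proof -
      have "H0 U (\<lambda>x. fst (W x)) (\<lambda>x. snd (W x))" using that by (simp add: V_def)
      from L2_pairs(1)[OF H0_L2[OF this]] show ?thesis by simp
    qed
    show "(\<lambda>x. a *\<^sub>R W x + b *\<^sub>R X x) \<in> V" if "W \<in> V" "X \<in> V" for W X a b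
      using H0_linear[OF U, of "\<lambda>x. fst (W x)" "\<lambda>x. snd (W x)" "\<lambda>x. fst (X x)" "\<lambda>x. snd (X x)" a b] that
      by (simp add: V_def)
    show "W \<in> V" if W: "\<And>n. Wn n \<in> V" "L2 M W" "(\<lambda>n. nrm2 M (\<lambda>x. Wn n x - W x)) \<longlonglongrightarrow> 0" for Wn W
    proof -
      have d: "L2 M (\<lambda>x. Wn n x - W x)" for n by (rule L2_diff[OF LV[OF W(1)] W(2)])
      have l1: "(\<lambda>n. nrm2 M (\<lambda>x. fst (Wn n x) - fst (W x))) \<longlonglongrightarrow> 0"
        by (rule tendsto_sandwich[OF _ _ tendsto_const W(3)]) (use L2_fst_snd(3)[OF d] in simp_all)
      have l2: "(\<lambda>n. nrm2 M (\<lambda>x. snd (Wn n x) - snd (W x))) \<longlonglongrightarrow> 0"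
        by (rule tendsto_sandwich[OF _ _ tendsto_const W(3)]) (use L2_fst_snd(4)[OF d] in simp_all)
      show ?thesis
        using H0_closed[OF U _ L2_fst_snd(1,2)[OF W(2)] l1 l2] W(1) by (simp add: V_def)
    qed
  qed
  define E where "E W \<phi> = form (\<lambda>x. fst (W x)) (\<lambda>x. snd (W x)) \<phi>" for W :: "real^'n \<Rightarrow> real \<times> (real^'n)" and \<phi>
  have jV: "j \<phi> \<in> V" if "\<phi> \<in> test_functions U" for \<phi>
    using H0_test[OF U that] by (simp add: V_def j_def)
  have nj: "(nrm2 M (j \<phi>))\<^sup>2 = (nrm2 M \<phi>)\<^sup>2 + (nrm2 M (gradient \<phi>))\<^sup>2" "nrm2 M (gradient \<phi>) \<le> nrm2 M (j \<phi>)"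
    if "\<phi> \<in> test_functions U" for \<phi>
    using L2_pairs(2)[OF test_L2[OF U that]] L2_fst_snd(4)[OF L2_pairs(1)[OF test_L2[OF U that]]]
    by (simp_all add: j_def[abs_def])
  have "\<exists>W\<in>V. \<forall>\<phi>\<in>test_functions U. E W \<phi> = rhs f F \<phi>"
  proof (rule V.Lions_theorem[where j=j])
    show "test_functions U \<noteq> {}" using test_zero by blast
    show "(\<lambda>x. a * \<phi> x + b * \<psi> x) \<in> test_functions U" if "\<phi> \<in> test_functions U" "\<psi> \<in> test_functions U" for \<phi> \<psi> a b
      by (rule test_linear(1)[OF that])
    show "E (\<lambda>x. a *\<^sub>R W x + b *\<^sub>R X x) \<phi> = a * E W \<phi> + b * E X \<phi>"
      if "W \<in> V" "X \<in> V" "\<phi> \<in> test_functions U" for W X a b \<phi>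
      using form_linear_left[of "\<lambda>x. fst (W x)" "\<lambda>x. snd (W x)" "\<lambda>x. fst (X x)" "\<lambda>x. snd (X x)" \<phi> a b] that
      by (simp add: V_def E_def)
    show "E W (\<lambda>x. a * \<phi> x + b * \<psi> x) = a * E W \<phi> + b * E W \<psi>"
      if "W \<in> V" "\<phi> \<in> test_functions U" "\<psi> \<in> test_functions U" for W \<phi> \<psi> a b
      using form_linear_right that by (simp add: V_def E_def)
    show "\<exists>C. \<forall>W\<in>V. \<bar>E W \<phi>\<bar> \<le> C * nrm2 M W" if \<phi>: "\<phi> \<in> test_functions U" for \<phi>
    proof -
      obtain C where C: "\<And>u G. H0 U u G \<Longrightarrow> \<bar>form u G \<phi>\<bar> \<le> C * nrm2 M u + C * nrm2 M G"
        using form_bounded[OF \<phi>] by blast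
      have "\<bar>E W \<phi>\<bar> \<le> (2 * \<bar>C\<bar>) * nrm2 M W" if "W \<in> V" for W
      proof -
        note d = L2_fst_snd[OF V.V_L2[OF that]]
        have "\<bar>E W \<phi>\<bar> \<le> C * nrm2 M (\<lambda>x. fst (W x)) + C * nrm2 M (\<lambda>x. snd (W x))"
          unfolding E_def by (rule C) (use that in \<open>simp add: V_def\<close>)
        also have "\<dots> \<le> \<bar>C\<bar> * nrm2 M W + \<bar>C\<bar> * nrm2 M W"
          by (intro add_mono mult_mono d(3,4)) auto
        finally show ?thesis by simp
      qed
      then show ?thesis by blast
    qed
    \<comment> \<open>By Poincare the squared norm of the pair is at most
      \<open>P\<^sup>2 + 1\<close> times that of the gradient, and ellipticity controls only the
      gradient.\<close>
    show "0 < lam / (P\<^sup>2 + 1)" using lam by (simp add: add_nonneg_pos)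
    show "lam / (P\<^sup>2 + 1) * (nrm2 M (j \<phi>))\<^sup>2 \<le> E (j \<phi>) \<phi>" if \<phi>: "\<phi> \<in> test_functions U" for \<phi>
    proof -
      have "(nrm2 M \<phi>)\<^sup>2 \<le> (P * nrm2 M (gradient \<phi>))\<^sup>2"
        by (intro power_mono Poincare[OF H0_test[OF U \<phi>]]) simp
      then have "(nrm2 M (j \<phi>))\<^sup>2 \<le> (P\<^sup>2 + 1) * (nrm2 M (gradient \<phi>))\<^sup>2"
        unfolding nj(1)[OF \<phi>] by (simp add: power_mult_distrib algebra_simps)
      then have "lam / (P\<^sup>2 + 1) * (nrm2 M (j \<phi>))\<^sup>2 \<le> lam / (P\<^sup>2 + 1) * ((P\<^sup>2 + 1) * (nrm2 M (gradient \<phi>))\<^sup>2)"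
        using lam by (intro mult_left_mono) auto
      also have "\<dots> = lam * (nrm2 M (gradient \<phi>))\<^sup>2"
        using add_nonneg_pos[of "P\<^sup>2" 1] by simp
      also have "\<dots> \<le> E (j \<phi>) \<phi>" using form_coercive[OF \<phi>] by (simp add: E_def j_def)
      finally show ?thesis .
    qed
    show "rhs f F (\<lambda>x. a * \<phi> x + b * \<psi> x) = a * rhs f F \<phi> + b * rhs f F \<psi>"
      if "\<phi> \<in> test_functions U" "\<psi> \<in> test_functions U" for \<phi> \<psi> a b
      by (rule rhs_linear[OF fi F that])
    show "\<bar>rhs f F \<phi>\<bar> \<le> (Lp_norm M (ennreal s) f * S + nrm2 M F) * nrm2 M (j \<phi>)"
      if \<phi>: "\<phi> \<in> test_functions U" for \<phi>
    proof -
      have "\<bar>LINT x|M. f x * \<phi> x\<bar> \<le> Lp_norm M (ennreal s) f * (S * nrm2 M (gradient \<phi>))"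
        by (rule order_trans[OF integral_norm_bound[of M "\<lambda>x. f x * \<phi> x", unfolded real_norm_def]
              Ls_pairing(2)[OF f H0_test[OF U \<phi>]]])
      moreover have "\<bar>LINT x|M. F x \<bullet> gradient \<phi> x\<bar> \<le> nrm2 M F * nrm2 M (gradient \<phi>)"
        by (rule L2_Cauchy_Schwarz[OF F test_L2(2)[OF U \<phi>]])
      ultimately have "\<bar>rhs f F \<phi>\<bar> \<le> (Lp_norm M (ennreal s) f * S + nrm2 M F) * nrm2 M (gradient \<phi>)"
        by (simp add: rhs_def algebra_simps)
      also have "\<dots> \<le> (Lp_norm M (ennreal s) f * S + nrm2 M F) * nrm2 M (j \<phi>)"
        using S0 Lp_norm_nonneg[of M "ennreal s" f] by (intro mult_left_mono nj(2)[OF \<phi>]) simp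
      finally show ?thesis .
    qed
  qed (rule jV)
  then obtain W where W: "W \<in> V" "\<And>\<phi>. \<phi> \<in> test_functions U \<Longrightarrow> E W \<phi> = rhs f F \<phi>" by blast
  have "weak_solution U A B c \<alpha> f F (\<lambda>x. fst (W x))"
    using W weak_solution_iff[OF fi F, of "\<lambda>x. fst (W x)" "\<lambda>x. snd (W x)"] by (simp add: V_def E_def)
  then show ?thesis by blast
qed

end

section \<open>The energy inequality for truncations\<close>

lemma (in finite_measure) bounded_mult_tendsto:
  fixes f :: "'a \<Rightarrow> real"
  assumes f: "integrable M f" and g: "\<And>n. g n \<in> borel_measurable M" "\<And>n x. \<bar>g n x\<bar> \<le> K"
    and g': "g' \<in> borel_measurable M" "AE x in M. (\<lambda>n. g n x) \<longlonglongrightarrow> g' x"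
  shows "(\<lambda>n. LINT x|M. f x * g n x) \<longlonglongrightarrow> (LINT x|M. f x * g' x)"
proof (rule integral_dominated_convergence[where w="\<lambda>x. K * \<bar>f x\<bar>"])
  have fm: "f \<in> borel_measurable M" using f by (rule borel_measurable_integrable)
  show "(\<lambda>x. f x * g' x) \<in> borel_measurable M" "\<And>n. (\<lambda>x. f x * g n x) \<in> borel_measurable M"
    using fm g(1) g'(1) by (auto intro: borel_measurable_times)
  show "integrable M (\<lambda>x. K * \<bar>f x\<bar>)" using f by simp
  show "AE x in M. (\<lambda>n. f x * g n x) \<longlonglongrightarrow> f x * g' x"
    using g'(2) by eventually_elim (intro tendsto_intros)
  show "AE x in M. norm (f x * g n x) \<le> K * \<bar>f x\<bar>" for n
  proof (rule AE_I2)
    fix x show "norm (f x * g n x) \<le> K * \<bar>f x\<bar>"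
      using mult_right_mono[OF g(2)[of n x] abs_ge_zero[of "f x"]] by (simp add: abs_mult mult.commute)
  qed
qed

text \<open>Turns a test nonlinearity \<open>h\<close> with the sign of its argument into a
  nonnegative \<open>H\<close>, so that \<open>H\<close> of a test function is admissible in the
  divergence condition.\<close>

lemma antiderivative_nonneg:
  fixes h :: "real \<Rightarrow> real"
  assumes H: "\<And>t. (H has_real_derivative h t) (at t)" "H 0 = 0" and h: "\<And>t. 0 \<le> h t * t" "h 0 = 0"
  shows "0 \<le> H t"
proof (cases "0 \<le> t")
  case True
  have "H 0 \<le> H t"
  proof (rule DERIV_nonneg_imp_nondecreasing[OF True])
    fix x assume "0 \<le> x" "x \<le> t"
    then have "0 \<le> h x" using h(1)[of x] h(2) by (cases "x = 0") (auto simp: zero_le_mult_iff)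
    then show "\<exists>y. DERIV H x :> y \<and> 0 \<le> y" using H(1) by blast
  qed
  then show ?thesis using H(2) by simp
next
  case False
  then have t: "t \<le> 0" by simp
  have "H 0 \<le> H t"
  proof (rule DERIV_nonpos_imp_nonincreasing[OF t])
    fix x assume "t \<le> x" "x \<le> 0"
    then have "h x \<le> 0" using h(1)[of x] h(2) by (cases "x = 0") (auto simp: zero_le_mult_iff)
    then show "\<exists>y. DERIV H x :> y \<and> y \<le> 0" using H(1) by blast
  qed
  then show ?thesis using H(2) by simp
qed

lemma trunc_sign: "0 \<le> trunc a b t * t"
proof (cases "0 \<le> t")
  case True
  then show ?thesis unfolding trunc_def by (intro mult_nonneg_nonneg) (auto simp: min_def max_def)
next
  case False
  then show ?thesis unfolding trunc_def by (intro mult_nonpos_nonpos) (auto simp: min_def max_def)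
qed

lemma trunc_bound: "a < b \<Longrightarrow> \<bar>trunc a b t\<bar> \<le> b - a"
  by (auto simp: trunc_def min_def max_def)

context elliptic_problem
begin

text \<open>Of \<open>f\<close> only integrability is kept, so sums, differences and sign changes of
  data are immediate; finer integrability is a separate hypothesis of each estimate.\<close>

definition sol :: "(real^'n \<Rightarrow> real) \<Rightarrow> (real^'n \<Rightarrow> real^'n) \<Rightarrow> (real^'n \<Rightarrow> real) \<Rightarrow> (real^'n \<Rightarrow> real^'n) \<Rightarrow> bool" where
  "sol f F u G \<longleftrightarrow> integrable M f \<and> L2 M F \<and> H0 U u G \<and> (\<forall>\<phi>\<in>test_functions U. form u G \<phi> = rhs f F \<phi>)"

lemma weak_solution_sol:
  assumes "integrable M f" "L2 M F" "weak_solution U A B c \<alpha> f F u"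
  obtains G where "sol f F u G"
  using weak_solution_H0[OF assms] assms(1,2) unfolding sol_def by metis

lemma sol_linear:
  assumes u: "sol f F u G" and v: "sol g K v H"
  shows "sol (\<lambda>x. a * f x + b * g x) (\<lambda>x. a *\<^sub>R F x + b *\<^sub>R K x) (\<lambda>x. a * u x + b * v x) (\<lambda>x. a *\<^sub>R G x + b *\<^sub>R H x)"
proof -
  have I: "integrable M f" "L2 M F" "H0 U u G" "integrable M g" "L2 M K" "H0 U v H"
    using u v by (auto simp: sol_def)
  have r: "rhs (\<lambda>x. a * f x + b * g x) (\<lambda>x. a *\<^sub>R F x + b *\<^sub>R K x) \<phi> = a * rhs f F \<phi> + b * rhs g K \<phi>"
    if \<phi>: "\<phi> \<in> test_functions U" for \<phi>
  proof -
    have i: "integrable M (\<lambda>x. f x * \<phi> x)" "integrable M (\<lambda>x. g x * \<phi> x)"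
      "integrable M (\<lambda>x. F x \<bullet> gradient \<phi> x)" "integrable M (\<lambda>x. K x \<bullet> gradient \<phi> x)"
      using I \<phi> by (auto intro!: test_times_integrable L2_inner_integrable test_L2(2)[OF U])
    have e: "(a * f x + b * g x) * \<phi> x = a * (f x * \<phi> x) + b * (g x * \<phi> x)" for x by (simp add: algebra_simps)
    show ?thesis
      unfolding rhs_def inner_add_left inner_scaleR_left e using i by (simp add: algebra_simps)
  qed
  show ?thesis
    unfolding sol_def
  proof (intro conjI ballI)
    show "integrable M (\<lambda>x. a * f x + b * g x)" using I by simp
    show "L2 M (\<lambda>x. a *\<^sub>R F x + b *\<^sub>R K x)" by (rule L2_linear[OF I(2,5)])
    show "H0 U (\<lambda>x. a * u x + b * v x) (\<lambda>x. a *\<^sub>R G x + b *\<^sub>R H x)" by (rule H0_linear[OF U I(3,6)])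
    show "form (\<lambda>x. a * u x + b * v x) (\<lambda>x. a *\<^sub>R G x + b *\<^sub>R H x) \<phi> =
        rhs (\<lambda>x. a * f x + b * g x) (\<lambda>x. a *\<^sub>R F x + b *\<^sub>R K x) \<phi>" if \<phi>: "\<phi> \<in> test_functions U" for \<phi>
      using form_linear_left[OF I(3,6) \<phi>] r[OF \<phi>] u v \<phi> by (simp add: sol_def)
  qed
qed

lemma sol_uminus: "sol f F u G \<Longrightarrow> sol (\<lambda>x. - f x) (\<lambda>x. - F x) (\<lambda>x. - u x) (\<lambda>x. - G x)"
  using sol_linear[of f F u G f F u G "- 1" 0] by simp

lemma sol_diff:
  "sol f F u G \<Longrightarrow> sol g K v H \<Longrightarrow> sol (\<lambda>x. f x - g x) (\<lambda>x. F x - K x) (\<lambda>x. u x - v x) (\<lambda>x. G x - H x)"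
  using sol_linear[of f F u G g K v H 1 "- 1"] by simp

text \<open>The equation holds for \<open>h (\<phi> n x)\<close>, a test function, and passes to the
  limit: boundedness of \<open>h\<close> serves the terms that are only integrable, boundedness of
  \<open>g\<close> the terms containing gradients.\<close>

lemma smooth_test:
  assumes u: "sol f F u G" and h: "smooth h" "h 0 = 0" "\<And>t. \<bar>h t\<bar> \<le> K"
    and g: "\<And>t. (h has_real_derivative g t) (at t)" "\<And>t. \<bar>g t\<bar> \<le> L" "continuous_on UNIV g"
  shows "(LINT x|M. g (u x) * ((A x *v G x) \<bullet> G x)) + (LINT x|M. low u G x * h (u x)) =
      (LINT x|M. f x * h (u x)) + (LINT x|M. g (u x) * (F x \<bullet> G x))"
proof -
  have f: "integrable M f" and F: "L2 M F" and H: "H0 U u G"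
    and eq: "\<And>\<phi>. \<phi> \<in> test_functions U \<Longrightarrow> form u G \<phi> = rhs f F \<phi>" using u by (auto simp: sol_def)
  obtain \<phi> where \<phi>: "\<And>n. \<phi> n \<in> test_functions U"
    "(\<lambda>n. nrm2 M (\<lambda>x. \<phi> n x - u x)) \<longlonglongrightarrow> 0" "(\<lambda>n. nrm2 M (\<lambda>x. gradient (\<phi> n) x - G x)) \<longlonglongrightarrow> 0"
    "AE x in M. (\<lambda>n. \<phi> n x) \<longlonglongrightarrow> u x"
    using H0_sequence[OF U H] by blast
  note L = H0_L2[OF H]
  have hm: "h \<in> borel_measurable borel" and gm: "g \<in> borel_measurable borel"
    using smooth_continuous[OF h(1)] g(3) by (auto intro: borel_measurable_continuous_onI)
  have um: "u \<in> borel_measurable M" and \<phi>m: "\<And>n. \<phi> n \<in> borel_measurable M"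
    using L2_measurable[OF L(1)] L2_measurable[OF test_L2(1)[OF U \<phi>(1)]] by auto
  note hu = measurable_compose[OF um hm] measurable_compose[OF \<phi>m hm]
  note gu = measurable_compose[OF um gm] measurable_compose[OF \<phi>m gm]
  have lim: "AE x in M. (\<lambda>n. k (\<phi> n x)) \<longlonglongrightarrow> k (u x)" if "continuous_on UNIV k" for k :: "real \<Rightarrow> real"
    using \<phi>(4)
  proof eventually_elim
    case (elim x)
    have "isCont k (u x)" using that by (simp add: continuous_on_eq_continuous_at)
    then show ?case using elim by (rule isCont_tendsto_compose)
  qed
  note limh = lim[OF smooth_continuous[OF h(1)]] and limg = lim[OF g(3)]
  have grad: "gradient (\<lambda>x. h (\<phi> n x)) x = g (\<phi> n x) *\<^sub>R gradient (\<phi> n) x" for n x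
    by (rule gradient_compose[OF \<phi>(1) g(1)])
  have f1: "form u G (\<lambda>x. h (\<phi> n x)) =
      (LINT x|M. g (\<phi> n x) * ((A x *v G x) \<bullet> gradient (\<phi> n) x)) + (LINT x|M. low u G x * h (\<phi> n x))" for n
    unfolding form_def grad inner_scaleR_right ..
  have r1: "rhs f F (\<lambda>x. h (\<phi> n x)) =
      (LINT x|M. f x * h (\<phi> n x)) + (LINT x|M. g (\<phi> n x) * (F x \<bullet> gradient (\<phi> n) x))" for n
    unfolding rhs_def grad inner_scaleR_right ..
  have "(\<lambda>n. form u G (\<lambda>x. h (\<phi> n x))) \<longlonglongrightarrow>
      (LINT x|M. g (u x) * ((A x *v G x) \<bullet> G x)) + (LINT x|M. low u G x * h (u x))"
    unfolding f1
    by (intro tendsto_add L2_inner_tendsto(1)[OF AG_L2[OF L(2)] L(2) test_L2(2)[OF U \<phi>(1)] \<phi>(3) gu(2) g(2) gu(1) limg]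
        bounded_mult_tendsto[OF low_integrable(4)[OF H] hu(2) h(3) hu(1) limh])
  moreover have "(\<lambda>n. rhs f F (\<lambda>x. h (\<phi> n x))) \<longlonglongrightarrow>
      (LINT x|M. f x * h (u x)) + (LINT x|M. g (u x) * (F x \<bullet> G x))"
    unfolding r1
    by (intro tendsto_add L2_inner_tendsto(1)[OF F L(2) test_L2(2)[OF U \<phi>(1)] \<phi>(3) gu(2) g(2) gu(1) limg]
        bounded_mult_tendsto[OF f hu(2) h(3) hu(1) limh])
  moreover have "form u G (\<lambda>x. h (\<phi> n x)) = rhs f F (\<lambda>x. h (\<phi> n x))" for n
    by (rule eq[OF test_compose[OF \<phi>(1) h(1,2)]])
  ultimately show ?thesis using LIMSEQ_unique by auto
qed

text \<open>The drift against \<open>h (\<phi> n x)\<close> is \<open>B\<close> against the gradient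
  of \<open>Q (\<phi> n x)\<close>, where \<open>Q\<close> is the antiderivative of
  \<open>h\<close>; its sign is the divergence condition, and it persists in the limit.\<close>

lemma drift_nonneg:
  assumes H: "H0 U u G" and Q: "smooth Q" "Q 0 = 0" "\<And>t. 0 \<le> Q t"
    and h: "\<And>t. (Q has_real_derivative h t) (at t)" "\<And>t. \<bar>h t\<bar> \<le> K" "continuous_on UNIV h"
  shows "0 \<le> (LINT x|M. h (u x) * (B x \<bullet> G x))"
proof -
  obtain \<phi> where \<phi>: "\<And>n. \<phi> n \<in> test_functions U"
    "(\<lambda>n. nrm2 M (\<lambda>x. \<phi> n x - u x)) \<longlonglongrightarrow> 0" "(\<lambda>n. nrm2 M (\<lambda>x. gradient (\<phi> n) x - G x)) \<longlonglongrightarrow> 0"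
    "AE x in M. (\<lambda>n. \<phi> n x) \<longlonglongrightarrow> u x"
    using H0_sequence[OF U H] by blast
  note L = H0_L2[OF H]
  have hm: "h \<in> borel_measurable borel" using h(3) by (rule borel_measurable_continuous_onI)
  have um: "u \<in> borel_measurable M" and \<phi>m: "\<And>n. \<phi> n \<in> borel_measurable M"
    using L2_measurable[OF L(1)] L2_measurable[OF test_L2(1)[OF U \<phi>(1)]] by auto
  have lim: "AE x in M. (\<lambda>n. h (\<phi> n x)) \<longlonglongrightarrow> h (u x)"
    using \<phi>(4)
  proof eventually_elim
    case (elim x)
    have "isCont h (u x)" using h(3) by (simp add: continuous_on_eq_continuous_at)
    then show ?case using elim by (rule isCont_tendsto_compose)
  qed
  have "0 \<le> (LINT x|M. h (\<phi> n x) * (B x \<bullet> gradient (\<phi> n) x))" for n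
  proof -
    have "0 \<le> (LINT x|M. B x \<bullet> gradient (\<lambda>x. Q (\<phi> n x)) x)"
      using div test_compose[OF \<phi>(1) Q(1,2), of n] Q(3) by (simp add: weakly_div_nonpos_def)
    then show ?thesis unfolding gradient_compose[OF \<phi>(1) h(1)] inner_scaleR_right .
  qed
  moreover have "(\<lambda>n. LINT x|M. h (\<phi> n x) * (B x \<bullet> gradient (\<phi> n) x)) \<longlonglongrightarrow> (LINT x|M. h (u x) * (B x \<bullet> G x))"
    by (rule L2_inner_tendsto(1)[OF B L(2) test_L2(2)[OF U \<phi>(1)] \<phi>(3)
        measurable_compose[OF \<phi>m hm] h(2) measurable_compose[OF um hm] lim])
  ultimately show ?thesis by (intro LIMSEQ_le_const) auto
qed

text \<open>After the drift is dropped, \<open>c x * u x\<close> times the truncation is nonnegative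
  by \<open>trunc_sign\<close> and is dropped too. The part with \<open>\<alpha>\<close> is retained
  because the contraction estimates live on it.\<close>

lemma truncation_inequality:
  assumes u: "sol f F u G" and ab: "a < b"
  defines "Ga \<equiv> \<lambda>x. indicator {a<..<b} (u x) *\<^sub>R G x"
  shows "lam * (nrm2 M Ga)\<^sup>2 + (LINT x|M. \<alpha> * (u x * trunc a b (u x))) \<le>
      (LINT x|M. f x * trunc a b (u x)) + (LINT x|M. F x \<bullet> Ga x)"
    and "integrable M (\<lambda>x. u x * trunc a b (u x))"
proof -
  have f: "integrable M f" and F: "L2 M F" and H: "H0 U u G" using u by (auto simp: sol_def)
  note L = H0_L2[OF H]
  obtain h where h: "\<And>n. smooth (h n)" "\<And>n. h n 0 = 0"
    "\<And>n t. (h n has_real_derivative interval_bump a b n t) (at t)"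
    "\<And>n t. \<bar>h n t\<bar> \<le> b - a" "\<And>n t. 0 \<le> h n t * t" "\<And>t. (\<lambda>n. h n t) \<longlonglongrightarrow> trunc a b t"
    using smooth_trunc_sequence[OF ab] by blast
  let ?g = "interval_bump a b" and ?T = "\<lambda>x. trunc a b (u x)"
  have gc: "continuous_on UNIV (?g n)" for n by (rule smooth_continuous[OF smooth_interval_bump])
  have g1: "\<bar>?g n t\<bar> \<le> 1" for n t using interval_bump_bounds[of a b n t] by simp
  have um: "u \<in> borel_measurable M" using L(1) by (rule L2_measurable)
  have hu: "(\<lambda>x. h n (u x)) \<in> borel_measurable M" for n
    by (rule measurable_compose[OF um borel_measurable_continuous_onI[OF smooth_continuous[OF h(1)]]])
  have gu: "(\<lambda>x. ?g n (u x)) \<in> borel_measurable M" for n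
    by (rule measurable_compose[OF um borel_measurable_continuous_onI[OF gc]])
  have Tu: "?T \<in> borel_measurable M" by (rule measurable_compose[OF um borel_measurable_trunc])
  have Iu: "(\<lambda>x. indicat_real {a<..<b} (u x)) \<in> borel_measurable M"
    by (rule measurable_compose[OF um]) measurable
  have lim_h: "AE x in M. (\<lambda>n. h n (u x)) \<longlonglongrightarrow> ?T x" by (rule AE_I2) (rule h(6))
  have lim_g: "AE x in M. (\<lambda>n. ?g n (u x)) \<longlonglongrightarrow> indicator {a<..<b} (u x)"
    by (rule AE_I2) (rule interval_bump_tendsto)
  have step: "(LINT x|M. ((A x *v G x) \<bullet> G x) * ?g n (u x)) + (LINT x|M. ((c x + \<alpha>) * u x) * h n (u x)) \<le>
      (LINT x|M. f x * h n (u x)) + (LINT x|M. (F x \<bullet> G x) * ?g n (u x))" for n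
  proof -
    \<comment> \<open>The sign condition on \<open>h n\<close> makes this antiderivative
      nonnegative, as \<open>drift_nonneg\<close> requires.\<close>
    obtain Q where Q: "\<And>t. (Q has_real_derivative h n t) (at t)" "Q 0 = 0"
      using continuous_antiderivative[OF smooth_continuous[OF h(1)[of n]]] by blast
    have d: "0 \<le> (LINT x|M. h n (u x) * (B x \<bullet> G x))"
      by (rule drift_nonneg[OF H smooth_antiderivative[OF Q(1) h(1)] Q(2) antiderivative_nonneg[OF Q h(5,2)] Q(1) h(4)
            smooth_continuous[OF h(1)]])
    have "low u G x * h n (u x) = h n (u x) * (B x \<bullet> G x) + ((c x + \<alpha>) * u x) * h n (u x)" for x
      by (simp add: low_def algebra_simps)
    moreover have "integrable M (\<lambda>x. h n (u x) * (B x \<bullet> G x))"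
      using integrable_mult_bounded[OF low_integrable(1)[OF H] hu h(4)] by (simp add: mult.commute)
    moreover have "integrable M (\<lambda>x. ((c x + \<alpha>) * u x) * h n (u x))"
      by (rule integrable_mult_bounded[OF low_integrable(5)[OF H] hu h(4)])
    ultimately have "(LINT x|M. low u G x * h n (u x)) =
        (LINT x|M. h n (u x) * (B x \<bullet> G x)) + (LINT x|M. ((c x + \<alpha>) * u x) * h n (u x))" by simp
    with d smooth_test[OF u h(1)[of n] h(2)[of n] h(4)[of n] h(3)[of n] g1 gc] show ?thesis
      by (simp add: mult.commute)
  qed
  have AG: "integrable M (\<lambda>x. (A x *v G x) \<bullet> G x)" by (rule L2_inner_integrable[OF AG_L2[OF L(2)] L(2)])
  have FG: "integrable M (\<lambda>x. F x \<bullet> G x)" by (rule L2_inner_integrable[OF F L(2)])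
  have key: "(LINT x|M. ((A x *v G x) \<bullet> G x) * indicator {a<..<b} (u x)) + (LINT x|M. ((c x + \<alpha>) * u x) * ?T x) \<le>
      (LINT x|M. f x * ?T x) + (LINT x|M. (F x \<bullet> G x) * indicator {a<..<b} (u x))"
  proof (rule LIMSEQ_le)
    show "(\<lambda>n. (LINT x|M. ((A x *v G x) \<bullet> G x) * ?g n (u x)) + (LINT x|M. ((c x + \<alpha>) * u x) * h n (u x))) \<longlonglongrightarrow>
        (LINT x|M. ((A x *v G x) \<bullet> G x) * indicator {a<..<b} (u x)) + (LINT x|M. ((c x + \<alpha>) * u x) * ?T x)"
      by (intro tendsto_add bounded_mult_tendsto[OF AG gu g1 Iu lim_g]
          bounded_mult_tendsto[OF low_integrable(5)[OF H] hu h(4) Tu lim_h])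
    show "(\<lambda>n. (LINT x|M. f x * h n (u x)) + (LINT x|M. (F x \<bullet> G x) * ?g n (u x))) \<longlonglongrightarrow>
        (LINT x|M. f x * ?T x) + (LINT x|M. (F x \<bullet> G x) * indicator {a<..<b} (u x))"
      by (intro tendsto_add bounded_mult_tendsto[OF FG gu g1 Iu lim_g] bounded_mult_tendsto[OF f hu h(4) Tu lim_h])
  qed (use step in blast)
  show uT: "integrable M (\<lambda>x. u x * trunc a b (u x))"
    by (rule integrable_mult_bounded[OF low_integrable(3)[OF H] Tu trunc_bound[OF ab]])
  have cT: "integrable M (\<lambda>x. ((c x + \<alpha>) * u x) * ?T x)"
    by (rule integrable_mult_bounded[OF low_integrable(5)[OF H] Tu trunc_bound[OF ab]])
  have "(LINT x|M. \<alpha> * (u x * ?T x)) \<le> (LINT x|M. ((c x + \<alpha>) * u x) * ?T x)"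
  proof (rule integral_mono_AE[OF _ cT])
    show "integrable M (\<lambda>x. \<alpha> * (u x * ?T x))" using uT by simp
    show "AE x in M. \<alpha> * (u x * ?T x) \<le> ((c x + \<alpha>) * u x) * ?T x"
      using c(2)
    proof eventually_elim
      case (elim x)
      have "0 \<le> c x * (?T x * u x)" using elim trunc_sign by (rule mult_nonneg_nonneg)
      then show ?case by (simp add: algebra_simps)
    qed
  qed
  moreover have "lam * (nrm2 M Ga)\<^sup>2 \<le> (LINT x|M. ((A x *v G x) \<bullet> G x) * indicator {a<..<b} (u x))"
  proof -
    have LGa: "L2 M Ga" unfolding Ga_def by (rule H0_L2(2)[OF H0_trunc[OF U H ab]])
    have "lam * (nrm2 M Ga)\<^sup>2 = (LINT x|M. lam * (norm (Ga x))\<^sup>2)" by (simp add: nrm2_sq)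
    also have "\<dots> \<le> (LINT x|M. ((A x *v G x) \<bullet> G x) * indicator {a<..<b} (u x))"
    proof (rule integral_mono)
      show "integrable M (\<lambda>x. lam * (norm (Ga x))\<^sup>2)" using L2_integrable[OF LGa] by simp
      show "integrable M (\<lambda>x. ((A x *v G x) \<bullet> G x) * indicator {a<..<b} (u x))"
        by (rule integrable_mult_bounded[OF AG Iu, of 1]) (auto simp: indicator_def)
      show "lam * (norm (Ga x))\<^sup>2 \<le> ((A x *v G x) \<bullet> G x) * indicator {a<..<b} (u x)" if "x \<in> space M" for x
        using elliptic[of x "G x"] that by (auto simp: Ga_def indicator_def)
    qed
    finally show ?thesis .
  qed
  moreover have "(LINT x|M. (F x \<bullet> G x) * indicator {a<..<b} (u x)) = (LINT x|M. F x \<bullet> Ga x)"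
    by (simp add: Ga_def mult.commute)
  ultimately show "lam * (nrm2 M Ga)\<^sup>2 + (LINT x|M. \<alpha> * (u x * trunc a b (u x))) \<le>
      (LINT x|M. f x * trunc a b (u x)) + (LINT x|M. F x \<bullet> Ga x)"
    using key by linarith
qed

text \<open>Truncation between \<open>- real (Suc n)\<close> and \<open>real (Suc n)\<close>: the
  right side is linear in the norm of the truncated gradient, so one factor cancels. The bound is
  uniform in \<open>n\<close>, and dominated convergence removes the truncation.\<close>

lemma energy_estimate:
  assumes u: "sol f F u G" and f: "f \<in> Lp_space M (ennreal s)"
  shows "lam * nrm2 M G \<le> S * Lp_norm M (ennreal s) f + nrm2 M F"
proof -
  have F: "L2 M F" and H: "H0 U u G" using u by (auto simp: sol_def)
  note L = H0_L2[OF H]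
  define Q where "Q = S * Lp_norm M (ennreal s) f + nrm2 M F"
  have Q0: "0 \<le> Q" using S0 by (simp add: Q_def Lp_norm_nonneg)
  define Gn where "Gn n x = indicat_real {- real (Suc n)<..<real (Suc n)} (u x) *\<^sub>R G x" for n x
  have le: "lam * nrm2 M (Gn n) \<le> Q" for n
  proof -
    let ?T = "\<lambda>x. trunc (- real (Suc n)) (real (Suc n)) (u x)"
    have ab: "- real (Suc n) < real (Suc n)" by simp
    have HT: "H0 U ?T (Gn n)" unfolding Gn_def[abs_def] by (rule H0_trunc[OF U H ab])
    have "0 \<le> \<alpha> * (u x * ?T x)" for x
      using mult_nonneg_nonneg[OF \<alpha> trunc_sign[of "- real (Suc n)" "real (Suc n)" "u x"]]
      by (simp only: mult.commute[of "u x"])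
    then have "0 \<le> (LINT x|M. \<alpha> * (u x * ?T x))"
      by (rule Bochner_Integration.integral_nonneg)
    then have "lam * (nrm2 M (Gn n))\<^sup>2 \<le> (LINT x|M. f x * ?T x) + (LINT x|M. F x \<bullet> Gn n x)"
      using truncation_inequality(1)[OF u ab, folded Gn_def] by linarith
    also have "\<dots> \<le> Lp_norm M (ennreal s) f * (S * nrm2 M (Gn n)) + nrm2 M F * nrm2 M (Gn n)"
    proof (rule add_mono)
      have "(LINT x|M. f x * ?T x) \<le> (LINT x|M. \<bar>f x * ?T x\<bar>)"
        by (rule order_trans[OF abs_ge_self integral_norm_bound[of M "\<lambda>x. f x * ?T x", unfolded real_norm_def]])
      then show "(LINT x|M. f x * ?T x) \<le> Lp_norm M (ennreal s) f * (S * nrm2 M (Gn n))"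
        using Ls_pairing(2)[OF f HT] by linarith
      show "(LINT x|M. F x \<bullet> Gn n x) \<le> nrm2 M F * nrm2 M (Gn n)"
        using L2_Cauchy_Schwarz[OF F H0_L2(2)[OF HT]] by linarith
    qed
    finally have "nrm2 M (Gn n) * (lam * nrm2 M (Gn n)) \<le> nrm2 M (Gn n) * Q"
      by (simp add: Q_def power2_eq_square algebra_simps)
    then show ?thesis
      using Q0 nrm2_nonneg[of M "Gn n"] by (cases "nrm2 M (Gn n) = 0") (auto simp: less_le)
  qed
  have um: "u \<in> borel_measurable M" and Gm: "G \<in> borel_measurable M"
    using L by (auto intro: L2_measurable)
  have "(\<lambda>n. nrm2 M (\<lambda>x. Gn n x - G x)) \<longlonglongrightarrow> 0"
  proof (rule L2_dominated_convergence(2)[where w="\<lambda>x. norm (G x)"])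
    show "L2 M (\<lambda>x. norm (G x))" by (rule L2_bound[OF L(2), of _ 1]) (use Gm in auto)
    show Gnm: "Gn n \<in> borel_measurable M" for n
      unfolding Gn_def[abs_def]
      by (rule borel_measurable_scaleR[OF measurable_compose[OF um] Gm]) measurable
    show "AE x in M. norm (Gn n x) \<le> \<bar>norm (G x)\<bar>" for n
      by (auto simp: Gn_def indicator_def)
    show "AE x in M. (\<lambda>n. Gn n x) \<longlonglongrightarrow> G x"
    proof (rule AE_I2)
      fix x
      obtain N :: nat where N: "\<bar>u x\<bar> < real N" using reals_Archimedean2 by blast
      have "\<forall>\<^sub>F n in sequentially. Gn n x = G x"
      proof (rule eventually_sequentiallyI[of N])
        fix n assume "N \<le> n"
        then have "\<bar>u x\<bar> < real (Suc n)" using N by simp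
        then have "u x \<in> {- real (Suc n)<..<real (Suc n)}" by (auto simp: abs_less_iff)
        then show "Gn n x = G x" unfolding Gn_def by (simp del: of_nat_Suc greaterThanLessThan_iff)
      qed
      then show "(\<lambda>n. Gn n x) \<longlonglongrightarrow> G x" by (rule tendsto_eventually)
    qed
  qed (rule Gm)
  moreover have "L2 M (Gn n)" for n
    unfolding Gn_def[abs_def] by (rule H0_L2(2)[OF H0_trunc[OF U H]]) simp
  ultimately have "(\<lambda>n. nrm2 M (Gn n)) \<longlonglongrightarrow> nrm2 M G"
    using nrm2_tendsto[OF L(2)] by blast
  then have "(\<lambda>n. lam * nrm2 M (Gn n)) \<longlonglongrightarrow> lam * nrm2 M G" by (rule tendsto_mult_left)
  then show ?thesis unfolding Q_def[symmetric] by (rule LIMSEQ_le_const2) (use le in blast)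
qed

text \<open>The difference solves the problem with zero data; the energy estimate kills its gradient
  and Poincare the function.\<close>

lemma uniqueness:
  assumes u: "sol f F u G" and v: "sol f F v H"
  shows "AE x in M. u x = v x"
proof -
  let ?w = "\<lambda>x. u x - v x" and ?K = "\<lambda>x. G x - H x"
  have w: "sol (\<lambda>x. 0) (\<lambda>x. 0) ?w ?K" using sol_diff[OF u v] by simp
  have z: "(\<lambda>x. 0) \<in> Lp_space M (ennreal s)" using s by (simp add: Lp_space_def)
  have n0: "nrm2 M (\<lambda>x. 0 :: real^'n) = 0" by (simp add: nrm2_def)
  have l0: "Lp_norm M (ennreal s) (\<lambda>x. 0 :: real) = 0" using s by (simp add: Lp_norm_def)
  have "lam * nrm2 M ?K \<le> 0" using energy_estimate[OF w z] n0 l0 by simp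
  then have "nrm2 M ?K \<le> 0" using lam by (simp add: mult_le_0_iff)
  then have "nrm2 M ?K = 0" using nrm2_nonneg by (rule antisym)
  moreover have Hw: "H0 U ?w ?K" using w by (simp add: sol_def)
  ultimately have "nrm2 M ?w \<le> 0" using Poincare[OF Hw] by simp
  then have "nrm2 M ?w = 0" using nrm2_nonneg by (rule antisym)
  then have "AE x in M. ?w x = 0" by (rule nrm2_eq_0_AE[OF H0_L2(1)[OF Hw]])
  then show ?thesis by eventually_elim simp
qed

text \<open>The square root adds the function to the gradient by Poincare;
  \<open>(S + 1) / lam\<close> bounds the gradient by the energy estimate with equal coefficients
  for both data.\<close>

lemma H12_estimate:
  assumes u: "sol f F u G" and f: "f \<in> Lp_space M (ennreal s)"
  shows "H12_norm U u \<le> sqrt (P\<^sup>2 + 1) * (S + 1) / lam * (Lp_norm M (ennreal s) f + nrm2 M F)"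
proof -
  have H: "H0 U u G" using u by (simp add: sol_def)
  let ?N = "Lp_norm M (ennreal s) f + nrm2 M F"
  have "(nrm2 M u)\<^sup>2 \<le> (P * nrm2 M G)\<^sup>2" by (intro power_mono Poincare[OF H]) simp
  then have "(nrm2 M u)\<^sup>2 + (nrm2 M G)\<^sup>2 \<le> (P\<^sup>2 + 1) * (nrm2 M G)\<^sup>2" by (simp add: power_mult_distrib algebra_simps)
  then have "H12_norm U u \<le> sqrt ((P\<^sup>2 + 1) * (nrm2 M G)\<^sup>2)"
    unfolding H0_H12_norm[OF U H] by (rule real_sqrt_le_mono)
  also have "\<dots> = sqrt (P\<^sup>2 + 1) * nrm2 M G" by (simp add: real_sqrt_mult)
  also have "\<dots> \<le> sqrt (P\<^sup>2 + 1) * ((S + 1) / lam * ?N)"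
  proof (rule mult_left_mono)
    have "lam * nrm2 M G \<le> (S + 1) * ?N"
    proof -
      have "(S + 1) * ?N = S * Lp_norm M (ennreal s) f + nrm2 M F + (S * nrm2 M F + Lp_norm M (ennreal s) f)"
        by (simp add: algebra_simps)
      moreover have "0 \<le> S * nrm2 M F + Lp_norm M (ennreal s) f"
        by (intro add_nonneg_nonneg mult_nonneg_nonneg S0 nrm2_nonneg Lp_norm_nonneg)
      ultimately show ?thesis using energy_estimate[OF u f] by linarith
    qed
    then show "nrm2 M G \<le> (S + 1) / lam * ?N" using lam by (simp add: field_simps)
  qed simp
  finally show ?thesis by simp
qed

end

section \<open>Boundedness\<close>

text \<open>The levels \<open>L * (1 - (1/2) ^ n)\<close> increase to \<open>L\<close>, and the
  decay is applied between neighbours. Since \<open>\<beta> > 1\<close>, a geometric bound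
  reproduces itself, and as it tends to 0, monotonicity gives \<open>\<nu> L = 0\<close>.\<close>

lemma Stampacchia:
  fixes \<nu> :: "real \<Rightarrow> real"
  assumes antimono: "\<And>a b. 0 \<le> a \<Longrightarrow> a \<le> b \<Longrightarrow> \<nu> b \<le> \<nu> a" and nonneg: "\<And>a. 0 \<le> \<nu> a"
    and \<nu>0: "\<nu> 0 \<le> \<nu>\<^sub>0" "0 < \<nu>\<^sub>0" and \<beta>: "1 < \<beta>" and Q: "0 < Q"
    and decay: "\<And>a m. 0 \<le> a \<Longrightarrow> 0 < m \<Longrightarrow> m * \<nu> (a + m) \<le> Q * \<nu> a powr \<beta>"
  shows "\<nu> (Q * \<nu>\<^sub>0 powr (\<beta> - 1) * 2 powr (\<beta> / (\<beta> - 1))) = 0"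
proof -
  define L where "L = Q * \<nu>\<^sub>0 powr (\<beta> - 1) * 2 powr (\<beta> / (\<beta> - 1))"
  have L: "0 < L" using Q \<nu>0 by (simp add: L_def)
  \<comment> \<open>The ratio \<open>2 powr (- (1 / (\<beta> - 1)))\<close> and the factor
    \<open>2 powr (\<beta> / (\<beta> - 1))\<close> in \<open>L\<close> are chosen together so that
    the induction step holds with equality in its last computation.\<close>
  have claim: "\<nu> (L * (1 - (1/2) ^ n)) \<le> \<nu>\<^sub>0 * 2 powr (- (real n / (\<beta> - 1)))" for n
  proof (induction n)
    case 0
    then show ?case using \<nu>0 by simp
  next
    case (Suc n)
    define a where "a = L * (1 - (1/2) ^ n)"
    define m where "m = L * (1/2) ^ Suc n"
    have a: "0 \<le> a" using L by (simp add: a_def power_le_one)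
    have m: "0 < m" using L by (simp add: m_def)
    have am: "a + m = L * (1 - (1/2) ^ Suc n)" by (simp add: a_def m_def algebra_simps)
    let ?X = "\<nu>\<^sub>0 * 2 powr (- (real (Suc n) / (\<beta> - 1)))"
    have "m * \<nu> (a + m) \<le> Q * (\<nu>\<^sub>0 * 2 powr (- (real n / (\<beta> - 1)))) powr \<beta>"
      using decay[OF a m] Suc.IH Q \<beta> nonneg[of a] unfolding a_def[symmetric]
      by (elim order_trans) (intro mult_left_mono powr_mono2, auto)
    also have "\<dots> = Q * \<nu>\<^sub>0 powr \<beta> * 2 powr (- (real n * \<beta> / (\<beta> - 1)))"
      using \<nu>0 by (simp add: powr_mult powr_powr)
    also have "\<dots> = m * ?X"
    proof -
      have p: "(1/2 :: real) ^ Suc n = 2 powr (- real (Suc n))"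
        by (simp add: powr_minus powr_realpow power_one_over inverse_eq_divide del: of_nat_Suc)
      have "m * ?X = Q * (\<nu>\<^sub>0 powr (\<beta> - 1) * \<nu>\<^sub>0 powr 1) *
          (2 powr (\<beta> / (\<beta> - 1)) * 2 powr (- real (Suc n)) * 2 powr (- (real (Suc n) / (\<beta> - 1))))"
        using \<nu>0 unfolding m_def L_def p by (simp add: mult_ac)
      also have "\<dots> = Q * \<nu>\<^sub>0 powr \<beta> * 2 powr (\<beta> / (\<beta> - 1) + - real (Suc n) + - (real (Suc n) / (\<beta> - 1)))"
        unfolding powr_add[symmetric] by simp
      also have "\<beta> / (\<beta> - 1) + - real (Suc n) + - (real (Suc n) / (\<beta> - 1)) = - (real n * \<beta> / (\<beta> - 1))"
      proof -
        have e: "\<beta> / (\<beta> - 1) = 1 + 1 / (\<beta> - 1)" using \<beta> by (simp add: field_simps)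
        have "real n * \<beta> / (\<beta> - 1) = real n + real n / (\<beta> - 1)"
        proof -
          have "real n * \<beta> / (\<beta> - 1) = real n * (\<beta> / (\<beta> - 1))" by simp
          then show ?thesis unfolding e by (simp add: distrib_left)
        qed
        then show ?thesis unfolding e by (simp add: add_divide_distrib)
      qed
      finally show ?thesis by simp
    qed
    finally show ?case using m unfolding am by simp
  qed
  have "\<nu> L \<le> \<nu>\<^sub>0 * (2 powr (- (1 / (\<beta> - 1)))) ^ n" for n
  proof -
    have "\<nu> L \<le> \<nu> (L * (1 - (1/2) ^ n))"
      using L by (intro antimono) (auto simp: power_le_one mult_left_le)
    also note claim[of n]
    also have "2 powr (- (real n / (\<beta> - 1))) = (2 powr (- (1 / (\<beta> - 1)))) ^ n"
      by (simp add: powr_realpow[symmetric] powr_powr)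
    finally show ?thesis .
  qed
  moreover have "(\<lambda>n. \<nu>\<^sub>0 * (2 powr (- (1 / (\<beta> - 1)))) ^ n) \<longlonglongrightarrow> 0"
  proof (rule tendsto_mult_right_zero[OF LIMSEQ_power_zero])
    have "2 powr (- (1 / (\<beta> - 1))) < 2 powr (0::real)" using \<beta> by (intro powr_less_mono) auto
    then show "norm (2 powr (- (1 / (\<beta> - 1))) :: real) < 1" by simp
  qed
  ultimately have "\<nu> L \<le> 0" by (intro LIMSEQ_le_const) auto
  then show ?thesis using nonneg[of L] unfolding L_def by (rule antisym)
qed

text \<open>Hoelder with three factors; the indicator of \<open>D\<close> takes the weight that the
  other two leave.\<close>

lemma (in finite_measure) Hoelder_on_set:
  fixes f g :: "'a \<Rightarrow> real"
  assumes m: "f \<in> borel_measurable M" "g \<in> borel_measurable M" "D \<in> sets M"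
    and pq: "0 < p" "0 < q" "1/p + 1/q \<le> 1"
    and int: "integrable M (\<lambda>x. \<bar>f x\<bar> powr p)" "integrable M (\<lambda>x. \<bar>g x\<bar> powr q)"
  shows "(LINT x|M. indicator D x * \<bar>f x * g x\<bar>) \<le>
    (LINT x|M. \<bar>f x\<bar> powr p) powr (1/p) * (LINT x|M. \<bar>g x\<bar> powr q) powr (1/q) * measure M D powr (1 - 1/p - 1/q)"
proof -
  define F where "F j x = (if j = 0 then \<bar>f x\<bar> powr p else if j = 1 then \<bar>g x\<bar> powr q else indicator D x)" for j :: nat and x
  define w where "w j = (if j = 0 then 1/p else if j = 1 then 1/q else 1 - 1/p - 1/q)" for j :: nat
  have prod3: "(\<Prod>j\<in>{0,1,2::nat}. h j) = h 0 * h 1 * h 2" for h :: "nat \<Rightarrow> real" by (simp add: mult.assoc)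
  have eq: "(\<Prod>j\<in>{0,1,2}. F j x powr w j) = indicator D x * \<bar>f x * g x\<bar>" for x
    unfolding prod3 using pq by (simp add: F_def w_def powr_powr abs_mult indicator_def)
  have Fi: "integrable M (F j)" for j
  proof -
    have "integrable M (indicat_real D)" using m(3) by (simp add: emeasure_eq_measure)
    then show ?thesis using int unfolding F_def[abs_def] by (cases "j = 0"; cases "j = 1") simp_all
  qed
  have "(LINT x|M. (\<Prod>j\<in>{0,1,2}. F j x powr w j)) \<le> (\<Prod>j\<in>{0,1,2}. (LINT x|M. F j x) powr w j)"
    by (rule generalized_Hoelder(2)[OF _ _ Fi]) (use pq in \<open>auto simp: F_def w_def\<close>)
  moreover have "(LINT x|M. indicat_real D x) = measure M D" using m(3) by simp
  moreover have "F 0 = (\<lambda>x. \<bar>f x\<bar> powr p)" "F 1 = (\<lambda>x. \<bar>g x\<bar> powr q)" "F 2 = (\<lambda>x. indicator D x)"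
    by (simp_all add: F_def[abs_def])
  moreover have "w 0 = 1/p" "w 1 = 1/q" "w 2 = 1 - 1/p - 1/q" by (simp_all add: w_def)
  ultimately show ?thesis unfolding eq unfolding prod3 by metis
qed

text \<open>The level produced by \<open>Stampacchia\<close> with the data norm divided out:
  \<open>\<theta>\<close> is the power of the level set measure in the estimate of the right side,
  \<open>\<beta>\<close> the resulting decay exponent, and \<open>v powr (1/k)\<close> the initial
  bound.\<close>

definition Linf_const :: "nat \<Rightarrow> real \<Rightarrow> real \<Rightarrow> real \<Rightarrow> real \<Rightarrow> real" where
  "Linf_const n lam v k q = (let S\<^sub>k = Sobolev_const n k v; \<theta> = 1/2 - 1/(2*q); \<beta> = k * \<theta>
     in S\<^sub>k / lam * (S\<^sub>k * v powr (\<theta> - 1/k) + 1) * (v powr (1/k)) powr (\<beta> - 1) * 2 powr (\<beta> / (\<beta> - 1)))"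

lemma Linf_const_pos:
  assumes "2 \<le> n" "0 < lam" "0 < v" "0 < k"
  shows "0 < Linf_const n lam v k q"
proof -
  have "0 < Sobolev_const n k v" using assms by (simp add: Sobolev_const_def)
  then show ?thesis using assms unfolding Linf_const_def Let_def by (simp add: add_pos_pos)
qed

context elliptic_problem
begin

definition level :: "(real^'n \<Rightarrow> real) \<Rightarrow> real \<Rightarrow> (real^'n) set" where
  "level u a = {x \<in> U. a < u x}"

lemma level_sets: "u \<in> borel_measurable M \<Longrightarrow> level u a \<in> sets M"
  using borel_measurable_less[of "\<lambda>_. a" M u] by (simp add: level_def)

lemma measure_M_le: "measure M D \<le> measure lebesgue U"
proof -
  have "measure M D \<le> measure M (space M)" by (rule bounded_measure)
  then show ?thesis by (simp add: measure_lebesgue_on_space[OF U(2)])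
qed

abbreviation "Linf \<equiv> Linf_const CARD('n) lam (measure lebesgue U)"

text \<open>\<open>Stampacchia\<close> is applied to the measure of \<open>level u a\<close> raised
  to \<open>1/k\<close>. Truncating between \<open>a\<close> and \<open>a + m\<close>, Hoelder over
  \<open>level u a\<close> bounds the gradient by a multiple of that measure to the power
  \<open>\<theta>\<close>, and Sobolev with Chebyshev bounds it below by
  \<open>m * \<nu> (a + m)\<close>. The hypothesis \<open>kq\<close> says
  \<open>\<beta> > 1\<close>. The strict majorant \<open>N\<close> keeps the decay constant positive
  when both norms vanish.\<close>

lemma essentially_bounded_above:
  assumes u: "sol f F u G" and q: "1 < q" and k: "2 < k" "k * (real CARD('n) - 2) \<le> 2 * real CARD('n)"
    and kq: "1/k < 1/2 - 1/(2*q)"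
    and f: "f \<in> Lp_space M (ennreal q)" and F: "F \<in> Lp_space M (ennreal (2*q))"
    and v: "0 < measure lebesgue U"
    and N: "Lp_norm M (ennreal q) f + Lp_norm M (ennreal (2*q)) F < N"
  shows "AE x in M. u x \<le> Linf k q * N"
proof -
  have H: "H0 U u G" using u by (simp add: sol_def)
  note L = H0_L2[OF H]
  have um: "u \<in> borel_measurable M" using L(1) by (rule L2_measurable)
  define v where "v = measure lebesgue U"
  have v0: "0 < v" using v by (simp add: v_def)
  define Sk where "Sk = Sobolev_const CARD('n) k v"
  have Sk: "0 < Sk" using k n2 v0 by (simp add: Sk_def Sobolev_const_def)
  define \<theta> where "\<theta> = 1/2 - 1/(2*q)"
  define \<beta> where "\<beta> = k * \<theta>"
  have \<theta>: "1/k < \<theta>" using kq by (simp add: \<theta>_def)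
  have \<theta>0: "0 < \<theta>" using \<theta> k by (meson less_trans zero_less_divide_1_iff less_numeral_extra(1) zero_less_numeral)
  have \<beta>: "1 < \<beta>" using \<theta> k by (simp add: \<beta>_def field_simps)
  define K where "K = Sk / lam * (Sk * v powr (\<theta> - 1/k) + 1)"
  have K: "0 < K" using Sk lam v0 by (simp add: K_def add_pos_pos)
  have N0: "0 < N" using N Lp_norm_nonneg[of M "ennreal q" f] Lp_norm_nonneg[of M "ennreal (2*q)" F] by linarith
  define \<mu> where "\<mu> a = measure M (level u a)" for a
  define \<nu> where "\<nu> a = \<mu> a powr (1/k)" for a
  have \<mu>v: "0 \<le> \<mu> a" "\<mu> a \<le> v" for a using measure_M_le by (simp_all add: \<mu>_def v_def)
  note fD = Lp_spaceD[OF f] and FD = Lp_spaceD[OF F]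
  have Fm: "F \<in> borel_measurable M" and Fi: "integrable M (\<lambda>x. norm (F x) powr (2*q))" using FD q by auto
  have fm: "f \<in> borel_measurable M" and fi: "integrable M (\<lambda>x. \<bar>f x\<bar> powr q)" using fD q by auto
  have decay: "m * \<nu> (a + m) \<le> (K * N) * \<nu> a powr \<beta>" if a: "0 \<le> a" and m: "0 < m" for a m
  proof -
    let ?T = "\<lambda>x. trunc a (a + m) (u x)"
    define Ga where "Ga x = indicat_real {a<..<a+m} (u x) *\<^sub>R G x" for x
    have am: "a < a + m" using m by simp
    have HT: "H0 U ?T Ga" unfolding Ga_def[abs_def] by (rule H0_trunc[OF U H am])
    have Tm: "?T \<in> borel_measurable M" by (rule measurable_compose[OF um borel_measurable_trunc])
    have Gm: "Ga \<in> borel_measurable M" by (rule L2_measurable[OF H0_L2(2)[OF HT]])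
    define X where "X = nrm2 M Ga"
    have X0: "0 \<le> X" by (simp add: X_def)
    define t where "t = (LINT x|M. \<bar>?T x\<bar> powr k) powr (1/k)"
    have Tk: "integrable M (\<lambda>x. \<bar>?T x\<bar> powr k)" and tX: "t \<le> Sk * X"
      using Sobolev_H0[OF U HT n2 k] by (simp_all add: t_def X_def Sk_def v_def)
    let ?D = "level u a"
    have D: "?D \<in> sets M" by (rule level_sets[OF um])
    have T0: "trunc a (a + m) y = 0" if "y \<le> a" for y using that a m by (simp add: trunc_def)
    have Tfull: "trunc a (a + m) y = m" if "a + m \<le> y" for y using that a m by (simp add: trunc_def)
    have "(LINT x|M. f x * ?T x) \<le> (LINT x|M. \<bar>f x * ?T x\<bar>)"
      by (rule order_trans[OF abs_ge_self integral_norm_bound[of M "\<lambda>x. f x * ?T x", unfolded real_norm_def]])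
    also have "\<dots> = (LINT x|M. indicator ?D x * \<bar>f x * ?T x\<bar>)"
      by (rule Bochner_Integration.integral_cong[OF refl]) (auto simp: level_def T0 indicator_def)
    also have "\<dots> \<le> (LINT x|M. \<bar>f x\<bar> powr q) powr (1/q) * t * \<mu> a powr (1 - 1/q - 1/k)"
      unfolding t_def \<mu>_def
    proof (rule Hoelder_on_set[OF fm Tm D _ _ _ fi Tk])
      have "1/q + 1/k \<le> 1/q + (1/2 - 1/(2*q))" using kq by linarith
      also have "\<dots> \<le> 1" using q by (simp add: field_simps)
      finally show "1/q + 1/k \<le> 1" .
    qed (use q k in auto)
    also have "(LINT x|M. \<bar>f x\<bar> powr q) powr (1/q) = Lp_norm M (ennreal q) f" using q by (simp add: Lp_norm_eq)
    \<comment> \<open>The term with \<open>f\<close> has a better power of the level set measure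
      than the term with \<open>F\<close>; the surplus \<open>\<theta> - 1/k\<close> is traded for a
      power of the volume so that both carry \<open>\<theta>\<close>.\<close>
    also have "1 - 1/q - 1/k = \<theta> + (\<theta> - 1/k)" by (simp add: \<theta>_def)
    also have "Lp_norm M (ennreal q) f * t * \<mu> a powr (\<theta> + (\<theta> - 1/k)) \<le>
        Lp_norm M (ennreal q) f * (Sk * X) * (\<mu> a powr \<theta> * v powr (\<theta> - 1/k))"
    proof (intro mult_mono mult_left_mono tX Lp_norm_nonneg mult_nonneg_nonneg X0)
      show "\<mu> a powr (\<theta> + (\<theta> - 1/k)) \<le> \<mu> a powr \<theta> * v powr (\<theta> - 1/k)"
        unfolding powr_add using \<mu>v \<theta> by (intro mult_left_mono powr_mono2) auto
    qed (use Sk in \<open>auto simp: t_def\<close>)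
    finally have b1: "(LINT x|M. f x * ?T x) \<le> Lp_norm M (ennreal q) f * (Sk * X) * (\<mu> a powr \<theta> * v powr (\<theta> - 1/k))" .
    have "(LINT x|M. F x \<bullet> Ga x) \<le> (LINT x|M. indicator ?D x * \<bar>norm (F x) * norm (Ga x)\<bar>)"
    proof (rule integral_mono)
      have F2: "L2 M F" using u by (simp add: sol_def)
      show "integrable M (\<lambda>x. F x \<bullet> Ga x)" by (rule L2_inner_integrable[OF F2 H0_L2(2)[OF HT]])
      show "integrable M (\<lambda>x. indicator ?D x * \<bar>norm (F x) * norm (Ga x)\<bar>)"
        using integrable_mult_bounded[OF L2_prod_norm(1)[OF F2 H0_L2(2)[OF HT]] borel_measurable_indicator[OF D], of 1]
        by (simp add: mult.commute indicator_def)
      fix x assume x: "x \<in> space M"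
      show "F x \<bullet> Ga x \<le> indicator ?D x * \<bar>norm (F x) * norm (Ga x)\<bar>"
      proof (cases "a < u x")
        case True
        then show ?thesis using x norm_cauchy_schwarz[of "F x" "Ga x"] by (simp add: level_def)
      next
        case False
        then show ?thesis by (simp add: Ga_def)
      qed
    qed
    also have "\<dots> \<le> (LINT x|M. \<bar>norm (F x)\<bar> powr (2*q)) powr (1/(2*q)) * (LINT x|M. \<bar>norm (Ga x)\<bar> powr 2) powr (1/2) *
        \<mu> a powr (1 - 1/(2*q) - 1/2)"
      unfolding \<mu>_def
    proof (rule Hoelder_on_set[OF _ _ D])
      show "1/(2*q) + 1/2 \<le> 1" using q by (simp add: field_simps)
      show "integrable M (\<lambda>x. \<bar>norm (Ga x)\<bar> powr 2)" using L2_integrable[OF H0_L2(2)[OF HT]] by simp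
    qed (use q Fm Gm Fi in auto)
    also have "\<dots> = Lp_norm M (ennreal (2*q)) F * X * \<mu> a powr \<theta>"
      using q by (simp add: Lp_norm_eq X_def nrm2_def powr_half_sqrt \<theta>_def)
    finally have b2: "(LINT x|M. F x \<bullet> Ga x) \<le> Lp_norm M (ennreal (2*q)) F * X * \<mu> a powr \<theta>" .
    have "0 \<le> \<alpha> * (u x * ?T x)" for x
      using mult_nonneg_nonneg[OF \<alpha> trunc_sign[of a "a + m" "u x"]] by (simp only: mult.commute[of "u x"])
    then have "0 \<le> (LINT x|M. \<alpha> * (u x * ?T x))" by (rule Bochner_Integration.integral_nonneg)
    then have "lam * X\<^sup>2 \<le> Lp_norm M (ennreal q) f * (Sk * X) * (\<mu> a powr \<theta> * v powr (\<theta> - 1/k)) +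
        Lp_norm M (ennreal (2*q)) F * X * \<mu> a powr \<theta>"
      using truncation_inequality(1)[OF u am, folded Ga_def] b1 b2 unfolding X_def by linarith
    also have "\<dots> = X * ((Lp_norm M (ennreal q) f * (Sk * v powr (\<theta> - 1/k)) + Lp_norm M (ennreal (2*q)) F * 1) * \<mu> a powr \<theta>)"
      by (simp add: algebra_simps)
    also have "\<dots> \<le> X * (((Sk * v powr (\<theta> - 1/k) + 1) * N) * \<mu> a powr \<theta>)"
    proof (intro mult_left_mono mult_right_mono X0)
      define Y where "Y = Sk * v powr (\<theta> - 1/k)"
      have Y: "0 \<le> Y" using Sk by (simp add: Y_def)
      have "Lp_norm M (ennreal q) f * Y + Lp_norm M (ennreal (2*q)) F * 1 \<le>
          Lp_norm M (ennreal q) f * (Y + 1) + Lp_norm M (ennreal (2*q)) F * (Y + 1)"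
        using Y by (intro add_mono mult_left_mono Lp_norm_nonneg) auto
      also have "\<dots> = (Y + 1) * (Lp_norm M (ennreal q) f + Lp_norm M (ennreal (2*q)) F)" by (simp add: algebra_simps)
      also have "\<dots> \<le> (Y + 1) * N" using N Y by (intro mult_left_mono) auto
      finally show "Lp_norm M (ennreal q) f * (Sk * v powr (\<theta> - 1/k)) + Lp_norm M (ennreal (2*q)) F * 1 \<le>
          (Sk * v powr (\<theta> - 1/k) + 1) * N" by (simp add: Y_def)
    qed simp
    finally have "X * (lam * X) \<le> X * (((Sk * v powr (\<theta> - 1/k) + 1) * N) * \<mu> a powr \<theta>)"
      by (simp add: power2_eq_square mult.left_commute)
    moreover have "0 \<le> ((Sk * v powr (\<theta> - 1/k) + 1) * N) * \<mu> a powr \<theta>"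
      using Sk N0 by (intro mult_nonneg_nonneg) auto
    ultimately have "lam * X \<le> ((Sk * v powr (\<theta> - 1/k) + 1) * N) * \<mu> a powr \<theta>"
      using X0 by (cases "X = 0") (auto simp: less_le)
    then have "Sk / lam * (lam * X) \<le> Sk / lam * (((Sk * v powr (\<theta> - 1/k) + 1) * N) * \<mu> a powr \<theta>)"
      using Sk lam by (intro mult_left_mono) auto
    then have "Sk * X \<le> (K * N) * \<mu> a powr \<theta>" using lam by (simp add: K_def mult.assoc)
    also have "\<mu> a powr \<theta> = \<nu> a powr \<beta>" using k by (simp add: \<nu>_def \<beta>_def powr_powr)
    finally have t1: "t \<le> (K * N) * \<nu> a powr \<beta>" using tX by linarith
    \<comment> \<open>Chebyshev: above level \<open>a + m\<close> the truncation is constantly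
      \<open>m\<close>.\<close>
    have "m powr k * \<mu> (a + m) = (LINT x|M. indicator (level u (a + m)) x * m powr k)"
    proof -
      have "level u (a + m) \<inter> U = level u (a + m)" by (auto simp: level_def)
      then show ?thesis using level_sets[OF um, of "a + m"] by (simp add: \<mu>_def mult.commute)
    qed
    also have "\<dots> \<le> (LINT x|M. \<bar>?T x\<bar> powr k)"
    proof (rule integral_mono[OF _ Tk])
      show "integrable M (\<lambda>x. indicator (level u (a + m)) x * m powr k)"
        using level_sets[OF um, of "a + m"] by (simp add: emeasure_eq_measure)
      show "indicator (level u (a + m)) x * m powr k \<le> \<bar>?T x\<bar> powr k" for x
        using Tfull[of "u x"] m by (cases "x \<in> level u (a + m)") (auto simp: level_def)
    qed
    finally have "(m powr k * \<mu> (a + m)) powr (1/k) \<le> t"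
      unfolding t_def using k \<mu>v by (intro powr_mono2) auto
    moreover have "(m powr k * \<mu> (a + m)) powr (1/k) = m * \<nu> (a + m)"
      using k m \<mu>v by (simp add: powr_mult powr_powr \<nu>_def)
    ultimately show ?thesis using t1 by linarith
  qed
  have "\<nu> ((K * N) * (v powr (1/k)) powr (\<beta> - 1) * 2 powr (\<beta> / (\<beta> - 1))) = 0"
  proof (rule Stampacchia[OF _ _ _ _ \<beta> _ decay])
    show "\<nu> b \<le> \<nu> a" if "a \<le> b" for a b
    proof -
      have "\<mu> b \<le> \<mu> a"
        unfolding \<mu>_def by (rule finite_measure_mono[OF _ level_sets[OF um]]) (use that in \<open>auto simp: level_def\<close>)
      then show ?thesis unfolding \<nu>_def using k \<mu>v by (intro powr_mono2) auto
    qed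
    show "\<nu> 0 \<le> v powr (1/k)" unfolding \<nu>_def using k \<mu>v by (intro powr_mono2) auto
  qed (use v0 K N0 in \<open>auto simp: \<nu>_def\<close>)
  moreover have "(K * N) * (v powr (1/k)) powr (\<beta> - 1) * 2 powr (\<beta> / (\<beta> - 1)) = Linf k q * N"
    by (simp add: Linf_const_def Let_def K_def Sk_def \<beta>_def \<theta>_def v_def mult_ac)
  ultimately have "\<mu> (Linf k q * N) = 0" by (simp add: \<nu>_def)
  then have "level u (Linf k q * N) \<in> null_sets M"
    using level_sets[OF um] by (simp add: \<mu>_def null_sets_def emeasure_eq_measure)
  then have "AE x in M. x \<notin> level u (Linf k q * N)" by (rule AE_not_in)
  then show ?thesis using AE_space by eventually_elim (auto simp: level_def not_less)
qed

lemma Lp_uminus: "(\<lambda>x. - f x) \<in> Lp_space N p \<longleftrightarrow> f \<in> Lp_space N p" "Lp_norm N p (\<lambda>x. - f x) = Lp_norm N p f"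
  by (simp_all add: Lp_space_def Lp_norm_def)

text \<open>The lower bound is the upper bound for \<open>- u\<close>, which solves the problem with
  negated data; the strict majorants then decrease to the sum of the norms along a sequence, so the
  exceptional set stays null.\<close>

lemma essentially_bounded:
  assumes u: "sol f F u G" and q: "1 < q" and k: "2 < k" "k * (real CARD('n) - 2) \<le> 2 * real CARD('n)"
    and kq: "1/k < 1/2 - 1/(2*q)"
    and f: "f \<in> Lp_space M (ennreal q)" and F: "F \<in> Lp_space M (ennreal (2*q))"
    and v: "0 < measure lebesgue U"
  shows "AE x in M. \<bar>u x\<bar> \<le> Linf k q * (Lp_norm M (ennreal q) f + Lp_norm M (ennreal (2*q)) F)"
proof -
  let ?N = "Lp_norm M (ennreal q) f + Lp_norm M (ennreal (2*q)) F" and ?C = "Linf k q"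
  have f': "(\<lambda>x. - f x) \<in> Lp_space M (ennreal q)" and F': "(\<lambda>x. - F x) \<in> Lp_space M (ennreal (2*q))"
    using f F by (simp_all add: Lp_uminus)
  have "AE x in M. u x \<le> ?C * (?N + inverse (real (Suc n)))" for n
    by (rule essentially_bounded_above[OF u q k kq f F v]) simp
  moreover have "AE x in M. - u x \<le> ?C * (?N + inverse (real (Suc n)))" for n
    by (rule essentially_bounded_above[OF sol_uminus[OF u] q k kq f' F' v]) (simp add: Lp_uminus)
  ultimately have "AE x in M. \<forall>n. u x \<le> ?C * (?N + inverse (real (Suc n))) \<and> - u x \<le> ?C * (?N + inverse (real (Suc n)))"
    by (simp add: AE_all_countable del: of_nat_Suc)
  then show ?thesis
  proof eventually_elim
    case (elim x)
    have "(\<lambda>n. ?C * (?N + inverse (real (Suc n)))) \<longlonglongrightarrow> ?C * (?N + 0)"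
      by (intro tendsto_intros LIMSEQ_inverse_real_of_nat)
    moreover have "\<bar>u x\<bar> \<le> ?C * (?N + inverse (real (Suc n)))" for n
      using elim[rule_format, of n] by (simp add: abs_le_iff del: of_nat_Suc)
    ultimately have "\<bar>u x\<bar> \<le> ?C * (?N + 0)" by (intro LIMSEQ_le_const) auto
    then show ?case by simp
  qed
qed

end

section \<open>Contraction properties\<close>

lemma trunc_eq:
  "b < a \<Longrightarrow> a \<le> t \<Longrightarrow> 0 \<le> b \<Longrightarrow> trunc b a t = a - b"
  "b < a \<Longrightarrow> t \<le> b \<Longrightarrow> 0 \<le> b \<Longrightarrow> trunc b a t = 0"
  by (auto simp: trunc_def min_def max_def)

text \<open>The lower level \<open>a - a / real (Suc n)\<close> is never negative, so the truncation
  vanishes below it and has full height from \<open>a\<close> on; the limit is therefore the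
  indicator of a closed half line.\<close>

lemma trunc_quotient_tendsto:
  assumes a: "0 < a"
  shows "(\<lambda>n. trunc (a - a / real (Suc n)) a t / (a / real (Suc n))) \<longlonglongrightarrow> indicator {a..} t"
proof (cases "a \<le> t")
  case True
  have "trunc (a - a / real (Suc n)) a t / (a / real (Suc n)) = 1" for n
  proof -
    have r: "a / real (Suc n) \<le> a" "0 < a / real (Suc n)" using a by (simp_all add: divide_le_eq)
    have "trunc (a - a / real (Suc n)) a t = a - (a - a / real (Suc n))"
      by (rule trunc_eq(1)) (use r True in linarith)+
    then show ?thesis using a by simp
  qed
  then show ?thesis using True by simp
next
  case False
  have "(\<lambda>n. a - a * inverse (real (Suc n))) \<longlonglongrightarrow> a - a * 0"
    by (intro tendsto_intros LIMSEQ_inverse_real_of_nat)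
  then have "\<forall>\<^sub>F n in sequentially. t < a - a * inverse (real (Suc n))"
    using False by (intro order_tendstoD(1)) auto
  then have "\<forall>\<^sub>F n in sequentially. trunc (a - a / real (Suc n)) a t / (a / real (Suc n)) = 0"
  proof eventually_elim
    case (elim n)
    have e: "t < a - a / real (Suc n)" using elim by (simp only: divide_inverse)
    have r: "0 \<le> a - a / real (Suc n)" "0 < a / real (Suc n)" using a by (simp_all add: divide_le_eq)
    have "trunc (a - a / real (Suc n)) a t = 0"
      by (rule trunc_eq(2)) (use r e in linarith)+
    then show ?case by simp
  qed
  then show ?thesis using False by (simp add: tendsto_eventually)
qed

context elliptic_problem
begin

text \<open>With \<open>F = 0\<close> no gradient stands on the right, so the elliptic term may be
  dropped and the rest divided by the width of the truncation before the width tends to 0.\<close>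

lemma level_inequality:
  assumes u: "sol f (\<lambda>x. 0) u G" and a: "0 < a"
  shows "\<alpha> * (LINT x|M. u x * indicator {a..} (u x)) \<le> (LINT x|M. f x * indicator {a..} (u x))"
proof (rule LIMSEQ_le)
  have f: "integrable M f" and H: "H0 U u G" using u by (auto simp: sol_def)
  have um: "u \<in> borel_measurable M" by (rule L2_measurable[OF H0_L2(1)[OF H]])
  define r where "r n = a / real (Suc n)" for n
  have r: "0 < r n" for n using a by (simp add: r_def)
  define T where "T n x = trunc (a - r n) a (u x) / r n" for n x
  have Tm: "T n \<in> borel_measurable M" for n
    unfolding T_def[abs_def] by (intro borel_measurable_divide measurable_compose[OF um borel_measurable_trunc] borel_measurable_const)
  have Tb: "\<bar>T n x\<bar> \<le> 1" for n x
    using trunc_bound[of "a - r n" a "u x"] r[of n] by (simp add: T_def abs_divide divide_le_eq)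
  have Im: "(\<lambda>x. indicat_real {a..} (u x)) \<in> borel_measurable M"
    by (rule measurable_compose[OF um]) measurable
  have lim: "AE x in M. (\<lambda>n. T n x) \<longlonglongrightarrow> indicator {a..} (u x)"
    unfolding T_def r_def by (intro AE_I2 trunc_quotient_tendsto a)
  show "(\<lambda>n. \<alpha> * (LINT x|M. u x * T n x)) \<longlonglongrightarrow> \<alpha> * (LINT x|M. u x * indicator {a..} (u x))"
    by (intro tendsto_mult_left bounded_mult_tendsto[OF low_integrable(3)[OF H] Tm Tb Im lim])
  show "(\<lambda>n. LINT x|M. f x * T n x) \<longlonglongrightarrow> (LINT x|M. f x * indicator {a..} (u x))"
    by (rule bounded_mult_tendsto[OF f Tm Tb Im lim])
  have "\<alpha> * (LINT x|M. u x * T n x) \<le> (LINT x|M. f x * T n x)" for n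
  proof -
    let ?t = "\<lambda>x. trunc (a - r n) a (u x)"
    have ab: "a - r n < a" using r by simp
    have "(LINT x|M. \<alpha> * (u x * ?t x)) \<le> (LINT x|M. f x * ?t x)"
    proof -
      have "0 \<le> lam * (nrm2 M (\<lambda>x. indicator {a - r n<..<a} (u x) *\<^sub>R G x))\<^sup>2" using lam by simp
      then show ?thesis
        using truncation_inequality(1)[OF u ab] unfolding inner_zero_left Bochner_Integration.integral_zero
        by linarith
    qed
    then have "(\<alpha> * (LINT x|M. u x * ?t x)) / r n \<le> (LINT x|M. f x * ?t x) / r n"
      using r[of n] by (simp add: divide_right_mono)
    moreover have "(LINT x|M. h x * T n x) = (LINT x|M. h x * ?t x) / r n" for h
      by (simp add: T_def)
    ultimately show ?thesis by simp
  qed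
  then show "\<exists>N. \<forall>n\<ge>N. \<alpha> * (LINT x|M. u x * T n x) \<le> (LINT x|M. f x * T n x)" by blast
qed

text \<open>The level inequalities for \<open>u\<close> and \<open>- u\<close> are added; for
  \<open>a > 0\<close> their level sets are disjoint and together make up that of
  \<open>\<bar>u\<bar>\<close>.\<close>

lemma abs_level_inequality:
  assumes u: "sol f (\<lambda>x. 0) u G" and a: "0 < a"
  shows "\<alpha> * (LINT x|M. \<bar>u x\<bar> * indicator {a..} \<bar>u x\<bar>) \<le> (LINT x|M. \<bar>f x\<bar> * indicator {a..} \<bar>u x\<bar>)"
proof -
  have f: "integrable M f" and H: "H0 U u G" using u by (auto simp: sol_def)
  have um: "u \<in> borel_measurable M" by (rule L2_measurable[OF H0_L2(1)[OF H]])
  have ui: "integrable M u" by (rule low_integrable(3)[OF H])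
  let ?p = "\<lambda>x. indicat_real {a..} (u x)" and ?m = "\<lambda>x. indicat_real {a..} (- u x)"
  have pm: "?p \<in> borel_measurable M" by (rule measurable_compose[OF um]) measurable
  have mm: "?m \<in> borel_measurable M"
    by (rule measurable_compose[OF borel_measurable_uminus[OF um]]) measurable
  have I: "integrable M (\<lambda>x. h x * ?p x)" "integrable M (\<lambda>x. h x * ?m x)" if "integrable M h" for h :: "real^'n \<Rightarrow> real"
    by (rule integrable_mult_bounded[OF that pm, of 1], simp add: indicator_def)
       (rule integrable_mult_bounded[OF that mm, of 1], simp add: indicator_def)
  have u': "sol (\<lambda>x. - f x) (\<lambda>x. 0) (\<lambda>x. - u x) (\<lambda>x. - G x)" using sol_uminus[OF u] by simp
  have e: "\<bar>h x\<bar> * indicator {a..} \<bar>u x\<bar> = \<bar>h x\<bar> * ?p x + \<bar>h x\<bar> * ?m x" for h :: "real^'n \<Rightarrow> real" and x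
    using a by (auto simp: indicator_def)
  have eu: "\<bar>u x\<bar> * ?p x = u x * ?p x" "\<bar>u x\<bar> * ?m x = - u x * ?m x" for x
    using a by (auto simp: indicator_def)
  have "\<alpha> * (LINT x|M. \<bar>u x\<bar> * indicator {a..} \<bar>u x\<bar>) =
      \<alpha> * (LINT x|M. u x * ?p x) + \<alpha> * (LINT x|M. - u x * ?m x)"
    unfolding e eu using I[OF ui] by (simp add: algebra_simps)
  also have "\<dots> \<le> (LINT x|M. f x * ?p x) + (LINT x|M. - f x * ?m x)"
    by (intro add_mono level_inequality[OF u a] level_inequality[OF u' a])
  also have "\<dots> \<le> (LINT x|M. \<bar>f x\<bar> * ?p x) + (LINT x|M. \<bar>f x\<bar> * ?m x)"
    using I[OF f] I[OF integrable_abs[OF f]]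
    by (intro add_mono integral_mono) (auto simp: indicator_def)
  also have "\<dots> = (LINT x|M. \<bar>f x\<bar> * indicator {a..} \<bar>u x\<bar>)"
    unfolding e using I[OF integrable_abs[OF f]] by simp
  finally show ?thesis .
qed

section \<open>Contraction for data without divergence part\<close>

text \<open>At the endpoint \<open>r = 1\<close> the weight \<open>a powr (r - 2)\<close> is not
  integrable at 0; instead \<open>a\<close> tends to 0 in the level inequality.\<close>

lemma contraction_L1:
  assumes u: "sol f (\<lambda>x. 0) u G"
  shows "\<alpha> * (LINT x|M. \<bar>u x\<bar>) \<le> (LINT x|M. \<bar>f x\<bar>)"
proof -
  have f: "integrable M f" and H: "H0 U u G" using u by (auto simp: sol_def)
  have um: "u \<in> borel_measurable M" by (rule L2_measurable[OF H0_L2(1)[OF H]])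
  have ui: "integrable M u" by (rule low_integrable(3)[OF H])
  let ?I = "\<lambda>n x. indicat_real {inverse (real (Suc n))..} \<bar>u x\<bar>"
  have Im: "?I n \<in> borel_measurable M" for n
    by (rule measurable_compose[OF borel_measurable_abs[OF um]]) measurable
  have "(\<lambda>n. LINT x|M. \<bar>u x\<bar> * ?I n x) \<longlonglongrightarrow> (LINT x|M. \<bar>u x\<bar>)"
  proof (rule integral_dominated_convergence[OF _ _ integrable_abs[OF ui]])
    show "AE x in M. (\<lambda>n. \<bar>u x\<bar> * ?I n x) \<longlonglongrightarrow> \<bar>u x\<bar>"
    proof (rule AE_I2)
      fix x
      show "(\<lambda>n. \<bar>u x\<bar> * ?I n x) \<longlonglongrightarrow> \<bar>u x\<bar>"
      proof (cases "u x = 0")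
        case False
        have "\<forall>\<^sub>F n in sequentially. inverse (real (Suc n)) < \<bar>u x\<bar>"
          by (rule order_tendstoD(2)[OF LIMSEQ_inverse_real_of_nat]) (use False in simp)
        then have "\<forall>\<^sub>F n in sequentially. \<bar>u x\<bar> * ?I n x = \<bar>u x\<bar>"
          by eventually_elim (simp add: less_imp_le del: of_nat_Suc)
        then show ?thesis by (rule tendsto_eventually)
      qed simp
    qed
    show "AE x in M. norm (\<bar>u x\<bar> * ?I n x) \<le> \<bar>u x\<bar>" for n
      by (intro AE_I2) (simp add: indicator_def)
  qed (use um Im in \<open>auto intro!: borel_measurable_times\<close>)
  then have "(\<lambda>n. \<alpha> * (LINT x|M. \<bar>u x\<bar> * ?I n x)) \<longlonglongrightarrow> \<alpha> * (LINT x|M. \<bar>u x\<bar>)" by (rule tendsto_mult_left)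
  moreover have "\<alpha> * (LINT x|M. \<bar>u x\<bar> * ?I n x) \<le> (LINT x|M. \<bar>f x\<bar>)" for n
  proof -
    have "\<alpha> * (LINT x|M. \<bar>u x\<bar> * ?I n x) \<le> (LINT x|M. \<bar>f x\<bar> * ?I n x)"
      by (rule abs_level_inequality[OF u]) simp
    also have "\<dots> \<le> (LINT x|M. \<bar>f x\<bar>)"
      by (intro integral_mono integrable_mult_bounded[OF integrable_abs[OF f] Im[of n], of 1] integrable_abs[OF f])
         (auto simp: indicator_def)
    finally show ?thesis .
  qed
  ultimately show ?thesis by (intro LIMSEQ_le_const2) auto
qed

text \<open>For \<open>\<alpha> * a > C\<close> the level inequality bounds a positive multiple of
  the measure of \<open>\<bar>u\<bar> \<ge> a\<close> by 0.\<close>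

lemma contraction_Linf:
  assumes u: "sol f (\<lambda>x. 0) u G" and \<alpha>p: "0 < \<alpha>" and C: "0 \<le> C" "AE x in M. \<bar>f x\<bar> \<le> C"
  shows "AE x in M. \<bar>u x\<bar> \<le> inverse \<alpha> * C"
proof -
  have f: "integrable M f" and H: "H0 U u G" using u by (auto simp: sol_def)
  have um: "u \<in> borel_measurable M" by (rule L2_measurable[OF H0_L2(1)[OF H]])
  have ui: "integrable M u" by (rule low_integrable(3)[OF H])
  have below: "AE x in M. \<bar>u x\<bar> < a" if a: "inverse \<alpha> * C < a" for a
  proof -
    have a0: "0 < a" using a C(1) \<alpha>p by (meson le_less_trans less_imp_le mult_nonneg_nonneg positive_imp_inverse_positive)
    have Ca: "C < \<alpha> * a" using a \<alpha>p by (simp add: field_simps)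
    let ?I = "\<lambda>x. indicat_real {a..} \<bar>u x\<bar>"
    have Im: "?I \<in> borel_measurable M"
      by (rule measurable_compose[OF borel_measurable_abs[OF um]]) measurable
    have Ii: "integrable M ?I" by (rule integrable_const_bound[of _ 1]) (auto simp: Im)
    have J: "integrable M (\<lambda>x. \<bar>h x\<bar> * ?I x)" if "integrable M h" for h :: "real^'n \<Rightarrow> real"
      by (rule integrable_mult_bounded[OF integrable_abs[OF that] Im, of 1]) (simp add: indicator_def)
    have "\<alpha> * a * (LINT x|M. ?I x) = \<alpha> * (LINT x|M. a * ?I x)" by simp
    also have "\<dots> \<le> \<alpha> * (LINT x|M. \<bar>u x\<bar> * ?I x)"
      using \<alpha>p Ii J[OF ui] by (intro mult_left_mono integral_mono) (auto simp: indicator_def)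
    also have "\<dots> \<le> (LINT x|M. \<bar>f x\<bar> * ?I x)" by (rule abs_level_inequality[OF u a0])
    also have "\<dots> \<le> (LINT x|M. C * ?I x)"
      using Ii J[OF f] C(2) by (intro integral_mono_AE) (auto elim!: eventually_mono simp: indicator_def)
    finally have "(\<alpha> * a - C) * (LINT x|M. ?I x) \<le> 0" by (simp add: algebra_simps)
    then have "(LINT x|M. ?I x) \<le> 0" using Ca by (simp add: mult_le_0_iff)
    moreover have "0 \<le> (LINT x|M. ?I x)" by (rule Bochner_Integration.integral_nonneg) simp
    ultimately have "(LINT x|M. ?I x) = 0" by (rule antisym)
    then have "AE x in M. ?I x = 0"
      using integral_nonneg_eq_0_iff_AE[OF Ii] by simp
    then show ?thesis by eventually_elim (auto simp: indicator_def split: if_splits)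
  qed
  have "AE x in M. \<bar>u x\<bar> < inverse \<alpha> * C + inverse (real (Suc n))" for n
    by (rule below) simp
  then have "AE x in M. \<forall>n. \<bar>u x\<bar> < inverse \<alpha> * C + inverse (real (Suc n))"
    by (simp add: AE_all_countable del: of_nat_Suc)
  then show ?thesis
  proof eventually_elim
    case (elim x)
    have "(\<lambda>n. inverse \<alpha> * C + inverse (real (Suc n))) \<longlonglongrightarrow> inverse \<alpha> * C + 0"
      by (intro tendsto_intros LIMSEQ_inverse_real_of_nat)
    then have "\<bar>u x\<bar> \<le> inverse \<alpha> * C + 0"
      by (rule LIMSEQ_le_const) (use elim in \<open>auto intro: less_imp_le\<close>)
    then show ?case by simp
  qed
qed

lemma nn_integral_powr_layer:
  assumes r: "1 < r" and w: "0 \<le> w"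
  shows "(\<integral>\<^sup>+a. indicator {0..w} a * ennreal (a powr (r - 2)) \<partial>lborel) = ennreal (w powr (r - 1) / (r - 1))"
proof -
  have "((\<lambda>a. a powr (r - 2)) has_integral (w powr (r - 2 + 1) / (r - 2 + 1))) {0..w}"
    by (rule has_integral_powr_from_0) (use r w in auto)
  then have h: "((\<lambda>a. a powr (r - 2)) has_integral (w powr (r - 1) / (r - 1))) {0..w}" by simp
  have "((\<lambda>a. if a \<in> {0..w} then a powr (r - 2) else 0) has_integral (w powr (r - 1) / (r - 1))) UNIV"
    using h by (simp only: has_integral_restrict_UNIV)
  then have "(\<integral>\<^sup>+a. ennreal (if a \<in> {0..w} then a powr (r - 2) else 0) \<partial>lborel) = ennreal (w powr (r - 1) / (r - 1))"
    by (intro nn_integral_has_integral_lborel) auto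
  moreover have "ennreal (if a \<in> {0..w} then a powr (r - 2) else 0) = indicator {0..w} a * ennreal (a powr (r - 2))" for a
    by (simp add: indicator_def)
  ultimately show ?thesis by simp
qed

text \<open>Integrating the level-set inequality against \<open>a powr (r - 2)\<close> over \<open>0 < a \<le> n\<close>.\<close>

lemma layer_cake_inequality:
  assumes u: "sol f (\<lambda>x. 0) u G" and r: "1 < r" and n: "0 \<le> n"
  shows "\<alpha> * (LINT x|M. \<bar>u x\<bar> * min \<bar>u x\<bar> n powr (r - 1)) \<le> (LINT x|M. \<bar>f x\<bar> * min \<bar>u x\<bar> n powr (r - 1))"
proof -
  have f: "integrable M f" and H: "H0 U u G" using u by (auto simp: sol_def)
  have [measurable]: "u \<in> borel_measurable M" by (rule L2_measurable[OF H0_L2(1)[OF H]])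
  have ui: "integrable M u" by (rule low_integrable(3)[OF H])
  have [measurable]: "f \<in> borel_measurable M" using f by (rule borel_measurable_integrable)
  let ?w = "\<lambda>x. min \<bar>u x\<bar> n"
  interpret LM: pair_sigma_finite lborel M by standard
  \<comment> \<open>The power of \<open>min \<bar>u x\<bar> n\<close> is \<open>r - 1\<close> times
    the integral of \<open>a powr (r - 2)\<close> over the levels \<open>a\<close> up to it, and
    Tonelli exchanges the integrals. It is stated for general \<open>h\<close> because both
    \<open>u\<close> and \<open>f\<close> are inserted.\<close>
  have layer: "(\<integral>\<^sup>+x. ennreal (\<bar>h x\<bar> * ?w x powr (r - 1)) \<partial>M) = ennreal (r - 1) *
      (\<integral>\<^sup>+a. indicator {0..n} a * ennreal (a powr (r - 2)) * (\<integral>\<^sup>+x. ennreal (\<bar>h x\<bar> * indicator {a..} \<bar>u x\<bar>) \<partial>M) \<partial>lborel)"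
    if [measurable]: "h \<in> borel_measurable M" for h :: "real^'n \<Rightarrow> real"
  proof -
    have "ennreal (\<bar>h x\<bar> * ?w x powr (r - 1)) =
        (\<integral>\<^sup>+a. ennreal (r - 1) * (indicator {0..n} a * ennreal (a powr (r - 2)) * ennreal (\<bar>h x\<bar> * indicator {a..} \<bar>u x\<bar>)) \<partial>lborel)" for x
    proof -
      have "ennreal (\<bar>h x\<bar> * ?w x powr (r - 1)) = ennreal ((r - 1) * \<bar>h x\<bar>) * ennreal (?w x powr (r - 1) / (r - 1))"
        using r by (subst ennreal_mult[symmetric]) auto
      also have "ennreal (?w x powr (r - 1) / (r - 1)) = (\<integral>\<^sup>+a. indicator {0..?w x} a * ennreal (a powr (r - 2)) \<partial>lborel)"
        using n by (intro nn_integral_powr_layer[OF r, symmetric]) auto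
      also have "ennreal ((r - 1) * \<bar>h x\<bar>) * \<dots> =
          (\<integral>\<^sup>+a. ennreal ((r - 1) * \<bar>h x\<bar>) * (indicator {0..?w x} a * ennreal (a powr (r - 2))) \<partial>lborel)"
        by (intro nn_integral_cmult[symmetric]) measurable
      also have "\<dots> = (\<integral>\<^sup>+a. ennreal (r - 1) * (indicator {0..n} a * ennreal (a powr (r - 2)) * ennreal (\<bar>h x\<bar> * indicator {a..} \<bar>u x\<bar>)) \<partial>lborel)"
        using r by (intro nn_integral_cong) (auto simp: indicator_def ennreal_mult mult_ac)
      finally show ?thesis .
    qed
    then have "(\<integral>\<^sup>+x. ennreal (\<bar>h x\<bar> * ?w x powr (r - 1)) \<partial>M) =
        (\<integral>\<^sup>+x. \<integral>\<^sup>+a. ennreal (r - 1) * (indicator {0..n} a * ennreal (a powr (r - 2)) * ennreal (\<bar>h x\<bar> * indicator {a..} \<bar>u x\<bar>)) \<partial>lborel \<partial>M)"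
      by (intro nn_integral_cong)
    also have "\<dots> = (\<integral>\<^sup>+a. \<integral>\<^sup>+x. ennreal (r - 1) * (indicator {0..n} a * ennreal (a powr (r - 2)) * ennreal (\<bar>h x\<bar> * indicator {a..} \<bar>u x\<bar>)) \<partial>M \<partial>lborel)"
    proof (rule LM.Fubini')
      have [measurable]: "Measurable.pred (lborel \<Otimes>\<^sub>M M) (\<lambda>z. fst z \<le> \<bar>u (snd z)\<bar>)" by measurable
      have e: "(\<lambda>(a, x). ennreal (r - 1) * (indicator {0..n} a * ennreal (a powr (r - 2)) * ennreal (\<bar>h x\<bar> * indicator {a..} \<bar>u x\<bar>))) =
          (\<lambda>z. ennreal (r - 1) * (indicator {0..n} (fst z) * ennreal (fst z powr (r - 2)) *
            ennreal (\<bar>h (snd z)\<bar> * (if fst z \<le> \<bar>u (snd z)\<bar> then 1 else 0))))"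
        by (auto simp: fun_eq_iff indicator_def)
      show "(\<lambda>(a, x). ennreal (r - 1) * (indicator {0..n} a * ennreal (a powr (r - 2)) * ennreal (\<bar>h x\<bar> * indicator {a..} \<bar>u x\<bar>)))
          \<in> borel_measurable (lborel \<Otimes>\<^sub>M M)"
        unfolding e by measurable
    qed
    also have "\<dots> = (\<integral>\<^sup>+a. ennreal (r - 1) * (indicator {0..n} a * ennreal (a powr (r - 2)) * (\<integral>\<^sup>+x. ennreal (\<bar>h x\<bar> * indicator {a..} \<bar>u x\<bar>) \<partial>M)) \<partial>lborel)"
    proof (intro nn_integral_cong)
      fix a
      have [measurable]: "(\<lambda>x. indicat_real {a..} \<bar>u x\<bar>) \<in> borel_measurable M" by measurable
      show "(\<integral>\<^sup>+x. ennreal (r - 1) * (indicator {0..n} a * ennreal (a powr (r - 2)) * ennreal (\<bar>h x\<bar> * indicator {a..} \<bar>u x\<bar>)) \<partial>M) =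
          ennreal (r - 1) * (indicator {0..n} a * ennreal (a powr (r - 2)) * (\<integral>\<^sup>+x. ennreal (\<bar>h x\<bar> * indicator {a..} \<bar>u x\<bar>) \<partial>M))"
        by (simp add: nn_integral_cmult mult.assoc)
    qed
    also have "\<dots> = ennreal (r - 1) *
        (\<integral>\<^sup>+a. indicator {0..n} a * ennreal (a powr (r - 2)) * (\<integral>\<^sup>+x. ennreal (\<bar>h x\<bar> * indicator {a..} \<bar>u x\<bar>) \<partial>M) \<partial>lborel)"
    proof (rule nn_integral_cmult)
      have e: "(\<lambda>a. \<integral>\<^sup>+x. ennreal (\<bar>h x\<bar> * indicator {a..} \<bar>u x\<bar>) \<partial>M) = (\<lambda>a. \<integral>\<^sup>+x. ennreal (\<bar>h x\<bar> * (if a \<le> \<bar>u x\<bar> then 1 else 0)) \<partial>M)"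
        by (intro ext nn_integral_cong) (simp add: indicator_def)
      have B: "(\<lambda>a. \<integral>\<^sup>+x. ennreal (\<bar>h x\<bar> * indicator {a..} \<bar>u x\<bar>) \<partial>M) \<in> borel_measurable lborel"
        unfolding e by measurable
      have "(\<lambda>a. indicator {0..n} a * ennreal (a powr (r - 2))) \<in> borel_measurable lborel" by measurable
      from borel_measurable_times_ennreal[OF this B] show "(\<lambda>a. indicator {0..n} a * ennreal (a powr (r - 2)) * (\<integral>\<^sup>+x. ennreal (\<bar>h x\<bar> * indicator {a..} \<bar>u x\<bar>) \<partial>M)) \<in> borel_measurable lborel"
        .
    qed
    finally show ?thesis .
  qed
  have lev: "ennreal \<alpha> * (\<integral>\<^sup>+x. ennreal (\<bar>u x\<bar> * indicator {a..} \<bar>u x\<bar>) \<partial>M) \<le> (\<integral>\<^sup>+x. ennreal (\<bar>f x\<bar> * indicator {a..} \<bar>u x\<bar>) \<partial>M)"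
    if a: "0 < a" for a
  proof -
    have Im: "(\<lambda>x. indicat_real {a..} \<bar>u x\<bar>) \<in> borel_measurable M" by measurable
    have J: "integrable M (\<lambda>x. \<bar>h x\<bar> * indicator {a..} \<bar>u x\<bar>)" if "integrable M h" for h :: "real^'n \<Rightarrow> real"
      by (rule integrable_mult_bounded[OF integrable_abs[OF that] Im, of 1]) (simp add: indicator_def)
    show ?thesis
      using abs_level_inequality[OF u a] \<alpha> J[OF ui] J[OF f]
      by (simp add: nn_integral_eq_integral ennreal_mult[symmetric] ennreal_leI)
  qed
  have "ennreal \<alpha> * (\<integral>\<^sup>+x. ennreal (\<bar>u x\<bar> * ?w x powr (r - 1)) \<partial>M) \<le> (\<integral>\<^sup>+x. ennreal (\<bar>f x\<bar> * ?w x powr (r - 1)) \<partial>M)"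
  proof -
    let ?k = "\<lambda>a. indicator {0..n} a * ennreal (a powr (r - 2))"
    let ?L = "\<lambda>h a. \<integral>\<^sup>+x. ennreal (\<bar>h x\<bar> * indicator {a..} \<bar>u x\<bar>) \<partial>M"
    have um: "(\<lambda>a. ?L u a) \<in> borel_measurable lborel"
    proof -
      have e: "(\<lambda>a. ?L u a) = (\<lambda>a. \<integral>\<^sup>+x. ennreal (\<bar>u x\<bar> * (if a \<le> \<bar>u x\<bar> then 1 else 0)) \<partial>M)"
        by (intro ext nn_integral_cong) (simp add: indicator_def)
      show ?thesis unfolding e by measurable
    qed
    have "ennreal \<alpha> * (\<integral>\<^sup>+a. ?k a * ?L u a \<partial>lborel) = (\<integral>\<^sup>+a. ennreal \<alpha> * (?k a * ?L u a) \<partial>lborel)"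
      by (intro nn_integral_cmult[symmetric] borel_measurable_times_ennreal um) measurable
    also have "\<dots> \<le> (\<integral>\<^sup>+a. ?k a * ?L f a \<partial>lborel)"
    proof (rule nn_integral_mono_AE)
      \<comment> \<open>The level inequality requires \<open>a > 0\<close>; the single level 0 is a
        null set.\<close>
      have "AE a in lborel. a \<noteq> (0::real)" by (rule AE_lborel_singleton)
      then show "AE a in lborel. ennreal \<alpha> * (?k a * ?L u a) \<le> ?k a * ?L f a"
      proof eventually_elim
        case (elim a)
        show ?case
        proof (cases "0 < a")
          case True
          then show ?thesis using mult_left_mono[OF lev[OF True], of "?k a"] by (simp add: mult_ac)
        next
          case False
          then show ?thesis using elim by (simp add: indicator_def)
        qed
      qed
    qed
    finally have "ennreal (r - 1) * (ennreal \<alpha> * (\<integral>\<^sup>+a. ?k a * ?L u a \<partial>lborel)) \<le> ennreal (r - 1) * (\<integral>\<^sup>+a. ?k a * ?L f a \<partial>lborel)"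
      by (rule mult_left_mono) simp
    then show ?thesis
      unfolding layer[OF \<open>u \<in> borel_measurable M\<close>] layer[OF \<open>f \<in> borel_measurable M\<close>]
      by (simp add: mult.left_commute)
  qed
  moreover have W: "integrable M (\<lambda>x. \<bar>h x\<bar> * ?w x powr (r - 1))" if "integrable M h" for h :: "real^'n \<Rightarrow> real"
    by (rule integrable_mult_bounded[OF integrable_abs[OF that], of _ "n powr (r - 1)"])
       (use r n in \<open>auto intro!: powr_mono2\<close>)
  ultimately have "ennreal (\<alpha> * (LINT x|M. \<bar>u x\<bar> * ?w x powr (r - 1))) \<le> ennreal (LINT x|M. \<bar>f x\<bar> * ?w x powr (r - 1))"
    using W[OF ui] W[OF f] \<alpha> by (simp add: nn_integral_eq_integral ennreal_mult[symmetric])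
  then show ?thesis by (subst (asm) ennreal_le_iff) (auto intro!: Bochner_Integration.integral_nonneg)
qed

text \<open>The cap \<open>n\<close> makes \<open>W\<close> finite before integrability of
  \<open>\<bar>u\<bar> powr r\<close> is known. Replacing one factor \<open>\<bar>u x\<bar>\<close>
  by its capped value and using Hoelder gives
  \<open>\<alpha> * W \<le> N * W powr (1 - 1/r)\<close>, where a power of \<open>W\<close> cancels;
  Fatou removes the cap.\<close>

lemma contraction_Lr:
  assumes u: "sol f (\<lambda>x. 0) u G" and \<alpha>p: "0 < \<alpha>" and r: "1 < r"
    and f: "f \<in> borel_measurable M" "integrable M (\<lambda>x. \<bar>f x\<bar> powr r)"
  shows "integrable M (\<lambda>x. \<bar>u x\<bar> powr r)"
    and "(LINT x|M. \<bar>u x\<bar> powr r) powr (1/r) \<le> inverse \<alpha> * (LINT x|M. \<bar>f x\<bar> powr r) powr (1/r)"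
proof -
  have H: "H0 U u G" using u by (auto simp: sol_def)
  have [measurable]: "u \<in> borel_measurable M" by (rule L2_measurable[OF H0_L2(1)[OF H]])
  have ui: "integrable M u" by (rule low_integrable(3)[OF H])
  define N where "N = (LINT x|M. \<bar>f x\<bar> powr r) powr (1/r)"
  have N0: "0 \<le> N" by (simp add: N_def)
  have bound: "(LINT x|M. min \<bar>u x\<bar> n powr r) \<le> (inverse \<alpha> * N) powr r \<and> integrable M (\<lambda>x. min \<bar>u x\<bar> n powr r)"
    if n: "0 \<le> n" for n
  proof -
    let ?w = "\<lambda>x. min \<bar>u x\<bar> n"
    define W where "W = (LINT x|M. ?w x powr r)"
    have w0: "0 \<le> ?w x" for x using n by simp
    have Wi: "integrable M (\<lambda>x. ?w x powr r)"
      by (rule integrable_const_bound[of _ "n powr r"]) (use r n in \<open>auto intro!: powr_mono2\<close>)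
    have W0: "0 \<le> W" by (simp add: W_def)
    have e1: "\<bar>?w x powr (r - 1)\<bar> powr (r / (r - 1)) = ?w x powr r" for x
      using r by (simp add: powr_powr)
    have e2: "?w x powr r = ?w x * ?w x powr (r - 1)" for x
      using w0[of x] r powr_mult_base[OF w0, of x "r - 1"] by simp
    have uW: "integrable M (\<lambda>x. \<bar>u x\<bar> * ?w x powr (r - 1))"
      by (rule integrable_mult_bounded[OF integrable_abs[OF ui], of _ "n powr (r - 1)"])
         (use r n in \<open>auto intro!: powr_mono2\<close>)
    have "\<alpha> * W \<le> \<alpha> * (LINT x|M. \<bar>u x\<bar> * ?w x powr (r - 1))"
      unfolding W_def e2 using \<alpha> Wi uW unfolding e2 by (intro mult_left_mono integral_mono mult_right_mono) auto
    also have "\<dots> \<le> (LINT x|M. \<bar>f x\<bar> * ?w x powr (r - 1))" by (rule layer_cake_inequality[OF u r n])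
    also have "\<dots> = (LINT x|M. \<bar>f x * ?w x powr (r - 1)\<bar>)" by (simp add: abs_mult)
    also have "\<dots> \<le> N * (LINT x|M. \<bar>?w x powr (r - 1)\<bar> powr (r / (r - 1))) powr (1 / (r / (r - 1)))"
      unfolding N_def
    proof (rule Hoelder(2)[OF f(1) _ _ _ _ f(2)])
      show "1 / r + 1 / (r / (r - 1)) = 1" using r by (simp add: field_simps)
      show "integrable M (\<lambda>x. \<bar>?w x powr (r - 1)\<bar> powr (r / (r - 1)))" unfolding e1 by (rule Wi)
    qed (use r in auto)
    also have "\<dots> = N * W powr (1 - 1/r)" unfolding e1 W_def using r by (simp add: diff_divide_distrib)
    finally have le: "\<alpha> * W \<le> N * W powr (1 - 1/r)" .
    have "W powr (1/r) \<le> inverse \<alpha> * N"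
    proof (cases "W = 0")
      case True
      then show ?thesis using N0 \<alpha>p by simp
    next
      case False
      then have Wp: "0 < W" using W0 by simp
      have "W = W powr (1/r) * W powr (1 - 1/r)" using Wp by (simp add: powr_add[symmetric])
      then have "(\<alpha> * W powr (1/r)) * W powr (1 - 1/r) \<le> N * W powr (1 - 1/r)"
        using le by (simp add: mult.assoc)
      then have "\<alpha> * W powr (1/r) \<le> N" using Wp by simp
      then show ?thesis using \<alpha>p by (simp add: field_simps)
    qed
    then have "(W powr (1/r)) powr r \<le> (inverse \<alpha> * N) powr r" using r by (intro powr_mono2) auto
    then show ?thesis using Wi W0 r by (simp add: powr_powr W_def)
  qed
  have "(\<integral>\<^sup>+x. ennreal (\<bar>u x\<bar> powr r) \<partial>M) = (\<integral>\<^sup>+x. liminf (\<lambda>n. ennreal (min \<bar>u x\<bar> (real n) powr r)) \<partial>M)"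
  proof (rule nn_integral_cong)
    fix x
    obtain N :: nat where N: "\<bar>u x\<bar> < real N" using reals_Archimedean2 by blast
    have "\<forall>\<^sub>F n in sequentially. ennreal (min \<bar>u x\<bar> (real n) powr r) = ennreal (\<bar>u x\<bar> powr r)"
    proof (rule eventually_sequentiallyI[of N])
      fix n assume "N \<le> n"
      then have "\<bar>u x\<bar> \<le> real n" using N by (meson less_imp_le less_le_trans of_nat_le_iff)
      then show "ennreal (min \<bar>u x\<bar> (real n) powr r) = ennreal (\<bar>u x\<bar> powr r)" by (simp add: min_absorb1)
    qed
    then have "(\<lambda>n. ennreal (min \<bar>u x\<bar> (real n) powr r)) \<longlonglongrightarrow> ennreal (\<bar>u x\<bar> powr r)" by (rule tendsto_eventually)
    then show "ennreal (\<bar>u x\<bar> powr r) = liminf (\<lambda>n. ennreal (min \<bar>u x\<bar> (real n) powr r))"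
      by (intro lim_imp_Liminf[symmetric]) auto
  qed
  also have "\<dots> \<le> liminf (\<lambda>n. \<integral>\<^sup>+x. ennreal (min \<bar>u x\<bar> (real n) powr r) \<partial>M)"
    by (rule nn_integral_liminf) measurable
  also have "\<dots> \<le> liminf (\<lambda>n::nat. ennreal ((inverse \<alpha> * N) powr r))"
  proof (intro Liminf_mono always_eventually allI)
    fix n :: nat
    show "(\<integral>\<^sup>+x. ennreal (min \<bar>u x\<bar> (real n) powr r) \<partial>M) \<le> ennreal ((inverse \<alpha> * N) powr r)"
      using bound[of "real n"] by (simp add: nn_integral_eq_integral ennreal_leI)
  qed
  also have "\<dots> = ennreal ((inverse \<alpha> * N) powr r)" by (intro Liminf_const) auto
  finally have le: "(\<integral>\<^sup>+x. ennreal (\<bar>u x\<bar> powr r) \<partial>M) \<le> ennreal ((inverse \<alpha> * N) powr r)" .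
  then have "(\<integral>\<^sup>+x. ennreal (norm (\<bar>u x\<bar> powr r)) \<partial>M) < \<infinity>" by (simp add: order_le_less_trans)
  then show int: "integrable M (\<lambda>x. \<bar>u x\<bar> powr r)" by (intro integrableI_bounded) auto
  have "(LINT x|M. \<bar>u x\<bar> powr r) \<le> (inverse \<alpha> * N) powr r"
    using le int by (simp add: nn_integral_eq_integral)
  then have "(LINT x|M. \<bar>u x\<bar> powr r) powr (1/r) \<le> ((inverse \<alpha> * N) powr r) powr (1/r)"
    using r by (intro powr_mono2) auto
  also have "\<dots> = inverse \<alpha> * N" using r N0 \<alpha>p by (simp add: powr_powr)
  finally show "(LINT x|M. \<bar>u x\<bar> powr r) powr (1/r) \<le> inverse \<alpha> * (LINT x|M. \<bar>f x\<bar> powr r) powr (1/r)"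
    by (simp add: N_def)
qed

end

section \<open>Essential suprema and Minkowski's inequality\<close>

lemma essentially_bounded_Lp_infinity:
  fixes f :: "'a \<Rightarrow> 'b::euclidean_space"
  assumes f: "f \<in> borel_measurable M" "AE x in M. norm (f x) \<le> C" and C: "0 \<le> C"
  shows "f \<in> Lp_space M \<infinity>" "Lp_norm M \<infinity> f \<le> C"
proof -
  have e: "esssup M (\<lambda>x. ennreal (norm (f x))) \<le> ennreal C"
    using f by (intro esssup_I) (auto simp: ennreal_leI elim!: eventually_mono)
  then show "f \<in> Lp_space M \<infinity>" using f(1) by (auto simp: Lp_space_def intro: order_le_less_trans)
  have "enn2real (esssup M (\<lambda>x. ennreal (norm (f x)))) \<le> enn2real (ennreal C)"
    by (rule enn2real_mono[OF e]) simp
  then show "Lp_norm M \<infinity> f \<le> C" using C by (simp add: Lp_norm_def)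
qed

lemma Lp_infinity_essentially_bounded:
  fixes f :: "'a \<Rightarrow> 'b::euclidean_space"
  assumes "f \<in> Lp_space M \<infinity>"
  shows "f \<in> borel_measurable M" "AE x in M. norm (f x) \<le> Lp_norm M \<infinity> f"
proof -
  let ?e = "esssup M (\<lambda>x. ennreal (norm (f x)))"
  show "f \<in> borel_measurable M" using assms by (simp add: Lp_space_def)
  have fin: "?e < \<infinity>" using assms by (simp add: Lp_space_def)
  have "AE x in M. ennreal (norm (f x)) \<le> ?e" by (rule esssup_AE)
  then show "AE x in M. norm (f x) \<le> Lp_norm M \<infinity> f"
  proof eventually_elim
    case (elim x)
    then have "enn2real (ennreal (norm (f x))) \<le> enn2real ?e" using fin by (intro enn2real_mono) auto
    then show ?case by (simp add: Lp_norm_def)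
  qed
qed

text \<open>Convexity of the power at \<open>s / a\<close> and \<open>t / b\<close> with weights
  \<open>a / (a + b)\<close> and \<open>b / (a + b)\<close>: Minkowski's inequality before
  integration. Convexity is invoked on positive arguments; if \<open>s\<close> or \<open>t\<close>
  is 0, the estimate \<open>w powr r \<le> w\<close> for weights at most 1 suffices.\<close>

lemma powr_weighted_add_le:
  fixes s t :: real
  assumes "0 < a" "0 < b" "0 \<le> s" "0 \<le> t" and r: "1 \<le> r"
  shows "((s + t) / (a + b)) powr r \<le> a / (a + b) * (s / a) powr r + b / (a + b) * (t / b) powr r"
proof -
  have ab: "a / (a + b) + b / (a + b) = 1" using assms by (simp add: add_divide_distrib[symmetric])
  have le: "(w * z) powr r \<le> w * z powr r" if "0 \<le> w" "w \<le> 1" "0 \<le> z" for w z :: real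
  proof -
    have "w powr r \<le> w powr 1" using that r by (intro powr_mono') auto
    then have "w powr r \<le> w" using that by simp
    then show ?thesis using that by (simp add: powr_mult mult_right_mono)
  qed
  have st: "(s + t) / (a + b) = a / (a + b) * (s / a) + b / (a + b) * (t / b)"
    using assms by (simp add: add_divide_distrib)
  have w: "0 \<le> a / (a + b)" "a / (a + b) \<le> 1" "0 \<le> b / (a + b)" "b / (a + b) \<le> 1"
    using assms by (simp_all add: divide_le_eq)
  consider "s = 0" | "t = 0" | "0 < s" "0 < t" using assms by fastforce
  then show ?thesis
  proof cases
    case 1
    then show ?thesis unfolding st using le[OF w(3,4), of "t / b"] assms by simp
  next
    case 2
    then show ?thesis unfolding st using le[OF w(1,2), of "s / a"] assms by simp
  next
    case 3
    have "1 - b / (a + b) = a / (a + b)" using ab by simp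
    then have "(a / (a + b) * (s / a) + b / (a + b) * (t / b)) powr r \<le>
        a / (a + b) * (s / a) powr r + b / (a + b) * (t / b) powr r"
      using convex_onD[OF powr_convex[OF r] w(3,4), of "s / a" "t / b"] 3 assms(1,2)
      by (simp del: times_divide_eq_right times_divide_eq_left)
    then show ?thesis unfolding st .
  qed
qed

text \<open>The bounded summand contributes its sup bound times a power of the total mass, which is
  the origin of the factor |U|^(1/r) in the contraction property. The pointwise inequality is
  integrated with \<open>a\<close> and \<open>b\<close> slightly above the two norms, since these
  may be 0, and the excess is then removed.\<close>

lemma (in finite_measure) Minkowski_bounded:
  fixes f g :: "'a \<Rightarrow> real"
  assumes [measurable]: "f \<in> borel_measurable M" "g \<in> borel_measurable M" and r: "1 \<le> r"
    and f: "integrable M (\<lambda>x. \<bar>f x\<bar> powr r)" and g: "AE x in M. \<bar>g x\<bar> \<le> K" and K: "0 \<le> K"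
  shows "integrable M (\<lambda>x. \<bar>f x + g x\<bar> powr r)"
    and "(LINT x|M. \<bar>f x + g x\<bar> powr r) powr (1/r) \<le>
      (LINT x|M. \<bar>f x\<bar> powr r) powr (1/r) + measure M (space M) powr (1/r) * K"
proof -
  let ?m = "measure M (space M)"
  define N where "N = (LINT x|M. \<bar>f x\<bar> powr r) powr (1/r)"
  define m where "m = ?m powr (1/r) * K"
  have N0: "0 \<le> N" "0 \<le> m" using K by (simp_all add: N_def m_def)
  have Nr: "N powr r = (LINT x|M. \<bar>f x\<bar> powr r)" using r by (simp add: N_def powr_powr)
  have mr: "m powr r = ?m * K powr r" using r K by (simp add: m_def powr_powr powr_mult)
  have pt: "AE x in M. \<bar>f x + g x\<bar> powr r \<le>
      (a + b) powr r * (a / (a + b) * (\<bar>f x\<bar> powr r / a powr r) + b / (a + b) * (K powr r / b powr r))"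
    if ab: "0 < a" "0 < b" for a b
    using g
  proof eventually_elim
    case (elim x)
    have "\<bar>f x + g x\<bar> powr r \<le> (\<bar>f x\<bar> + K) powr r"
      using elim r by (intro powr_mono2) auto
    also have "\<dots> = (a + b) powr r * ((\<bar>f x\<bar> + K) / (a + b)) powr r"
      using ab K by (simp add: powr_divide)
    also have "\<dots> \<le> (a + b) powr r * (a / (a + b) * (\<bar>f x\<bar> / a) powr r + b / (a + b) * (K / b) powr r)"
      using ab K r by (intro mult_left_mono powr_weighted_add_le) auto
    finally show ?case using ab K by (simp add: powr_divide)
  qed
  show int: "integrable M (\<lambda>x. \<bar>f x + g x\<bar> powr r)"
  proof (rule Bochner_Integration.integrable_bound)
    \<comment> \<open>Any positive pair \<open>a\<close>, \<open>b\<close> yields an integrable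
      majorant; here both are 1.\<close>
    show "integrable M (\<lambda>x. (1 + 1) powr r * (1 / (1 + 1) * (\<bar>f x\<bar> powr r / 1 powr r) + 1 / (1 + 1) * (K powr r / 1 powr r)))"
      using f by auto
    show "AE x in M. norm (\<bar>f x + g x\<bar> powr r) \<le>
        norm ((1 + 1) powr r * (1 / (1 + 1) * (\<bar>f x\<bar> powr r / 1 powr r) + 1 / (1 + 1) * (K powr r / 1 powr r)))"
      using pt[of 1 1, OF zero_less_one zero_less_one] by eventually_elim (simp add: abs_of_nonneg)
  qed simp
  have le: "(LINT x|M. \<bar>f x + g x\<bar> powr r) powr (1/r) \<le> a + b" if ab: "N < a" "m < b" for a b
  proof -
    have p: "0 < a" "0 < b" using ab N0 by auto
    have le: "N powr r / a powr r \<le> 1" "m powr r / b powr r \<le> 1"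
      using ab N0 p r by (simp_all add: divide_le_eq powr_mono2)
    have "(LINT x|M. \<bar>f x + g x\<bar> powr r) \<le>
        (LINT x|M. (a + b) powr r * (a / (a + b) * (\<bar>f x\<bar> powr r / a powr r) + b / (a + b) * (K powr r / b powr r)))"
      using f by (intro integral_mono_AE int pt p) auto
    also have "\<dots> = (a + b) powr r * (a / (a + b) * (N powr r / a powr r) + b / (a + b) * (m powr r / b powr r))"
      using f by (simp add: Nr mr mult_ac)
    also have "\<dots> \<le> (a + b) powr r * (a / (a + b) * 1 + b / (a + b) * 1)"
      using p by (intro mult_left_mono add_mono le) auto
    also have "\<dots> = (a + b) powr r" using p by (simp add: add_divide_distrib[symmetric])
    finally have "(LINT x|M. \<bar>f x + g x\<bar> powr r) powr (1/r) \<le> ((a + b) powr r) powr (1/r)"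
      using r by (intro powr_mono2) auto
    also have "\<dots> = a + b" using p r by (simp add: powr_powr)
    finally show ?thesis .
  qed
  have lt: "(LINT x|M. \<bar>f x + g x\<bar> powr r) powr (1/r) \<le> (N + e/2) + (m + e/2)" if "0 < e" for e
    by (rule le) (use that in simp_all)
  have "(LINT x|M. \<bar>f x + g x\<bar> powr r) powr (1/r) \<le> N + m"
    by (rule field_le_epsilon) (drule lt, linarith)
  then show "(LINT x|M. \<bar>f x + g x\<bar> powr r) powr (1/r) \<le>
      (LINT x|M. \<bar>f x\<bar> powr r) powr (1/r) + measure M (space M) powr (1/r) * K"
    by (simp add: N_def m_def)
qed

text \<open>For \<open>n = 2\<close> any exponent above \<open>2q/(q-1)\<close> would do; for \<open>n \<ge> 3\<close> this is the Sobolev exponent.\<close>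

definition Linf_exponent :: "nat \<Rightarrow> real \<Rightarrow> real" where
  "Linf_exponent n q = (if n = 2 then 2 * q / (q - 1) + 1 else 2 * real n / (real n - 2))"

text \<open>For \<open>n \<ge> 3\<close> the reciprocal of the exponent is \<open>1/2 - 1/n\<close>,
  so the last inequality says exactly that \<open>q > n/2\<close>.\<close>

lemma Linf_exponent:
  assumes n: "2 \<le> n" and q: "real n / 2 < q"
  shows "2 < Linf_exponent n q" "Linf_exponent n q * (real n - 2) \<le> 2 * real n"
    "1 / Linf_exponent n q < 1/2 - 1/(2*q)"
proof -
  have q1: "1 < q" using n q by simp
  have "2 < Linf_exponent n q \<and> Linf_exponent n q * (real n - 2) \<le> 2 * real n \<and>
    1 / Linf_exponent n q < 1/2 - 1/(2*q)"
  proof (cases "n = 2")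
    case True
    have p: "2 < 2 * q / (q - 1)" using q1 by (simp add: less_divide_eq)
    have "1 / (2 * q / (q - 1) + 1) < 1 / (2 * q / (q - 1))" using p
      by (intro divide_strict_left_mono mult_pos_pos) linarith+
    also have "\<dots> = 1/2 - 1/(2*q)" using q1 by (simp add: field_simps)
    finally show ?thesis using p True by (simp add: Linf_exponent_def)
  next
    case False
    then have n3: "2 < real n" using n by simp
    have e: "Linf_exponent n q = 2 * real n / (real n - 2)" using False by (simp add: Linf_exponent_def)
    have "1 / (2 * real n / (real n - 2)) = 1/2 - 1 / real n" using n3 by (simp add: field_simps)
    moreover have "1 / (2*q) < 1 / real n" using n3 q by (intro divide_strict_left_mono) auto
    ultimately show ?thesis unfolding e using n3 by (simp add: less_divide_eq)
  qed
  then show "2 < Linf_exponent n q" "Linf_exponent n q * (real n - 2) \<le> 2 * real n"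
    "1 / Linf_exponent n q < 1/2 - 1/(2*q)" by auto
qed

section \<open>The constants and the final assembly\<close>

text \<open>The constant of \<open>H12_estimate\<close> written outside the locale. The theorem asks
  for positivity at all real arguments, hence the default 1.\<close>

definition energy_bound :: "nat \<Rightarrow> real \<Rightarrow> real \<Rightarrow> real \<Rightarrow> real" where
  "energy_bound n s lam v = (let \<kappa> = s / (s - 1) in if 0 < lam
     then sqrt ((Poincare_const n \<kappa> v)\<^sup>2 + 1) * (Sobolev_const n \<kappa> v + 1) / lam else 1)"

text \<open>Again 1 is a default outside the admissible range; \<open>v = 0\<close> has to be among
  the exceptions because the formula vanishes there.\<close>

definition sup_bound :: "nat \<Rightarrow> real \<Rightarrow> real \<Rightarrow> real \<Rightarrow> real" where
  "sup_bound n lam q v = (if 0 < lam \<and> real n / 2 < q \<and> 0 < v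
     then Linf_const n lam v (Linf_exponent n q) q else 1)"

lemma sup_bound_pos: "2 \<le> n \<Longrightarrow> 0 < sup_bound n lam q v"
  using Linf_exponent(1)[of n q] by (auto simp: sup_bound_def intro!: Linf_const_pos)

context elliptic_problem
begin

lemma Lp_L2:
  assumes F: "F \<in> Lp_space M (ennreal p)" and p: "2 \<le> p"
  shows "L2 M F"
proof -
  have p0: "0 < p" using p by simp
  note FD = Lp_spaceD[OF F p0]
  have "integrable M (\<lambda>x. indicator (space M) x * \<bar>norm (F x)\<bar> powr 2)"
    using FD p by (intro powr_integral_exponent_le(1)) auto
  then have "integrable M (\<lambda>x. norm (F x) powr 2)" by (rule Bochner_Integration.integrable_cong[OF refl, THEN iffD1, rotated]) simp
  then show ?thesis using FD(1) by (simp add: L2_def)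
qed

lemma sup_estimate:
  assumes u: "sol f F u G" and q: "real CARD('n) / 2 < q"
    and f: "f \<in> Lp_space M (ennreal q)" and F: "F \<in> Lp_space M (ennreal (2*q))"
  shows "AE x in M. \<bar>u x\<bar> \<le> sup_bound CARD('n) lam q (measure lebesgue U) * (Lp_norm M (ennreal q) f + Lp_norm M (ennreal (2*q)) F)"
proof (cases "U = {}")
  \<comment> \<open>The empty set has volume 0 and so receives the default constant, but there the
    claim is void; a nonempty open set has positive volume.\<close>
  case True
  then show ?thesis by (intro AE_I2) simp
next
  case False
  have v: "0 < measure lebesgue U"
  proof -
    have "measure lebesgue U \<noteq> 0"
      using False U open_not_negligible[OF U(2)] lmeasurable_open[OF U] by (simp add: negligible_iff_measure)
    then show ?thesis by (simp add: zero_less_measure_iff)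
  qed
  have q1: "1 < q" using q n2 by simp
  show ?thesis
    using essentially_bounded[OF u q1 Linf_exponent[OF n2 q] f F v] lam q v by (simp add: sup_bound_def)
qed

lemma contraction:
  assumes u: "sol f (\<lambda>x. 0) u G" and \<alpha>p: "0 < \<alpha>" and r: "1 \<le> r" and f: "f \<in> Lp_space M (ennreal r)"
  shows "integrable M (\<lambda>x. \<bar>u x\<bar> powr r)"
    and "(LINT x|M. \<bar>u x\<bar> powr r) powr (1/r) \<le> inverse \<alpha> * Lp_norm M (ennreal r) f"
proof -
  have r0: "0 < r" using r by simp
  note fD = Lp_spaceD[OF f r0, unfolded real_norm_def]
  note N = Lp_norm_eq[OF r0, of M f, unfolded real_norm_def]
  have H: "H0 U u G" using u by (simp add: sol_def)
  have "integrable M (\<lambda>x. \<bar>u x\<bar> powr r) \<and>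
    (LINT x|M. \<bar>u x\<bar> powr r) powr (1/r) \<le> inverse \<alpha> * Lp_norm M (ennreal r) f"
  proof (cases "r = 1")
    case True
    have "(LINT x|M. \<bar>u x\<bar>) \<le> inverse \<alpha> * (LINT x|M. \<bar>f x\<bar>)"
      using contraction_L1[OF u] \<alpha>p by (simp add: field_simps)
    then show ?thesis using low_integrable(3)[OF H] unfolding N by (simp add: True)
  next
    case False
    then show ?thesis unfolding N using contraction_Lr[OF u \<alpha>p _ fD] r by auto
  qed
  then show "integrable M (\<lambda>x. \<bar>u x\<bar> powr r)"
    and "(LINT x|M. \<bar>u x\<bar> powr r) powr (1/r) \<le> inverse \<alpha> * Lp_norm M (ennreal r) f" by auto
qed

text \<open>Existence is used separately for the data \<open>f\<close> and \<open>F\<close>, and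
  uniqueness identifies the sum of the two solutions with the given \<open>u\<close>. The first part
  is contracted, the second is bounded by \<open>sup_estimate\<close> with zero source term.\<close>

lemma contraction_Lp:
  fixes r :: ennreal
  defines "v \<equiv> measure lebesgue U"
  assumes \<alpha>p: "0 < \<alpha>" and r: "1 \<le> r" and q: "real CARD('n) / 2 < q"
    and f: "f \<in> Lp_space M r" "f \<in> Lp_space M (ennreal s)" and F: "F \<in> Lp_space M (ennreal (2 * q))"
    and u: "weak_solution U A B c \<alpha> f F u"
  shows "u \<in> Lp_space M r \<and> Lp_norm M r u \<le> inverse \<alpha> * Lp_norm M r f +
    sup_bound CARD('n) lam q v * (if r = \<infinity> then 1 else v powr (1 / enn2real r)) * Lp_norm M (ennreal (2 * q)) F"
proof -
  have q1: "1 < q" using q n2 by simp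
  have F2: "L2 M F" by (rule Lp_L2[OF F]) (use q1 in simp)
  have Z: "(\<lambda>x. 0 :: real) \<in> Lp_space M (ennreal p)" "Lp_norm M (ennreal p) (\<lambda>x. 0::real) = 0" if "0 < p" for p
    using that by (auto simp: Lp_space_def Lp_norm_def)
  have Z2: "L2 M (\<lambda>x. 0 :: real^'n)" by (simp add: L2_def)
  obtain u1 where u1: "weak_solution U A B c \<alpha> f (\<lambda>x. 0) u1" using existence[OF f(2) Z2] by blast
  obtain u2 where u2: "weak_solution U A B c \<alpha> (\<lambda>x. 0) F u2" using existence[OF Z(1) F2] s by auto
  obtain G where G: "sol f F u G" by (rule weak_solution_sol[OF Ls_integrable[OF f(2)] F2 u])
  obtain G1 where G1: "sol f (\<lambda>x. 0) u1 G1" by (rule weak_solution_sol[OF Ls_integrable[OF f(2)] Z2 u1])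
  obtain G2 where G2: "sol (\<lambda>x. 0) F u2 G2" by (rule weak_solution_sol[OF _ F2 u2]) simp
  have "sol f F (\<lambda>x. u1 x + u2 x) (\<lambda>x. G1 x + G2 x)" using sol_linear[OF G1 G2, of 1 1] by simp
  then have ae: "AE x in M. u x = u1 x + u2 x" by (rule uniqueness[OF G])
  have [measurable]: "u \<in> borel_measurable M" "u1 \<in> borel_measurable M" "u2 \<in> borel_measurable M"
    using G G1 G2 by (auto simp: sol_def dest!: H0_L2(1) L2_measurable)
  define K where "K = sup_bound CARD('n) lam q v * Lp_norm M (ennreal (2*q)) F"
  have K0: "0 \<le> K" unfolding K_def by (intro mult_nonneg_nonneg less_imp_le[OF sup_bound_pos[OF n2]] Lp_norm_nonneg)
  have b2: "AE x in M. \<bar>u2 x\<bar> \<le> K"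
    using sup_estimate[OF G2 q Z(1) F] q1 by (simp add: K_def v_def Z(2))
  show ?thesis
  proof (cases "r = \<infinity>")
    case True
    have f': "f \<in> Lp_space M \<infinity>" using f(1) True by simp
    have "AE x in M. \<bar>f x\<bar> \<le> Lp_norm M \<infinity> f" using Lp_infinity_essentially_bounded(2)[OF f'] by simp
    then have "AE x in M. \<bar>u1 x\<bar> \<le> inverse \<alpha> * Lp_norm M \<infinity> f"
      by (rule contraction_Linf[OF G1 \<alpha>p Lp_norm_nonneg])
    with b2 ae have "AE x in M. norm (u x) \<le> inverse \<alpha> * Lp_norm M \<infinity> f + K"
      by eventually_elim (auto intro!: order_trans[OF abs_triangle_ineq])
    moreover have "0 \<le> inverse \<alpha> * Lp_norm M \<infinity> f + K"
      using K0 \<alpha>p Lp_norm_nonneg[of M \<infinity> f] by simp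
    ultimately show ?thesis
      using essentially_bounded_Lp_infinity[of u M "inverse \<alpha> * Lp_norm M \<infinity> f + K"] True by (simp add: K_def)
  next
    case False
    define p where "p = enn2real r"
    have rp: "r = ennreal p" using False by (simp add: p_def less_top)
    have p: "1 \<le> p" using enn2real_mono[OF r] False by (simp add: p_def less_top)
    note c = contraction[OF G1 \<alpha>p p f(1)[unfolded rp]]
    note m = Minkowski_bounded[OF \<open>u1 \<in> _\<close> \<open>u2 \<in> _\<close> p c(1) b2 K0]
    have ae': "AE x in M. \<bar>u x\<bar> powr p = \<bar>u1 x + u2 x\<bar> powr p" using ae by eventually_elim simp
    have i: "integrable M (\<lambda>x. \<bar>u x\<bar> powr p)" using m(1) integrable_cong_AE[OF _ _ ae'] by simp
    have e: "(LINT x|M. \<bar>u x\<bar> powr p) = (LINT x|M. \<bar>u1 x + u2 x\<bar> powr p)" using integral_cong_AE[OF _ _ ae'] by simp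
    have "Lp_norm M r u \<le> inverse \<alpha> * Lp_norm M r f + measure M (space M) powr (1/p) * K"
      using m(2) c(2) p unfolding rp by (simp add: Lp_norm_eq e)
    moreover have "measure M (space M) = v" by (simp add: measure_lebesgue_on_space[OF U(2)] v_def)
    ultimately show ?thesis using i p False by (simp add: Lp_space_def rp K_def mult_ac)
  qed
qed

end

text \<open>Dependence of the constants is expressed by quantifier order: both functions are chosen
  before the domain and the coefficients, with \<open>s\<close> and the dimension fixed. The witness
  \<open>energy_bound\<close> involves \<open>s\<close>, the fixed exponent, while
  \<open>sup_bound\<close> does not; the latter serves both the boundedness and the contraction
  estimate.\<close>

theorem theorem1p1:
  fixes s :: real
  assumes "2 \<le> CARD('n::finite)"
    and "is_two_star CARD('n) s"
  shows
    "\<exists>(C\<^sub>1 :: real \<Rightarrow> real \<Rightarrow> real) (C\<^sub>2 :: real \<Rightarrow> real \<Rightarrow> real \<Rightarrow> real).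
       (\<forall>lam v. 0 < C\<^sub>1 lam v) \<and> (\<forall>lam q v. 0 < C\<^sub>2 lam q v) \<and>
       (\<forall>(U :: (real^'n) set) A B c \<alpha> lam Lam. assumption_A s U A B c \<alpha> lam Lam \<longrightarrow>
         (\<forall>f \<in> Lp_space (lebesgue_on U) (ennreal s). \<forall>F \<in> Lp_space (lebesgue_on U) 2.
            (\<exists>u. weak_solution U A B c \<alpha> f F u \<and>
                 (\<forall>v. weak_solution U A B c \<alpha> f F v \<longrightarrow> (AE x in lebesgue_on U. v x = u x))) \<and>
            (\<forall>u. weak_solution U A B c \<alpha> f F u \<longrightarrow>
                 H12_norm U u \<le> C\<^sub>1 lam (measure lebesgue U) *
                   (Lp_norm (lebesgue_on U) (ennreal s) f + Lp_norm (lebesgue_on U) 2 F) \<and>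
                 (\<forall>q::real. real CARD('n) / 2 < q \<and> s \<le> q \<and>
                      f \<in> Lp_space (lebesgue_on U) (ennreal q) \<and>
                      F \<in> Lp_space (lebesgue_on U) (ennreal (2 * q)) \<longrightarrow>
                    u \<in> Lp_space (lebesgue_on U) \<infinity> \<and>
                    Lp_norm (lebesgue_on U) \<infinity> u \<le> C\<^sub>2 lam q (measure lebesgue U) *
                      (Lp_norm (lebesgue_on U) (ennreal q) f +
                       Lp_norm (lebesgue_on U) (ennreal (2 * q)) F)))) \<and>
         (\<forall>(r::ennreal) (q::real) f F u.
            0 < \<alpha> \<and> 1 \<le> r \<and> real CARD('n) / 2 < q \<and>
            f \<in> Lp_space (lebesgue_on U) r \<inter> Lp_space (lebesgue_on U) (ennreal s) \<and>
            F \<in> Lp_space (lebesgue_on U) (ennreal (2 * q)) \<and>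
            weak_solution U A B c \<alpha> f F u \<longrightarrow>
              u \<in> Lp_space (lebesgue_on U) r \<and>
              Lp_norm (lebesgue_on U) r u \<le>
                inverse \<alpha> * Lp_norm (lebesgue_on U) r f +
                C\<^sub>2 lam q (measure lebesgue U) *
                (if r = \<infinity> then 1 else measure lebesgue U powr (1 / enn2real r)) *
                Lp_norm (lebesgue_on U) (ennreal (2 * q)) F))"
proof (rule exI[of _ "energy_bound CARD('n) s"], rule exI[of _ "sup_bound CARD('n)"], intro conjI allI impI)
  have s: "1 < s"
  proof (cases "CARD('n) = 2")
    case True
    then show ?thesis using assms by (simp add: is_two_star_def)
  next
    case False
    then have "2 < real CARD('n)" using assms by simp
    then show ?thesis using assms False by (simp add: is_two_star_def less_divide_eq)
  qed
  show "0 < energy_bound CARD('n) s lam v" for lam v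
  proof -
    have "0 \<le> Sobolev_const CARD('n) (s / (s - 1)) v"
      using s assms(1) by (intro Sobolev_const_nonneg) auto
    then show ?thesis by (auto simp: energy_bound_def Let_def intro!: divide_pos_pos mult_pos_pos add_nonneg_pos)
  qed
  show "0 < sup_bound CARD('n) lam q v" for lam q v by (rule sup_bound_pos[OF assms(1)])
next
  fix U :: "(real^'n) set" and A B c \<alpha> lam Lam
  assume "assumption_A s U A B c \<alpha> lam Lam"
  then interpret elliptic_problem s U A B c \<alpha> lam Lam using assms by unfold_locales
  show "\<forall>f \<in> Lp_space M (ennreal s). \<forall>F \<in> Lp_space M 2.
      (\<exists>u. weak_solution U A B c \<alpha> f F u \<and>
           (\<forall>v. weak_solution U A B c \<alpha> f F v \<longrightarrow> (AE x in M. v x = u x))) \<and>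
      (\<forall>u. weak_solution U A B c \<alpha> f F u \<longrightarrow>
           H12_norm U u \<le> energy_bound CARD('n) s lam (measure lebesgue U) *
             (Lp_norm M (ennreal s) f + Lp_norm M 2 F) \<and>
           (\<forall>q::real. real CARD('n) / 2 < q \<and> s \<le> q \<and>
                f \<in> Lp_space M (ennreal q) \<and> F \<in> Lp_space M (ennreal (2 * q)) \<longrightarrow>
              u \<in> Lp_space M \<infinity> \<and>
              Lp_norm M \<infinity> u \<le> sup_bound CARD('n) lam q (measure lebesgue U) *
                (Lp_norm M (ennreal q) f + Lp_norm M (ennreal (2 * q)) F)))"
  proof (intro ballI conjI allI impI)
    fix f :: "real^'n \<Rightarrow> real" and F :: "real^'n \<Rightarrow> real^'n"
    assume f: "f \<in> Lp_space M (ennreal s)" and "F \<in> Lp_space M 2"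
    then have F: "L2 M F" by (simp add: Lp_space_2)
    note sol = weak_solution_sol[OF Ls_integrable[OF f] F]
    obtain u where u: "weak_solution U A B c \<alpha> f F u" using existence[OF f F] by blast
    obtain G where G: "sol f F u G" by (rule sol[OF u])
    have "AE x in M. v x = u x" if "weak_solution U A B c \<alpha> f F v" for v
      by (rule sol[OF that]) (rule uniqueness[OF _ G])
    then show "\<exists>u. weak_solution U A B c \<alpha> f F u \<and>
        (\<forall>v. weak_solution U A B c \<alpha> f F v \<longrightarrow> (AE x in M. v x = u x))" using u by blast
  next
    fix f u :: "real^'n \<Rightarrow> real" and F :: "real^'n \<Rightarrow> real^'n"
    assume f: "f \<in> Lp_space M (ennreal s)" and "F \<in> Lp_space M 2" and u: "weak_solution U A B c \<alpha> f F u"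
    then have F: "L2 M F" by (simp add: Lp_space_2)
    obtain G where G: "sol f F u G" by (rule weak_solution_sol[OF Ls_integrable[OF f] F u])
    show "H12_norm U u \<le> energy_bound CARD('n) s lam (measure lebesgue U) *
        (Lp_norm M (ennreal s) f + Lp_norm M 2 F)"
      using H12_estimate[OF G f] lam by (simp add: energy_bound_def Let_def \<kappa>_def Lp_norm_2)
    fix q :: real
    assume q: "real CARD('n) / 2 < q \<and> s \<le> q \<and> f \<in> Lp_space M (ennreal q) \<and> F \<in> Lp_space M (ennreal (2 * q))"
    let ?C = "sup_bound CARD('n) lam q (measure lebesgue U) *
        (Lp_norm M (ennreal q) f + Lp_norm M (ennreal (2 * q)) F)"
    have m: "u \<in> borel_measurable M" using G by (auto simp: sol_def dest!: H0_L2(1) L2_measurable)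
    have b: "AE x in M. norm (u x) \<le> ?C" using sup_estimate[OF G] q by simp
    have C: "0 \<le> ?C"
      by (intro mult_nonneg_nonneg add_nonneg_nonneg Lp_norm_nonneg less_imp_le[OF sup_bound_pos[OF n2]])
    show "u \<in> Lp_space M \<infinity>" by (rule essentially_bounded_Lp_infinity(1)[OF m b C])
    show "Lp_norm M \<infinity> u \<le> ?C" by (rule essentially_bounded_Lp_infinity(2)[OF m b C])
  qed
  fix r :: ennreal and q :: real and f u :: "real^'n \<Rightarrow> real" and F :: "real^'n \<Rightarrow> real^'n"
  assume h: "0 < \<alpha> \<and> 1 \<le> r \<and> real CARD('n) / 2 < q \<and> f \<in> Lp_space M r \<inter> Lp_space M (ennreal s) \<and>
    F \<in> Lp_space M (ennreal (2 * q)) \<and> weak_solution U A B c \<alpha> f F u"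
  then have "u \<in> Lp_space M r \<and> Lp_norm M r u \<le> inverse \<alpha> * Lp_norm M r f +
      sup_bound CARD('n) lam q (measure lebesgue U) * (if r = \<infinity> then 1 else measure lebesgue U powr (1 / enn2real r)) *
      Lp_norm M (ennreal (2 * q)) F"
    by (intro contraction_Lp) auto
  then show "u \<in> Lp_space M r" "Lp_norm M r u \<le> inverse \<alpha> * Lp_norm M r f +
      sup_bound CARD('n) lam q (measure lebesgue U) * (if r = \<infinity> then 1 else measure lebesgue U powr (1 / enn2real r)) *
      Lp_norm M (ennreal (2 * q)) F"
    by blast+
qed

end
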